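(* Assume (H$_1$)–(H$_3$) (listed in the context). Let $\overline W$ be a constant equilibrium state (with $\overline\eta=\overline\theta^4$) and let $\widetilde A^0,\widetilde A^1,\widetilde L,\widetilde B$ be the constant matrices defined in the context. Let $s\ge0$ and consider the Cauchy problem for $$\widetilde A^0Z_t+\widetilde A^1Z_x+\widetilde LZ=\widetilde BZ_{xx},\qquad x\in\mathbb{R},\ t>0,$$ with initial data $Z(\cdot,0)=Z_0\in(H^s(\mathbb{R})\cap L^1(\mathbb{R}))^4$. Then for each fixed integer $0\le\ell\le s$ there exist positive constants $C,c_1$ (independent of $t$ and $Z_0$) such that for all $t\ge0$ $$\|\partial_x^\ell Z(t)\|_0\le Ce^{-c_1t}\|\partial_x^\ell Z_0\|_0+C(1+t)^{-(\ell/2+1/4)}\|Z_0\|_{L^1}.$$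
   Context: $\|\cdot\|_0$ is the $L^2(\mathbb{R})$ norm. Variables: $V=(\rho,u,\theta,\eta)$ with $\rho,\theta,\eta>0$, $u\in\mathbb{R}$, and $W=(\rho,m,\mathcal E,\eta)$ with $m=\rho u$, $\mathcal E=\rho(e(\rho,\theta)+u^2/2)$. Since $e_\theta>0$, $V\mapsto W$ is a diffeomorphism of $\{\rho>0,u\in\mathbb{R},\theta>0,\eta>0\}$ onto its image $\mathcal O_W\subset\mathbb{R}^4$; $u,\theta,p,e,s$ are regarded as functions of $W$ through its inverse. Put $$f^1(W)=\begin{pmatrix}\rho u\\ \rho u^2+p+\tfrac13\eta\\ \mathcal Eu+(p+\tfrac13\eta)u\\ \eta u\end{pmatrix},\quad Q(W)=\begin{pmatrix}0\\0\\ \sigma_a(\eta-\theta^4)\\-\sigma_a(\eta-\theta^4)\end{pmatrix},$$ $$C(W)=\begin{pmatrix}0&0&0&0\\0&0&0&0\\-\frac{u\eta}{3\rho}&\frac{\eta}{3\rho}&0&0\\ \frac{u\eta}{3\rho}&-\frac{\eta}{3\rho}&0&0\end{pmatrix},\quad \overline G=\mathrm{diag}\big(0,0,0,\tfrac1{3\sigma_s}\big),\quad \mathcal S(W)=-\rho s-\tfrac43\eta^{3/4}.$$ The Hessian $D_W^2\mathcal S$ is positive definite. Define $\widetilde A^0=D_W^2\mathcal S(\overline W)^{-1}$, $\widetilde A^1=(D_Wf^1(\overline W)-C(\overline W))D_W^2\mathcal S(\overline W)^{-1}$, $\widetilde L=-D_WQ(\overline W)D_W^2\mathcal S(\overline W)^{-1}$,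 $\widetilde B=\overline G\,D_W^2\mathcal S(\overline W)^{-1}$. Explicitly $\widetilde B=\mathrm{diag}(0,0,0,4\overline\eta^{5/4}/(3\sigma_s))$ and $\widetilde L$ vanishes except for its lower-right block $4\sigma_a\overline\theta^5\begin{pmatrix}1&-1\\-1&1\end{pmatrix}$. Assumptions: (H$_1$) the independent thermodynamic variables $(\rho,\theta)$ take values in $\mathcal D=\{\rho>0,\theta>0\}$. (H$_2$) the pressure $p$, internal energy $e$ and specific entropy $s$ of the fluid are $C^\infty$ functions on $\mathcal D$ with $p>0$, $p_\rho>0$, $p_\theta>0$, $e_\theta>0$, satisfying $de=\theta\,ds-p\,d(1/\rho)$, i.e. $e_\rho=(p-\theta p_\theta)/\rho^2$, $s_\rho=-p_\theta/\rho^2$, $s_\theta=e_\theta/\theta$. (H$_3$) $\sigma_a,\sigma_s$ are positive constants. (The letter $s$ in Sobolev indices is unrelated to the entropy $s$.) *)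

theory Defs
  imports "HOL-Analysis.Analysis"
begin

section \<open>Function spaces on the real line\<close>

text \<open>Smoothness is only used on open sets.  Iterating directional derivatives along basis vectors
  amounts to iterating partial derivatives.\<close>

fun Ck_on :: "nat \<Rightarrow> 'a::euclidean_space set \<Rightarrow> ('a \<Rightarrow> real) \<Rightarrow> bool" where
  "Ck_on 0 S f \<longleftrightarrow> continuous_on S f"
| "Ck_on (Suc k) S f \<longleftrightarrow>
     f differentiable_on S \<and> (\<forall>b\<in>Basis. Ck_on k S (\<lambda>x. frechet_derivative f (at x) b))"

definition smooth_on :: "'a::euclidean_space set \<Rightarrow> ('a \<Rightarrow> real) \<Rightarrow> bool" where
  "smooth_on S f \<longleftrightarrow> (\<forall>k. Ck_on k S f)"

definition test_function :: "(real \<Rightarrow> real) \<Rightarrow> bool" where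
  "test_function \<phi> \<longleftrightarrow> smooth_on UNIV \<phi> \<and> compact (closure {x. \<phi> x \<noteq> 0})"

definition square_integrable :: "(real \<Rightarrow> 'b::euclidean_space) \<Rightarrow> bool" where
  "square_integrable f \<longleftrightarrow>
     f \<in> borel_measurable lborel \<and> integrable lborel (\<lambda>x. (norm (f x))\<^sup>2)"

definition L2_norm :: "(real \<Rightarrow> 'b::euclidean_space) \<Rightarrow> real" where
  "L2_norm f = sqrt (\<integral>x. (norm (f x))\<^sup>2 \<partial>lborel)"

definition L1_norm :: "(real \<Rightarrow> 'b::euclidean_space) \<Rightarrow> real" where
  "L1_norm f = (\<integral>x. norm (f x) \<partial>lborel)"

text \<open>Weak derivatives are locally integrable and unique up to null sets, so the choice made in
  \<open>weak_deriv\<close> does not affect norms.\<close>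

definition is_weak_deriv ::
  "nat \<Rightarrow> (real \<Rightarrow> 'b::euclidean_space) \<Rightarrow> (real \<Rightarrow> 'b) \<Rightarrow> bool" where
  "is_weak_deriv l f g \<longleftrightarrow>
     (\<forall>a b. set_integrable lborel {a..b} g) \<and>
     (\<forall>\<phi>. test_function \<phi> \<longrightarrow>
        (\<integral>x. (deriv ^^ l) \<phi> x *\<^sub>R f x \<partial>lborel) = (-1) ^ l *\<^sub>R (\<integral>x. \<phi> x *\<^sub>R g x \<partial>lborel))"

definition weak_deriv :: "nat \<Rightarrow> (real \<Rightarrow> 'b::euclidean_space) \<Rightarrow> real \<Rightarrow> 'b" where
  "weak_deriv l f = (SOME g. is_weak_deriv l f g)"

text \<open>The Fourier transform on \<open>L\<^sup>2\<close> is the \<open>L\<^sup>2\<close>-limit of the transforms of the truncations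
  to \<open>{-n..n}\<close>; by Plancherel it exists and is unique up to null sets.\<close>

definition fourier_trunc :: "nat \<Rightarrow> (real \<Rightarrow> real ^ 'n) \<Rightarrow> real \<Rightarrow> complex ^ 'n" where
  "fourier_trunc n f \<xi> =
     (\<chi> i. \<integral>x\<in>{- real n..real n}. cis (- (x * \<xi>)) * complex_of_real (f x $ i) \<partial>lborel)"

definition is_fourier_L2 :: "(real \<Rightarrow> real ^ 'n) \<Rightarrow> (real \<Rightarrow> complex ^ 'n) \<Rightarrow> bool" where
  "is_fourier_L2 f g \<longleftrightarrow>
     square_integrable g \<and>
     (\<lambda>n. \<integral>\<^sup>+\<xi>. ennreal ((norm (fourier_trunc n f \<xi> - g \<xi>))\<^sup>2) \<partial>lborel) \<longlonglongrightarrow> 0"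

definition fourier_L2 :: "(real \<Rightarrow> real ^ 'n) \<Rightarrow> real \<Rightarrow> complex ^ 'n" where
  "fourier_L2 f = (SOME g. is_fourier_L2 f g)"

text \<open>\<open>H\<^sup>s(\<real>)\<close> is defined through the weight \<open>(1 + \<xi>\<^sup>2)\<^sup>s\<^sup>/\<^sup>2\<close> on the Fourier side so that non-integer
  \<open>s \<ge> 0\<close> is covered.\<close>

definition bessel :: "real \<Rightarrow> (real \<Rightarrow> real ^ 'n) \<Rightarrow> real \<Rightarrow> complex ^ 'n" where
  "bessel s f \<xi> = (1 + \<xi>\<^sup>2) powr (s / 2) *\<^sub>R fourier_L2 f \<xi>"

definition sobolev :: "real \<Rightarrow> (real \<Rightarrow> real ^ 'n) set" where
  "sobolev s = {f. square_integrable f \<and> square_integrable (bessel s f)}"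

definition sobolev_norm :: "real \<Rightarrow> (real \<Rightarrow> real ^ 'n) \<Rightarrow> real" where
  "sobolev_norm s f = L2_norm (bessel s f)"

section \<open>Thermodynamics and the radiation hydrodynamics system\<close>

definition d_rho :: "(real \<Rightarrow> real \<Rightarrow> real) \<Rightarrow> real \<Rightarrow> real \<Rightarrow> real" where
  "d_rho f \<rho> \<theta> = deriv (\<lambda>r. f r \<theta>) \<rho>"

definition d_theta :: "(real \<Rightarrow> real \<Rightarrow> real) \<Rightarrow> real \<Rightarrow> real \<Rightarrow> real" where
  "d_theta f \<rho> \<theta> = deriv (\<lambda>y. f \<rho> y) \<theta>"

text \<open>The three identities are the component form of \<open>de = \<theta> ds - p d(1/\<rho>)\<close> in the variables
  \<open>(\<rho>, \<theta>)\<close>.\<close>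

definition thermodynamics ::
  "(real \<Rightarrow> real \<Rightarrow> real) \<Rightarrow> (real \<Rightarrow> real \<Rightarrow> real) \<Rightarrow> (real \<Rightarrow> real \<Rightarrow> real) \<Rightarrow> bool" where
  "thermodynamics p e s \<longleftrightarrow>
     smooth_on ({0<..} \<times> {0<..}) (\<lambda>(\<rho>, \<theta>). p \<rho> \<theta>) \<and>
     smooth_on ({0<..} \<times> {0<..}) (\<lambda>(\<rho>, \<theta>). e \<rho> \<theta>) \<and>
     smooth_on ({0<..} \<times> {0<..}) (\<lambda>(\<rho>, \<theta>). s \<rho> \<theta>) \<and>
     (\<forall>\<rho>>0. \<forall>\<theta>>0.
        p \<rho> \<theta> > 0 \<and> d_rho p \<rho> \<theta> > 0 \<and> d_theta p \<rho> \<theta> > 0 \<and> d_theta e \<rho> \<theta> > 0 \<and>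
        d_rho e \<rho> \<theta> = (p \<rho> \<theta> - \<theta> * d_theta p \<rho> \<theta>) / \<rho>\<^sup>2 \<and>
        d_rho s \<rho> \<theta> = - d_theta p \<rho> \<theta> / \<rho>\<^sup>2 \<and>
        d_theta s \<rho> \<theta> = d_theta e \<rho> \<theta> / \<theta>)"

text \<open>Primitive variables are ordered \<open>V = (\<rho>, u, \<theta>, \<eta>)\<close>, conserved ones
  \<open>W = (\<rho>, m, E, \<eta>)\<close>.\<close>

definition V_domain :: "(real ^ 4) set" where
  "V_domain = {V. V $ 1 > 0 \<and> V $ 3 > 0 \<and> V $ 4 > 0}"

definition W_of_V :: "(real \<Rightarrow> real \<Rightarrow> real) \<Rightarrow> real ^ 4 \<Rightarrow> real ^ 4" where
  "W_of_V e V =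
     vector [V $ 1, V $ 1 * V $ 2, V $ 1 * (e (V $ 1) (V $ 3) + (V $ 2)\<^sup>2 / 2), V $ 4]"

definition V_of_W :: "(real \<Rightarrow> real \<Rightarrow> real) \<Rightarrow> real ^ 4 \<Rightarrow> real ^ 4" where
  "V_of_W e = inv_into V_domain (W_of_V e)"

definition vel :: "(real \<Rightarrow> real \<Rightarrow> real) \<Rightarrow> real ^ 4 \<Rightarrow> real" where
  "vel e W = V_of_W e W $ 2"

definition temp :: "(real \<Rightarrow> real \<Rightarrow> real) \<Rightarrow> real ^ 4 \<Rightarrow> real" where
  "temp e W = V_of_W e W $ 3"

definition equilibrium_state :: "(real \<Rightarrow> real \<Rightarrow> real) \<Rightarrow> real ^ 4 \<Rightarrow> bool" where
  "equilibrium_state e W \<longleftrightarrow> W \<in> W_of_V e ` V_domain \<and> W $ 4 = temp e W ^ 4"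

definition flux ::
  "(real \<Rightarrow> real \<Rightarrow> real) \<Rightarrow> (real \<Rightarrow> real \<Rightarrow> real) \<Rightarrow> real ^ 4 \<Rightarrow> real ^ 4" where
  "flux p e W =
     (let \<rho> = W $ 1; E = W $ 3; \<eta> = W $ 4; u = vel e W; P = p \<rho> (temp e W) in
      vector [\<rho> * u, \<rho> * u\<^sup>2 + P + \<eta> / 3, E * u + (P + \<eta> / 3) * u, \<eta> * u])"

definition source :: "real \<Rightarrow> (real \<Rightarrow> real \<Rightarrow> real) \<Rightarrow> real ^ 4 \<Rightarrow> real ^ 4" where
  "source \<sigma>a e W =
     (let \<eta> = W $ 4; \<theta> = temp e W in
      vector [0, 0, \<sigma>a * (\<eta> - \<theta> ^ 4), - \<sigma>a * (\<eta> - \<theta> ^ 4)])"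

definition nonconservative :: "(real \<Rightarrow> real \<Rightarrow> real) \<Rightarrow> real ^ 4 \<Rightarrow> real ^ 4 ^ 4" where
  "nonconservative e W =
     (let \<rho> = W $ 1; \<eta> = W $ 4; u = vel e W in
      vector [vector [0, 0, 0, 0],
              vector [0, 0, 0, 0],
              vector [- (u * \<eta> / (3 * \<rho>)), \<eta> / (3 * \<rho>), 0, 0],
              vector [u * \<eta> / (3 * \<rho>), - (\<eta> / (3 * \<rho>)), 0, 0]])"

definition diffusion :: "real \<Rightarrow> real ^ 4 ^ 4" where
  "diffusion \<sigma>s = (\<chi> i j. if i = 4 \<and> j = 4 then 1 / (3 * \<sigma>s) else 0)"

definition math_entropy ::
  "(real \<Rightarrow> real \<Rightarrow> real) \<Rightarrow> (real \<Rightarrow> real \<Rightarrow> real) \<Rightarrow> real ^ 4 \<Rightarrow> real" where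
  "math_entropy e s W = - (W $ 1) * s (W $ 1) (temp e W) - 4 / 3 * (W $ 4) powr (3 / 4)"

definition hessian :: "(real ^ 'n \<Rightarrow> real) \<Rightarrow> real ^ 'n \<Rightarrow> real ^ 'n ^ 'n" where
  "hessian f x =
     (\<chi> i j. frechet_derivative (\<lambda>y. frechet_derivative f (at y) (axis j 1)) (at x) (axis i 1))"

definition inv_hess ::
  "(real \<Rightarrow> real \<Rightarrow> real) \<Rightarrow> (real \<Rightarrow> real \<Rightarrow> real) \<Rightarrow> real ^ 4 \<Rightarrow> real ^ 4 ^ 4" where
  "inv_hess e s W = matrix_inv (hessian (math_entropy e s) W)"

text \<open>\<open>A0_mat\<close>, \<open>A1_mat\<close>, \<open>L_mat\<close>, \<open>B_mat\<close> are the matrices of the system linearized at \<open>W\<close>, written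
  in the entropy variable \<open>Z\<close>, hence the right factor \<open>inv_hess\<close>.\<close>

definition A0_mat ::
  "(real \<Rightarrow> real \<Rightarrow> real) \<Rightarrow> (real \<Rightarrow> real \<Rightarrow> real) \<Rightarrow> real ^ 4 \<Rightarrow> real ^ 4 ^ 4" where
  "A0_mat e s W = inv_hess e s W"

definition A1_mat ::
  "(real \<Rightarrow> real \<Rightarrow> real) \<Rightarrow> (real \<Rightarrow> real \<Rightarrow> real) \<Rightarrow> (real \<Rightarrow> real \<Rightarrow> real) \<Rightarrow>
     real ^ 4 \<Rightarrow> real ^ 4 ^ 4" where
  "A1_mat p e s W = (jacobian (flux p e) (at W) - nonconservative e W) ** inv_hess e s W"

definition L_mat ::
  "real \<Rightarrow> (real \<Rightarrow> real \<Rightarrow> real) \<Rightarrow> (real \<Rightarrow> real \<Rightarrow> real) \<Rightarrow> real ^ 4 \<Rightarrow> real ^ 4 ^ 4" where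
  "L_mat \<sigma>a e s W = - jacobian (source \<sigma>a e) (at W) ** inv_hess e s W"

definition B_mat ::
  "real \<Rightarrow> (real \<Rightarrow> real \<Rightarrow> real) \<Rightarrow> (real \<Rightarrow> real \<Rightarrow> real) \<Rightarrow> real ^ 4 \<Rightarrow> real ^ 4 ^ 4" where
  "B_mat \<sigma>s e s W = diffusion \<sigma>s ** inv_hess e s W"

section \<open>The linear Cauchy problem\<close>

text \<open>\<open>Z\<close> is a solution of \<open>A0 Z\<^sub>t + A1 Z\<^sub>x + L Z = B Z\<^sub>x\<^sub>x\<close>, \<open>Z(0) = Z0\<close>, in
  \<open>C([0,\<infinity>); H\<^sup>r)\<close>: the equation holds in the sense of distributions on \<open>\<real>\<close> at every time
  \<open>t > 0\<close>, where \<open>Z t x\<close> is the value at time \<open>t\<close> and position \<open>x\<close>.\<close>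

definition cauchy_solution ::
  "real \<Rightarrow> real ^ 'n ^ 'n \<Rightarrow> real ^ 'n ^ 'n \<Rightarrow> real ^ 'n ^ 'n \<Rightarrow> real ^ 'n ^ 'n \<Rightarrow>
     (real \<Rightarrow> real ^ 'n) \<Rightarrow> (real \<Rightarrow> real \<Rightarrow> real ^ 'n) \<Rightarrow> bool" where
  "cauchy_solution r A0 A1 L B Z0 Z \<longleftrightarrow>
     (\<forall>t\<ge>0. Z t \<in> sobolev r) \<and>
     (\<forall>t\<ge>0. ((\<lambda>\<tau>. sobolev_norm r (\<lambda>x. Z \<tau> x - Z t x)) \<longlongrightarrow> 0) (at t within {0..})) \<and>
     (AE x in lborel. Z 0 x = Z0 x) \<and>
     (\<forall>t>0. \<forall>\<phi>. test_function \<phi> \<longrightarrow>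
        ((\<lambda>\<tau>. \<integral>x. \<phi> x *\<^sub>R (A0 *v Z \<tau> x) \<partial>lborel) has_vector_derivative
         (\<integral>x. deriv \<phi> x *\<^sub>R (A1 *v Z t x) - \<phi> x *\<^sub>R (L *v Z t x)
               + deriv (deriv \<phi>) x *\<^sub>R (B *v Z t x) \<partial>lborel)) (at t))"

end

theory Submission
  imports Defs "HOL-Probability.Probability" "HOL-Real_Asymp.Real_Asymp"
begin

text \<open>The system has constant coefficients, so the estimate is a statement about single Fourier modes.

In the perturbation \<open>X = (\<rho>, u, \<theta>, \<eta>)\<close> of the primitive variables, and after multiplication by a fixed
matrix, the system reads \<open>K X\<^sub>t + S X\<^sub>x + R X = D X\<^sub>x\<^sub>x\<close> with \<open>K\<close> diagonal and positive, \<open>S\<close> symmetric,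
\<open>R \<ge> 0\<close> vanishing exactly where \<open>\<eta> = 4 \<theta>bar\<^sup>3 \<theta>\<close>, and \<open>D \<ge> 0\<close> acting on \<open>\<eta>\<close> only
(\<open>linearized_normal_form\<close>).  The symmetrizer is the Hessian of the entropy; the symmetry of \<open>S\<close> and
\<open>R\<close> rests on the nonconservative term \<open>C\<close> and on the equilibrium relation \<open>\<eta>bar = \<theta>bar\<^sup>4\<close>.

For one frequency \<open>\<xi>\<close> the energy is dissipated by \<open>R\<close> and \<open>\<xi>\<^sup>2 D\<close>, which control \<open>\<theta>\<close> and \<open>\<eta>\<close> with
the weight \<open>w = \<xi>\<^sup>2 / (1 + \<xi>\<^sup>2)\<close> but not \<open>u\<close> and \<open>\<rho>\<close>.  The entries of \<open>S\<close> that couple \<open>\<theta>\<close> to \<open>u\<close> and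
\<open>u\<close> to \<open>\<rho>\<close> are positive multiples of \<open>p\<^sub>\<theta>\<close> and \<open>p\<^sub>\<rho>\<close>, hence nonzero.  Adding small multiples of the
skew products of \<open>\<theta>\<close> with \<open>u\<close> and of \<open>u\<close> with \<open>\<rho>\<close> to the energy (the compensating function of Kawashima)
therefore yields damping of all four components, at the rate \<open>w\<close> up to a constant (\<open>mode_decay\<close>).

A solution is only assumed to satisfy the system weakly in \<open>x\<close>, so its Fourier transform does not obviously
solve the mode equation.  Testing with \<open>\<zeta>(x/n) exp (- i x \<xi>)\<close> gives the mode equation for the
transform of \<open>\<zeta>(x/n) X\<close>, with a forcing that contains derivatives of \<open>\<zeta>(x/n)\<close> and tends to \<open>0\<close> in
\<open>L\<^sup>2\<close> like \<open>1/n\<close>, apart from a factor \<open>1 + |\<xi>|\<close>.  Since \<open>mode_decay\<close> allows a forcing, a subsequence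
gives the bound \<open>C exp (- \<gamma> w t)\<close> times the squared transform of the data at almost every \<open>\<xi>\<close> (\<open>pointwise_decay\<close>).

Finally the \<open>L\<^sup>2\<close> norm of the weak derivative is the norm of \<open>\<xi>\<^sup>l\<close> times the transform
(\<open>L2_norm_weak_deriv\<close>, from Plancherel).  For \<open>|\<xi>| \<ge> 1\<close> the rate \<open>w\<close> is at least \<open>1/2\<close>, which gives the
exponential term.  For \<open>|\<xi>| \<le> 1\<close> it is at least \<open>\<xi>\<^sup>2/2\<close>, the transform of the data is bounded by their
\<open>L\<^sup>1\<close> norm, and the moment \<open>\<integral> \<xi>\<^sup>2\<^sup>l exp (- \<gamma> t \<xi>\<^sup>2 / 2) d\<xi>\<close> decays like \<open>t\<close> to the power \<open>- (l + 1/2)\<close>,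
which gives the algebraic term.

The \<open>L\<^sup>2\<close> Fourier transform is built here from the one on \<open>L\<^sup>1\<close>: a Gaussian weight and the multiplication
formula give the upper bound on \<open>L\<^sup>1 \<inter> L\<^sup>2\<close>, completeness extends it, and inversion on test functions turns
the bound into Plancherel's identity.\<close>

section \<open>Smooth functions, cutoffs and the fundamental lemma\<close>

declare Ck_on.simps(2)[simp del]

lemma frechet_derivative_real_1:
  assumes "(f::real\<Rightarrow>real) differentiable at x"
  shows "frechet_derivative f (at x) 1 = deriv f x"
proof -
  have "(f has_real_derivative deriv f x) (at x)"
    using assms by (simp add: DERIV_deriv_iff_real_differentiable)
  hence "(f has_derivative (*) (deriv f x)) (at x)" by (simp add: has_field_derivative_def)
  from frechet_derivative_at[OF this] show ?thesis by (metis mult.right_neutral)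
qed

lemma Ck_on_Suc_real:
  "Ck_on (Suc k) UNIV (f::real\<Rightarrow>real) \<longleftrightarrow> (\<forall>x. f differentiable at x) \<and> Ck_on k UNIV (deriv f)"
proof -
  have "(\<forall>x. f differentiable at x) \<Longrightarrow> (\<lambda>x. frechet_derivative f (at x) 1) = deriv f"
    using frechet_derivative_real_1 by blast
  thus ?thesis by (auto simp: differentiable_on_def Ck_on.simps(2))
qed

lemma Ck_on_Suc_realI:
  assumes "\<And>x. (f has_real_derivative g x) (at x)" "Ck_on k UNIV (g::real\<Rightarrow>real)"
  shows "Ck_on (Suc k) UNIV f"
proof -
  have "deriv f = g" using assms(1) DERIV_imp_deriv by blast
  thus ?thesis using assms unfolding Ck_on_Suc_real
    using real_differentiable_def by blast
qed

lemma Ck_on_SucD: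
  "Ck_on (Suc k) UNIV (f::real\<Rightarrow>real) \<Longrightarrow> Ck_on k UNIV f"
proof (induction k arbitrary: f)
  case 0 thus ?case unfolding Ck_on_Suc_real
    by (simp add: continuous_at_imp_continuous_on differentiable_imp_continuous_within)
next
  case (Suc k) thus ?case using Ck_on_Suc_real by metis
qed

lemma Ck_on_add:
  "Ck_on k UNIV (f::real\<Rightarrow>real) \<Longrightarrow> Ck_on k UNIV g \<Longrightarrow> Ck_on k UNIV (\<lambda>x. f x + g x)"
proof (induction k arbitrary: f g)
  case 0 thus ?case by (auto intro: continuous_intros)
next
  case (Suc k)
  hence "\<And>x. (f has_real_derivative deriv f x) (at x)" "\<And>x. (g has_real_derivative deriv g x) (at x)"
    by (auto simp: Ck_on_Suc_real DERIV_deriv_iff_real_differentiable)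
  thus ?case using Suc
    by (intro Ck_on_Suc_realI[where g="\<lambda>x. deriv f x + deriv g x"] derivative_intros)
       (auto simp: Ck_on_Suc_real)
qed

lemma Ck_on_mult:
  "Ck_on k UNIV (f::real\<Rightarrow>real) \<Longrightarrow> Ck_on k UNIV g \<Longrightarrow> Ck_on k UNIV (\<lambda>x. f x * g x)"
proof (induction k arbitrary: f g)
  case 0 thus ?case by (auto intro: continuous_intros)
next
  case (Suc k)
  hence "\<And>x. (f has_real_derivative deriv f x) (at x)" "\<And>x. (g has_real_derivative deriv g x) (at x)"
    by (auto simp: Ck_on_Suc_real DERIV_deriv_iff_real_differentiable)
  moreover have "Ck_on k UNIV f" "Ck_on k UNIV g" using Suc.prems Ck_on_SucD by blast+
  ultimately show ?case using Suc
    by (intro Ck_on_Suc_realI[where g="\<lambda>x. deriv f x * g x + deriv g x * f x"] derivative_intros Ck_on_add)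
       (auto simp: Ck_on_Suc_real)
qed

lemma Ck_on_const: "Ck_on k UNIV (\<lambda>x::real. c::real)"
proof (induction k arbitrary: c)
  case (Suc k)
  show ?case by (rule Ck_on_Suc_realI[where g="\<lambda>x. 0"]) (auto simp: Suc)
qed auto

lemma Ck_on_affine:
  "Ck_on k UNIV (f::real\<Rightarrow>real) \<Longrightarrow> Ck_on k UNIV (\<lambda>x. f (a * x + b))"
proof (induction k arbitrary: f)
  case 0 thus ?case by (auto intro!: continuous_intros intro: continuous_on_compose2)
next
  case (Suc k)
  hence D: "(f has_real_derivative deriv f x) (at x)" for x
    by (auto simp: Ck_on_Suc_real DERIV_deriv_iff_real_differentiable)
  have "((\<lambda>x. f (a * x + b)) has_real_derivative deriv f (a * x + b) * a) (at x)" for x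
    by (rule DERIV_chain'[where g=f, OF _ D]) (auto intro!: derivative_eq_intros)
  moreover have "Ck_on k UNIV (\<lambda>x. deriv f (a*x+b) * a)"
    using Suc by (intro Ck_on_mult Ck_on_const) (auto simp: Ck_on_Suc_real)
  ultimately show ?case by (rule Ck_on_Suc_realI)
qed

lemma smooth_on_deriv: "smooth_on UNIV (f::real\<Rightarrow>real) \<Longrightarrow> smooth_on UNIV (deriv f)"
  unfolding smooth_on_def using Ck_on_Suc_real by blast

lemma smooth_on_DERIV: "smooth_on UNIV (f::real\<Rightarrow>real) \<Longrightarrow> (f has_real_derivative deriv f x) (at x)"
  unfolding smooth_on_def using Ck_on_Suc_real DERIV_deriv_iff_real_differentiable by blast

lemma smooth_onI_DERIV:
  assumes "\<And>x. (f has_real_derivative g x) (at x)" "smooth_on UNIV (g::real\<Rightarrow>real)"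
  shows "smooth_on UNIV f"
  unfolding smooth_on_def
proof
  fix k show "Ck_on k UNIV f"
    using Ck_on_SucD[of k f] Ck_on_Suc_realI[OF assms(1), of k] assms(2) by (auto simp: smooth_on_def)
qed

lemma smooth_on_mult: "smooth_on UNIV (f::real\<Rightarrow>real) \<Longrightarrow> smooth_on UNIV g \<Longrightarrow> smooth_on UNIV (\<lambda>x. f x * g x)"
  by (simp add: smooth_on_def Ck_on_mult)

lemma smooth_on_const: "smooth_on UNIV (\<lambda>x::real. c::real)"
  by (simp add: smooth_on_def Ck_on_const)

lemma smooth_on_affine: "smooth_on UNIV (f::real\<Rightarrow>real) \<Longrightarrow> smooth_on UNIV (\<lambda>x. f (a * x + b))"
  by (simp add: smooth_on_def Ck_on_affine)

lemma smooth_on_cos_sin: "smooth_on UNIV (\<lambda>x::real. a * cos (\<xi> * x) + b * sin (\<xi> * x))"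
proof -
  have "Ck_on k UNIV (\<lambda>x::real. a * cos (\<xi> * x) + b * sin (\<xi> * x))" for k
  proof (induction k arbitrary: a b)
    case 0 show ?case by (auto intro!: continuous_intros)
  next
    case (Suc k)
    show ?case
      by (rule Ck_on_Suc_realI[OF _ Suc[of "\<xi>*b" "-\<xi>*a"]])
         (auto intro!: derivative_eq_intros simp: algebra_simps)
  qed
  thus ?thesis by (simp add: smooth_on_def)
qed

text \<open>For \<open>P = 1\<close> this is the classical flat function \<open>e\<^sup>-\<^sup>1\<^sup>/\<^sup>x\<close>.  The polynomial in \<open>1/x\<close> makes the family closed
under differentiation, so smoothness is an induction over the order.\<close>

definition flat_exp :: "real poly \<Rightarrow> real \<Rightarrow> real" where
  "flat_exp P x = (if x > 0 then poly P (1 / x) * exp (- (1 / x)) else 0)"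

lemma tendsto_poly_exp_neg: "((\<lambda>y::real. poly P y * exp (- y)) \<longlongrightarrow> 0) at_top"
proof -
  have "((\<lambda>y::real. \<Sum>i\<le>degree P. coeff P i * (y ^ i / exp y)) \<longlongrightarrow> (\<Sum>i\<le>degree P. coeff P i * 0)) at_top"
    by (intro tendsto_intros tendsto_power_div_exp_0)
  thus ?thesis by (simp add: poly_altdef sum_distrib_right exp_minus divide_inverse mult.assoc)
qed

text \<open>The recursion \<open>P \<mapsto> t\<^sup>2 (P - P')\<close> is the chain rule for \<open>t = 1/x\<close>; at \<open>0\<close> both one-sided limits vanish because
\<open>e\<^sup>-\<^sup>t\<close> beats every polynomial.\<close>

lemma DERIV_flat_exp:
  "(flat_exp P has_real_derivative flat_exp (monom 1 2 * (P - pderiv P)) x) (at x)"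
proof -
  consider "x > 0" | "x < 0" | "x = 0" by linarith
  thus ?thesis
  proof cases
    case 1
    have D: "((\<lambda>x. poly P (1 / x) * exp (- (1 / x))) has_real_derivative
        poly (pderiv P) (1/x) * (-(1/x^2)) * exp (-(1/x)) + exp (-(1/x)) * (1/x^2) * poly P (1/x)) (at x)"
      using 1 by (auto intro!: derivative_eq_intros DERIV_chain'[where g="poly P"] simp: power2_eq_square field_simps)
    have "eventually (\<lambda>y. y \<in> {0<..}) (nhds x)"
      using 1 by (intro eventually_nhds_in_open) auto
    hence "eventually (\<lambda>y. flat_exp P y = poly P (1 / y) * exp (- (1 / y))) (nhds x)"
      by eventually_elim (auto simp: flat_exp_def)
    from DERIV_cong_ev[OF refl this refl] D
    have "(flat_exp P has_real_derivative poly (pderiv P) (1/x) * (-(1/x^2)) * exp (-(1/x))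
        + exp (-(1/x)) * (1/x^2) * poly P (1/x)) (at x)" by blast
    moreover have "flat_exp (monom 1 2 * (P - pderiv P)) x = poly (pderiv P) (1/x) * (-(1/x^2)) * exp (-(1/x))
        + exp (-(1/x)) * (1/x^2) * poly P (1/x)"
      using 1 by (simp add: flat_exp_def poly_monom algebra_simps power_one_over)
    ultimately show ?thesis by simp
  next
    case 2
    have "eventually (\<lambda>y. y \<in> {..<0}) (nhds x)"
      using 2 by (intro eventually_nhds_in_open) auto
    hence "eventually (\<lambda>y. flat_exp P y = 0) (nhds x)"
      by eventually_elim (auto simp: flat_exp_def)
    from DERIV_cong_ev[OF refl this refl]
    have "(flat_exp P has_real_derivative 0) (at x)" by simp
    thus ?thesis using 2 by (simp add: flat_exp_def)
  next
    case 3
    have "((\<lambda>h. flat_exp P h / h) \<longlongrightarrow> 0) (at_right 0)"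
    proof -
      have "((\<lambda>y::real. poly (pCons 0 P) y * exp (-y)) \<longlongrightarrow> 0) at_top" by (rule tendsto_poly_exp_neg)
      hence "((\<lambda>h. poly (pCons 0 P) (inverse h) * exp (- inverse h)) \<longlongrightarrow> 0) (at_right 0)"
        by (rule filterlim_compose[OF _ filterlim_inverse_at_top_right])
      thus ?thesis
        by (rule Lim_transform_eventually)
           (auto simp: eventually_at_right_field flat_exp_def field_simps intro!: exI[of _ 1])
    qed
    moreover have "((\<lambda>h. flat_exp P h / h) \<longlongrightarrow> 0) (at_left 0)"
      by (rule tendsto_eventually) (auto simp: eventually_at_left_field flat_exp_def intro!: exI[of _ "-1"])
    ultimately have "((\<lambda>h. flat_exp P h / h) \<longlongrightarrow> 0) (at 0)"
      by (simp add: filterlim_split_at)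
    thus ?thesis using 3 by (simp add: has_field_derivative_iff flat_exp_def)
  qed
qed

lemma smooth_on_flat_exp: "smooth_on UNIV (flat_exp P)"
proof -
  have "Ck_on k UNIV (flat_exp P)" for k
  proof (induction k arbitrary: P)
    case 0
    show ?case using DERIV_isCont[OF DERIV_flat_exp] by (auto intro!: continuous_at_imp_continuous_on)
  next
    case (Suc k)
    show ?case by (rule Ck_on_Suc_realI[OF DERIV_flat_exp Suc])
  qed
  thus ?thesis by (simp add: smooth_on_def)
qed

text \<open>The normalised antiderivative of the bump \<open>e\<^sup>-\<^sup>1\<^sup>/\<^sup>x e\<^sup>-\<^sup>1\<^sup>/\<^sup>(\<^sup>1\<^sup>-\<^sup>x\<^sup>)\<close>.\<close>

lemma exists_smooth_step:
  obtains \<sigma> :: "real \<Rightarrow> real" where "smooth_on UNIV \<sigma>" "\<And>x. 0 \<le> \<sigma> x" "\<And>x. \<sigma> x \<le> 1"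
    "\<And>x. x \<le> 0 \<Longrightarrow> \<sigma> x = 0" "\<And>x. x \<ge> 1 \<Longrightarrow> \<sigma> x = 1"
proof -
  define b where "b = (\<lambda>x. flat_exp 1 x * flat_exp 1 (1 - x))"
  have "smooth_on UNIV (\<lambda>x. flat_exp 1 x * flat_exp 1 ((-1) * x + 1))"
    by (intro smooth_on_mult smooth_on_flat_exp smooth_on_affine)
  hence sb: "smooth_on UNIV b" by (simp add: b_def)
  have cb: "continuous_on A b" for A
    using DERIV_isCont[OF smooth_on_DERIV[OF sb]] by (intro continuous_at_imp_continuous_on) auto
  have b0: "b x \<ge> 0" for x by (simp add: b_def flat_exp_def)
  have bp: "b x > 0" if "0 < x" "x < 1" for x using that by (simp add: b_def flat_exp_def)
  have bz: "b x = 0" if "x \<le> 0 \<or> x \<ge> 1" for x using that by (auto simp: b_def flat_exp_def)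
  define B where "B = (\<lambda>x. integral {-1..x} b)"
  (* The lower limit -1 of B lies left of the support of b, so that B is differentiable at 0;
     S extends B by zero to the whole line. *)
  define S where "S = (\<lambda>x. if x < 0 then 0 else B x)"
  have dB: "(B has_real_derivative b x) (at x)" if "x > -1" for x
  proof -
    have "(B has_vector_derivative b x) (at x within {-1..x+1})"
      unfolding B_def by (rule integral_has_vector_derivative) (use that cb in auto)
    moreover have "at x within {-1..x+1} = at x"
      by (rule at_within_interior) (use that in auto)
    ultimately show ?thesis by (simp add: has_real_derivative_iff_has_vector_derivative)
  qed
  have Bz: "B x = 0" if "x \<le> 0" for x
    proof -
    have "B x = integral {-1..x} (\<lambda>_. 0)"
      unfolding B_def using bz that by (intro Henstock_Kurzweil_Integration.integral_cong) auto
    thus ?thesis by simp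
  qed
  have SB: "S x = B x" for x using Bz by (auto simp: S_def)
  have dS: "(S has_real_derivative b x) (at x)" for x
  proof (cases "x > -1")
    case True thus ?thesis using dB SB by (metis ext)
  next
    case False
    have "eventually (\<lambda>y. y \<in> {..<0}) (nhds x)"
      using False by (intro eventually_nhds_in_open) auto
    hence "eventually (\<lambda>y. S y = 0) (nhds x)"
      by eventually_elim (auto simp: S_def)
    from DERIV_cong_ev[OF refl this refl] show ?thesis using False bz[of x] by simp
  qed
  have sS: "smooth_on UNIV S" by (rule smooth_onI_DERIV[OF dS sb])
  have mono: "x \<le> y \<Longrightarrow> S x \<le> S y" for x y
    by (rule DERIV_nonneg_imp_nondecreasing) (use dS b0 in auto)
  have S1: "S 1 > 0"
  proof -
    have "S 0 < S 1"
    proof (rule DERIV_pos_imp_increasing_open[of 0 1 S])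
      show "\<exists>y. (S has_real_derivative y) (at x) \<and> 0 < y" if "0 < x" "x < 1" for x
        using dS bp that by blast
      show "continuous_on {0..1} S"
        using DERIV_isCont[OF dS] by (intro continuous_at_imp_continuous_on) auto
    qed auto
    thus ?thesis by (simp add: S_def Bz)
  qed
  have Sc: "S x = S 1" if "x \<ge> 1" for x
  proof (cases "x = 1")
    case False
    show ?thesis
    proof (rule DERIV_isconst_end[of 1 x S])
      show "1 < x" using that False by simp
      show "continuous_on {1..x} S"
        using DERIV_isCont[OF dS] by (intro continuous_at_imp_continuous_on) auto
      show "(S has_real_derivative 0) (at y)" if "1 < y" "y < x" for y
        using dS[of y] bz[of y] that by simp
    qed
  qed auto
  define \<sigma> where "\<sigma> = (\<lambda>x. S x * (1 / S 1))"
  show ?thesis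
  proof
    show "smooth_on UNIV \<sigma>" unfolding \<sigma>_def by (intro smooth_on_mult sS smooth_on_const)
    show "0 \<le> \<sigma> x" for x
    proof -
      have "S x \<ge> 0" using mono[of "min x 0" x] SB[of "min x 0"] Bz[of "min x 0"] by simp
      thus ?thesis using S1 by (simp add: \<sigma>_def)
    qed
    show "\<sigma> x \<le> 1" for x using mono[of x "max x 1"] Sc[of "max x 1"] S1 by (auto simp: \<sigma>_def)
    show "\<sigma> x = 0" if "x \<le> 0" for x using that by (simp add: \<sigma>_def SB Bz)
    show "\<sigma> x = 1" if "x \<ge> 1" for x using S1 Sc[OF that] by (simp add: \<sigma>_def)
  qed
qed

lemma test_functionI:
  assumes "smooth_on UNIV \<phi>" "\<And>x. \<bar>x\<bar> > R \<Longrightarrow> \<phi> x = 0"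
  shows "test_function \<phi>"
proof -
  have "{x. \<phi> x \<noteq> 0} \<subseteq> {-R..R}" using assms(2) by (force simp: abs_le_iff)
  hence "closure {x. \<phi> x \<noteq> 0} \<subseteq> {-R..R}" by (simp add: closure_minimal)
  hence "compact (closure {x. \<phi> x \<noteq> 0})"
    by (meson bounded_closed_interval bounded_subset closed_closure compact_eq_bounded_closed)
  thus ?thesis using assms(1) by (simp add: test_function_def)
qed

lemma test_function_support:
  assumes "test_function \<phi>"
  obtains R where "R > 0" "\<And>x. \<bar>x\<bar> \<ge> R \<Longrightarrow> \<phi> x = 0"
proof -
  have "bounded {x. \<phi> x \<noteq> 0}"
    using assms bounded_subset[OF compact_imp_bounded closure_subset] by (auto simp: test_function_def)
  then obtain b where "\<And>x. \<phi> x \<noteq> 0 \<Longrightarrow> \<bar>x\<bar> \<le> b" by (auto simp: bounded_iff)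
  thus ?thesis by (intro that[of "\<bar>b\<bar> + 1"]) (force)+
qed

lemma test_function_DERIV: "test_function \<phi> \<Longrightarrow> (\<phi> has_real_derivative deriv \<phi> x) (at x)"
  by (simp add: test_function_def smooth_on_DERIV)

lemma test_function_continuous: "test_function \<phi> \<Longrightarrow> continuous_on A \<phi>"
  using DERIV_isCont[OF test_function_DERIV] by (intro continuous_at_imp_continuous_on) auto

lemma test_function_measurable: "test_function \<phi> \<Longrightarrow> \<phi> \<in> borel_measurable borel"
  by (simp add: borel_measurable_continuous_onI test_function_continuous)

lemma test_function_bounded:
  assumes "test_function \<phi>"
  obtains B where "B > 0" "\<And>x. \<bar>\<phi> x\<bar> \<le> B"
proof -
  obtain R where R: "R > 0" "\<And>x. \<bar>x\<bar> \<ge> R \<Longrightarrow> \<phi> x = 0" using test_function_support[OF assms] by blast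
  have "bounded (\<phi> ` {-R..R})"
    by (intro compact_imp_bounded compact_continuous_image test_function_continuous assms) auto
  then obtain B where "\<And>x. x \<in> {-R..R} \<Longrightarrow> \<bar>\<phi> x\<bar> \<le> B" unfolding bounded_iff by fastforce
  hence "\<bar>\<phi> x\<bar> \<le> \<bar>B\<bar> + 1" for x
  proof (cases "\<bar>x\<bar> \<ge> R")
    case False
    hence "x \<in> {-R..R}" by auto
    thus ?thesis using \<open>\<And>x. x \<in> {-R..R} \<Longrightarrow> \<bar>\<phi> x\<bar> \<le> B\<close>[of x] by linarith
  qed (use R in simp)
  thus ?thesis by (intro that[of "\<bar>B\<bar> + 1"]) auto
qed

lemma test_function_deriv:
  assumes "test_function \<phi>" shows "test_function (deriv \<phi>)"
proof -
  obtain R where R: "R > 0" "\<And>x. \<bar>x\<bar> \<ge> R \<Longrightarrow> \<phi> x = 0" using test_function_support[OF assms] by blast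
  show ?thesis
  proof (rule test_functionI)
    show "smooth_on UNIV (deriv \<phi>)" using assms by (simp add: test_function_def smooth_on_deriv)
    fix x assume x: "\<bar>x\<bar> > R"
    have "open {x::real. \<bar>x\<bar> > R}" by (intro open_Collect_less continuous_intros)
    hence "eventually (\<lambda>y. y \<in> {x. \<bar>x\<bar> > R}) (nhds x)"
      using x by (intro eventually_nhds_in_open) auto
    hence "eventually (\<lambda>y. \<phi> y = 0) (nhds x)" by eventually_elim (use R in auto)
    from DERIV_cong_ev[OF refl this refl] have "(\<phi> has_real_derivative 0) (at x)" by simp
    thus "deriv \<phi> x = 0" by (rule DERIV_imp_deriv)
  qed
qed

lemma test_function_iter_deriv: "test_function \<phi> \<Longrightarrow> test_function ((deriv ^^ l) \<phi>)"
  by (induction l) (auto intro: test_function_deriv)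

lemma test_function_mult_smooth:
  assumes "test_function \<phi>" "smooth_on UNIV f" shows "test_function (\<lambda>x. \<phi> x * f x)"
proof -
  obtain R where R: "R > 0" "\<And>x. \<bar>x\<bar> \<ge> R \<Longrightarrow> \<phi> x = 0" using test_function_support[OF assms(1)] by blast
  show ?thesis by (rule test_functionI[of _ R])
    (use R assms in \<open>auto simp: test_function_def intro: smooth_on_mult\<close>)
qed

lemma test_function_scale:
  assumes "test_function \<phi>" "a \<noteq> 0" shows "test_function (\<lambda>x. \<phi> (a * x))"
proof -
  obtain R where R: "R > 0" "\<And>x. \<bar>x\<bar> \<ge> R \<Longrightarrow> \<phi> x = 0" using test_function_support[OF assms(1)] by blast
  show ?thesis
  proof (rule test_functionI[of _ "R / \<bar>a\<bar>"])
    show "smooth_on UNIV (\<lambda>x. \<phi> (a * x))"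
      using smooth_on_affine[of \<phi> a 0] assms(1) by (simp add: test_function_def)
    show "\<phi> (a * x) = 0" if "\<bar>x\<bar> > R / \<bar>a\<bar>" for x
      using that assms(2) by (intro R(2)) (simp add: field_simps abs_mult)
  qed
qed

lemma test_function_reflect: "test_function \<phi> \<Longrightarrow> test_function (\<lambda>x. \<phi> (- x))"
  using test_function_scale[of \<phi> "-1"] by simp

lemma exists_cutoff:
  obtains \<zeta> :: "real \<Rightarrow> real" where "test_function \<zeta>" "\<And>x. 0 \<le> \<zeta> x" "\<And>x. \<zeta> x \<le> 1"
    "\<And>x. \<bar>x\<bar> \<le> 1 \<Longrightarrow> \<zeta> x = 1"
proof -
  obtain \<sigma> :: "real \<Rightarrow> real" where \<sigma>: "smooth_on UNIV \<sigma>" "\<And>x. 0 \<le> \<sigma> x" "\<And>x. \<sigma> x \<le> 1"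
    "\<And>x. x \<le> 0 \<Longrightarrow> \<sigma> x = 0" "\<And>x. x \<ge> 1 \<Longrightarrow> \<sigma> x = 1" using exists_smooth_step by blast
  define \<zeta> where "\<zeta> = (\<lambda>x. \<sigma> (1 * x + 2) * \<sigma> ((-1) * x + 2))"
  show ?thesis
  proof
    show "test_function \<zeta>"
    proof (rule test_functionI[of _ 2])
      show "smooth_on UNIV \<zeta>" unfolding \<zeta>_def by (intro smooth_on_mult smooth_on_affine \<sigma>)
      fix x :: real assume "\<bar>x\<bar> > 2"
      hence "1 * x + 2 \<le> 0 \<or> (-1) * x + 2 \<le> 0" by auto
      thus "\<zeta> x = 0" using \<sigma>(4) by (auto simp: \<zeta>_def)
    qed
    show "0 \<le> \<zeta> x" "\<zeta> x \<le> 1" for x using \<sigma>(2,3) by (auto simp: \<zeta>_def mult_le_one)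
    show "\<zeta> x = 1" if "\<bar>x\<bar> \<le> 1" for x using that \<sigma>(5) by (auto simp: \<zeta>_def)
  qed
qed

text \<open>The indicator of an open interval is a bounded pointwise limit of products of two steepening smooth steps that
vanish outside the interval.\<close>

lemma interval_integral_zero_by_test_functions:
  fixes g :: "real \<Rightarrow> real"
  assumes g: "\<And>a b. set_integrable lborel {a..b} g"
    and z: "\<And>\<phi>. test_function \<phi> \<Longrightarrow> (\<integral>x. \<phi> x * g x \<partial>lborel) = 0"
  shows "(\<integral>x. indicator {a<..<b} x * g x \<partial>lborel) = 0"
proof -
  obtain \<sigma> :: "real \<Rightarrow> real" where \<sigma>: "smooth_on UNIV \<sigma>" "\<And>x. 0 \<le> \<sigma> x" "\<And>x. \<sigma> x \<le> 1"
    "\<And>x. x \<le> 0 \<Longrightarrow> \<sigma> x = 0" "\<And>x. x \<ge> 1 \<Longrightarrow> \<sigma> x = 1" using exists_smooth_step by blast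
  define \<phi> where "\<phi> = (\<lambda>(n::nat) x. \<sigma> (real n * x + (- real n * a)) * \<sigma> ((- real n) * x + real n * b))"
  have sm: "smooth_on UNIV (\<phi> n)" for n unfolding \<phi>_def by (intro smooth_on_mult smooth_on_affine \<sigma>)
  have out: "\<phi> n x = 0" if "x \<notin> {a<..<b}" for n x
  proof -
    have "x \<le> a \<or> x \<ge> b" using that by auto
    hence "real n * x + (- real n * a) \<le> 0 \<or> (- real n) * x + real n * b \<le> 0"
      using mult_left_mono[of x a "real n"] mult_left_mono[of b x "real n"] by auto
    thus ?thesis using \<sigma>(4) by (auto simp: \<phi>_def)
  qed
  have tf: "test_function (\<phi> n)" for n
    by (rule test_functionI[OF sm, of "max \<bar>a\<bar> \<bar>b\<bar>"]) (rule out, auto)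
  have bd: "\<bar>\<phi> n x\<bar> \<le> indicator {a..b} x" for n x
    using out[of x n] \<sigma>(2,3) by (cases "x \<in> {a<..<b}") (auto simp: \<phi>_def mult_le_one abs_mult indicator_def)
  have lim: "(\<lambda>n. \<phi> n x) \<longlonglongrightarrow> indicator {a<..<b} x" for x
  proof (cases "x \<in> {a<..<b}")
    case True
    have "eventually (\<lambda>n. real n * (x - a) \<ge> 1) sequentially" "eventually (\<lambda>n. real n * (b - x) \<ge> 1) sequentially"
      using True by real_asymp+
    hence "eventually (\<lambda>n. \<phi> n x = 1) sequentially"
    proof eventually_elim
      case (elim n)
      thus ?case using \<sigma>(5) by (simp add: \<phi>_def algebra_simps)
    qed
    thus ?thesis using True by (simp add: tendsto_eventually)
  qed (use out in auto)
  have [measurable]: "g \<in> borel_measurable borel"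
  proof (rule borel_measurable_LIMSEQ_real)
    show "(\<lambda>n. indicator {- real n..real n} x * g x) \<longlonglongrightarrow> g x" for x
    proof (rule tendsto_eventually)
      have "eventually (\<lambda>n. real n \<ge> \<bar>x\<bar>) sequentially" by real_asymp
      thus "\<forall>\<^sub>F n in sequentially. indicator {- real n..real n} x * g x = g x"
        by eventually_elim (auto simp: indicator_def abs_le_iff)
    qed
    show "(\<lambda>x. indicator {- real n..real n} x * g x) \<in> borel_measurable borel" for n
      using borel_measurable_integrable[OF g[of "- real n" "real n", unfolded set_integrable_def]] by simp
  qed
  have "(\<lambda>n. \<integral>x. \<phi> n x * g x \<partial>lborel) \<longlonglongrightarrow> (\<integral>x. indicator {a<..<b} x * g x \<partial>lborel)"
  proof (rule integral_dominated_convergence[where w="\<lambda>x. \<bar>indicator {a..b} x * g x\<bar>"])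
    show "integrable lborel (\<lambda>x. \<bar>indicator {a..b} x * g x\<bar>)"
      using g[of a b] by (simp add: set_integrable_def integrable_abs)
    show "AE x in lborel. norm (\<phi> n x * g x) \<le> \<bar>indicator {a..b} x * g x\<bar>" for n
      using bd by (intro AE_I2) (auto simp: abs_mult intro: mult_right_mono)
    show "(\<lambda>x. \<phi> n x * g x) \<in> borel_measurable lborel" for n
      using test_function_measurable[OF tf[of n]] by simp
  qed (auto intro!: tendsto_intros lim)
  moreover have "(\<integral>x. \<phi> n x * g x \<partial>lborel) = 0" for n by (rule z[OF tf])
  ultimately show ?thesis by (simp add: LIMSEQ_const_iff)
qed

text \<open>The integrals over open intervals vanish, hence, by a Dynkin argument on each bounded window, so do those over
all Borel sets.\<close>

lemma fundamental_lemma: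
  fixes g :: "real \<Rightarrow> real"
  assumes g: "\<And>a b. set_integrable lborel {a..b} g"
    and z: "\<And>\<phi>. test_function \<phi> \<Longrightarrow> (\<integral>x. \<phi> x * g x \<partial>lborel) = 0"
  shows "AE x in lborel. g x = 0"
proof -
  have "AE x in lborel. indicator {- real N<..<real N} x * g x = 0" for N :: nat
  proof -
    define G where "G = (\<lambda>x. indicator {- real N<..<real N} x * g x)"
    have Gi: "integrable lborel G"
    proof -
      have "set_integrable lborel {- real N<..<real N} g"
        by (rule set_integrable_subset[OF g[of "- real N" "real N"]]) auto
      thus ?thesis unfolding G_def set_integrable_def by simp
    qed
    have basic: "(\<integral>x\<in>{a<..<b}. G x \<partial>lborel) = 0" for a b
    proof -
      have "(\<integral>x\<in>{a<..<b}. G x \<partial>lborel) = (\<integral>x. indicator {max a (- real N)<..<min b (real N)} x * g x \<partial>lborel)"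
        unfolding set_lebesgue_integral_def G_def
        by (intro Bochner_Integration.integral_cong) (auto simp: indicator_def)
      thus ?thesis using interval_integral_zero_by_test_functions[OF g z] by simp
    qed
    have G0: "(\<integral>x. G x \<partial>lborel) = 0"
      using interval_integral_zero_by_test_functions[OF g z] by (simp add: G_def)
    have si: "set_integrable lborel A G" if "A \<in> sets borel" for A
      using integrable_mult_indicator[OF _ Gi, of A] that by (simp add: set_integrable_def)
    have "(\<integral>x\<in>A. G x \<partial>lborel) = 0" if A: "A \<in> sets borel" for A
    proof -
      let ?I = "range (\<lambda>(a::real, b). {a <..< b})"
      have bs: "sets (borel :: real measure) = sigma_sets UNIV ?I"
        by (simp add: borel_eq_box box_real)
      have "Int_stable ?I"
      proof (rule Int_stableI)
        fix A B assume "A \<in> ?I" "B \<in> ?I"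
        then obtain a b c d where "A = {a<..<b}" "B = {c<..<d}" by auto
        hence "A \<inter> B = {max a c<..<min b d}" by auto
        thus "A \<inter> B \<in> ?I" by auto
      qed
      moreover have "?I \<subseteq> Pow UNIV" by simp
      moreover have "A \<in> sigma_sets UNIV ?I" using A bs by simp
      ultimately show ?thesis
      proof (induction rule: sigma_sets_induct_disjoint)
        case (basic A) thus ?case using \<open>\<And>a b. (\<integral>x\<in>{a<..<b}. G x \<partial>lborel) = 0\<close> by auto
      next
        case empty show ?case by (simp add: set_lebesgue_integral_def)
      next
        case (compl A)
        hence A: "A \<in> sets borel" using bs by simp
        have "(\<integral>x\<in>UNIV - A. G x \<partial>lborel) = (\<integral>x. G x - indicator A x *\<^sub>R G x \<partial>lborel)"
          unfolding set_lebesgue_integral_def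
          by (intro Bochner_Integration.integral_cong) (auto simp: indicator_def)
        also have "\<dots> = 0" using Gi si[OF A] compl(2) G0
          by (simp add: set_integrable_def set_lebesgue_integral_def)
        finally show ?case .
      next
        case (union A)
        hence A: "A i \<in> sets borel" for i using bs by auto
        have "(\<integral>x\<in>(\<Union>i. A i). G x \<partial>lborel) = (\<Sum>i. (\<integral>x\<in>(A i). G x \<partial>lborel))"
          by (rule lebesgue_integral_countable_add)
             (use A union(1) si in \<open>auto simp: disjoint_family_on_def\<close>)
        thus ?case using union by simp
      qed
    qed
    hence "AE x in lborel. G x = 0"
      using sigma_finite_measure.density_zero[OF lborel.sigma_finite_measure_axioms Gi] by auto
    thus ?thesis by (simp add: G_def)
  qed
  hence "AE x in lborel. \<forall>N. indicator {- real N<..<real N} x * g x = 0"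
    unfolding AE_all_countable by blast
  thus ?thesis
  proof eventually_elim
    case (elim x)
    obtain N where "\<bar>x\<bar> < real N" using reals_Archimedean2 by blast
    thus ?case using elim[rule_format, of N] by (auto simp: indicator_def abs_less_iff split: if_splits)
  qed
qed

section \<open>Square-integrable functions on the line\<close>

lemma square_integrable_measurable: "square_integrable f \<Longrightarrow> f \<in> borel_measurable borel"
  by (simp add: square_integrable_def)

lemma square_integrable_sq: "square_integrable f \<Longrightarrow> integrable lborel (\<lambda>x. (norm (f x))\<^sup>2)"
  by (simp add: square_integrable_def)

lemma L2_norm_nonneg [simp]: "L2_norm f \<ge> 0"
  by (simp add: L2_norm_def)

lemma L2_norm_sq: "(L2_norm f)\<^sup>2 = (\<integral>x. (norm (f x))\<^sup>2 \<partial>lborel)"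
  by (simp add: L2_norm_def)

lemma nn_integral_L2_norm:
  "square_integrable f \<Longrightarrow> (\<integral>\<^sup>+x. ennreal ((norm (f x))\<^sup>2) \<partial>lborel) = ennreal ((L2_norm f)\<^sup>2)"
  by (simp add: L2_norm_sq nn_integral_eq_integral square_integrable_sq)

lemma square_integrable_from_nn_integral:
  fixes f :: "real \<Rightarrow> 'b::euclidean_space"
  assumes "f \<in> borel_measurable borel" "(\<integral>\<^sup>+x. ennreal ((norm (f x))\<^sup>2) \<partial>lborel) \<le> ennreal (c\<^sup>2)" "c \<ge> 0"
  shows "square_integrable f" "L2_norm f \<le> c"
proof -
  have i: "integrable lborel (\<lambda>x. (norm (f x))\<^sup>2)"
    using assms by (intro integrableI_bounded) (auto intro: le_less_trans)
  thus sq: "square_integrable f" using assms by (simp add: square_integrable_def)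
  have "ennreal ((L2_norm f)\<^sup>2) \<le> ennreal (c\<^sup>2)" using assms(2) nn_integral_L2_norm[OF sq] by simp
  hence "(L2_norm f)\<^sup>2 \<le> c\<^sup>2" by simp
  thus "L2_norm f \<le> c" using assms(3) power2_le_imp_le by blast
qed

lemma square_integrable_bound:
  fixes f :: "real \<Rightarrow> 'b::euclidean_space" and h :: "real \<Rightarrow> real"
  assumes "f \<in> borel_measurable borel" "integrable lborel h" "\<And>x. (norm (f x))\<^sup>2 \<le> h x"
  shows "square_integrable f"
proof -
  have "integrable lborel (\<lambda>x. (norm (f x))\<^sup>2)"
  proof (rule Bochner_Integration.integrable_bound[OF assms(2)])
    show "AE x in lborel. norm ((norm (f x))\<^sup>2) \<le> norm (h x)"
      using order_trans[OF assms(3) abs_ge_self] by (intro AE_I2) simp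
  qed (use assms(1) in simp)
  thus ?thesis using assms(1) by (simp add: square_integrable_def)
qed

lemma square_integrable_add:
  fixes f :: "real \<Rightarrow> 'b::euclidean_space"
  assumes "square_integrable f" "square_integrable g"
  shows "square_integrable (\<lambda>x. f x + g x)"
proof (rule square_integrable_bound[where h="\<lambda>x. 2 * (norm (f x))\<^sup>2 + 2 * (norm (g x))\<^sup>2"])
  show "(\<lambda>x. f x + g x) \<in> borel_measurable borel"
    using assms square_integrable_measurable by (intro borel_measurable_add) auto
  show "integrable lborel (\<lambda>x. 2 * (norm (f x))\<^sup>2 + 2 * (norm (g x))\<^sup>2)"
    using assms by (simp add: square_integrable_sq)
  fix x
  have "(norm (f x + g x))\<^sup>2 \<le> (norm (f x) + norm (g x))\<^sup>2" by (intro power_mono norm_triangle_ineq) auto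
  also have "\<dots> \<le> 2 * (norm (f x))\<^sup>2 + 2 * (norm (g x))\<^sup>2"
    using zero_le_power2[of "norm (f x) - norm (g x)"] by (simp add: power2_eq_square algebra_simps)
  finally show "(norm (f x + g x))\<^sup>2 \<le> 2 * (norm (f x))\<^sup>2 + 2 * (norm (g x))\<^sup>2" .
qed

lemma square_integrable_mult_bounded:
  fixes f :: "real \<Rightarrow> complex"
  assumes "square_integrable f" "m \<in> borel_measurable borel" "\<And>x. norm (m x) \<le> B"
  shows "square_integrable (\<lambda>x. m x * f x)"
proof (rule square_integrable_bound[where h="\<lambda>x. B\<^sup>2 * (norm (f x))\<^sup>2"])
  show "(\<lambda>x. m x * f x) \<in> borel_measurable borel"
    using assms square_integrable_measurable by (intro borel_measurable_times) auto
qed (use assms in \<open>auto simp: square_integrable_sq norm_mult power_mult_distrib intro!: mult_right_mono power_mono\<close>)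

lemma square_integrable_cmult:
  "square_integrable (f::real\<Rightarrow>complex) \<Longrightarrow> square_integrable (\<lambda>x. c * f x)"
  by (rule square_integrable_mult_bounded[where B="norm c"]) auto

lemma square_integrable_diff:
  fixes f :: "real \<Rightarrow> 'b::euclidean_space"
  assumes "square_integrable f" "square_integrable g"
  shows "square_integrable (\<lambda>x. f x - g x)"
proof -
  have "square_integrable (\<lambda>x. - g x)" using assms(2) by (auto simp: square_integrable_def)
  from square_integrable_add[OF assms(1) this] show ?thesis by simp
qed

lemma L2_norm_cmult: "L2_norm (\<lambda>x. c * f x :: complex) = norm c * L2_norm f"
  by (simp add: L2_norm_def norm_mult power_mult_distrib real_sqrt_mult)

lemma L2_norm_minus_commute: "L2_norm (\<lambda>x. f x - g x) = L2_norm (\<lambda>x. g x - f x)"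
  by (simp add: L2_norm_def norm_minus_commute)

lemma L2_norm_cong_AE:
  fixes f :: "real \<Rightarrow> 'b::euclidean_space"
  assumes "f \<in> borel_measurable borel" "g \<in> borel_measurable borel" "AE x in lborel. f x = g x"
  shows "L2_norm f = L2_norm g"
proof -
  have "(\<integral>x. (norm (f x))\<^sup>2 \<partial>lborel) = (\<integral>x. (norm (g x))\<^sup>2 \<partial>lborel)"
    using assms by (intro integral_cong_AE) auto
  thus ?thesis by (simp add: L2_norm_def)
qed

lemma square_integrable_cong_AE:
  fixes f :: "real \<Rightarrow> 'b::euclidean_space"
  assumes "square_integrable f" "g \<in> borel_measurable borel" "AE x in lborel. f x = g x"
  shows "square_integrable g"
proof -
  have "integrable lborel (\<lambda>x. (norm (g x))\<^sup>2)"
    by (rule Bochner_Integration.integrable_cong_AE_imp[OF square_integrable_sq[OF assms(1)]])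
       (use assms in auto)
  thus ?thesis using assms by (simp add: square_integrable_def)
qed

lemma L2_norm_reflect: "L2_norm (\<lambda>x. f (- x)) = L2_norm f"
proof -
  have "(\<integral>x. (norm (f (- x)))\<^sup>2 \<partial>lborel) = (\<integral>x. (norm (f x))\<^sup>2 \<partial>lborel)"
    using lborel_integral_real_affine[of "-1" "\<lambda>x. (norm (f x))\<^sup>2" 0] by simp
  thus ?thesis by (simp add: L2_norm_def)
qed

lemma square_integrable_reflect:
  fixes f :: "real \<Rightarrow> 'b::euclidean_space"
  assumes "square_integrable f" shows "square_integrable (\<lambda>x. f (- x))"
proof -
  have [measurable]: "f \<in> borel_measurable borel" using assms by (rule square_integrable_measurable)
  have "integrable lborel (\<lambda>x. (norm (f (- x)))\<^sup>2)"
    using lborel_integrable_real_affine[OF square_integrable_sq[OF assms], of "-1" 0] by simp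
  thus ?thesis by (simp add: square_integrable_def)
qed

lemma norm_mult_le_half_squares: "norm (a * b :: complex) \<le> ((norm a)\<^sup>2 + (norm b)\<^sup>2) / 2"
  using zero_le_power2[of "norm a - norm b"] by (simp add: norm_mult power2_eq_square algebra_simps)

lemma integrable_mult_L2:
  assumes "square_integrable (f::real\<Rightarrow>complex)" "square_integrable g"
  shows "integrable lborel (\<lambda>x. f x * g x)"
proof (rule Bochner_Integration.integrable_bound)
  show "integrable lborel (\<lambda>x. ((norm (f x))\<^sup>2 + (norm (g x))\<^sup>2) / 2)"
    using assms by (simp add: square_integrable_sq)
  show "(\<lambda>x. f x * g x) \<in> borel_measurable lborel"
    using square_integrable_measurable[OF assms(1)] square_integrable_measurable[OF assms(2)]
    by (simp add: borel_measurable_times)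
qed (use norm_mult_le_half_squares order_trans[OF _ abs_ge_self] in auto)

lemma Cauchy_Schwarz_L2:
  assumes f: "square_integrable (f::real\<Rightarrow>complex)" and g: "square_integrable g"
  shows "(\<integral>x. norm (f x * g x) \<partial>lborel) \<le> L2_norm f * L2_norm g"
proof -
  have [measurable]: "f \<in> borel_measurable borel" "g \<in> borel_measurable borel"
    using assms square_integrable_measurable by auto
  have "ennreal ((\<integral>x. norm (f x * g x) \<partial>lborel)\<^sup>2) = (\<integral>\<^sup>+x. ennreal (norm (f x)) * ennreal (norm (g x)) \<partial>lborel)\<^sup>2"
    using nn_integral_eq_integral[OF integrable_norm[OF integrable_mult_L2[OF f g]]]
    by (simp add: norm_mult ennreal_mult ennreal_power integral_nonneg_AE)
  also have "\<dots> \<le> (\<integral>\<^sup>+x. (ennreal (norm (f x)))\<^sup>2 \<partial>lborel) * (\<integral>\<^sup>+x. (ennreal (norm (g x)))\<^sup>2 \<partial>lborel)"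
    by (rule Cauchy_Schwarz_nn_integral) auto
  also have "\<dots> = ennreal ((L2_norm f * L2_norm g)\<^sup>2)"
    using nn_integral_L2_norm[OF f] nn_integral_L2_norm[OF g]
    by (simp add: ennreal_power power_mult_distrib ennreal_mult)
  finally have "(\<integral>x. norm (f x * g x) \<partial>lborel)\<^sup>2 \<le> (L2_norm f * L2_norm g)\<^sup>2" by simp
  thus ?thesis by (rule power2_le_imp_le) simp
qed

lemma Cauchy_Schwarz_L2':
  assumes f: "square_integrable (f::real\<Rightarrow>complex)" and g: "square_integrable g"
  shows "norm (\<integral>x. f x * g x \<partial>lborel) \<le> L2_norm f * L2_norm g"
  using Cauchy_Schwarz_L2[OF assms] integral_norm_bound[of lborel "\<lambda>x. f x * g x"] by linarith

lemma L2_norm_triangle: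
  fixes f :: "real \<Rightarrow> complex"
  assumes f: "square_integrable f" and g: "square_integrable g"
  shows "L2_norm (\<lambda>x. f x + g x) \<le> L2_norm f + L2_norm g"
proof -
  note [simp] = square_integrable_sq[OF f] square_integrable_sq[OF g] integrable_norm[OF integrable_mult_L2[OF f g]]
  have "(L2_norm (\<lambda>x. f x + g x))\<^sup>2 \<le> (\<integral>x. (norm (f x))\<^sup>2 + 2 * norm (f x * g x) + (norm (g x))\<^sup>2 \<partial>lborel)"
    unfolding L2_norm_sq
  proof (rule integral_mono)
    fix x
    have "(norm (f x + g x))\<^sup>2 \<le> (norm (f x) + norm (g x))\<^sup>2" by (intro power_mono norm_triangle_ineq) auto
    thus "(norm (f x + g x))\<^sup>2 \<le> (norm (f x))\<^sup>2 + 2 * norm (f x * g x) + (norm (g x))\<^sup>2"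
      by (simp add: power2_sum norm_mult)
  qed (auto simp: square_integrable_sq[OF square_integrable_add[OF f g]])
  also have "\<dots> = (L2_norm f)\<^sup>2 + 2 * (\<integral>x. norm (f x * g x) \<partial>lborel) + (L2_norm g)\<^sup>2"
    by (simp add: L2_norm_sq)
  also have "\<dots> \<le> (L2_norm f + L2_norm g)\<^sup>2"
    using Cauchy_Schwarz_L2[OF f g] by (simp add: power2_sum)
  finally show ?thesis by (rule power2_le_imp_le) simp
qed

lemma L2_norm_diff_triangle:
  fixes f :: "real \<Rightarrow> complex"
  assumes "square_integrable f" "square_integrable g" "square_integrable h"
  shows "L2_norm (\<lambda>x. f x - h x) \<le> L2_norm (\<lambda>x. f x - g x) + L2_norm (\<lambda>x. g x - h x)"
  using L2_norm_triangle[OF square_integrable_diff[OF assms(1,2)] square_integrable_diff[OF assms(2,3)]] by simp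

lemma L2_norm_mono:
  fixes f :: "real \<Rightarrow> 'a::euclidean_space" and g :: "real \<Rightarrow> 'b::euclidean_space"
  assumes "f \<in> borel_measurable borel" "square_integrable g" "AE x in lborel. norm (f x) \<le> norm (g x)"
  shows "square_integrable f" "L2_norm f \<le> L2_norm g"
proof -
  have "(\<integral>\<^sup>+x. ennreal ((norm (f x))\<^sup>2) \<partial>lborel) \<le> (\<integral>\<^sup>+x. ennreal ((norm (g x))\<^sup>2) \<partial>lborel)"
    using assms(3) by (intro nn_integral_mono_AE) (auto intro!: ennreal_leI power_mono)
  hence *: "(\<integral>\<^sup>+x. ennreal ((norm (f x))\<^sup>2) \<partial>lborel) \<le> ennreal ((L2_norm g)\<^sup>2)"
    using nn_integral_L2_norm[OF assms(2)] by simp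
  show "square_integrable f" "L2_norm f \<le> L2_norm g"
    using square_integrable_from_nn_integral[OF assms(1) *] by auto
qed

lemma L2_norm_zero_AE:
  fixes f :: "real \<Rightarrow> 'a::euclidean_space"
  assumes "square_integrable f" "L2_norm f = 0"
  shows "AE x in lborel. f x = 0"
proof -
  have "(\<integral>x. (norm (f x))\<^sup>2 \<partial>lborel) = 0" using assms(2) L2_norm_sq[of f] by simp
  hence "AE x in lborel. (norm (f x))\<^sup>2 = 0"
    using integral_nonneg_eq_0_iff_AE[OF square_integrable_sq[OF assms(1)]] by auto
  thus ?thesis by simp
qed

lemma L2_limit_unique:
  fixes f :: "nat \<Rightarrow> real \<Rightarrow> complex"
  assumes "\<And>n. square_integrable (f n)" "square_integrable g" "square_integrable h"
    "(\<lambda>n. L2_norm (\<lambda>x. f n x - g x)) \<longlonglongrightarrow> 0" "(\<lambda>n. L2_norm (\<lambda>x. f n x - h x)) \<longlonglongrightarrow> 0"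
  shows "AE x in lborel. g x = h x"
proof -
  have "(\<lambda>n. L2_norm (\<lambda>x. f n x - g x) + L2_norm (\<lambda>x. f n x - h x)) \<longlonglongrightarrow> 0 + 0"
    by (intro tendsto_add assms)
  hence "L2_norm (\<lambda>x. g x - h x) \<le> 0"
    using L2_norm_diff_triangle[OF assms(2) assms(1) assms(3)]
    by (intro LIMSEQ_le_const[of "\<lambda>n. L2_norm (\<lambda>x. f n x - g x) + L2_norm (\<lambda>x. f n x - h x)"])
       (auto simp: L2_norm_minus_commute[of g])
  hence "L2_norm (\<lambda>x. g x - h x) = 0" by (simp add: order_antisym)
  from L2_norm_zero_AE[OF square_integrable_diff[OF assms(2,3)] this] show ?thesis by simp
qed

lemma L2_norm_tendsto:
  fixes f :: "nat \<Rightarrow> real \<Rightarrow> complex"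
  assumes f: "\<And>n. square_integrable (f n)" and g: "square_integrable g"
    and lim: "(\<lambda>n. L2_norm (\<lambda>x. f n x - g x)) \<longlonglongrightarrow> 0"
  shows "(\<lambda>n. L2_norm (f n)) \<longlonglongrightarrow> L2_norm g"
proof -
  have "\<bar>L2_norm (f n) - L2_norm g\<bar> \<le> L2_norm (\<lambda>x. f n x - g x)" for n
    using L2_norm_triangle[OF square_integrable_diff[OF f g] g, of n]
      L2_norm_triangle[OF square_integrable_diff[OF g f] f, of n n] L2_norm_minus_commute[of "f n" g] by simp
  hence "(\<lambda>n. L2_norm (f n) - L2_norm g) \<longlonglongrightarrow> 0"
    using lim by (intro tendsto_0_le[OF lim, of _ 1]) auto
  thus ?thesis by (simp add: LIM_zero_iff)
qed

lemma L2_pairing_tendsto: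
  fixes f :: "nat \<Rightarrow> real \<Rightarrow> complex"
  assumes f: "\<And>n. square_integrable (f n)" and f': "square_integrable f'"
    and g: "\<And>n. square_integrable (g n)" and g': "square_integrable g'"
    and limf: "(\<lambda>n. L2_norm (\<lambda>x. f n x - f' x)) \<longlonglongrightarrow> 0"
    and limg: "(\<lambda>n. L2_norm (\<lambda>x. g n x - g' x)) \<longlonglongrightarrow> 0"
  shows "(\<lambda>n. \<integral>x. f n x * g n x \<partial>lborel) \<longlonglongrightarrow> (\<integral>x. f' x * g' x \<partial>lborel)"
proof -
  have A: "norm ((\<integral>x. f n x * g n x \<partial>lborel) - (\<integral>x. f' x * g' x \<partial>lborel))
      \<le> L2_norm (\<lambda>x. f n x - f' x) * L2_norm (g n) + L2_norm f' * L2_norm (\<lambda>x. g n x - g' x)" for n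
  proof -
    note si = f[of n] g[of n] f' g' square_integrable_diff[OF f f', of n] square_integrable_diff[OF g g', of n]
    have "(\<integral>x. f n x * g n x \<partial>lborel) - (\<integral>x. f' x * g' x \<partial>lborel)
        = (\<integral>x. f n x * g n x - f' x * g' x \<partial>lborel)"
      using si by (simp add: integrable_mult_L2)
    also have "\<dots> = (\<integral>x. (f n x - f' x) * g n x + f' x * (g n x - g' x) \<partial>lborel)"
      by (simp add: algebra_simps)
    also have "\<dots> = (\<integral>x. (f n x - f' x) * g n x \<partial>lborel) + (\<integral>x. f' x * (g n x - g' x) \<partial>lborel)"
      using si by (intro Bochner_Integration.integral_add integrable_mult_L2)
    finally have "norm ((\<integral>x. f n x * g n x \<partial>lborel) - (\<integral>x. f' x * g' x \<partial>lborel))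
        \<le> norm (\<integral>x. (f n x - f' x) * g n x \<partial>lborel) + norm (\<integral>x. f' x * (g n x - g' x) \<partial>lborel)"
      by (simp add: norm_triangle_ineq)
    also have "\<dots> \<le> L2_norm (\<lambda>x. f n x - f' x) * L2_norm (g n) + L2_norm f' * L2_norm (\<lambda>x. g n x - g' x)"
      using si by (intro add_mono Cauchy_Schwarz_L2')
    finally show ?thesis .
  qed
  have "(\<lambda>n. L2_norm (\<lambda>x. f n x - f' x) * L2_norm (g n) + L2_norm f' * L2_norm (\<lambda>x. g n x - g' x))
      \<longlonglongrightarrow> 0 * L2_norm g' + L2_norm f' * 0"
    by (intro tendsto_intros limf limg L2_norm_tendsto[OF g g' limg])
  hence "(\<lambda>n. L2_norm (\<lambda>x. f n x - f' x) * L2_norm (g n) + L2_norm f' * L2_norm (\<lambda>x. g n x - g' x)) \<longlonglongrightarrow> 0"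
    by simp
  hence "(\<lambda>n. (\<integral>x. f n x * g n x \<partial>lborel) - (\<integral>x. f' x * g' x \<partial>lborel)) \<longlonglongrightarrow> 0"
    by (rule Lim_null_comparison[OF always_eventually[OF allI[OF A]]])
  thus ?thesis by (rule LIM_zero_cancel)
qed

text \<open>The Riesz--Fischer theorem.  The space is a set of functions here, not a quotient, so the limit is constructed
as a pointwise limit of a fast subsequence and identified by Fatou's lemma.\<close>

lemma L2_complete:
  fixes f :: "nat \<Rightarrow> real \<Rightarrow> complex"
  assumes f: "\<And>n. square_integrable (f n)"
    and cau: "\<And>\<epsilon>. \<epsilon> > 0 \<Longrightarrow> \<exists>N. \<forall>m\<ge>N. \<forall>n\<ge>N. L2_norm (\<lambda>x. f m x - f n x) \<le> \<epsilon>"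
  obtains g where "square_integrable g" "(\<lambda>n. L2_norm (\<lambda>x. f n x - g x)) \<longlonglongrightarrow> 0"
proof -
  have [measurable]: "f n \<in> borel_measurable borel" for n using f square_integrable_measurable by blast
  have "\<exists>N. \<forall>m\<ge>N. \<forall>n\<ge>N. L2_norm (\<lambda>x. f m x - f n x) \<le> (1/2)^k" for k using cau[of "(1/2)^k"] by simp
  then obtain N where N: "\<And>k m n. m \<ge> N k \<Longrightarrow> n \<ge> N k \<Longrightarrow> L2_norm (\<lambda>x. f m x - f n x) \<le> (1/2)^k" by metis
  define M where "M = (\<lambda>k. \<Sum>i\<le>k. N i)"
  have MN: "N k \<le> M k" for k unfolding M_def by (rule member_le_sum) auto
  have Mmono: "i \<le> k \<Longrightarrow> M i \<le> M k" for i k unfolding M_def by (rule sum_mono2) auto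
  (* M is a nondecreasing sequence of indices with successive differences at most 2^-k in norm.
     The weight 2^k below still leaves a summable series and, by 2ab <= a^2 + b^2, turns the
     summability of squares into that of the differences themselves. *)
  define d where "d = (\<lambda>k x. f (M (Suc k)) x - f (M k) x)"
  have [measurable]: "d k \<in> borel_measurable borel" for k by (simp add: d_def)
  have d: "square_integrable (d k)" for k unfolding d_def by (intro square_integrable_diff f)
  have dn: "L2_norm (d k) \<le> (1/2)^k" for k
    unfolding d_def by (rule N) (use MN[of k] Mmono[of k "Suc k"] in auto)
  have "(\<integral>\<^sup>+x. (\<Sum>k. ennreal (2^k * (norm (d k x))\<^sup>2)) \<partial>lborel) = (\<Sum>k. \<integral>\<^sup>+x. ennreal (2^k * (norm (d k x))\<^sup>2) \<partial>lborel)"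
    by (intro nn_integral_suminf) auto
  also have "\<dots> \<le> (\<Sum>k. ennreal ((1/2)^k))"
  proof (intro suminf_le summableI)
    fix k
    have "(\<integral>\<^sup>+x. ennreal (2^k * (norm (d k x))\<^sup>2) \<partial>lborel) = ennreal (2^k * (L2_norm (d k))\<^sup>2)"
      by (simp add: ennreal_mult nn_integral_cmult nn_integral_L2_norm[OF d])
    also have "\<dots> \<le> ennreal (2^k * ((1/2)^k)\<^sup>2)"
      by (intro ennreal_leI mult_left_mono power_mono dn) auto
    also have "2^k * ((1/2)^k)\<^sup>2 = (1/2::real)^k" by (simp add: power2_eq_square field_simps flip: power_mult_distrib)
    finally show "(\<integral>\<^sup>+x. ennreal (2^k * (norm (d k x))\<^sup>2) \<partial>lborel) \<le> ennreal ((1/2)^k)" .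
  qed
  also have "\<dots> = ennreal 2"
  proof -
    have "(\<Sum>k. ennreal ((1/2)^k)) = ennreal (\<Sum>k. (1/2)^k)"
      by (rule suminf_ennreal2) (auto intro: summable_geometric)
    also have "(\<Sum>k. (1/2::real)^k) = 2" by (subst suminf_geometric) auto
    finally show ?thesis .
  qed
  also have "\<dots> < \<infinity>" by simp
  finally have "AE x in lborel. (\<Sum>k. ennreal (2^k * (norm (d k x))\<^sup>2)) \<noteq> \<infinity>"
    by (intro nn_integral_PInf_AE) auto
  hence conv: "AE x in lborel. convergent (\<lambda>k. f (M k) x)"
  proof eventually_elim
    case (elim x)
    have s: "summable (\<lambda>k. 2^k * (norm (d k x))\<^sup>2)"
      using elim by (intro summable_suminf_not_top) auto
    have "summable (\<lambda>k. norm (d k x))"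
    proof (rule summable_comparison_test)
      show "summable (\<lambda>k. (1/2)^k + 2^k * (norm (d k x))\<^sup>2)"
        by (intro summable_add s summable_geometric) auto
      have "norm (d k x) \<le> (1/2)^k + 2^k * (norm (d k x))\<^sup>2" for k
      proof -
        have "0 \<le> 2^k * (norm (d k x) - (1/2)^k)\<^sup>2" by simp
        also have "\<dots> = 2^k * (norm (d k x))\<^sup>2 - 2 * norm (d k x) + (1/2)^k"
          by (simp add: power2_eq_square algebra_simps power_one_over)
        finally show ?thesis using norm_ge_zero[of "d k x"] by linarith
      qed
      thus "\<exists>N. \<forall>n\<ge>N. norm (norm (d n x)) \<le> (1/2)^n + 2^n * (norm (d n x))\<^sup>2" by auto
    qed
    hence "summable (\<lambda>k. d k x)" by (rule summable_norm_cancel)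
    hence "convergent (\<lambda>n. \<Sum>k<n. d k x)" by (simp add: summable_iff_convergent)
    hence "convergent (\<lambda>n. f (M 0) x + (\<Sum>k<n. d k x))" by (intro convergent_add convergent_const)
    moreover have "f (M 0) x + (\<Sum>k<n. d k x) = f (M n) x" for n
      unfolding d_def by (subst sum_lessThan_telescope) auto
    ultimately show ?case by simp
  qed
  define g where "g = (\<lambda>x. lim (\<lambda>k. f (M k) x))"
  have [measurable]: "g \<in> borel_measurable borel" unfolding g_def by measurable
  have key: "(\<integral>\<^sup>+x. ennreal ((norm (f n x - g x))\<^sup>2) \<partial>lborel) \<le> ennreal (\<epsilon>\<^sup>2)"
    if "\<And>m. m \<ge> K \<Longrightarrow> L2_norm (\<lambda>x. f n x - f (M m) x) \<le> \<epsilon>" "\<epsilon> > 0" for n \<epsilon> K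
  proof -
    have "(\<integral>\<^sup>+x. ennreal ((norm (f n x - g x))\<^sup>2) \<partial>lborel)
        = (\<integral>\<^sup>+x. liminf (\<lambda>k. ennreal ((norm (f n x - f (M k) x))\<^sup>2)) \<partial>lborel)"
    proof (rule nn_integral_cong_AE)
      show "AE x in lborel. ennreal ((norm (f n x - g x))\<^sup>2) = liminf (\<lambda>k. ennreal ((norm (f n x - f (M k) x))\<^sup>2))"
        using conv
      proof eventually_elim
        case (elim x)
        hence "(\<lambda>k. f (M k) x) \<longlonglongrightarrow> g x" by (simp add: g_def convergent_LIMSEQ_iff)
        hence "(\<lambda>k. ennreal ((norm (f n x - f (M k) x))\<^sup>2)) \<longlonglongrightarrow> ennreal ((norm (f n x - g x))\<^sup>2)"
          by (intro tendsto_intros)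
        from lim_imp_Liminf[OF trivial_limit_sequentially this] show ?case by (rule sym)
      qed
    qed
    also have "\<dots> \<le> liminf (\<lambda>k. \<integral>\<^sup>+x. ennreal ((norm (f n x - f (M k) x))\<^sup>2) \<partial>lborel)"
      by (rule nn_integral_liminf) auto
    also have "\<dots> \<le> ennreal (\<epsilon>\<^sup>2)"
    proof (rule Liminf_le)
      show "\<forall>\<^sub>F k in sequentially. (\<integral>\<^sup>+x. ennreal ((norm (f n x - f (M k) x))\<^sup>2) \<partial>lborel) \<le> ennreal (\<epsilon>\<^sup>2)"
        unfolding eventually_sequentially using that
        by (intro exI[of _ K]) (auto simp: nn_integral_L2_norm[OF square_integrable_diff[OF f f]] intro!: ennreal_leI power_mono)
    qed auto
    finally show ?thesis .
  qed
  have est: "square_integrable (\<lambda>x. f n x - g x) \<and> L2_norm (\<lambda>x. f n x - g x) \<le> (1/2)^k" if "n \<ge> N k" for n k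
  proof -
    have "L2_norm (\<lambda>x. f n x - f (M m) x) \<le> (1/2)^k" if "m \<ge> k" for m
      by (rule N) (use \<open>n \<ge> N k\<close> that MN[of k] Mmono[of k m] in auto)
    from key[OF this] show ?thesis
      by (auto intro!: square_integrable_from_nn_integral[where f="\<lambda>x. f n x - g x" and c="(1/2)^k"])
  qed
  show ?thesis
  proof
    show "square_integrable g"
      using square_integrable_diff[OF f[of "N 0"] est[of 0 "N 0", THEN conjunct1]] by simp
    show "(\<lambda>n. L2_norm (\<lambda>x. f n x - g x)) \<longlonglongrightarrow> 0"
    proof (rule LIMSEQ_I)
      fix r :: real assume "r > 0"
      then obtain k where k: "(1/2)^k < r" using real_arch_pow_inv[of r "1/2"] by auto
      show "\<exists>no. \<forall>n\<ge>no. norm (L2_norm (\<lambda>x. f n x - g x) - 0) < r"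
        using est[of k] k by (intro exI[of _ "N k"]) force
    qed
  qed
qed

lemma integrable_indicator_Icc [simp]: "integrable lborel (indicat_real {a..b::real})"
  by (rule integrable_real_indicator) (auto simp: emeasure_lborel_Icc_eq)

lemma square_integrable_locally_integrable:
  fixes F :: "real \<Rightarrow> 'b::euclidean_space"
  assumes F: "square_integrable F" shows "set_integrable lborel {a..b} F"
  unfolding set_integrable_def
proof (rule Bochner_Integration.integrable_bound)
  show "integrable lborel (\<lambda>x. indicator {a..b} x + (norm (F x))\<^sup>2)"
    by (intro Bochner_Integration.integrable_add square_integrable_sq[OF F]) simp
  show "(\<lambda>x. indicator {a..b} x *\<^sub>R F x) \<in> borel_measurable lborel"
    using square_integrable_measurable[OF F] by simp
  show "AE x in lborel. norm (indicator {a..b} x *\<^sub>R F x) \<le> norm (indicat_real {a..b} x + (norm (F x))\<^sup>2)"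
  proof (intro AE_I2)
    fix x
    have "norm (F x) \<le> 1 + (norm (F x))\<^sup>2"
      using zero_le_power2[of "norm (F x) - 1"] norm_ge_zero[of "F x"]
      unfolding power2_diff by (simp only: mult_1_right power_one)
    thus "norm (indicator {a..b} x *\<^sub>R F x) \<le> norm (indicat_real {a..b} x + (norm (F x))\<^sup>2)"
      by (auto simp: indicator_def)
  qed
qed

section \<open>The Fourier transform of integrable functions\<close>

text \<open>The sign and the missing normalisation agree with \<open>fourier_trunc\<close>; they put the factor \<open>2 \<pi>\<close> into the inversion
formula.\<close>

definition FT1 :: "(real \<Rightarrow> complex) \<Rightarrow> real \<Rightarrow> complex" where
  "FT1 f \<xi> = (\<integral>x. cis (- (x * \<xi>)) * f x \<partial>lborel)"

lemma borel_measurable_cis [measurable]: "cis \<in> borel_measurable borel"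
  by (intro borel_measurable_continuous_onI continuous_intros)

lemma integrable_cis_mult:
  assumes "integrable lborel f"
  shows "integrable lborel (\<lambda>x. cis (- (x * \<xi>)) * f x)"
proof (rule Bochner_Integration.integrable_bound[OF assms])
  have [measurable]: "f \<in> borel_measurable borel" using assms by auto
  show "(\<lambda>x. cis (- (x * \<xi>)) * f x) \<in> borel_measurable lborel" by measurable
qed (auto simp: norm_mult)

lemma norm_integral_le_nn_integral:
  fixes f :: "'a \<Rightarrow> 'b::{banach, second_countable_topology}"
  shows "ennreal (norm (\<integral>x. f x \<partial>M)) \<le> (\<integral>\<^sup>+x. ennreal (norm (f x)) \<partial>M)"
  by (cases "integrable M f") (auto simp: integral_norm_bound_ennreal not_integrable_integral_eq)

lemma FT1_measurable [measurable]:
  assumes [measurable]: "f \<in> borel_measurable borel"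
  shows "FT1 f \<in> borel_measurable borel"
  unfolding FT1_def[abs_def] by measurable

lemma norm_FT1_le:
  shows "norm (FT1 f \<xi>) \<le> (\<integral>x. norm (f x) \<partial>lborel)"
  unfolding FT1_def
  using integral_norm_bound[of lborel "\<lambda>x. cis (- (x * \<xi>)) * f x"] by (simp add: norm_mult)

lemma FT1_diff:
  assumes "integrable lborel f" "integrable lborel g"
  shows "FT1 (\<lambda>x. f x - g x) \<xi> = FT1 f \<xi> - FT1 g \<xi>"
  unfolding FT1_def
  by (subst Bochner_Integration.integral_diff[symmetric])
     (auto intro: integrable_cis_mult assms simp: right_diff_distrib)

lemma FT1_cmult: "FT1 (\<lambda>x. c * f x) \<xi> = c * FT1 f \<xi>"
  unfolding FT1_def by (simp add: algebra_simps flip: integral_mult_right_zero)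

lemma FT1_reflect: "FT1 (\<lambda>x. f (- x)) \<xi> = FT1 f (- \<xi>)"
  unfolding FT1_def
  using lborel_integral_real_affine[of "-1" "\<lambda>x. cis (x * \<xi>) * f x" 0] by simp

lemma FT1_multiplication:
  assumes f: "integrable lborel f" and g: "integrable lborel g"
  shows "(\<integral>x. FT1 f x * g x \<partial>lborel) = (\<integral>x. f x * FT1 g x \<partial>lborel)"
proof -
  have [measurable]: "f \<in> borel_measurable borel" "g \<in> borel_measurable borel" using f g by auto
  define h where "h = (\<lambda>x \<xi>. cis (- (x * \<xi>)) * f x * g \<xi>)"
  have int: "integrable (lborel \<Otimes>\<^sub>M lborel) (case_prod h)"
  proof (rule lborel_pair.Fubini_integrable)
    show "case_prod h \<in> borel_measurable (lborel \<Otimes>\<^sub>M lborel)" unfolding h_def by measurable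
    have "(\<integral>\<xi>. norm (h x \<xi>) \<partial>lborel) = norm (f x) * (\<integral>\<xi>. norm (g \<xi>) \<partial>lborel)" for x
      by (simp add: h_def norm_mult)
    thus "integrable lborel (\<lambda>x. \<integral>\<xi>. norm (case_prod h (x, \<xi>)) \<partial>lborel)" using f by simp
    have "integrable lborel (\<lambda>\<xi>. f x * (cis (- (\<xi> * x)) * g \<xi>))" for x
      using integrable_cis_mult[OF g, of x] by (rule integrable_mult_right)
    thus "AE x in lborel. integrable lborel (\<lambda>\<xi>. case_prod h (x, \<xi>))"
      by (simp add: h_def mult_ac)
  qed
  have "(\<integral>\<xi>. FT1 f \<xi> * g \<xi> \<partial>lborel) = (\<integral>\<xi>. (\<integral>x. h x \<xi> \<partial>lborel) \<partial>lborel)"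
    by (simp add: FT1_def h_def)
  also have "\<dots> = (\<integral>x. (\<integral>\<xi>. h x \<xi> \<partial>lborel) \<partial>lborel)"
    by (rule lborel_pair.Fubini_integral[OF int])
  also have "\<dots> = (\<integral>x. f x * FT1 g x \<partial>lborel)"
  proof (intro Bochner_Integration.integral_cong refl)
    fix x
    have "(\<integral>\<xi>. h x \<xi> \<partial>lborel) = (\<integral>\<xi>. f x * (cis (- (\<xi> * x)) * g \<xi>) \<partial>lborel)"
      by (simp add: h_def mult_ac)
    thus "(\<integral>\<xi>. h x \<xi> \<partial>lborel) = f x * FT1 g x" by (simp add: FT1_def)
  qed
  finally show ?thesis .
qed

definition gauss :: "real \<Rightarrow> real \<Rightarrow> real" where
  "gauss \<epsilon> \<xi> = exp (- (\<epsilon> * \<xi>)\<^sup>2 / 2)"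

lemma gauss_measurable [measurable]: "gauss \<epsilon> \<in> borel_measurable borel"
  unfolding gauss_def[abs_def] by measurable

lemma gauss_bounds: "0 < gauss \<epsilon> \<xi>" "gauss \<epsilon> \<xi> \<le> 1"
  by (auto simp: gauss_def)

lemma gauss_normal_density:
  "gauss \<epsilon> \<xi> = sqrt (2 * pi) * std_normal_density (\<epsilon> * \<xi>)"
  by (simp add: gauss_def std_normal_density_def)

lemma integrable_gauss: "\<epsilon> > 0 \<Longrightarrow> integrable lborel (gauss \<epsilon>)"
  using lborel_integrable_real_affine[of std_normal_density \<epsilon> 0]
  unfolding gauss_normal_density[abs_def] by simp

lemma FT1_gauss:
  assumes "\<epsilon> > 0"
  shows "FT1 (\<lambda>\<xi>. of_real (gauss \<epsilon> \<xi>)) x = of_real (2 * pi * normal_density 0 \<epsilon> x)"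
proof -
  have "of_real (exp (- (x / \<epsilon>)\<^sup>2 / 2)) = (CLINT y|std_normal_distribution. iexp ((x / \<epsilon>) * y))"
    using fun_cong[OF char_std_normal_distribution, of "x / \<epsilon>"] by (simp add: char_def)
  also have "\<dots> = (\<integral>y. std_normal_density y *\<^sub>R iexp ((x / \<epsilon>) * y) \<partial>lborel)"
    by (subst integral_density) (auto simp: normal_density_nonneg)
  also have "\<dots> = \<epsilon> *\<^sub>R (\<integral>\<xi>. std_normal_density (- \<epsilon> * \<xi>) *\<^sub>R iexp ((x / \<epsilon>) * (- \<epsilon> * \<xi>)) \<partial>lborel)"
    using lborel_integral_real_affine[of "- \<epsilon>" "\<lambda>y. std_normal_density y *\<^sub>R iexp ((x / \<epsilon>) * y)" 0] assms by simp
  also have "(\<lambda>\<xi>. std_normal_density (- \<epsilon> * \<xi>) *\<^sub>R iexp ((x / \<epsilon>) * (- \<epsilon> * \<xi>)))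
      = (\<lambda>\<xi>. of_real (1 / sqrt (2 * pi)) * (cis (- (\<xi> * x)) * of_real (gauss \<epsilon> \<xi>)))"
    using assms by (auto simp: gauss_normal_density cis_conv_exp std_normal_density_def scaleR_conv_of_real mult_ac)
  also have "\<epsilon> *\<^sub>R (\<integral>\<xi>. of_real (1 / sqrt (2 * pi)) * (cis (- (\<xi> * x)) * of_real (gauss \<epsilon> \<xi>)) \<partial>lborel)
     = of_real (\<epsilon> / sqrt (2 * pi)) * FT1 (\<lambda>\<xi>. of_real (gauss \<epsilon> \<xi>)) x"
    by (simp only: integral_mult_right_zero FT1_def) (simp add: scaleR_conv_of_real)
  finally have eq: "of_real (exp (- (x / \<epsilon>)\<^sup>2 / 2)) = of_real (\<epsilon> / sqrt (2 * pi)) * FT1 (\<lambda>\<xi>. of_real (gauss \<epsilon> \<xi>)) x" .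
  have "of_real (sqrt (2 * pi) / \<epsilon>) * (of_real (\<epsilon> / sqrt (2 * pi)) :: complex) = 1"
    using assms by (simp flip: of_real_mult)
  hence "FT1 (\<lambda>\<xi>. of_real (gauss \<epsilon> \<xi>)) x = of_real (sqrt (2 * pi) / \<epsilon>) * of_real (exp (- (x / \<epsilon>)\<^sup>2 / 2))"
    using eq by (metis mult.assoc mult_1)
  also have "\<dots> = of_real (sqrt (2 * pi) / \<epsilon> * exp (- (x / \<epsilon>)\<^sup>2 / 2))" by simp
  also have "sqrt (2 * pi) / \<epsilon> * exp (- (x / \<epsilon>)\<^sup>2 / 2) = 2 * pi * normal_density 0 \<epsilon> x"
  proof -
    have "2 * pi = sqrt (2 * pi) * sqrt (2 * pi)" by simp
    thus ?thesis using assms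
      by (simp add: normal_density_def real_sqrt_mult power_divide field_simps)
  qed
  finally show ?thesis .
qed

lemma FT1_shift: "FT1 (\<lambda>\<xi>. cis (- (x * \<xi>)) * f \<xi>) y = FT1 f (x + y)"
  unfolding FT1_def by (intro Bochner_Integration.integral_cong) (auto simp: algebra_simps cis_mult)

lemma nn_integral_normal_density_shift:
  assumes "\<epsilon> > 0"
  shows "(\<integral>\<^sup>+y. ennreal (normal_density 0 \<epsilon> (x - y)) \<partial>lborel) = 1"
    "(\<integral>\<^sup>+y. ennreal (normal_density 0 \<epsilon> (y - x)) \<partial>lborel) = 1"
proof -
  have *: "(\<integral>\<^sup>+y. ennreal (normal_density 0 \<epsilon> y) \<partial>lborel) = 1"
    by (simp add: nn_integral_eq_integral assms)
  show "(\<integral>\<^sup>+y. ennreal (normal_density 0 \<epsilon> (x - y)) \<partial>lborel) = 1"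
    using nn_integral_real_affine[of "\<lambda>y. ennreal (normal_density 0 \<epsilon> y)" "-1" x] * by simp
  show "(\<integral>\<^sup>+y. ennreal (normal_density 0 \<epsilon> (y - x)) \<partial>lborel) = 1"
    using nn_integral_real_affine[of "\<lambda>y. ennreal (normal_density 0 \<epsilon> y)" "1" "-x"] * by simp
qed

text \<open>Schur's test for the kernel \<open>normal_density 0 \<epsilon> (x - y)\<close>, whose mass in each variable is one; this replaces
Young's inequality for convolutions.\<close>

lemma gaussian_convolution_bound:
  fixes f :: "real \<Rightarrow> complex"
  assumes f: "square_integrable f" and "\<epsilon> > 0"
  shows "(\<integral>\<^sup>+x. (\<integral>\<^sup>+y. ennreal (norm (f x) * norm (f y) * normal_density 0 \<epsilon> (x - y)) \<partial>lborel) \<partial>lborel)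
     \<le> ennreal ((L2_norm f)\<^sup>2)"
proof -
  have [measurable]: "f \<in> borel_measurable borel" using f by (rule square_integrable_measurable)
  let ?G = "\<lambda>x y. ennreal (normal_density 0 \<epsilon> (x - y))"
  have "ennreal (norm (f x) * norm (f y) * normal_density 0 \<epsilon> (x - y))
      \<le> ennreal ((norm (f x))\<^sup>2 / 2) * ?G x y + ennreal ((norm (f y))\<^sup>2 / 2) * ?G x y" for x y
  proof -
    have "norm (f x) * norm (f y) \<le> (norm (f x))\<^sup>2 / 2 + (norm (f y))\<^sup>2 / 2"
      using norm_mult_le_half_squares[of "f x" "f y"] by (simp add: norm_mult field_simps)
    hence "norm (f x) * norm (f y) * normal_density 0 \<epsilon> (x - y)
        \<le> ((norm (f x))\<^sup>2 / 2 + (norm (f y))\<^sup>2 / 2) * normal_density 0 \<epsilon> (x - y)"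
      by (intro mult_right_mono) auto
    thus ?thesis by (simp add: distrib_right ennreal_leI flip: ennreal_mult ennreal_plus)
  qed
  hence "(\<integral>\<^sup>+x. (\<integral>\<^sup>+y. ennreal (norm (f x) * norm (f y) * normal_density 0 \<epsilon> (x - y)) \<partial>lborel) \<partial>lborel)
     \<le> (\<integral>\<^sup>+x. (\<integral>\<^sup>+y. ennreal ((norm (f x))\<^sup>2 / 2) * ?G x y + ennreal ((norm (f y))\<^sup>2 / 2) * ?G x y \<partial>lborel) \<partial>lborel)"
    by (intro nn_integral_mono)
  also have "\<dots> = (\<integral>\<^sup>+x. (\<integral>\<^sup>+y. ennreal ((norm (f x))\<^sup>2 / 2) * ?G x y \<partial>lborel) \<partial>lborel)
      + (\<integral>\<^sup>+x. (\<integral>\<^sup>+y. ennreal ((norm (f y))\<^sup>2 / 2) * ?G x y \<partial>lborel) \<partial>lborel)"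
    by (simp add: nn_integral_add)
  also have "(\<integral>\<^sup>+x. (\<integral>\<^sup>+y. ennreal ((norm (f x))\<^sup>2 / 2) * ?G x y \<partial>lborel) \<partial>lborel)
      = (\<integral>\<^sup>+x. ennreal ((norm (f x))\<^sup>2 / 2) \<partial>lborel)"
    by (simp add: nn_integral_cmult nn_integral_normal_density_shift[OF assms(2)])
  also have "(\<integral>\<^sup>+x. (\<integral>\<^sup>+y. ennreal ((norm (f y))\<^sup>2 / 2) * ?G x y \<partial>lborel) \<partial>lborel)
      = (\<integral>\<^sup>+y. (\<integral>\<^sup>+x. ennreal ((norm (f y))\<^sup>2 / 2) * ?G x y \<partial>lborel) \<partial>lborel)"
    by (rule lborel_pair.Fubini'[symmetric]) measurable
  also have "\<dots> = (\<integral>\<^sup>+x. ennreal ((norm (f x))\<^sup>2 / 2) \<partial>lborel)"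
    by (simp add: nn_integral_cmult nn_integral_normal_density_shift[OF assms(2)])
  also have "(\<integral>\<^sup>+x. ennreal ((norm (f x))\<^sup>2 / 2) \<partial>lborel) + (\<integral>\<^sup>+x. ennreal ((norm (f x))\<^sup>2 / 2) \<partial>lborel)
      = (\<integral>\<^sup>+x. ennreal ((norm (f x))\<^sup>2 / 2) + ennreal ((norm (f x))\<^sup>2 / 2) \<partial>lborel)"
    by (rule nn_integral_add[symmetric]) auto
  also have "\<dots> = (\<integral>\<^sup>+x. ennreal ((norm (f x))\<^sup>2) \<partial>lborel)"
    by (simp flip: ennreal_plus)
  also have "\<dots> = ennreal ((L2_norm f)\<^sup>2)" by (rule nn_integral_L2_norm[OF f])
  finally show ?thesis .
qed

text \<open>By the multiplication formula the left side is \<open>2 \<pi>\<close> times the pairing of \<open>f\<close> with its convolution with a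
Gaussian of mass one, which is at most the squared norm of \<open>f\<close> for every width.\<close>

lemma FT1_gauss_weighted_bound:
  assumes f: "integrable lborel f" "square_integrable f" and e: "\<epsilon> > 0"
  shows "(\<integral>\<^sup>+\<xi>. ennreal ((norm (FT1 f \<xi>))\<^sup>2 * gauss \<epsilon> \<xi>) \<partial>lborel) \<le> ennreal (2 * pi * (L2_norm f)\<^sup>2)"
proof -
  have [measurable]: "f \<in> borel_measurable borel" using f by auto
  (* The conjugate of the transform is again a transform, which allows the multiplication formula. *)
  define fr where "fr = (\<lambda>y. cnj (f (- y)))"
  have fr: "integrable lborel fr"
    unfolding fr_def using lborel_integrable_real_affine[OF f(1), of "-1" 0] by simp
  have cF: "cnj (FT1 f \<xi>) = FT1 fr \<xi>" for \<xi>
  proof -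
    have "cnj (FT1 f \<xi>) = (\<integral>x. cnj (cis (- (x * \<xi>)) * f x) \<partial>lborel)"
      unfolding FT1_def by (rule Bochner_Integration.integral_cnj[symmetric])
    also have "\<dots> = (\<integral>x. cis (x * \<xi>) * cnj (f x) \<partial>lborel)"
      by (intro Bochner_Integration.integral_cong) (auto simp: cis_cnj)
    also have "\<dots> = FT1 fr \<xi>" unfolding FT1_def fr_def
      using lborel_integral_real_affine[of "-1" "\<lambda>x. cis (x * \<xi>) * cnj (f x)" 0] by simp
    finally show ?thesis .
  qed
  let ?g = "\<lambda>\<xi>. of_real (gauss \<epsilon> \<xi>) :: complex"
  have gi: "integrable lborel ?g" using integrable_gauss[OF e] by simp
  obtain K where K: "\<And>\<xi>. norm (FT1 f \<xi>) \<le> K" using norm_FT1_le by blast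
  define h where "h = (\<lambda>\<xi>. cnj (FT1 f \<xi>) * ?g \<xi>)"
  have hi: "integrable lborel h"
  proof (rule Bochner_Integration.integrable_bound)
    show "integrable lborel (\<lambda>\<xi>. K * gauss \<epsilon> \<xi>)" using integrable_gauss[OF e] by simp
    show "h \<in> borel_measurable lborel"
      using borel_measurable_integrable[OF fr] borel_measurable_integrable[OF gi]
      unfolding h_def cF by (simp add: borel_measurable_times FT1_measurable)
    have "K \<ge> 0" using K[of 0] norm_ge_zero[of "FT1 f 0"] by linarith
    thus "AE \<xi> in lborel. norm (h \<xi>) \<le> norm (K * gauss \<epsilon> \<xi>)"
      using K by (intro AE_I2) (auto simp: h_def norm_mult abs_mult intro!: mult_right_mono)
  qed
  have FTh: "FT1 h x = (\<integral>y. cnj (f y) * of_real (2 * pi * normal_density 0 \<epsilon> (x - y)) \<partial>lborel)" for x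
  proof -
    have "FT1 h x = (\<integral>\<xi>. cis (- (\<xi> * x)) * h \<xi> \<partial>lborel)" by (rule FT1_def)
    also have "\<dots> = (\<integral>\<xi>. FT1 fr \<xi> * (cis (- (x * \<xi>)) * ?g \<xi>) \<partial>lborel)"
      by (simp add: h_def cF mult_ac)
    also have "\<dots> = (\<integral>y. fr y * FT1 (\<lambda>\<xi>. cis (- (x * \<xi>)) * ?g \<xi>) y \<partial>lborel)"
      by (rule FT1_multiplication[OF fr]) (use integrable_cis_mult[OF gi, of x] in \<open>simp add: mult.commute\<close>)
    also have "\<dots> = (\<integral>y. fr y * of_real (2 * pi * normal_density 0 \<epsilon> (x + y)) \<partial>lborel)"
      by (simp only: FT1_shift FT1_gauss[OF e])
    also have "\<dots> = (\<integral>y. cnj (f y) * of_real (2 * pi * normal_density 0 \<epsilon> (x - y)) \<partial>lborel)"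
      using lborel_integral_real_affine[of "-1" "\<lambda>y. fr y * of_real (2 * pi * normal_density 0 \<epsilon> (x + y))" 0]
      by (simp add: fr_def)
    finally show ?thesis .
  qed
  have Fhn: "ennreal (norm (FT1 h x)) \<le> (\<integral>\<^sup>+y. ennreal (2 * pi * (norm (f y) * normal_density 0 \<epsilon> (x - y))) \<partial>lborel)" for x
  proof -
    have "ennreal (norm (FT1 h x)) \<le> (\<integral>\<^sup>+y. ennreal (norm (cnj (f y) * of_real (2 * pi * normal_density 0 \<epsilon> (x - y)))) \<partial>lborel)"
      unfolding FTh by (rule norm_integral_le_nn_integral)
    thus ?thesis by (simp add: norm_mult mult_ac)
  qed
  have sq: "FT1 f \<xi> * h \<xi> = of_real ((norm (FT1 f \<xi>))\<^sup>2 * gauss \<epsilon> \<xi>)" for \<xi>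
    unfolding h_def of_real_mult complex_norm_square by (simp add: mult_ac)
  have Fhi: "integrable lborel (\<lambda>\<xi>. FT1 f \<xi> * h \<xi>)"
  proof (rule Bochner_Integration.integrable_bound)
    show "integrable lborel (\<lambda>\<xi>. K * norm (h \<xi>))" using hi by simp
    show "(\<lambda>\<xi>. FT1 f \<xi> * h \<xi>) \<in> borel_measurable lborel"
      using borel_measurable_integrable[OF hi] by (simp add: borel_measurable_times FT1_measurable)
    show "AE \<xi> in lborel. norm (FT1 f \<xi> * h \<xi>) \<le> norm (K * norm (h \<xi>))"
      using K order_trans[OF K abs_ge_self] by (intro AE_I2) (auto simp: norm_mult abs_mult intro!: mult_right_mono)
  qed
  have int: "integrable lborel (\<lambda>\<xi>. (norm (FT1 f \<xi>))\<^sup>2 * gauss \<epsilon> \<xi>)"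
    using Fhi unfolding sq complex_of_real_integrable_eq .
  have "(\<integral>\<^sup>+\<xi>. ennreal ((norm (FT1 f \<xi>))\<^sup>2 * gauss \<epsilon> \<xi>) \<partial>lborel) = ennreal (\<integral>\<xi>. (norm (FT1 f \<xi>))\<^sup>2 * gauss \<epsilon> \<xi> \<partial>lborel)"
    by (intro nn_integral_eq_integral int AE_I2) (simp add: less_imp_le[OF gauss_bounds(1)])
  also have "(\<integral>\<xi>. (norm (FT1 f \<xi>))\<^sup>2 * gauss \<epsilon> \<xi> \<partial>lborel) \<le> norm (\<integral>\<xi>. FT1 f \<xi> * h \<xi> \<partial>lborel)"
    unfolding sq integral_complex_of_real by simp
  also have "(\<integral>\<xi>. FT1 f \<xi> * h \<xi> \<partial>lborel) = (\<integral>x. f x * FT1 h x \<partial>lborel)"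
    by (rule FT1_multiplication[OF f(1) hi])
  also have "ennreal (norm (\<integral>x. f x * FT1 h x \<partial>lborel)) \<le> (\<integral>\<^sup>+x. ennreal (norm (f x * FT1 h x)) \<partial>lborel)"
    by (rule norm_integral_le_nn_integral)
  also have "\<dots> \<le> (\<integral>\<^sup>+x. ennreal (norm (f x)) * (\<integral>\<^sup>+y. ennreal (2 * pi * (norm (f y) * normal_density 0 \<epsilon> (x - y))) \<partial>lborel) \<partial>lborel)"
  proof (intro nn_integral_mono)
    fix x
    have "ennreal (norm (f x * FT1 h x)) = ennreal (norm (f x)) * ennreal (norm (FT1 h x))"
      by (simp add: norm_mult ennreal_mult)
    also have "\<dots> \<le> ennreal (norm (f x)) * (\<integral>\<^sup>+y. ennreal (2 * pi * (norm (f y) * normal_density 0 \<epsilon> (x - y))) \<partial>lborel)"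
      by (intro mult_left_mono Fhn) simp
    finally show "ennreal (norm (f x * FT1 h x)) \<le> \<dots>" .
  qed
  also have "\<dots> = (\<integral>\<^sup>+x. ennreal (2 * pi) * (\<integral>\<^sup>+y. ennreal (norm (f x) * norm (f y) * normal_density 0 \<epsilon> (x - y)) \<partial>lborel) \<partial>lborel)"
  proof (intro nn_integral_cong)
    fix x
    have "ennreal (norm (f x)) * ennreal (2 * pi * (norm (f y) * normal_density 0 \<epsilon> (x - y)))
        = ennreal (2 * pi) * ennreal (norm (f x) * norm (f y) * normal_density 0 \<epsilon> (x - y))" for y
    proof -
      have "ennreal (norm (f x)) * ennreal (2 * pi * (norm (f y) * normal_density 0 \<epsilon> (x - y)))
          = ennreal (norm (f x) * (2 * pi * (norm (f y) * normal_density 0 \<epsilon> (x - y))))"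
        by (rule ennreal_mult[symmetric]) auto
      also have "\<dots> = ennreal ((2 * pi) * (norm (f x) * norm (f y) * normal_density 0 \<epsilon> (x - y)))"
        by (simp only: mult_ac)
      also have "\<dots> = ennreal (2 * pi) * ennreal (norm (f x) * norm (f y) * normal_density 0 \<epsilon> (x - y))"
        by (rule ennreal_mult) auto
      finally show ?thesis .
    qed
    thus "ennreal (norm (f x)) * (\<integral>\<^sup>+y. ennreal (2 * pi * (norm (f y) * normal_density 0 \<epsilon> (x - y))) \<partial>lborel)
        = ennreal (2 * pi) * (\<integral>\<^sup>+y. ennreal (norm (f x) * norm (f y) * normal_density 0 \<epsilon> (x - y)) \<partial>lborel)"
      by (subst (1 2) nn_integral_cmult[symmetric]) (auto simp del: ennreal_mult' ennreal_mult'')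
  qed
  also have "\<dots> = ennreal (2 * pi) * (\<integral>\<^sup>+x. (\<integral>\<^sup>+y. ennreal (norm (f x) * norm (f y) * normal_density 0 \<epsilon> (x - y)) \<partial>lborel) \<partial>lborel)"
    by (rule nn_integral_cmult) measurable
  also have "\<dots> \<le> ennreal (2 * pi) * ennreal ((L2_norm f)\<^sup>2)"
    by (intro mult_left_mono gaussian_convolution_bound f e) auto
  finally show ?thesis by (simp add: ennreal_leI flip: ennreal_mult)
qed

text \<open>The Gaussian weight is removed by Fatou's lemma.  This inequality is all that the extension to \<open>L\<^sup>2\<close> needs;
equality follows only after inversion.\<close>

lemma FT1_L2_bound:
  assumes f: "integrable lborel f" "square_integrable f"
  shows "square_integrable (FT1 f)" "L2_norm (FT1 f) \<le> sqrt (2 * pi) * L2_norm f"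
proof -
  have [measurable]: "f \<in> borel_measurable borel" using f by auto
  let ?u = "\<lambda>n \<xi>. ennreal ((norm (FT1 f \<xi>))\<^sup>2 * gauss (1 / real (Suc n)) \<xi>)"
  have lim: "(\<lambda>n. ?u n \<xi>) \<longlonglongrightarrow> ennreal ((norm (FT1 f \<xi>))\<^sup>2)" for \<xi>
  proof -
    have "(\<lambda>n. gauss (1 / real (Suc n)) \<xi>) \<longlonglongrightarrow> 1"     proof -
      have "(\<lambda>n. 1 / real (Suc n)) \<longlonglongrightarrow> 0" using LIMSEQ_Suc[OF lim_1_over_n] by simp
      hence "(\<lambda>n. gauss (1 / real (Suc n)) \<xi>) \<longlonglongrightarrow> exp (- (0 * \<xi>)\<^sup>2 / 2)"
        unfolding gauss_def by (intro tendsto_intros) auto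
      thus ?thesis by simp
    qed
    hence "(\<lambda>n. (norm (FT1 f \<xi>))\<^sup>2 * gauss (1 / real (Suc n)) \<xi>) \<longlonglongrightarrow> (norm (FT1 f \<xi>))\<^sup>2 * 1"
      by (intro tendsto_intros)
    thus ?thesis by simp
  qed
  have "(\<integral>\<^sup>+\<xi>. ennreal ((norm (FT1 f \<xi>))\<^sup>2) \<partial>lborel) = (\<integral>\<^sup>+\<xi>. liminf (\<lambda>n. ?u n \<xi>) \<partial>lborel)"
    using lim_imp_Liminf[OF trivial_limit_sequentially lim] by simp
  also have "\<dots> \<le> liminf (\<lambda>n. \<integral>\<^sup>+\<xi>. ?u n \<xi> \<partial>lborel)"
    by (rule nn_integral_liminf) measurable
  also have "\<dots> \<le> ennreal (2 * pi * (L2_norm f)\<^sup>2)"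
    by (intro Liminf_le always_eventually allI FT1_gauss_weighted_bound f) auto
  also have "2 * pi * (L2_norm f)\<^sup>2 = (sqrt (2 * pi) * L2_norm f)\<^sup>2" by (simp add: power_mult_distrib)
  finally have "(\<integral>\<^sup>+\<xi>. ennreal ((norm (FT1 f \<xi>))\<^sup>2) \<partial>lborel) \<le> ennreal ((sqrt (2 * pi) * L2_norm f)\<^sup>2)" .
  from square_integrable_from_nn_integral[OF _ this]
  show "square_integrable (FT1 f)" "L2_norm (FT1 f) \<le> sqrt (2 * pi) * L2_norm f" by auto
qed

section \<open>The Fourier transform on \<open>L\<^sup>2\<close>\<close>

definition trunc :: "nat \<Rightarrow> (real \<Rightarrow> complex) \<Rightarrow> real \<Rightarrow> complex" where
  "trunc n f x = indicator {- real n..real n} x * f x"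

text \<open>A relation rather than a function, because the transform is determined only up to null sets.  It is the scalar
counterpart of \<open>is_fourier_L2\<close>.\<close>

definition is_FT :: "(real \<Rightarrow> complex) \<Rightarrow> (real \<Rightarrow> complex) \<Rightarrow> bool" where
  "is_FT f g \<longleftrightarrow> square_integrable f \<and> square_integrable g \<and>
     (\<lambda>n. L2_norm (\<lambda>\<xi>. FT1 (trunc n f) \<xi> - g \<xi>)) \<longlonglongrightarrow> 0"

lemma is_FT_square_integrable: "is_FT f g \<Longrightarrow> square_integrable f" "is_FT f g \<Longrightarrow> square_integrable g"
  by (auto simp: is_FT_def)

lemma trunc_square_integrable: "square_integrable f \<Longrightarrow> square_integrable (trunc n f)"
  unfolding trunc_def[abs_def]
  by (rule square_integrable_mult_bounded[where B=1]) (auto simp: indicator_def)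

lemma integrable_if_square_integrable_bounded_support:
  fixes f :: "real \<Rightarrow> complex"
  assumes "square_integrable f" "\<And>x. x \<notin> {a..b} \<Longrightarrow> f x = 0"
  shows "integrable lborel f"
proof -
  have "square_integrable (\<lambda>x. indicator {a..b} x :: complex)"
    unfolding square_integrable_def
  proof
    have "(\<lambda>x. (norm (indicator {a..b} x :: complex))\<^sup>2) = (indicator {a..b} :: real \<Rightarrow> real)"
      by (auto simp: indicator_def)
    thus "integrable lborel (\<lambda>x. (norm (indicator {a..b} x :: complex))\<^sup>2)" by simp
  qed auto
  from integrable_mult_L2[OF this assms(1)]
  have "integrable lborel (\<lambda>x. indicator {a..b} x * f x)" .
  moreover have "(\<lambda>x. indicator {a..b} x * f x) = f"
    using assms(2) by (intro ext) (auto simp: indicator_def)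
  ultimately show ?thesis by simp
qed

lemma trunc_integrable: "square_integrable f \<Longrightarrow> integrable lborel (trunc n f)"
  by (rule integrable_if_square_integrable_bounded_support[OF trunc_square_integrable, where a="- real n" and b="real n"])
     (auto simp: trunc_def)

text \<open>Serves both the sharp truncations in the definition of the transform and the smooth windows applied to solutions.\<close>

lemma L2_norm_cutoff_tendsto:
  fixes f :: "real \<Rightarrow> complex"
  assumes f: "square_integrable f"
    and m: "\<And>n. m n \<in> borel_measurable borel" "\<And>n x. norm (m n x) \<le> 1"
    and lim: "\<And>x. (\<lambda>n. m n x) \<longlonglongrightarrow> 1"
  shows "(\<lambda>n. L2_norm (\<lambda>x. m n x * f x - f x)) \<longlonglongrightarrow> 0"
proof -
  have [measurable]: "f \<in> borel_measurable borel" "\<And>n. m n \<in> borel_measurable borel"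
    using square_integrable_measurable[OF f] m by auto
  have "(\<lambda>n. \<integral>x. (norm (m n x * f x - f x))\<^sup>2 \<partial>lborel) \<longlonglongrightarrow> (\<integral>x. 0 \<partial>(lborel::real measure))"
  proof (rule integral_dominated_convergence[where w="\<lambda>x. 4 * (norm (f x))\<^sup>2"])
    show "integrable lborel (\<lambda>x. 4 * (norm (f x))\<^sup>2)" using square_integrable_sq[OF f] by simp
    show "AE x in lborel. (\<lambda>n. (norm (m n x * f x - f x))\<^sup>2) \<longlonglongrightarrow> 0"
    proof (intro AE_I2)
      fix x
      have "(\<lambda>n. (norm (m n x * f x - f x))\<^sup>2) \<longlonglongrightarrow> (norm (1 * f x - f x))\<^sup>2"
        by (intro tendsto_intros lim)
      thus "(\<lambda>n. (norm (m n x * f x - f x))\<^sup>2) \<longlonglongrightarrow> 0" by simp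
    qed
    show "AE x in lborel. norm ((norm (m n x * f x - f x))\<^sup>2) \<le> 4 * (norm (f x))\<^sup>2" for n
    proof (intro AE_I2)
      fix x
      have "norm (m n x * f x - f x) = norm (m n x - 1) * norm (f x)"
        by (simp add: left_diff_distrib flip: norm_mult)
      also have "norm (m n x - 1) \<le> 2" using norm_triangle_ineq4[of "m n x" 1] m(2)[of n x] by simp
      finally have "norm (m n x * f x - f x) \<le> 2 * norm (f x)" by (simp add: mult_right_mono)
      from power_mono[OF this, of 2]
      show "norm ((norm (m n x * f x - f x))\<^sup>2) \<le> 4 * (norm (f x))\<^sup>2" by (simp add: power_mult_distrib)
    qed
  qed measurable
  hence "(\<lambda>n. sqrt (\<integral>x. (norm (m n x * f x - f x))\<^sup>2 \<partial>lborel)) \<longlonglongrightarrow> sqrt 0"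
    by (intro tendsto_real_sqrt) simp
  thus ?thesis by (simp add: L2_norm_def)
qed

lemma trunc_tendsto:
  assumes "square_integrable f" shows "(\<lambda>n. L2_norm (\<lambda>x. trunc n f x - f x)) \<longlonglongrightarrow> 0"
  unfolding trunc_def
proof (rule L2_norm_cutoff_tendsto[OF assms])
  fix x :: real
  have "eventually (\<lambda>n. real n \<ge> \<bar>x\<bar>) sequentially" by real_asymp
  hence "\<forall>\<^sub>F n in sequentially. indicator {- real n..real n} x = (1::complex)"
    by eventually_elim (auto simp: indicator_def abs_le_iff)
  thus "(\<lambda>n. indicator {- real n..real n} x :: complex) \<longlonglongrightarrow> 1" by (rule tendsto_eventually)
qed (auto simp: indicator_def)

text \<open>Any approximation from \<open>L\<^sup>1 \<inter> L\<^sup>2\<close> computes the same transform as the truncations, by the \<open>L\<^sup>2\<close> bound.  With smooth cutoffs as the approximation this connects the transform with the weak formulation.\<close>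

lemma is_FT_approx:
  assumes F: "is_FT f g" and fn: "\<And>n. integrable lborel (fn n)" "\<And>n. square_integrable (fn n)"
    and lim: "(\<lambda>n. L2_norm (\<lambda>x. fn n x - f x)) \<longlonglongrightarrow> 0"
  shows "(\<lambda>n. L2_norm (\<lambda>\<xi>. FT1 (fn n) \<xi> - g \<xi>)) \<longlonglongrightarrow> 0"
proof -
  note f = is_FT_square_integrable(1)[OF F] and g = is_FT_square_integrable(2)[OF F]
  note ti = trunc_integrable[OF f] and ts = trunc_square_integrable[OF f]
  have A: "L2_norm (\<lambda>\<xi>. FT1 (fn n) \<xi> - g \<xi>)
      \<le> sqrt (2*pi) * (L2_norm (\<lambda>x. fn n x - f x) + L2_norm (\<lambda>x. trunc n f x - f x))
        + L2_norm (\<lambda>\<xi>. FT1 (trunc n f) \<xi> - g \<xi>)" for n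
  proof -
    have d: "integrable lborel (\<lambda>x. fn n x - trunc n f x)" "square_integrable (\<lambda>x. fn n x - trunc n f x)"
      by (intro Bochner_Integration.integrable_diff square_integrable_diff fn ti ts)+
    have "L2_norm (\<lambda>\<xi>. FT1 (fn n) \<xi> - g \<xi>) \<le> L2_norm (\<lambda>\<xi>. FT1 (fn n) \<xi> - FT1 (trunc n f) \<xi>)
        + L2_norm (\<lambda>\<xi>. FT1 (trunc n f) \<xi> - g \<xi>)"
      by (intro L2_norm_diff_triangle FT1_L2_bound fn ti ts g)
    also have "(\<lambda>\<xi>. FT1 (fn n) \<xi> - FT1 (trunc n f) \<xi>) = FT1 (\<lambda>x. fn n x - trunc n f x)"
      by (intro ext FT1_diff[symmetric] fn ti)
    also have "L2_norm \<dots> \<le> sqrt (2*pi) * L2_norm (\<lambda>x. fn n x - trunc n f x)"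
      by (rule FT1_L2_bound[OF d])
    also have "L2_norm (\<lambda>x. fn n x - trunc n f x) \<le> L2_norm (\<lambda>x. fn n x - f x) + L2_norm (\<lambda>x. trunc n f x - f x)"
      using L2_norm_diff_triangle[OF fn(2)[of n] f ts[of n]] L2_norm_minus_commute[of f "trunc n f"] by simp
    finally show ?thesis by (simp add: mult_left_mono)
  qed
  have "(\<lambda>n. sqrt (2*pi) * (L2_norm (\<lambda>x. fn n x - f x) + L2_norm (\<lambda>x. trunc n f x - f x))
        + L2_norm (\<lambda>\<xi>. FT1 (trunc n f) \<xi> - g \<xi>)) \<longlonglongrightarrow> sqrt (2*pi) * (0 + 0) + 0"
    using F by (intro tendsto_intros lim trunc_tendsto f) (auto simp: is_FT_def)
  hence B: "(\<lambda>n. sqrt (2*pi) * (L2_norm (\<lambda>x. fn n x - f x) + L2_norm (\<lambda>x. trunc n f x - f x))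
        + L2_norm (\<lambda>\<xi>. FT1 (trunc n f) \<xi> - g \<xi>)) \<longlonglongrightarrow> 0" by simp
  show ?thesis by (rule Lim_null_comparison[OF always_eventually B]) (use A in simp)
qed

lemma is_FT_exists:
  assumes f: "square_integrable f"
  obtains g where "is_FT f g"
proof -
  note ti = trunc_integrable[OF f] and ts = trunc_square_integrable[OF f]
  have "\<exists>N. \<forall>m\<ge>N. \<forall>n\<ge>N. L2_norm (\<lambda>\<xi>. FT1 (trunc m f) \<xi> - FT1 (trunc n f) \<xi>) \<le> \<epsilon>" if "\<epsilon> > 0" for \<epsilon>
  proof -
    define \<delta> where "\<delta> = \<epsilon> / (2 * sqrt (2 * pi))"
    have \<delta>: "\<delta> > 0" "sqrt (2*pi) * (2 * \<delta>) = \<epsilon>" using that by (auto simp: \<delta>_def)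
    obtain N where N: "\<And>n. n \<ge> N \<Longrightarrow> L2_norm (\<lambda>x. trunc n f x - f x) < \<delta>"
      using LIMSEQ_D[OF trunc_tendsto[OF f] \<delta>(1)] by auto
    show ?thesis
    proof (intro exI[of _ N] allI impI)
      fix m n assume mn: "N \<le> m" "N \<le> n"
      have d: "integrable lborel (\<lambda>x. trunc m f x - trunc n f x)" "square_integrable (\<lambda>x. trunc m f x - trunc n f x)"
        by (intro Bochner_Integration.integrable_diff square_integrable_diff ti ts)+
      have "(\<lambda>\<xi>. FT1 (trunc m f) \<xi> - FT1 (trunc n f) \<xi>) = FT1 (\<lambda>x. trunc m f x - trunc n f x)"
        by (intro ext FT1_diff[symmetric] ti)
      hence "L2_norm (\<lambda>\<xi>. FT1 (trunc m f) \<xi> - FT1 (trunc n f) \<xi>) \<le> sqrt (2*pi) * L2_norm (\<lambda>x. trunc m f x - trunc n f x)"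
        using FT1_L2_bound(2)[OF d] by simp
      also have "L2_norm (\<lambda>x. trunc m f x - trunc n f x) \<le> 2 * \<delta>"
        using L2_norm_diff_triangle[OF ts[of m] f ts[of n]] L2_norm_minus_commute[of f "trunc n f"]
          N[OF mn(1)] N[OF mn(2)] by simp
      finally show "L2_norm (\<lambda>\<xi>. FT1 (trunc m f) \<xi> - FT1 (trunc n f) \<xi>) \<le> \<epsilon>"
        using \<delta>(2) by (simp add: mult_left_mono)
    qed
  qed
  from L2_complete[of "\<lambda>n. FT1 (trunc n f)", OF FT1_L2_bound(1)[OF ti ts] this] f that show ?thesis
    unfolding is_FT_def by blast
qed

lemma is_FT_unique:
  assumes "is_FT f g" "is_FT f h" shows "AE \<xi> in lborel. g \<xi> = h \<xi>"
proof -
  have f: "square_integrable f" using assms by (auto simp: is_FT_def)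
  show ?thesis
    using L2_limit_unique[of "\<lambda>n. FT1 (trunc n f)" g h, OF FT1_L2_bound(1)[OF trunc_integrable[OF f] trunc_square_integrable[OF f]]] assms
    by (auto simp: is_FT_def)
qed

lemma is_FT_cong_AE:
  assumes "is_FT f g" "h \<in> borel_measurable borel" "AE \<xi> in lborel. g \<xi> = h \<xi>"
  shows "is_FT f h"
proof -
  have f: "square_integrable f" and g: "square_integrable g" using assms by (auto simp: is_FT_def)
  have [measurable]: "f \<in> borel_measurable borel" "g \<in> borel_measurable borel" "h \<in> borel_measurable borel"
    using f g assms square_integrable_measurable by auto
  have [measurable]: "trunc n f \<in> borel_measurable borel" for n unfolding trunc_def[abs_def] by measurable
  have "L2_norm (\<lambda>\<xi>. FT1 (trunc n f) \<xi> - g \<xi>) = L2_norm (\<lambda>\<xi>. FT1 (trunc n f) \<xi> - h \<xi>)" for n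
    by (rule L2_norm_cong_AE) (use assms(3) in auto)
  thus ?thesis using assms(1) square_integrable_cong_AE[OF g assms(2,3)] by (simp add: is_FT_def)
qed

lemma is_FT_of_integrable:
  assumes "integrable lborel f" "square_integrable f"
  shows "is_FT f (FT1 f)"
proof -
  obtain g where g: "is_FT f g" using is_FT_exists[OF assms(2)] by blast
  have "(\<lambda>n. L2_norm (\<lambda>\<xi>. FT1 f \<xi> - g \<xi>)) \<longlonglongrightarrow> 0"
    by (rule is_FT_approx[OF g]) (use assms in \<open>auto simp: L2_norm_def\<close>)
  hence "L2_norm (\<lambda>\<xi>. FT1 f \<xi> - g \<xi>) = 0" by (simp add: LIMSEQ_const_iff)
  hence "AE \<xi> in lborel. FT1 f \<xi> - g \<xi> = 0"
    by (intro L2_norm_zero_AE square_integrable_diff FT1_L2_bound assms is_FT_square_integrable(2)[OF g])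
  hence "AE \<xi> in lborel. g \<xi> = FT1 f \<xi>" by eventually_elim simp
  moreover have "FT1 f \<in> borel_measurable borel" using assms(1) by (intro FT1_measurable) auto
  ultimately show ?thesis using is_FT_cong_AE[OF g] by blast
qed

lemma is_FT_diff:
  assumes "is_FT f f'" "is_FT g g'"
  shows "is_FT (\<lambda>x. f x - g x) (\<lambda>\<xi>. f' \<xi> - g' \<xi>)"
proof -
  have s: "square_integrable f" "square_integrable g" "square_integrable f'" "square_integrable g'"
    using assms by (auto simp: is_FT_def)
  have eq: "FT1 (trunc n (\<lambda>x. f x - g x)) \<xi> = FT1 (trunc n f) \<xi> - FT1 (trunc n g) \<xi>" for n \<xi>
  proof -
    have "trunc n (\<lambda>x. f x - g x) = (\<lambda>x. trunc n f x - trunc n g x)"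
      by (rule ext) (simp add: trunc_def algebra_simps)
    thus ?thesis by (simp add: FT1_diff trunc_integrable s)
  qed
  have A: "L2_norm (\<lambda>\<xi>. FT1 (trunc n (\<lambda>x. f x - g x)) \<xi> - (f' \<xi> - g' \<xi>))
      \<le> L2_norm (\<lambda>\<xi>. FT1 (trunc n f) \<xi> - f' \<xi>) + L2_norm (\<lambda>\<xi>. FT1 (trunc n g) \<xi> - g' \<xi>)" for n
  proof -
    have d: "square_integrable (\<lambda>\<xi>. FT1 (trunc n f) \<xi> - f' \<xi>)" "square_integrable (\<lambda>\<xi>. g' \<xi> - FT1 (trunc n g) \<xi>)"
      by (intro square_integrable_diff FT1_L2_bound trunc_integrable trunc_square_integrable s)+
    have "(\<lambda>\<xi>. FT1 (trunc n (\<lambda>x. f x - g x)) \<xi> - (f' \<xi> - g' \<xi>))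
      = (\<lambda>\<xi>. (FT1 (trunc n f) \<xi> - f' \<xi>) + (g' \<xi> - FT1 (trunc n g) \<xi>))"
      by (simp add: eq algebra_simps)
    thus ?thesis using L2_norm_triangle[OF d] L2_norm_minus_commute[of g' "FT1 (trunc n g)"] by simp
  qed
  have "(\<lambda>n. L2_norm (\<lambda>\<xi>. FT1 (trunc n f) \<xi> - f' \<xi>) + L2_norm (\<lambda>\<xi>. FT1 (trunc n g) \<xi> - g' \<xi>)) \<longlonglongrightarrow> 0 + 0"
    using assms by (intro tendsto_add) (auto simp: is_FT_def)
  hence B: "(\<lambda>n. L2_norm (\<lambda>\<xi>. FT1 (trunc n f) \<xi> - f' \<xi>) + L2_norm (\<lambda>\<xi>. FT1 (trunc n g) \<xi> - g' \<xi>)) \<longlonglongrightarrow> 0" by simp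
  have "(\<lambda>n. L2_norm (\<lambda>\<xi>. FT1 (trunc n (\<lambda>x. f x - g x)) \<xi> - (f' \<xi> - g' \<xi>))) \<longlonglongrightarrow> 0"
    by (rule Lim_null_comparison[OF always_eventually B]) (use A in simp)
  thus ?thesis using s by (simp add: is_FT_def square_integrable_diff)
qed

lemma is_FT_cmult:
  assumes "is_FT f f'" shows "is_FT (\<lambda>x. c * f x) (\<lambda>\<xi>. c * f' \<xi>)"
proof -
  have eq: "FT1 (trunc n (\<lambda>x. c * f x)) \<xi> - c * f' \<xi> = c * (FT1 (trunc n f) \<xi> - f' \<xi>)" for n \<xi>
    by (subst right_diff_distrib, subst FT1_cmult[symmetric]) (simp add: trunc_def[abs_def] mult_ac)
  have "(\<lambda>n. norm c * L2_norm (\<lambda>\<xi>. FT1 (trunc n f) \<xi> - f' \<xi>)) \<longlonglongrightarrow> norm c * 0"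
    using assms by (intro tendsto_intros) (auto simp: is_FT_def)
  thus ?thesis using assms by (simp add: is_FT_def eq L2_norm_cmult square_integrable_cmult)
qed

lemma is_FT_multiplication:
  assumes "is_FT f f'" "is_FT g g'"
  shows "(\<integral>x. f' x * g x \<partial>lborel) = (\<integral>x. f x * g' x \<partial>lborel)"
proof -
  have s: "square_integrable f" "square_integrable g" "square_integrable f'" "square_integrable g'"
    using assms by (auto simp: is_FT_def)
  note i = trunc_integrable[OF s(1)] trunc_integrable[OF s(2)]
  note t = trunc_square_integrable[OF s(1)] trunc_square_integrable[OF s(2)]
  have "(\<lambda>n. \<integral>x. FT1 (trunc n f) x * trunc n g x \<partial>lborel) \<longlonglongrightarrow> (\<integral>x. f' x * g x \<partial>lborel)"
    using assms by (intro L2_pairing_tendsto FT1_L2_bound i t s trunc_tendsto) (auto simp: is_FT_def)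
  moreover have "(\<lambda>n. \<integral>x. trunc n f x * FT1 (trunc n g) x \<partial>lborel) \<longlonglongrightarrow> (\<integral>x. f x * g' x \<partial>lborel)"
    using assms by (intro L2_pairing_tendsto FT1_L2_bound i t s trunc_tendsto) (auto simp: is_FT_def)
  ultimately show ?thesis
    using FT1_multiplication[OF i] LIMSEQ_unique by (simp add: LIMSEQ_unique)
qed

lemma test_function_square_integrable:
  assumes "test_function \<phi>" shows "square_integrable (\<lambda>x. complex_of_real (\<phi> x))" "integrable lborel (\<lambda>x. complex_of_real (\<phi> x))"
proof -
  obtain R where R: "R > 0" "\<And>x. \<bar>x\<bar> \<ge> R \<Longrightarrow> \<phi> x = 0" using test_function_support[OF assms] by blast
  obtain B where B: "B > 0" "\<And>x. \<bar>\<phi> x\<bar> \<le> B" using test_function_bounded[OF assms] by blast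
  have [measurable]: "\<phi> \<in> borel_measurable borel" by (rule test_function_measurable[OF assms])
  show "square_integrable (\<lambda>x. complex_of_real (\<phi> x))"
  proof (rule square_integrable_bound[where h="\<lambda>x. B\<^sup>2 * indicator {-R..R} x"])
    fix x
    show "(norm (complex_of_real (\<phi> x)))\<^sup>2 \<le> B\<^sup>2 * indicator {-R..R} x"
      using R(2)[of x] power_mono[OF B(2)[of x], of 2] by (cases "\<bar>x\<bar> \<ge> R") (auto simp: indicator_def abs_le_iff)
  qed auto
  thus "integrable lborel (\<lambda>x. complex_of_real (\<phi> x))"
    using R(2) by (intro integrable_if_square_integrable_bounded_support[of _ "-R" R]) (auto simp: abs_le_iff)
qed

text \<open>The integral over \<open>\<real>\<close> of the derivative of \<open>e\<^sup>-\<^sup>i\<^sup>x\<^sup>\<xi> \<phi>(x)\<close> vanishes by compact support.\<close>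

lemma FT1_deriv:
  assumes "test_function \<phi>"
  shows "FT1 (\<lambda>x. of_real (deriv \<phi> x)) \<xi> = \<i> * of_real \<xi> * FT1 (\<lambda>x. of_real (\<phi> x)) \<xi>"
proof -
  obtain R where R: "R > 0" "\<And>x. \<bar>x\<bar> \<ge> R \<Longrightarrow> \<phi> x = 0" using test_function_support[OF assms] by blast
  obtain R' where R': "R' > 0" "\<And>x. \<bar>x\<bar> \<ge> R' \<Longrightarrow> deriv \<phi> x = 0"
    using test_function_support[OF test_function_deriv[OF assms]] by blast
  define S where "S = max R R'"
  have S: "S > 0" "\<And>x. \<bar>x\<bar> \<ge> S \<Longrightarrow> \<phi> x = 0 \<and> deriv \<phi> x = 0" using R R' by (auto simp: S_def)
  let ?E = "\<lambda>x. cis (- (x * \<xi>))"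
  define f where "f = (\<lambda>x. ?E x * of_real (deriv \<phi> x) - \<i> * of_real \<xi> * (?E x * of_real (\<phi> x)))"
  have cE: "(?E has_vector_derivative (- \<i> * of_real \<xi> * ?E x)) (at x within A)" for x A
  proof -
    have "((\<lambda>z. exp (z * (- \<i> * of_real \<xi>))) has_field_derivative
        (- \<i> * of_real \<xi>) * exp (of_real x * (- \<i> * of_real \<xi>))) (at (of_real x))"
      by (auto intro!: derivative_eq_intros)
    from has_vector_derivative_real_field[OF this, of A] show ?thesis
      by (simp add: cis_conv_exp mult_ac)
  qed
  have D: "((\<lambda>x. ?E x * of_real (\<phi> x)) has_vector_derivative f x) (at x within A)" for x A
  proof -
    have "(\<phi> has_vector_derivative deriv \<phi> x) (at x within A)"
      using test_function_DERIV[OF assms, of x] has_vector_derivative_at_within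
      by (auto simp: has_real_derivative_iff_has_vector_derivative)
    hence "((\<lambda>x. complex_of_real (\<phi> x)) has_vector_derivative of_real (deriv \<phi> x)) (at x within A)"
      by (rule bounded_linear.has_vector_derivative[OF bounded_linear_of_real])
    from has_vector_derivative_mult[OF cE this] show ?thesis by (simp add: f_def algebra_simps)
  qed
  have cont: "continuous_on A f" for A
    unfolding f_def by (intro continuous_intros test_function_continuous assms test_function_deriv)
  have "(\<integral>x. f x \<partial>lborel) = (\<integral>x. indicator {-S..S} x *\<^sub>R f x \<partial>lborel)"
  proof (intro Bochner_Integration.integral_cong refl)
    fix x show "f x = indicator {-S..S} x *\<^sub>R f x"
      using S(2)[of x] by (cases "\<bar>x\<bar> \<ge> S") (auto simp: f_def indicator_def abs_le_iff)
  qed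
  also have "\<dots> = ?E S * of_real (\<phi> S) - ?E (- S) * of_real (\<phi> (- S))"
    by (rule integral_FTC_atLeastAtMost) (use S D cont in auto)
  also have "\<dots> = 0" using S by simp
  finally have "(\<integral>x. f x \<partial>lborel) = 0" .
  moreover have "(\<integral>x. f x \<partial>lborel) = FT1 (\<lambda>x. of_real (deriv \<phi> x)) \<xi> - \<i> * of_real \<xi> * FT1 (\<lambda>x. of_real (\<phi> x)) \<xi>"
    unfolding f_def FT1_def
    by (subst Bochner_Integration.integral_diff)
       (auto intro!: integrable_cis_mult integrable_mult_right test_function_square_integrable assms test_function_deriv)
  ultimately show ?thesis by simp
qed

lemma FT1_iter_deriv:
  assumes "test_function \<phi>"
  shows "FT1 (\<lambda>x. of_real ((deriv ^^ l) \<phi> x)) \<xi> = (\<i> * of_real \<xi>) ^ l * FT1 (\<lambda>x. of_real (\<phi> x)) \<xi>"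
proof (induction l)
  case (Suc l)
  show ?case using FT1_deriv[OF test_function_iter_deriv[OF assms, of l], of \<xi>] Suc by (simp add: mult_ac)
qed simp

lemma integrable_inverse_1_plus_sq: "integrable lborel (\<lambda>x::real. 1 / (1 + x\<^sup>2))"
  using integrable_inverse_1_plus_square by (simp add: set_integrable_def einterval_def inverse_eq_divide)

lemma FT1_test_integrable:
  assumes "test_function \<phi>"
  shows "integrable lborel (FT1 (\<lambda>x. of_real (\<phi> x)))"
proof -
  let ?\<phi> = "\<lambda>x. complex_of_real (\<phi> x)" and ?\<phi>2 = "\<lambda>x. complex_of_real ((deriv ^^ 2) \<phi> x)"
  define K where "K = (\<integral>x. norm (?\<phi> x) \<partial>lborel) + (\<integral>x. norm (?\<phi>2 x) \<partial>lborel)"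
  have bd: "norm (FT1 ?\<phi> \<xi>) \<le> K * (1 / (1 + \<xi>\<^sup>2))" for \<xi>
  proof -
    have "\<xi>\<^sup>2 * norm (FT1 ?\<phi> \<xi>) = norm (FT1 ?\<phi>2 \<xi>)"
      unfolding FT1_iter_deriv[OF assms] by (simp add: norm_mult power_mult_distrib norm_power)
    hence "(1 + \<xi>\<^sup>2) * norm (FT1 ?\<phi> \<xi>) \<le> K"
      unfolding K_def distrib_right using norm_FT1_le[of ?\<phi> \<xi>] norm_FT1_le[of ?\<phi>2 \<xi>] by linarith
    moreover have "1 + \<xi>\<^sup>2 > 0" by (simp add: add_pos_nonneg)
    ultimately show ?thesis by (simp add: field_simps)
  qed
  have m: "FT1 ?\<phi> \<in> borel_measurable borel"
    using test_function_measurable[OF assms] by (intro FT1_measurable) simp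
  show ?thesis
  proof (rule Bochner_Integration.integrable_bound)
    show "integrable lborel (\<lambda>\<xi>::real. K * (1 / (1 + \<xi>\<^sup>2)))"
      by (intro integrable_mult_right integrable_inverse_1_plus_sq)
    show "AE \<xi> in lborel. norm (FT1 ?\<phi> \<xi>) \<le> norm (K * (1 / (1 + \<xi>\<^sup>2)))"
      using order_trans[OF bd abs_ge_self] by (intro AE_I2) simp
  qed (use m in simp)
qed

text \<open>Inserting a Gaussian weight and letting its width tend to infinity: on one side dominated convergence gives the
double transform, on the other the multiplication formula gives the convolution of \<open>\<phi>\<close> with an approximate
identity.\<close>

lemma FT1_inversion_test:
  assumes "test_function \<phi>"
  shows "FT1 (FT1 (\<lambda>x. of_real (\<phi> x))) x = of_real (2 * pi * \<phi> (- x))"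
proof -
  let ?\<phi> = "\<lambda>x. complex_of_real (\<phi> x)"
  obtain B where B: "B > 0" "\<And>x. \<bar>\<phi> x\<bar> \<le> B" using test_function_bounded[OF assms] by blast
  note \<phi>i = test_function_square_integrable(2)[OF assms]
  have [measurable]: "\<phi> \<in> borel_measurable borel" by (rule test_function_measurable[OF assms])
  define \<epsilon> where "\<epsilon> = (\<lambda>n. 1 / real (Suc n))"
  have e: "\<epsilon> n > 0" for n by (simp add: \<epsilon>_def)
  have e0: "\<epsilon> \<longlonglongrightarrow> 0" unfolding \<epsilon>_def using LIMSEQ_Suc[OF lim_1_over_n] by simp
  define J where "J = (\<lambda>n. \<integral>\<xi>. FT1 ?\<phi> \<xi> * (cis (- (x * \<xi>)) * of_real (gauss (\<epsilon> n) \<xi>)) \<partial>lborel)"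
  have "J \<longlonglongrightarrow> (\<integral>\<xi>. FT1 ?\<phi> \<xi> * (cis (- (x * \<xi>)) * 1) \<partial>lborel)"
    unfolding J_def
  proof (rule integral_dominated_convergence[where w="\<lambda>\<xi>. norm (FT1 ?\<phi> \<xi>)"])
    show "integrable lborel (\<lambda>\<xi>. norm (FT1 ?\<phi> \<xi>))" by (intro integrable_norm FT1_test_integrable assms)
    show "AE \<xi> in lborel. (\<lambda>n. FT1 ?\<phi> \<xi> * (cis (- (x * \<xi>)) * of_real (gauss (\<epsilon> n) \<xi>)))
        \<longlonglongrightarrow> FT1 ?\<phi> \<xi> * (cis (- (x * \<xi>)) * 1)"
    proof (intro AE_I2 tendsto_intros)
      fix \<xi>
      have "(\<lambda>n. gauss (\<epsilon> n) \<xi>) \<longlonglongrightarrow> exp (- (0 * \<xi>)\<^sup>2 / 2)" unfolding gauss_def by (intro tendsto_intros e0) auto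
      hence "(\<lambda>n. complex_of_real (gauss (\<epsilon> n) \<xi>)) \<longlonglongrightarrow> complex_of_real 1" by (intro tendsto_of_real) simp
      thus "(\<lambda>n. complex_of_real (gauss (\<epsilon> n) \<xi>)) \<longlonglongrightarrow> 1" by simp
    qed
    show "AE \<xi> in lborel. norm (FT1 ?\<phi> \<xi> * (cis (- (x * \<xi>)) * of_real (gauss (\<epsilon> n) \<xi>))) \<le> norm (FT1 ?\<phi> \<xi>)" for n
      using gauss_bounds[of "\<epsilon> n"] by (intro AE_I2) (auto simp: norm_mult abs_of_pos intro!: mult_left_le)
  qed measurable
  hence lim1: "J \<longlonglongrightarrow> FT1 (FT1 ?\<phi>) x" by (simp add: FT1_def[of "FT1 ?\<phi>"] mult_ac)
  have Jeq: "J n = (\<integral>z. of_real (2 * pi * (std_normal_density z * \<phi> (- x + \<epsilon> n * z))) \<partial>lborel)" for n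
  proof -
    have "J n = (\<integral>y. ?\<phi> y * FT1 (\<lambda>\<xi>. cis (- (x * \<xi>)) * of_real (gauss (\<epsilon> n) \<xi>)) y \<partial>lborel)"
      unfolding J_def
      by (rule FT1_multiplication[OF \<phi>i]) (use integrable_cis_mult[of "\<lambda>\<xi>. of_real (gauss (\<epsilon> n) \<xi>)" x] integrable_gauss[OF e[of n]] in \<open>simp add: mult.commute\<close>)
    also have "\<dots> = (\<integral>y. of_real (2 * pi * (normal_density 0 (\<epsilon> n) (x + y) * \<phi> y)) \<partial>lborel)"
      by (simp only: FT1_shift FT1_gauss[OF e]) (simp add: mult_ac)
    also have "\<dots> = \<epsilon> n *\<^sub>R (\<integral>z. of_real (2 * pi * (normal_density 0 (\<epsilon> n) (x + (- x + \<epsilon> n * z)) * \<phi> (- x + \<epsilon> n * z))) \<partial>lborel)"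
      using lborel_integral_real_affine[of "\<epsilon> n" "\<lambda>y. complex_of_real (2 * pi * (normal_density 0 (\<epsilon> n) (x + y) * \<phi> y))" "- x"] e[of n]
      by (simp add: abs_of_pos)
    also have "\<dots> = (\<integral>z. \<epsilon> n *\<^sub>R of_real (2 * pi * (normal_density 0 (\<epsilon> n) (x + (- x + \<epsilon> n * z)) * \<phi> (- x + \<epsilon> n * z))) \<partial>lborel)"
      by (rule integral_scaleR_right[symmetric])
    also have "\<dots> = (\<integral>z. of_real (2 * pi * (std_normal_density z * \<phi> (- x + \<epsilon> n * z))) \<partial>lborel)"
    proof (intro Bochner_Integration.integral_cong refl)
      fix z
      have "\<epsilon> n * normal_density 0 (\<epsilon> n) (\<epsilon> n * z) = std_normal_density z"
        using e[of n] by (simp add: normal_density_def real_sqrt_mult power_mult_distrib)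
      thus "\<epsilon> n *\<^sub>R of_real (2 * pi * (normal_density 0 (\<epsilon> n) (x + (- x + \<epsilon> n * z)) * \<phi> (- x + \<epsilon> n * z)))
        = complex_of_real (2 * pi * (std_normal_density z * \<phi> (- x + \<epsilon> n * z)))"
        by (simp add: scaleR_conv_of_real flip: of_real_mult)
    qed
    finally show ?thesis .
  qed
  have "J \<longlonglongrightarrow> (\<integral>z. of_real (2 * pi * (std_normal_density z * \<phi> (- x))) \<partial>lborel)"
    unfolding Jeq
  proof (rule integral_dominated_convergence[where w="\<lambda>z. 2 * pi * B * std_normal_density z"])
    show "AE z in lborel. (\<lambda>n. complex_of_real (2 * pi * (std_normal_density z * \<phi> (- x + \<epsilon> n * z))))
        \<longlonglongrightarrow> of_real (2 * pi * (std_normal_density z * \<phi> (- x)))"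
    proof (intro AE_I2 tendsto_intros)
      fix z
      have "(\<lambda>n. - x + \<epsilon> n * z) \<longlonglongrightarrow> - x + 0 * z" by (intro tendsto_intros e0)
      hence "(\<lambda>n. - x + \<epsilon> n * z) \<longlonglongrightarrow> - x" by simp
      thus "(\<lambda>n. \<phi> (- x + \<epsilon> n * z)) \<longlonglongrightarrow> \<phi> (- x)"
        by (rule isCont_tendsto_compose[OF DERIV_isCont[OF test_function_DERIV[OF assms]]])
    qed
    show "AE z in lborel. norm (complex_of_real (2 * pi * (std_normal_density z * \<phi> (- x + \<epsilon> n * z))))
        \<le> 2 * pi * B * std_normal_density z" for n
    proof (intro AE_I2)
      fix z
      have "std_normal_density z * \<bar>\<phi> (- x + \<epsilon> n * z)\<bar> \<le> std_normal_density z * B"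
        by (intro mult_left_mono B) auto
      thus "norm (complex_of_real (2 * pi * (std_normal_density z * \<phi> (- x + \<epsilon> n * z))))
        \<le> 2 * pi * B * std_normal_density z" by (simp add: norm_mult abs_mult mult_ac)
    qed
  qed simp_all
  moreover have "(\<integral>z. complex_of_real (2 * pi * (std_normal_density z * \<phi> (- x))) \<partial>lborel) = of_real (2 * pi * \<phi> (- x))"
    by (simp only: integral_complex_of_real) simp
  ultimately show ?thesis using LIMSEQ_unique[OF lim1] by simp
qed

lemma fundamental_lemma_complex:
  fixes g :: "real \<Rightarrow> complex"
  assumes g: "square_integrable g"
    and z: "\<And>\<phi>. test_function \<phi> \<Longrightarrow> (\<integral>x. of_real (\<phi> x) * g x \<partial>lborel) = 0"
  shows "AE x in lborel. g x = 0"
proof -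
  have i: "integrable lborel (\<lambda>x. of_real (\<phi> x) * g x)" if "test_function \<phi>" for \<phi>
    by (intro integrable_mult_L2 test_function_square_integrable that g)
  have "set_integrable lborel {a..b} (\<lambda>x. Re (g x))" "set_integrable lborel {a..b} (\<lambda>x. Im (g x))" for a b
    using integrable_Re[OF square_integrable_locally_integrable[OF g, of a b, unfolded set_integrable_def]]
      integrable_Im[OF square_integrable_locally_integrable[OF g, of a b, unfolded set_integrable_def]]
    by (auto simp: set_integrable_def)
  moreover have "(\<integral>x. \<phi> x * Re (g x) \<partial>lborel) = 0" if "test_function \<phi>" for \<phi>
    using integral_Re[OF i[OF that]] z[OF that] by simp
  moreover have "(\<integral>x. \<phi> x * Im (g x) \<partial>lborel) = 0" if "test_function \<phi>" for \<phi>
    using integral_Im[OF i[OF that]] z[OF that] by simp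
  ultimately have "AE x in lborel. Re (g x) = 0" "AE x in lborel. Im (g x) = 0"
    using fundamental_lemma by blast+
  thus ?thesis by eventually_elim (simp add: complex_eq_iff)
qed

text \<open>Both sides have the same pairing with every test function, by applying the multiplication formula twice and
inverting on the test function.\<close>

lemma is_FT_inversion:
  assumes F: "is_FT f g" and G: "is_FT g k"
  shows "AE x in lborel. k x = of_real (2 * pi) * f (- x)"
proof -
  have s: "square_integrable f" "square_integrable k" using assms by (auto simp: is_FT_def)
  have s': "square_integrable (\<lambda>x. of_real (2 * pi) * f (- x))"
    by (intro square_integrable_cmult square_integrable_reflect s)
  have "AE x in lborel. k x - of_real (2 * pi) * f (- x) = 0"
  proof (rule fundamental_lemma_complex)
    show "square_integrable (\<lambda>x. k x - of_real (2 * pi) * f (- x))" by (intro square_integrable_diff s s')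
    fix \<phi> assume \<phi>: "test_function \<phi>"
    let ?\<phi> = "\<lambda>x. complex_of_real (\<phi> x)"
    note \<phi>s = test_function_square_integrable[OF \<phi>]
    have "(\<integral>x. ?\<phi> x * k x \<partial>lborel) = (\<integral>x. FT1 ?\<phi> x * g x \<partial>lborel)"
      by (rule is_FT_multiplication[OF is_FT_of_integrable[OF \<phi>s(2,1)] G, symmetric])
    also have "\<dots> = (\<integral>x. FT1 (FT1 ?\<phi>) x * f x \<partial>lborel)"
      by (rule is_FT_multiplication[OF is_FT_of_integrable F, symmetric])
         (intro FT1_test_integrable \<phi> FT1_L2_bound \<phi>s)+
    also have "\<dots> = (\<integral>x. of_real (2 * pi) * (?\<phi> (- x) * f x) \<partial>lborel)"
      by (simp add: FT1_inversion_test[OF \<phi>] mult_ac)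
    also have "\<dots> = (\<integral>x. ?\<phi> x * (of_real (2 * pi) * f (- x)) \<partial>lborel)"
      using lborel_integral_real_affine[of "-1" "\<lambda>x. of_real (2 * pi) * (?\<phi> (- x) * f x)" 0] by (simp add: mult_ac)
    finally have "(\<integral>x. ?\<phi> x * k x \<partial>lborel) = (\<integral>x. ?\<phi> x * (of_real (2 * pi) * f (- x)) \<partial>lborel)" .
    thus "(\<integral>x. ?\<phi> x * (k x - of_real (2 * pi) * f (- x)) \<partial>lborel) = 0"
      using integrable_mult_L2[OF \<phi>s(1) s(2)] integrable_mult_L2[OF \<phi>s(1) s']
      by (simp add: right_diff_distrib)
  qed
  thus ?thesis by simp
qed

lemma is_FT_norm_le:
  assumes "is_FT f g" shows "L2_norm g \<le> sqrt (2 * pi) * L2_norm f"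
proof -
  have s: "square_integrable f" "square_integrable g" using assms by (auto simp: is_FT_def)
  have "(\<lambda>n. L2_norm (FT1 (trunc n f))) \<longlonglongrightarrow> L2_norm g"
    using assms by (intro L2_norm_tendsto FT1_L2_bound trunc_integrable trunc_square_integrable s) (auto simp: is_FT_def)
  moreover have "(\<lambda>n. sqrt (2 * pi) * L2_norm (trunc n f)) \<longlonglongrightarrow> sqrt (2 * pi) * L2_norm f"
    by (intro tendsto_intros L2_norm_tendsto trunc_square_integrable s trunc_tendsto)
  ultimately show ?thesis
    by (rule LIMSEQ_le) (use FT1_L2_bound(2)[OF trunc_integrable trunc_square_integrable] s in blast)
qed

text \<open>The bound \<open>is_FT_norm_le\<close>, applied to the transform of the transform, is the reverse inequality by inversion.\<close>

lemma Plancherel: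
  assumes "is_FT f g" shows "L2_norm g = sqrt (2 * pi) * L2_norm f"
proof (rule antisym[OF is_FT_norm_le[OF assms]])
  have s: "square_integrable f" "square_integrable g" using assms by (auto simp: is_FT_def)
  obtain k where k: "is_FT g k" using is_FT_exists[OF s(2)] by blast
  have sk: "square_integrable k" using k by (auto simp: is_FT_def)
  have s': "square_integrable (\<lambda>x. of_real (2 * pi) * f (- x))"
    by (intro square_integrable_cmult square_integrable_reflect s)
  have "L2_norm k = L2_norm (\<lambda>x. of_real (2 * pi) * f (- x))"
    by (intro L2_norm_cong_AE square_integrable_measurable sk s' is_FT_inversion[OF assms k])
  also have "\<dots> = 2 * pi * L2_norm f" by (simp add: L2_norm_cmult L2_norm_reflect)
  finally have "2 * pi * L2_norm f \<le> sqrt (2 * pi) * L2_norm g" using is_FT_norm_le[OF k] by simp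
  moreover have "2 * pi = sqrt (2 * pi) * sqrt (2 * pi)" by simp
  ultimately have "sqrt (2 * pi) * (sqrt (2 * pi) * L2_norm f) \<le> sqrt (2 * pi) * L2_norm g" by (metis mult.assoc)
  thus "sqrt (2 * pi) * L2_norm f \<le> L2_norm g" by (rule mult_left_le_imp_le) simp
qed

section \<open>Sobolev spaces and weak derivatives on the Fourier side\<close>

lemma norm_vec_sq: "(norm (v :: 'a::real_normed_vector ^ 'n))\<^sup>2 = (\<Sum>i\<in>UNIV. (norm (v $ i))\<^sup>2)"
  by (simp add: norm_vec_def L2_set_def sum_nonneg)

lemma borel_measurable_vec_iff:
  fixes f :: "'a \<Rightarrow> 'b::euclidean_space ^ 'n"
  shows "f \<in> borel_measurable M \<longleftrightarrow> (\<forall>i. (\<lambda>x. f x $ i) \<in> borel_measurable M)"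
proof
  assume "f \<in> borel_measurable M"
  moreover have "(\<lambda>v::'b^'n. v $ i) \<in> borel_measurable borel" for i
    by (intro borel_measurable_continuous_onI continuous_intros)
  ultimately show "\<forall>i. (\<lambda>x. f x $ i) \<in> borel_measurable M"
    using measurable_compose[of f M borel] by blast
next
  assume "\<forall>i. (\<lambda>x. f x $ i) \<in> borel_measurable M"
  thus "f \<in> borel_measurable M"
    by (subst borel_measurable_euclidean_space)
       (auto simp: Basis_vec_def inner_axis intro!: borel_measurable_inner)
qed

lemma square_integrable_vec_iff:
  fixes f :: "real \<Rightarrow> 'b::euclidean_space ^ 'n"
  shows "square_integrable f \<longleftrightarrow> (\<forall>i. square_integrable (\<lambda>x. f x $ i))"
proof
  assume f: "square_integrable f"
  hence "(\<lambda>x. f x $ i) \<in> borel_measurable borel" for i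
    using borel_measurable_vec_iff square_integrable_measurable by blast
  moreover have "AE x in lborel. norm (f x $ i) \<le> norm (f x)" for i
    by (intro AE_I2) (rule Finite_Cartesian_Product.norm_nth_le)
  ultimately show "\<forall>i. square_integrable (\<lambda>x. f x $ i)" using L2_norm_mono(1)[OF _ f] by blast
next
  assume f: "\<forall>i. square_integrable (\<lambda>x. f x $ i)"
  hence "f \<in> borel_measurable borel" using borel_measurable_vec_iff square_integrable_measurable by blast
  thus "square_integrable f" using f by (simp add: square_integrable_def norm_vec_sq)
qed

lemma L2_norm_vec:
  fixes f :: "real \<Rightarrow> 'b::euclidean_space ^ 'n"
  assumes "square_integrable f"
  shows "(L2_norm f)\<^sup>2 = (\<Sum>i\<in>UNIV. (L2_norm (\<lambda>x. f x $ i))\<^sup>2)"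
  using assms square_integrable_vec_iff[of f]
  by (simp add: L2_norm_sq norm_vec_sq square_integrable_sq)

lemma square_integrable_of_real_iff:
  "square_integrable (\<lambda>x. complex_of_real (f x)) \<longleftrightarrow> square_integrable f"
  by (simp add: square_integrable_def borel_measurable_complex_iff)

lemma L2_norm_of_real: "L2_norm (\<lambda>x. complex_of_real (f x)) = L2_norm f"
  by (simp add: L2_norm_def)

lemma fourier_trunc_component:
  "fourier_trunc n f \<xi> $ i = FT1 (trunc n (\<lambda>x. complex_of_real (f x $ i))) \<xi>"
  unfolding fourier_trunc_def FT1_def trunc_def set_lebesgue_integral_def
  by (simp, intro Bochner_Integration.integral_cong) (auto simp: indicator_def)

lemma nn_integral_fourier_trunc:
  fixes f :: "real \<Rightarrow> real ^ 'n"
  assumes f: "square_integrable f" and g: "square_integrable g"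
  shows "(\<integral>\<^sup>+\<xi>. ennreal ((norm (fourier_trunc n f \<xi> - g \<xi>))\<^sup>2) \<partial>lborel)
    = ennreal (\<Sum>i\<in>UNIV. (L2_norm (\<lambda>\<xi>. FT1 (trunc n (\<lambda>x. complex_of_real (f x $ i))) \<xi> - g \<xi> $ i))\<^sup>2)"
proof -
  have "square_integrable (\<lambda>x. complex_of_real (f x $ i))" for i
    using f square_integrable_vec_iff[of f] by (simp add: square_integrable_of_real_iff)
  hence "square_integrable (\<lambda>\<xi>. FT1 (trunc n (\<lambda>x. complex_of_real (f x $ i))) \<xi> - g \<xi> $ i)" for i
    using g square_integrable_vec_iff[of g]
    by (intro square_integrable_diff FT1_L2_bound trunc_integrable trunc_square_integrable) auto
  hence s: "square_integrable (\<lambda>\<xi>. fourier_trunc n f \<xi> - g \<xi>)"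
    by (simp add: square_integrable_vec_iff fourier_trunc_component)
  show ?thesis
    using nn_integral_L2_norm[OF s] L2_norm_vec[OF s] by (simp add: fourier_trunc_component)
qed

text \<open>Reduces the vector-valued transform to scalar ones, for which the theory above is available.\<close>

lemma is_fourier_L2_iff:
  fixes f :: "real \<Rightarrow> real ^ 'n"
  assumes f: "square_integrable f"
  shows "is_fourier_L2 f g \<longleftrightarrow> (\<forall>i. is_FT (\<lambda>x. complex_of_real (f x $ i)) (\<lambda>\<xi>. g \<xi> $ i))"
proof -
  have fi: "square_integrable (\<lambda>x. complex_of_real (f x $ i))" for i
    using f square_integrable_vec_iff[of f] by (simp add: square_integrable_of_real_iff)
  let ?d = "\<lambda>i n. L2_norm (\<lambda>\<xi>. FT1 (trunc n (\<lambda>x. complex_of_real (f x $ i))) \<xi> - g \<xi> $ i)"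
  have "is_fourier_L2 f g \<longleftrightarrow> square_integrable g \<and> (\<lambda>n. ennreal (\<Sum>i\<in>UNIV. (?d i n)\<^sup>2)) \<longlonglongrightarrow> 0"
    unfolding is_fourier_L2_def using nn_integral_fourier_trunc[OF f, of g] by auto
  also have "\<dots> \<longleftrightarrow> square_integrable g \<and> (\<lambda>n. \<Sum>i\<in>UNIV. (?d i n)\<^sup>2) \<longlonglongrightarrow> 0"
  proof -
    have "((\<lambda>n. ennreal (\<Sum>i\<in>UNIV. (?d i n)\<^sup>2)) \<longlonglongrightarrow> ennreal 0) \<longleftrightarrow> (\<lambda>n. \<Sum>i\<in>UNIV. (?d i n)\<^sup>2) \<longlonglongrightarrow> 0"
      by (rule tendsto_ennreal_iff) (auto simp: sum_nonneg)
    thus ?thesis by simp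
  qed
  also have "(\<lambda>n. \<Sum>i\<in>UNIV. (?d i n)\<^sup>2) \<longlonglongrightarrow> 0 \<longleftrightarrow> (\<forall>i. (\<lambda>n. ?d i n) \<longlonglongrightarrow> 0)"
  proof
    assume *: "(\<lambda>n. \<Sum>i\<in>UNIV. (?d i n)\<^sup>2) \<longlonglongrightarrow> 0"
    show "\<forall>i. (\<lambda>n. ?d i n) \<longlonglongrightarrow> 0"
    proof
      fix i
      have "(?d i n)\<^sup>2 \<le> (\<Sum>i\<in>UNIV. (?d i n)\<^sup>2)" for n
        by (rule member_le_sum) auto
      hence "(\<lambda>n. (?d i n)\<^sup>2) \<longlonglongrightarrow> 0"
        by (intro Lim_null_comparison[OF always_eventually *]) simp
      hence "(\<lambda>n. sqrt ((?d i n)\<^sup>2)) \<longlonglongrightarrow> sqrt 0" by (rule tendsto_real_sqrt)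
      thus "(\<lambda>n. ?d i n) \<longlonglongrightarrow> 0" by simp
    qed
  next
    assume *: "\<forall>i. (\<lambda>n. ?d i n) \<longlonglongrightarrow> 0"
    have "(\<lambda>n. \<Sum>i\<in>UNIV. (?d i n)\<^sup>2) \<longlonglongrightarrow> (\<Sum>i\<in>(UNIV::'n set). 0\<^sup>2)"
      by (intro tendsto_intros) (use * in auto)
    thus "(\<lambda>n. \<Sum>i\<in>UNIV. (?d i n)\<^sup>2) \<longlonglongrightarrow> 0" by simp
  qed
  finally show ?thesis using fi by (auto simp: is_FT_def square_integrable_vec_iff[of g])
qed

text \<open>The existence of the transform, needed because \<open>fourier_L2\<close> is a choice.\<close>

lemma fourier_L2_component:
  fixes f :: "real \<Rightarrow> real ^ 'n"
  assumes f: "square_integrable f"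
  shows "is_FT (\<lambda>x. complex_of_real (f x $ i)) (\<lambda>\<xi>. fourier_L2 f \<xi> $ i)"
proof -
  have fi: "square_integrable (\<lambda>x. complex_of_real (f x $ i))" for i
    using f square_integrable_vec_iff[of f] by (simp add: square_integrable_of_real_iff)
  have "\<exists>g. is_FT (\<lambda>x. complex_of_real (f x $ i)) g" for i using is_FT_exists[OF fi] by blast
  then obtain G where "\<And>i. is_FT (\<lambda>x. complex_of_real (f x $ i)) (G i)" by metis
  hence "is_fourier_L2 f (\<lambda>\<xi>. \<chi> i. G i \<xi>)" by (simp add: is_fourier_L2_iff[OF f])
  hence "is_fourier_L2 f (fourier_L2 f)" unfolding fourier_L2_def by (rule someI[of "is_fourier_L2 f"])
  thus ?thesis by (simp add: is_fourier_L2_iff[OF f])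
qed

lemma fourier_L2_bounded_by_L1:
  fixes f :: "real \<Rightarrow> real ^ 'n"
  assumes f: "square_integrable f" "integrable lborel f"
  shows "AE \<xi> in lborel. norm (fourier_L2 f \<xi> $ i) \<le> L1_norm f"
proof -
  have m: "(\<lambda>x. f x $ i) \<in> borel_measurable borel"
    using borel_measurable_vec_iff square_integrable_measurable[OF f(1)] by blast
  have fi: "square_integrable (\<lambda>x. complex_of_real (f x $ i))"
    using f square_integrable_vec_iff[of f] by (simp add: square_integrable_of_real_iff)
  have i: "integrable lborel (\<lambda>x. complex_of_real (f x $ i))"
    by (rule Bochner_Integration.integrable_bound[OF f(2)]) (use m in \<open>auto intro!: AE_I2 component_le_norm_cart\<close>)
  have "norm (FT1 (\<lambda>x. complex_of_real (f x $ i)) \<xi>) \<le> L1_norm f" for \<xi>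
  proof -
    have "norm (FT1 (\<lambda>x. complex_of_real (f x $ i)) \<xi>) \<le> (\<integral>x. norm (complex_of_real (f x $ i)) \<partial>lborel)"
      by (rule norm_FT1_le)
    also have "\<dots> \<le> L1_norm f" unfolding L1_norm_def
      by (intro integral_mono integrable_norm i f) (simp add: component_le_norm_cart)
    finally show ?thesis .
  qed
  moreover have "AE \<xi> in lborel. fourier_L2 f \<xi> $ i = FT1 (\<lambda>x. complex_of_real (f x $ i)) \<xi>"
    by (rule is_FT_unique[OF fourier_L2_component[OF f(1)] is_FT_of_integrable[OF i fi]])
  ultimately show ?thesis by (auto elim!: eventually_mono)
qed

lemma sobolev_square_integrable: "f \<in> sobolev r \<Longrightarrow> square_integrable f"
  by (simp add: sobolev_def)

lemma sobolev_power_weight: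
  fixes f :: "real \<Rightarrow> real ^ 'n"
  assumes f: "f \<in> sobolev r" and l: "real l \<le> r"
  shows "square_integrable (\<lambda>\<xi>. of_real (\<xi> ^ l) * (fourier_L2 f \<xi> $ i))"
proof -
  have b: "square_integrable (bessel r f)" using f by (simp add: sobolev_def)
  have s: "square_integrable (\<lambda>\<xi>. fourier_L2 f \<xi> $ i)"
    using fourier_L2_component[OF sobolev_square_integrable[OF f]] is_FT_square_integrable by blast
  have w: "\<bar>\<xi> ^ l\<bar> \<le> (1 + \<xi>\<^sup>2) powr (r / 2)" for \<xi> :: real
  proof -
    have p: "1 + \<xi>\<^sup>2 > 0" by (simp add: add_pos_nonneg)
    have "\<bar>\<xi> ^ l\<bar> = \<bar>\<xi>\<bar> ^ l" by (simp add: power_abs)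
    also have "\<dots> \<le> (sqrt (1 + \<xi>\<^sup>2)) ^ l"
      by (intro power_mono real_le_rsqrt) auto
    also have "\<dots> = (1 + \<xi>\<^sup>2) powr (real l / 2)"
      using p by (simp add: powr_half_sqrt[symmetric] powr_powr flip: powr_realpow)
    also have "\<dots> \<le> (1 + \<xi>\<^sup>2) powr (r / 2)"
      using l by (intro powr_mono) auto
    finally show ?thesis .
  qed
  have bi: "square_integrable (\<lambda>\<xi>. bessel r f \<xi> $ i)" using b square_integrable_vec_iff by blast
  show ?thesis
  proof (rule L2_norm_mono(1)[OF _ bi])
    show "(\<lambda>\<xi>. of_real (\<xi> ^ l) * (fourier_L2 f \<xi> $ i)) \<in> borel_measurable borel"
      using square_integrable_measurable[OF s] by simp
    show "AE \<xi> in lborel. norm (of_real (\<xi> ^ l) * (fourier_L2 f \<xi> $ i)) \<le> norm (bessel r f \<xi> $ i)"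
    proof (intro AE_I2)
      fix \<xi>
      show "norm (of_real (\<xi> ^ l) * (fourier_L2 f \<xi> $ i)) \<le> norm (bessel r f \<xi> $ i)"
        using mult_right_mono[OF w norm_ge_zero[of "fourier_L2 f \<xi> $ i"], of \<xi>]
        by (simp add: bessel_def norm_mult norm_power power_abs)
    qed
  qed
qed

text \<open>Turns the continuity in time of a solution, given in the Sobolev norm, into continuity in \<open>L\<^sup>2\<close>.
The weight is at least one since \<open>r \<ge> 0\<close>.\<close>

lemma L2_norm_diff_le_sobolev_norm:
  fixes f g :: "real \<Rightarrow> real ^ 'n"
  assumes f: "f \<in> sobolev r" and g: "g \<in> sobolev r" and r: "r \<ge> 0"
  shows "L2_norm (\<lambda>x. f x - g x) \<le> sobolev_norm r (\<lambda>x. f x - g x)"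
proof -
  let ?h = "\<lambda>x. f x - g x"
  note sf = sobolev_square_integrable[OF f] and sg = sobolev_square_integrable[OF g]
  have sh: "square_integrable ?h" by (intro square_integrable_diff sf sg)
  have hc: "is_FT (\<lambda>x. complex_of_real (?h x $ i)) (\<lambda>\<xi>. fourier_L2 ?h \<xi> $ i)" for i
    by (rule fourier_L2_component[OF sh])
  have ae: "AE \<xi> in lborel. fourier_L2 f \<xi> $ i - fourier_L2 g \<xi> $ i = fourier_L2 ?h \<xi> $ i" for i
    by (rule is_FT_unique[OF _ hc])
       (use is_FT_diff[OF fourier_L2_component[OF sf] fourier_L2_component[OF sg], of i i] in simp)
  have sfh: "square_integrable (\<lambda>\<xi>. fourier_L2 ?h \<xi> $ i)" for i using hc is_FT_square_integrable by blast
  have bf: "square_integrable (\<lambda>\<xi>. bessel r f \<xi> $ i)" "square_integrable (\<lambda>\<xi>. bessel r g \<xi> $ i)" for i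
    using f g by (auto simp: sobolev_def square_integrable_vec_iff)
  have bh: "square_integrable (\<lambda>\<xi>. bessel r ?h \<xi> $ i)" for i
  proof (rule square_integrable_cong_AE[OF square_integrable_diff[OF bf]])
    show "(\<lambda>\<xi>. bessel r ?h \<xi> $ i) \<in> borel_measurable borel"
      using square_integrable_measurable[OF sfh, of i] by (simp add: bessel_def)
    show "AE \<xi> in lborel. bessel r f \<xi> $ i - bessel r g \<xi> $ i = bessel r ?h \<xi> $ i"
      using ae[of i] by eventually_elim (simp add: bessel_def flip: scaleR_diff_right)
  qed
  hence bh': "square_integrable (bessel r ?h)" by (simp add: square_integrable_vec_iff)
  have "L2_norm (\<lambda>x. ?h x $ i) \<le> L2_norm (\<lambda>\<xi>. bessel r ?h \<xi> $ i)" for i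
  proof -
    have "L2_norm (\<lambda>x. ?h x $ i) * 1 \<le> L2_norm (\<lambda>x. ?h x $ i) * sqrt (2 * pi)"
      using pi_gt3 by (intro mult_left_mono) auto
    also have "\<dots> = L2_norm (\<lambda>\<xi>. fourier_L2 ?h \<xi> $ i)"
      using Plancherel[OF hc, of i] L2_norm_of_real[of "\<lambda>x. ?h x $ i"] by (simp add: mult.commute)
    also have "\<dots> \<le> L2_norm (\<lambda>\<xi>. bessel r ?h \<xi> $ i)"
    proof (rule L2_norm_mono(2)[OF square_integrable_measurable[OF sfh] bh], intro AE_I2)
      fix \<xi> :: real
      have "1 \<le> (1 + \<xi>\<^sup>2) powr (r / 2)" using r by (intro ge_one_powr_ge_zero) auto
      from mult_right_mono[OF this norm_ge_zero[of "fourier_L2 ?h \<xi> $ i"]]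
      show "norm (fourier_L2 ?h \<xi> $ i) \<le> norm (bessel r ?h \<xi> $ i)" by (simp add: bessel_def)
    qed
    finally show ?thesis by simp
  qed
  hence "(\<Sum>i\<in>UNIV. (L2_norm (\<lambda>x. ?h x $ i))\<^sup>2) \<le> (\<Sum>i\<in>UNIV. (L2_norm (\<lambda>\<xi>. bessel r ?h \<xi> $ i))\<^sup>2)"
    by (intro sum_mono power_mono) auto
  hence "(L2_norm ?h)\<^sup>2 \<le> (sobolev_norm r ?h)\<^sup>2"
    using L2_norm_vec[OF sh] L2_norm_vec[OF bh'] by (simp add: sobolev_norm_def)
  thus ?thesis by (rule power2_le_imp_le) (simp add: sobolev_norm_def)
qed

text \<open>The candidate is the inverse transform of \<open>(i \<xi>)\<^sup>l g\<close>, written as the reflected transform divided by \<open>2 \<pi>\<close>.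
It is real almost everywhere because its pairings with real test functions are real.\<close>

lemma exists_scalar_weak_deriv:
  fixes f :: "real \<Rightarrow> real"
  assumes F: "is_FT (\<lambda>x. complex_of_real (f x)) g" and w: "square_integrable (\<lambda>\<xi>. of_real (\<xi> ^ l) * g \<xi>)"
  obtains h :: "real \<Rightarrow> real" where "square_integrable h"
    "\<And>\<phi>. test_function \<phi> \<Longrightarrow> (\<integral>x. (deriv ^^ l) \<phi> x * f x \<partial>lborel) = (-1) ^ l * (\<integral>x. \<phi> x * h x \<partial>lborel)"
    "sqrt (2 * pi) * L2_norm h = L2_norm (\<lambda>\<xi>. of_real (\<xi> ^ l) * g \<xi>)"
proof -
  define m where "m = (\<lambda>\<xi>. (\<i> * of_real \<xi>) ^ l * g \<xi>)"
  have meq: "m = (\<lambda>\<xi>. \<i> ^ l * (of_real (\<xi> ^ l) * g \<xi>))" by (simp add: m_def power_mult_distrib mult_ac)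
  have sm: "square_integrable m" unfolding meq by (rule square_integrable_cmult[OF w])
  have nm: "L2_norm m = L2_norm (\<lambda>\<xi>. of_real (\<xi> ^ l) * g \<xi>)"
    unfolding meq by (simp only: L2_norm_cmult) (simp add: norm_power)
  have sf: "square_integrable (\<lambda>x. complex_of_real (f x))" and sg: "square_integrable g"
    using F by (auto simp: is_FT_def)
  obtain k where k: "is_FT m k" using is_FT_exists[OF sm] by blast
  obtain K where K: "is_FT g K" using is_FT_exists[OF sg] by blast
  have sk: "square_integrable k" using k by (auto simp: is_FT_def)
  define H where "H = (\<lambda>x. of_real (1 / (2 * pi)) * k (- x))"
  have sH: "square_integrable H" unfolding H_def by (intro square_integrable_cmult square_integrable_reflect sk)
  have pair: "(\<integral>x. of_real (\<phi> x) * H x \<partial>lborel) = (-1) ^ l * (\<integral>x. of_real ((deriv ^^ l) \<phi> x * f x) \<partial>lborel)"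
    if \<phi>: "test_function \<phi>" for \<phi>
  proof -
    (* The test function is reflected because inversion returns f reflected. *)
    let ?r = "\<lambda>x. complex_of_real (\<phi> (- x))"
    let ?d = "\<lambda>x. complex_of_real ((deriv ^^ l) \<phi> (- x))"
    note t1 = test_function_square_integrable[OF test_function_reflect[OF \<phi>]]
    note t2 = test_function_square_integrable[OF test_function_reflect[OF test_function_iter_deriv[OF \<phi>, of l]]]
    have fr: "FT1 ?d \<xi> = (-1) ^ l * ((\<i> * of_real \<xi>) ^ l * FT1 ?r \<xi>)" for \<xi>
    proof -
      have "FT1 ?d \<xi> = FT1 (\<lambda>x. of_real ((deriv ^^ l) \<phi> x)) (- \<xi>)"
        by (rule FT1_reflect)
      also have "\<dots> = (\<i> * of_real (- \<xi>)) ^ l * FT1 (\<lambda>x. of_real (\<phi> x)) (- \<xi>)"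
        by (rule FT1_iter_deriv[OF \<phi>])
      also have "FT1 (\<lambda>x. of_real (\<phi> x)) (- \<xi>) = FT1 ?r \<xi>" by (rule FT1_reflect[symmetric])
      also have "(\<i> * of_real (- \<xi>)) ^ l = (-1) ^ l * (\<i> * of_real \<xi>) ^ l"
        by (simp flip: power_mult_distrib)
      finally show ?thesis by simp
    qed
    have "(\<integral>x. of_real (\<phi> x) * H x \<partial>lborel) = (\<integral>x. of_real (1 / (2 * pi)) * (?r x * k x) \<partial>lborel)"
      using lborel_integral_real_affine[of "-1" "\<lambda>x. of_real (\<phi> x) * H x" 0] by (simp add: H_def mult_ac)
    also have "\<dots> = of_real (1 / (2 * pi)) * (\<integral>x. ?r x * k x \<partial>lborel)" by (rule integral_mult_right_zero)
    also have "(\<integral>x. ?r x * k x \<partial>lborel) = (\<integral>\<xi>. FT1 ?r \<xi> * m \<xi> \<partial>lborel)"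
      by (rule is_FT_multiplication[OF is_FT_of_integrable[OF t1(2,1)] k, symmetric])
    also have "\<dots> = (\<integral>\<xi>. (-1) ^ l * (FT1 ?d \<xi> * g \<xi>) \<partial>lborel)"
    proof (intro Bochner_Integration.integral_cong refl)
      fix \<xi>
      have "(-1) ^ l * (-1) ^ l = (1::complex)" by (simp flip: power_mult_distrib)
      thus "FT1 ?r \<xi> * m \<xi> = (-1) ^ l * (FT1 ?d \<xi> * g \<xi>)"
        unfolding fr m_def by (metis (no_types, lifting) mult.assoc mult.commute mult_1)
    qed
    also have "\<dots> = (-1) ^ l * (\<integral>\<xi>. FT1 ?d \<xi> * g \<xi> \<partial>lborel)" by (rule integral_mult_right_zero)
    also have "(\<integral>\<xi>. FT1 ?d \<xi> * g \<xi> \<partial>lborel) = (\<integral>x. ?d x * K x \<partial>lborel)"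
      by (rule is_FT_multiplication[OF is_FT_of_integrable[OF t2(2,1)] K])
    also have "\<dots> = (\<integral>x. of_real (2 * pi) * (?d x * of_real (f (- x))) \<partial>lborel)"
    proof (rule integral_cong_AE)
      have [measurable]: "K \<in> borel_measurable borel" "f \<in> borel_measurable borel" "(\<lambda>x. (deriv ^^ l) \<phi> (- x)) \<in> borel_measurable borel"
        using K square_integrable_measurable sf square_integrable_of_real_iff[of f]
          test_function_measurable[OF test_function_reflect[OF test_function_iter_deriv[OF \<phi>]]]
        by (auto simp: is_FT_def)
      show "(\<lambda>x. ?d x * K x) \<in> borel_measurable lborel" by measurable
      show "(\<lambda>x. of_real (2 * pi) * (?d x * of_real (f (- x)))) \<in> borel_measurable lborel" by measurable
      show "AE x in lborel. ?d x * K x = of_real (2 * pi) * (?d x * of_real (f (- x)))"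
        using is_FT_inversion[OF F K] by eventually_elim simp
    qed
    also have "\<dots> = of_real (2 * pi) * (\<integral>x. ?d x * of_real (f (- x)) \<partial>lborel)" by (rule integral_mult_right_zero)
    also have "(\<integral>x. ?d x * of_real (f (- x)) \<partial>lborel) = (\<integral>x. of_real ((deriv ^^ l) \<phi> x * f x) \<partial>lborel)"
      using lborel_integral_real_affine[of "-1" "\<lambda>x. complex_of_real ((deriv ^^ l) \<phi> x * f x)" 0] by simp
    finally show ?thesis by simp
  qed
  have pr: "(-1) ^ l * complex_of_real X = complex_of_real ((-1) ^ l * X)" for X by simp
  define h where "h = (\<lambda>x. Re (H x))"
  have [measurable]: "H \<in> borel_measurable borel" using square_integrable_measurable[OF sH] .
  have Hi: "integrable lborel (\<lambda>x. of_real (\<phi> x) * H x)" if "test_function \<phi>" for \<phi>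
    by (intro integrable_mult_L2 test_function_square_integrable that sH)
  have im: "AE x in lborel. Im (H x) = 0"
  proof (rule fundamental_lemma)
    show "set_integrable lborel {a..b} (\<lambda>x. Im (H x))" for a b
      using integrable_Im[OF square_integrable_locally_integrable[OF sH, of a b, unfolded set_integrable_def]]
      by (simp add: set_integrable_def)
    fix \<phi> assume \<phi>: "test_function \<phi>"
    have "(\<integral>x. \<phi> x * Im (H x) \<partial>lborel) = Im (\<integral>x. of_real (\<phi> x) * H x \<partial>lborel)"
      using integral_Im[OF Hi[OF \<phi>]] by simp
    also have "\<dots> = 0" unfolding pair[OF \<phi>] integral_complex_of_real pr by (rule Im_complex_of_real)
    finally show "(\<integral>x. \<phi> x * Im (H x) \<partial>lborel) = 0" .
  qed
  have Hh: "AE x in lborel. H x = complex_of_real (h x)"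
    using im by eventually_elim (simp add: h_def complex_eq_iff)
  have hm: "h \<in> borel_measurable borel" unfolding h_def by measurable
  have "square_integrable (\<lambda>x. complex_of_real (h x))"
    by (rule square_integrable_cong_AE[OF sH _ Hh]) (use hm in simp)
  hence sh: "square_integrable h" by (simp add: square_integrable_of_real_iff)
  show ?thesis
  proof
    show "square_integrable h" by (rule sh)
    show "(\<integral>x. (deriv ^^ l) \<phi> x * f x \<partial>lborel) = (-1) ^ l * (\<integral>x. \<phi> x * h x \<partial>lborel)" if \<phi>: "test_function \<phi>" for \<phi>
    proof -
      have "(\<integral>x. \<phi> x * h x \<partial>lborel) = Re (\<integral>x. of_real (\<phi> x) * H x \<partial>lborel)"
        using integral_Re[OF Hi[OF \<phi>]] by (simp add: h_def)
      also have "\<dots> = (-1) ^ l * (\<integral>x. (deriv ^^ l) \<phi> x * f x \<partial>lborel)"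
        unfolding pair[OF \<phi>] integral_complex_of_real pr by (rule Re_complex_of_real)
      finally show ?thesis by (simp flip: mult.assoc power_mult_distrib)
    qed
    have "L2_norm h = L2_norm H"
      using L2_norm_cong_AE[OF _ _ Hh] hm L2_norm_of_real[of h] by simp
    also have "\<dots> = 1 / (2 * pi) * L2_norm k"
      unfolding H_def by (simp only: L2_norm_cmult L2_norm_reflect norm_of_real) simp
    also have "L2_norm k = sqrt (2 * pi) * L2_norm m" by (rule Plancherel[OF k])
    finally have "sqrt (2 * pi) * L2_norm h = (sqrt (2 * pi) * sqrt (2 * pi)) / (2 * pi) * L2_norm m"
      by (simp only: mult_ac times_divide_eq_left times_divide_eq_right mult_1_left mult_1_right)
    also have "(sqrt (2 * pi) * sqrt (2 * pi)) / (2 * pi) = 1" by simp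
    finally show "sqrt (2 * pi) * L2_norm h = L2_norm (\<lambda>\<xi>. of_real (\<xi> ^ l) * g \<xi>)" using nm by simp
  qed
qed

lemma locally_integrable_measurable:
  fixes g :: "real \<Rightarrow> 'b::euclidean_space"
  assumes g: "\<And>a b. set_integrable lborel {a..b} g"
  shows "g \<in> borel_measurable borel"
proof (rule borel_measurable_LIMSEQ_metric)
  show "(\<lambda>n. indicator {- real n..real n} x *\<^sub>R g x) \<longlonglongrightarrow> g x" for x
  proof (rule tendsto_eventually)
    have "eventually (\<lambda>n. real n \<ge> \<bar>x\<bar>) sequentially" by real_asymp
    thus "\<forall>\<^sub>F n in sequentially. indicator {- real n..real n} x *\<^sub>R g x = g x"
      by eventually_elim (auto simp: indicator_def abs_le_iff)
  qed
  show "(\<lambda>x. indicator {- real n..real n} x *\<^sub>R g x) \<in> borel_measurable borel" for n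
    using borel_measurable_integrable[OF g[of "- real n" "real n", unfolded set_integrable_def]] by simp
qed

lemma test_function_scaleR_integrable:
  fixes g :: "real \<Rightarrow> 'b::euclidean_space"
  assumes \<phi>: "test_function \<phi>" and g: "\<And>a b. set_integrable lborel {a..b} g"
  shows "integrable lborel (\<lambda>x. \<phi> x *\<^sub>R g x)"
proof -
  obtain R where R: "R > 0" "\<And>x. \<bar>x\<bar> \<ge> R \<Longrightarrow> \<phi> x = 0" using test_function_support[OF \<phi>] by blast
  obtain B where B: "B > 0" "\<And>x. \<bar>\<phi> x\<bar> \<le> B" using test_function_bounded[OF \<phi>] by blast
  show ?thesis
  proof (rule Bochner_Integration.integrable_bound)
    show "integrable lborel (\<lambda>x. B *\<^sub>R (indicator {-R..R} x *\<^sub>R g x))"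
      by (intro integrable_scaleR_right g[unfolded set_integrable_def])
    show "(\<lambda>x. \<phi> x *\<^sub>R g x) \<in> borel_measurable lborel"
      using locally_integrable_measurable[OF g] test_function_measurable[OF \<phi>] by simp
    show "AE x in lborel. norm (\<phi> x *\<^sub>R g x) \<le> norm (B *\<^sub>R (indicator {-R..R} x *\<^sub>R g x))"
    proof (intro AE_I2)
      fix x
      show "norm (\<phi> x *\<^sub>R g x) \<le> norm (B *\<^sub>R (indicator {-R..R} x *\<^sub>R g x))"
        using R(2)[of x] B mult_right_mono[OF B(2)[of x] norm_ge_zero[of "g x"]]
        by (cases "\<bar>x\<bar> \<ge> R") (auto simp: indicator_def abs_le_iff)
    qed
  qed
qed

lemma integral_vec_nth:
  fixes f :: "'a \<Rightarrow> real ^ 'n"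
  assumes "integrable M f" shows "(\<integral>x. f x \<partial>M) $ i = (\<integral>x. f x $ i \<partial>M)"
  using integral_bounded_linear[OF bounded_linear_vec_nth assms, of i] by simp

text \<open>Removes the arbitrariness of the choice in \<open>weak_deriv\<close> from all norms.\<close>

lemma weak_deriv_unique:
  fixes f :: "real \<Rightarrow> real ^ 'n"
  assumes g: "is_weak_deriv l f g" and h: "is_weak_deriv l f h"
  shows "AE x in lborel. g x = h x"
proof -
  have gi: "set_integrable lborel {a..b} g" and hi: "set_integrable lborel {a..b} h" for a b
    using g h by (auto simp: is_weak_deriv_def)
  have "AE x in lborel. g x $ i - h x $ i = 0" for i
  proof (rule fundamental_lemma)
    show "set_integrable lborel {a..b} (\<lambda>x. g x $ i - h x $ i)" for a b
    proof -
      have "integrable lborel (\<lambda>x. (indicator {a..b} x *\<^sub>R g x - indicator {a..b} x *\<^sub>R h x) $ i)"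
        by (rule integrable_bounded_linear[OF bounded_linear_vec_nth
              Bochner_Integration.integrable_diff[OF gi[of a b, unfolded set_integrable_def] hi[of a b, unfolded set_integrable_def]]])
      thus ?thesis by (simp add: set_integrable_def right_diff_distrib)
    qed
    fix \<phi> assume \<phi>: "test_function \<phi>"
    note ig = test_function_scaleR_integrable[OF \<phi> gi] and ih = test_function_scaleR_integrable[OF \<phi> hi]
    have "(-1) ^ l *\<^sub>R (\<integral>x. \<phi> x *\<^sub>R g x \<partial>lborel) = (-1) ^ l *\<^sub>R (\<integral>x. \<phi> x *\<^sub>R h x \<partial>lborel)"
    proof (rule trans[OF sym])
      show "(\<integral>x. (deriv ^^ l) \<phi> x *\<^sub>R f x \<partial>lborel) = (-1) ^ l *\<^sub>R (\<integral>x. \<phi> x *\<^sub>R g x \<partial>lborel)"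
        using g \<phi> by (simp add: is_weak_deriv_def)
      show "(\<integral>x. (deriv ^^ l) \<phi> x *\<^sub>R f x \<partial>lborel) = (-1) ^ l *\<^sub>R (\<integral>x. \<phi> x *\<^sub>R h x \<partial>lborel)"
        using h \<phi> by (simp add: is_weak_deriv_def)
    qed
    hence "(\<integral>x. \<phi> x *\<^sub>R g x \<partial>lborel) = (\<integral>x. \<phi> x *\<^sub>R h x \<partial>lborel)" by simp
    hence "(\<integral>x. \<phi> x *\<^sub>R (g x - h x) \<partial>lborel) = 0"
      using ig ih by (simp add: scaleR_diff_right)
    moreover have "integrable lborel (\<lambda>x. \<phi> x *\<^sub>R (g x - h x))"
      using Bochner_Integration.integrable_diff[OF ig ih] by (simp add: scaleR_diff_right)
    ultimately show "(\<integral>x. \<phi> x * (g x $ i - h x $ i) \<partial>lborel) = 0"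
      using integral_vec_nth[of lborel "\<lambda>x. \<phi> x *\<^sub>R (g x - h x)" i] by simp
  qed
  hence "AE x in lborel. \<forall>i\<in>UNIV. g x $ i - h x $ i = 0"
    by (subst AE_ball_countable) auto
  thus ?thesis by eventually_elim (simp add: vec_eq_iff)
qed

text \<open>This is how weak derivatives enter the decay estimate: it turns both of its \<open>L\<^sup>2\<close> norms into
weighted integrals of the transform.\<close>

proposition L2_norm_weak_deriv:
  fixes f :: "real \<Rightarrow> real ^ 'n"
  assumes f: "f \<in> sobolev r" and l: "real l \<le> r"
  shows "2 * pi * (L2_norm (weak_deriv l f))\<^sup>2
    = (\<Sum>i\<in>UNIV. (L2_norm (\<lambda>\<xi>. of_real (\<xi> ^ l) * (fourier_L2 f \<xi> $ i)))\<^sup>2)"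
proof -
  note sf = sobolev_square_integrable[OF f]
  let ?N = "\<lambda>i. L2_norm (\<lambda>\<xi>. of_real (\<xi> ^ l) * (fourier_L2 f \<xi> $ i))"
  define P where "P = (\<lambda>i (h::real\<Rightarrow>real). square_integrable h \<and>
    (\<forall>\<phi>. test_function \<phi> \<longrightarrow> (\<integral>x. (deriv ^^ l) \<phi> x * f x $ i \<partial>lborel) = (-1) ^ l * (\<integral>x. \<phi> x * h x \<partial>lborel)) \<and>
    sqrt (2 * pi) * L2_norm h = ?N i)"
  have "\<exists>h. P i h" for i
  proof (rule exists_scalar_weak_deriv[OF fourier_L2_component[OF sf, of i] sobolev_power_weight[OF f l]])
    fix h :: "real \<Rightarrow> real"
    assume "square_integrable h"
      "\<And>\<phi>. test_function \<phi> \<Longrightarrow> (\<integral>x. (deriv ^^ l) \<phi> x * f x $ i \<partial>lborel) = (-1) ^ l * (\<integral>x. \<phi> x * h x \<partial>lborel)"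
      "sqrt (2 * pi) * L2_norm h = ?N i"
    thus ?thesis unfolding P_def by blast
  qed
  then obtain h where "\<And>i. P i (h i)" by metis
  hence h: "\<And>i. square_integrable (h i)"
    "\<And>i \<phi>. test_function \<phi> \<Longrightarrow> (\<integral>x. (deriv ^^ l) \<phi> x * f x $ i \<partial>lborel) = (-1) ^ l * (\<integral>x. \<phi> x * h i x \<partial>lborel)"
    "\<And>i. sqrt (2 * pi) * L2_norm (h i) = ?N i" unfolding P_def by blast+
  define H where "H = (\<lambda>x. \<chi> i. h i x)"
  have sH: "square_integrable H" using h(1) by (simp add: square_integrable_vec_iff H_def)
  note si = square_integrable_locally_integrable
  have wd: "is_weak_deriv l f H"
    unfolding is_weak_deriv_def
  proof (intro conjI allI impI)
    show "set_integrable lborel {a..b} H" for a b by (rule si[OF sH])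
    fix \<phi> assume \<phi>: "test_function \<phi>"
    have i1: "integrable lborel (\<lambda>x. (deriv ^^ l) \<phi> x *\<^sub>R f x)"
      by (rule test_function_scaleR_integrable[OF test_function_iter_deriv[OF \<phi>] si[OF sf]])
    have i2: "integrable lborel (\<lambda>x. \<phi> x *\<^sub>R H x)"
      by (rule test_function_scaleR_integrable[OF \<phi> si[OF sH]])
    show "(\<integral>x. (deriv ^^ l) \<phi> x *\<^sub>R f x \<partial>lborel) = (-1) ^ l *\<^sub>R (\<integral>x. \<phi> x *\<^sub>R H x \<partial>lborel)"
      using h(2)[OF \<phi>] by (simp add: vec_eq_iff integral_vec_nth[OF i1] integral_vec_nth[OF i2]) (simp add: H_def)
  qed
  hence wd': "is_weak_deriv l f (weak_deriv l f)" unfolding weak_deriv_def by (rule someI[of "is_weak_deriv l f"])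
  have "L2_norm (weak_deriv l f) = L2_norm H"
  proof (rule L2_norm_cong_AE[OF _ _ weak_deriv_unique[OF wd' wd]])
    show "weak_deriv l f \<in> borel_measurable borel"
      using wd' by (intro locally_integrable_measurable) (auto simp: is_weak_deriv_def)
    show "H \<in> borel_measurable borel" by (rule square_integrable_measurable[OF sH])
  qed
  hence "2 * pi * (L2_norm (weak_deriv l f))\<^sup>2 = (\<Sum>i\<in>UNIV. 2 * pi * (L2_norm (h i))\<^sup>2)"
    using L2_norm_vec[OF sH] by (simp add: H_def sum_distrib_left)
  also have "\<dots> = (\<Sum>i\<in>UNIV. (?N i)\<^sup>2)"
    unfolding h(3)[symmetric] by (simp add: power_mult_distrib)
  finally show ?thesis .
qed

section \<open>The linearized system in primitive variables\<close>

lemma vector_4 [simp]: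
  "(vector [x, y, z, w] :: 'a::zero ^ 4) $ 1 = x" "(vector [x, y, z, w] :: 'a ^ 4) $ 2 = y"
  "(vector [x, y, z, w] :: 'a ^ 4) $ 3 = z" "(vector [x, y, z, w] :: 'a ^ 4) $ 4 = w"
  unfolding vector_def by simp_all

lemma has_derivative_vec_nth: "((\<lambda>V::real^'n. V $ i) has_derivative (\<lambda>X. X $ i)) F"
  by (rule bounded_linear_imp_has_derivative[OF bounded_linear_vec_nth])

lemma has_derivative_vec_iff:
  fixes f :: "'a::real_normed_vector \<Rightarrow> real ^ 'n"
  shows "(f has_derivative D) (at a within S) \<longleftrightarrow> (\<forall>i. ((\<lambda>x. f x $ i) has_derivative (\<lambda>x. D x $ i)) (at a within S))"
  by (subst has_derivative_componentwise_within) (auto simp: Basis_vec_def inner_axis)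

lemma matrix_inv_eqI:
  fixes A :: "real ^ 'n ^ 'n"
  assumes "A ** B = mat 1" "B ** A = mat 1"
  shows "matrix_inv A = B"
proof -
  have "A ** matrix_inv A = mat 1 \<and> matrix_inv A ** A = mat 1"
    unfolding matrix_inv_def by (rule someI[of _ B]) (simp add: assms)
  hence r: "A ** matrix_inv A = mat 1" ..
  have "matrix_inv A = (B ** A) ** matrix_inv A" by (simp only: assms(2) matrix_mul_lid)
  also have "\<dots> = B ** (A ** matrix_inv A)" by (simp only: matrix_mul_assoc)
  finally show ?thesis by (simp only: r matrix_mul_rid)
qed

text \<open>Links two notions of derivative: smoothness is a property of the function of pairs, while \<open>d_rho\<close> and \<open>d_theta\<close>
differentiate in one variable with the other one fixed.\<close>

lemma smooth_pair_has_derivative: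
  assumes "smooth_on ({0<..} \<times> {0<..}) (\<lambda>(\<rho>, \<theta>). f \<rho> \<theta>)" "\<rho> > 0" "\<theta> > 0"
  shows "((\<lambda>(\<rho>, \<theta>). f \<rho> \<theta>) has_derivative (\<lambda>(h, k). d_rho f \<rho> \<theta> * h + d_theta f \<rho> \<theta> * k)) (at (\<rho>, \<theta>))"
proof -
  let ?g = "\<lambda>(\<rho>, \<theta>). f \<rho> \<theta>"
  have "?g differentiable_on ({0<..} \<times> {0<..})"
    using assms(1) unfolding smooth_on_def by (metis Ck_on.simps(2))
  moreover have "open ({0::real<..} \<times> {0::real<..})" by (intro open_Times) auto
  ultimately have "?g differentiable at (\<rho>, \<theta>)"
    using assms by (simp add: differentiable_on_eq_differentiable_at)
  then obtain D where D: "(?g has_derivative D) (at (\<rho>, \<theta>))" unfolding differentiable_def by blast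
  interpret D: bounded_linear D using D by (rule has_derivative_bounded_linear)
  have "((\<lambda>r. ?g (r, \<theta>)) has_derivative (\<lambda>h. D (h, 0))) (at \<rho>)"
    by (rule has_derivative_compose[where g="?g" and f="\<lambda>r. (r, \<theta>)", OF _ D])
       (auto intro!: derivative_eq_intros)
  moreover have "(\<lambda>h. D (h, 0)) = (*) (D (1, 0))"
  proof
    show "D (h, 0) = D (1, 0) * h" for h using D.scaleR[of h "(1, 0)"] by simp
  qed
  ultimately have "((\<lambda>r. f r \<theta>) has_real_derivative D (1, 0)) (at \<rho>)"
    unfolding has_field_derivative_def by (simp only: case_prod_conv)
  hence 1: "d_rho f \<rho> \<theta> = D (1, 0)" unfolding d_rho_def by (rule DERIV_imp_deriv)
  have "((\<lambda>r. ?g (\<rho>, r)) has_derivative (\<lambda>h. D (0, h))) (at \<theta>)"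
    by (rule has_derivative_compose[where g="?g" and f="\<lambda>r. (\<rho>, r)", OF _ D])
       (auto intro!: derivative_eq_intros)
  moreover have "(\<lambda>h. D (0, h)) = (*) (D (0, 1))"
  proof
    show "D (0, h) = D (0, 1) * h" for h using D.scaleR[of h "(0, 1)"] by simp
  qed
  ultimately have "((\<lambda>r. f \<rho> r) has_real_derivative D (0, 1)) (at \<theta>)"
    unfolding has_field_derivative_def by (simp only: case_prod_conv)
  hence 2: "d_theta f \<rho> \<theta> = D (0, 1)" unfolding d_theta_def by (rule DERIV_imp_deriv)
  have "D = (\<lambda>(h, k). d_rho f \<rho> \<theta> * h + d_theta f \<rho> \<theta> * k)"
  proof
    fix x :: "real \<times> real"
    obtain h k where x: "x = (h, k)" by force
    have "D x = D ((h, 0) + (0, k))" by (simp add: x)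
    also have "\<dots> = h * D (1, 0) + k * D (0, 1)"
      using D.scaleR[of h "(1, 0)"] D.scaleR[of k "(0, 1)"] by (simp only: D.add) simp
    finally show "D x = (\<lambda>(h, k). d_rho f \<rho> \<theta> * h + d_theta f \<rho> \<theta> * k) x" by (simp add: x 1 2)
  qed
  thus ?thesis using D by simp
qed

lemma has_derivative_state_function:
  assumes "smooth_on ({0<..} \<times> {0<..}) (\<lambda>(\<rho>, \<theta>). f \<rho> \<theta>)" "V \<in> V_domain"
  shows "((\<lambda>V. f (V $ 1) (V $ 3)) has_derivative
    (\<lambda>X. d_rho f (V $ 1) (V $ 3) * X $ 1 + d_theta f (V $ 1) (V $ 3) * X $ 3)) (at V)"
proof -
  have "((\<lambda>V::real^4. (V $ 1, V $ 3)) has_derivative (\<lambda>X. (X $ 1, X $ 3))) (at V)"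
    by (intro has_derivative_Pair has_derivative_vec_nth)
  from has_derivative_compose[OF this smooth_pair_has_derivative[OF assms(1)]] assms(2)
  show ?thesis by (simp add: V_domain_def)
qed

lemma d_theta_has_real_derivative:
  assumes "smooth_on ({0<..} \<times> {0<..}) (\<lambda>(\<rho>, \<theta>). f \<rho> \<theta>)" "\<rho> > 0" "\<theta> > 0"
  shows "((\<lambda>y. f \<rho> y) has_real_derivative d_theta f \<rho> \<theta>) (at \<theta>)"
proof -
  have "((\<lambda>y. (\<lambda>(\<rho>, \<theta>). f \<rho> \<theta>) (\<rho>, y)) has_derivative
      (\<lambda>h. (\<lambda>(h, k). d_rho f \<rho> \<theta> * h + d_theta f \<rho> \<theta> * k) (0, h))) (at \<theta>)"
    by (rule has_derivative_compose[where f="\<lambda>y. (\<rho>, y)", OF _ smooth_pair_has_derivative[OF assms]])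
       (auto intro!: derivative_eq_intros)
  thus ?thesis by (simp add: has_field_derivative_def)
qed

locale fluid_state =
  fixes p e s :: "real \<Rightarrow> real \<Rightarrow> real" and V :: "real ^ 4"
  assumes thermo: "thermodynamics p e s" and V: "V \<in> V_domain"
begin

lemma smooth: "smooth_on ({0<..} \<times> {0<..}) (\<lambda>(\<rho>, \<theta>). p \<rho> \<theta>)"
  "smooth_on ({0<..} \<times> {0<..}) (\<lambda>(\<rho>, \<theta>). e \<rho> \<theta>)" "smooth_on ({0<..} \<times> {0<..}) (\<lambda>(\<rho>, \<theta>). s \<rho> \<theta>)"
  using thermo by (auto simp: thermodynamics_def)

abbreviation "\<rho> \<equiv> V $ 1"
abbreviation "u \<equiv> V $ 2"
abbreviation "\<theta> \<equiv> V $ 3"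
abbreviation "\<eta> \<equiv> V $ 4"
abbreviation "p\<^sub>\<rho> \<equiv> d_rho p \<rho> \<theta>"
abbreviation "p\<^sub>\<theta> \<equiv> d_theta p \<rho> \<theta>"
abbreviation "e\<^sub>\<theta> \<equiv> d_theta e \<rho> \<theta>"
definition "E\<^sub>\<rho> = e \<rho> \<theta> + u\<^sup>2 / 2 + \<rho> * d_rho e \<rho> \<theta>"

lemma pos: "\<rho> > 0" "\<theta> > 0" "\<eta> > 0" "p\<^sub>\<rho> > 0" "p\<^sub>\<theta> > 0" "e\<^sub>\<theta> > 0"
  using thermo V by (auto simp: thermodynamics_def V_domain_def)

lemma gibbs: "d_rho e \<rho> \<theta> = (p \<rho> \<theta> - \<theta> * p\<^sub>\<theta>) / \<rho>\<^sup>2" "d_rho s \<rho> \<theta> = - p\<^sub>\<theta> / \<rho>\<^sup>2" "d_theta s \<rho> \<theta> = e\<^sub>\<theta> / \<theta>"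
  using thermo pos by (auto simp: thermodynamics_def)

definition dW :: "real ^ 4 ^ 4" where
  "dW = vector [vector [1, 0, 0, 0], vector [u, \<rho>, 0, 0], vector [E\<^sub>\<rho>, \<rho> * u, \<rho> * e\<^sub>\<theta>, 0], vector [0, 0, 0, 1]]"

definition dV :: "real ^ 4 ^ 4" where
  "dV = vector [vector [1, 0, 0, 0], vector [- u / \<rho>, 1 / \<rho>, 0, 0],
     vector [(u\<^sup>2 - E\<^sub>\<rho>) / (\<rho> * e\<^sub>\<theta>), - u / (\<rho> * e\<^sub>\<theta>), 1 / (\<rho> * e\<^sub>\<theta>), 0], vector [0, 0, 0, 1]]"

lemma dV_dW: "dV ** dW = mat 1" "dW ** dV = mat 1"
  using pos by (auto simp: dV_def dW_def vec_eq_iff forall_4 matrix_matrix_mult_def sum_4 mat_def field_simps power2_eq_square)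

lemma W_of_V_has_derivative: "(W_of_V e has_derivative (\<lambda>X. dW *v X)) (at V)"
  unfolding has_derivative_vec_iff forall_4 W_of_V_def
  by (auto simp: dW_def matrix_vector_mult_def sum_4 E\<^sub>\<rho>_def power2_eq_square algebra_simps
      intro!: derivative_eq_intros has_derivative_vec_nth has_derivative_state_function[OF smooth(2) V])

end

lemma W_of_V_continuous:
  assumes "thermodynamics p e s" shows "continuous_on V_domain (W_of_V e)"
proof (intro continuous_at_imp_continuous_on ballI)
  fix V :: "real ^ 4" assume "V \<in> V_domain"
  then interpret fluid_state p e s V by unfold_locales (use assms in auto)
  show "isCont (W_of_V e) V" using has_derivative_continuous[OF W_of_V_has_derivative] .
qed

lemma open_V_domain: "open V_domain"
  unfolding V_domain_def by (intro open_Collect_conj open_Collect_less continuous_intros)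

text \<open>Only the temperature has to be recovered nontrivially, from the internal energy, which increases in \<open>\<theta>\<close>
because \<open>e\<^sub>\<theta> > 0\<close>.\<close>

lemma W_of_V_inj:
  assumes "thermodynamics p e s" shows "inj_on (W_of_V e) V_domain"
proof (rule inj_onI)
  fix V V' assume V: "V \<in> V_domain" and V': "V' \<in> V_domain" and eq: "W_of_V e V = W_of_V e V'"
  have pos: "V $ 1 > 0" "V $ 3 > 0" "V' $ 3 > 0" using V V' by (auto simp: V_domain_def)
  have c: "W_of_V e V $ i = W_of_V e V' $ i" for i using eq by simp
  have 1: "V $ 1 = V' $ 1" and 4: "V $ 4 = V' $ 4" using c[of 1] c[of 4] by (auto simp: W_of_V_def)
  have 2: "V $ 2 = V' $ 2" using c[of 2] 1 pos by (auto simp: W_of_V_def)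
  have e: "e (V $ 1) (V $ 3) = e (V $ 1) (V' $ 3)" using c[of 3] 1 2 pos by (auto simp: W_of_V_def)
  have mono: "e (V $ 1) x < e (V $ 1) y" if "0 < x" "x < y" for x y
  proof (rule DERIV_pos_imp_increasing[OF that(2)])
    fix z assume "x \<le> z" "z \<le> y"
    thus "\<exists>d. ((\<lambda>y. e (V $ 1) y) has_real_derivative d) (at z) \<and> 0 < d"
      using assms that pos d_theta_has_real_derivative[of e "V $ 1" z]
      unfolding thermodynamics_def by (intro exI[of _ "d_theta e (V $ 1) z"]) auto
  qed
  have 3: "V $ 3 = V' $ 3"
    using mono[of "V $ 3" "V' $ 3"] mono[of "V' $ 3" "V $ 3"] e pos by (cases "V $ 3" "V' $ 3" rule: linorder_cases) auto
  show "V = V'" using 1 2 3 4 by (simp add: vec_eq_iff forall_4)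
qed

text \<open>Needed to differentiate on the image; invariance of domain replaces an inverse function theorem.\<close>

lemma open_W_image: "thermodynamics p e s \<Longrightarrow> open (W_of_V e ` V_domain)"
  by (intro invariance_of_domain W_of_V_continuous open_V_domain W_of_V_inj)

lemma V_of_W_of_V: "thermodynamics p e s \<Longrightarrow> V \<in> V_domain \<Longrightarrow> V_of_W e (W_of_V e V) = V"
  unfolding V_of_W_def by (intro inv_into_f_f W_of_V_inj)

text \<open>The entropy variables, that is, the gradient of the entropy with respect to \<open>W\<close>, as functions of \<open>V\<close>.\<close>

definition entropy_grad ::
  "(real \<Rightarrow> real \<Rightarrow> real) \<Rightarrow> (real \<Rightarrow> real \<Rightarrow> real) \<Rightarrow> (real \<Rightarrow> real \<Rightarrow> real) \<Rightarrow> real ^ 4 \<Rightarrow> real ^ 4" where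
  "entropy_grad p e s V = vector [- s (V $ 1) (V $ 3) + (e (V $ 1) (V $ 3) - (V $ 2)\<^sup>2 / 2 + p (V $ 1) (V $ 3) / V $ 1) / V $ 3,
     V $ 2 / V $ 3, - 1 / V $ 3, - ((V $ 4) powr (- 1 / 4))]"

context fluid_state
begin

lemma V_of_W_has_derivative: "(V_of_W e has_derivative (\<lambda>Y. dV *v Y)) (at (W_of_V e V))"
proof (rule has_derivative_inverse_strong[OF open_V_domain V W_of_V_continuous[OF thermo] _ W_of_V_has_derivative])
  show "(*v) dW \<circ> (*v) dV = id"
    by (auto simp: fun_eq_iff matrix_vector_mul_assoc dV_dW)
qed (rule V_of_W_of_V[OF thermo])

text \<open>All functions of \<open>W\<close> in the system are defined through \<open>V\<close>; this computes their derivatives without ever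
writing down the inverse map.\<close>

lemma has_derivative_through_V:
  fixes F :: "real ^ 4 \<Rightarrow> 'b::real_normed_vector"
  assumes G: "(G has_derivative D) (at V)" and FG: "\<And>V. V \<in> V_domain \<Longrightarrow> F (W_of_V e V) = G V"
  shows "(F has_derivative (\<lambda>Y. D (dV *v Y))) (at (W_of_V e V))"
proof (rule has_derivative_transform_within_open[OF _ open_W_image[OF thermo]])
  have "(G has_derivative D) (at (V_of_W e (W_of_V e V)))" using G V_of_W_of_V[OF thermo V] by simp
  from has_derivative_compose[OF V_of_W_has_derivative this]
  show "((\<lambda>W. G (V_of_W e W)) has_derivative (\<lambda>Y. D (dV *v Y))) (at (W_of_V e V))" .
qed (use V FG V_of_W_of_V[OF thermo] in auto)

lemma jacobian_through_V:
  assumes G: "(G has_derivative (\<lambda>X. A *v X)) (at V)" and FG: "\<And>V. V \<in> V_domain \<Longrightarrow> F (W_of_V e V) = G V"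
  shows "jacobian F (at (W_of_V e V)) = A ** dV"
proof -
  have "(F has_derivative (\<lambda>Y. (A ** dV) *v Y)) (at (W_of_V e V))"
    using has_derivative_through_V[OF G FG] by (simp add: matrix_vector_mul_assoc)
  from frechet_derivative_at[OF this, symmetric] show ?thesis
    by (simp only: jacobian_def matrix_of_matrix_vector_mul)
qed

lemma temp_W_of_V: "V' \<in> V_domain \<Longrightarrow> temp e (W_of_V e V') = V' $ 3"
  by (simp add: temp_def V_of_W_of_V[OF thermo])

lemma vel_W_of_V: "V' \<in> V_domain \<Longrightarrow> vel e (W_of_V e V') = V' $ 2"
  by (simp add: vel_def V_of_W_of_V[OF thermo])

lemma has_derivative_powr_nth:
  "((\<lambda>V. V $ 4 powr a) has_derivative (\<lambda>X. a * \<eta> powr (a - 1) * X $ 4)) (at V)"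
  using has_derivative_compose[OF has_derivative_vec_nth has_field_derivative_imp_has_derivative[OF has_real_derivative_powr]] pos(3)
  by blast

lemmas state_derivs = has_derivative_vec_nth has_derivative_powr_nth
  has_derivative_state_function[OF smooth(1) V] has_derivative_state_function[OF smooth(2) V]
  has_derivative_state_function[OF smooth(3) V]

text \<open>The Gibbs relation cancels the pressure terms and leaves the gradient in closed form.\<close>

lemma math_entropy_has_derivative:
  "(math_entropy e s has_derivative (\<lambda>Y. entropy_grad p e s V \<bullet> Y)) (at (W_of_V e V))"
proof -
  let ?G = "\<lambda>V::real^4. - (V $ 1) * s (V $ 1) (V $ 3) - 4 / 3 * (V $ 4) powr (3 / 4)"
  let ?D = "\<lambda>X::real^4. (- s \<rho> \<theta> - \<rho> * d_rho s \<rho> \<theta>) * X $ 1 - \<rho> * d_theta s \<rho> \<theta> * X $ 3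
      - \<eta> powr (- 1 / 4) * X $ 4"
  have "(?G has_derivative ?D) (at V)"
    by (rule has_derivative_eq_rhs, (rule derivative_intros state_derivs)+) (auto simp: algebra_simps)
  from has_derivative_through_V[OF this, of "math_entropy e s"]
  have "(math_entropy e s has_derivative (\<lambda>Y. ?D (dV *v Y))) (at (W_of_V e V))"
    by (simp add: math_entropy_def temp_W_of_V) (simp add: W_of_V_def)
  moreover have "?D X = entropy_grad p e s V \<bullet> (dW *v X)" for X
    using pos
    by (simp add: entropy_grad_def inner_vec_def sum_4 dW_def matrix_vector_mult_def E\<^sub>\<rho>_def gibbs field_simps power2_eq_square)
  hence "?D (dV *v Y) = entropy_grad p e s V \<bullet> Y" for Y
    by (simp only: matrix_vector_mul_assoc dV_dW matrix_vector_mul_lid)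
  ultimately show ?thesis by simp
qed

definition d_grad :: "real ^ 4 ^ 4" where
  "d_grad = vector [vector [p\<^sub>\<rho> / (\<rho> * \<theta>), - u / \<theta>, - (E\<^sub>\<rho> - u\<^sup>2) / \<theta>\<^sup>2, 0],
    vector [0, 1 / \<theta>, - u / \<theta>\<^sup>2, 0], vector [0, 0, 1 / \<theta>\<^sup>2, 0], vector [0, 0, 0, \<eta> powr (- 5 / 4) / 4]]"

lemma entropy_grad_has_derivative: "(entropy_grad p e s has_derivative (\<lambda>X. d_grad *v X)) (at V)"
  unfolding has_derivative_vec_iff forall_4 entropy_grad_def
proof (simp only: vector_4, intro conjI)
  show "((\<lambda>V. - s (V $ 1) (V $ 3) + (e (V $ 1) (V $ 3) - (V $ 2)\<^sup>2 / 2 + p (V $ 1) (V $ 3) / V $ 1) / V $ 3)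
      has_derivative (\<lambda>X. (d_grad *v X) $ 1)) (at V)"
  proof -
    have 1: "((\<lambda>V::real^4. (V $ 2)\<^sup>2 / 2) has_derivative (\<lambda>X. u * X $ 2)) (at V)"
      by (rule has_derivative_eq_rhs, (rule derivative_intros state_derivs)+) (auto simp: fun_eq_iff)
    have 2: "((\<lambda>V. p (V $ 1) (V $ 3) / V $ 1) has_derivative
        (\<lambda>X. ((p\<^sub>\<rho> * X $ 1 + p\<^sub>\<theta> * X $ 3) * \<rho> - p \<rho> \<theta> * X $ 1) / (\<rho> * \<rho>))) (at V)"
      by (rule has_derivative_divide'[OF state_derivs(3) state_derivs(1)]) (use pos in auto)
    have 3: "((\<lambda>V. (e (V $ 1) (V $ 3) - (V $ 2)\<^sup>2 / 2 + p (V $ 1) (V $ 3) / V $ 1) / V $ 3) has_derivative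
        (\<lambda>X. (((d_rho e \<rho> \<theta> * X $ 1 + e\<^sub>\<theta> * X $ 3) - u * X $ 2
          + ((p\<^sub>\<rho> * X $ 1 + p\<^sub>\<theta> * X $ 3) * \<rho> - p \<rho> \<theta> * X $ 1) / (\<rho> * \<rho>)) * \<theta>
          - (e \<rho> \<theta> - u\<^sup>2 / 2 + p \<rho> \<theta> / \<rho>) * X $ 3) / (\<theta> * \<theta>))) (at V)"
      by (rule has_derivative_divide'[OF has_derivative_add[OF has_derivative_diff[OF state_derivs(4) 1] 2] state_derivs(1)])
         (use pos in auto)
    have coeff: "- (d_rho s \<rho> \<theta> * X1 + d_theta s \<rho> \<theta> * X3) + (((d_rho e \<rho> \<theta> * X1 + e\<^sub>\<theta> * X3) - u * X2
          + ((p\<^sub>\<rho> * X1 + p\<^sub>\<theta> * X3) * \<rho> - p \<rho> \<theta> * X1) / (\<rho> * \<rho>)) * \<theta>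
          - (e \<rho> \<theta> - u\<^sup>2 / 2 + p \<rho> \<theta> / \<rho>) * X3) / (\<theta> * \<theta>)
        = p\<^sub>\<rho> / (\<rho> * \<theta>) * X1 + - u / \<theta> * X2 + - (E\<^sub>\<rho> - u\<^sup>2) / \<theta>\<^sup>2 * X3" for X1 X2 X3
    proof -
      have p: "p \<rho> \<theta> = \<rho>\<^sup>2 * d_rho e \<rho> \<theta> + \<theta> * p\<^sub>\<theta>" using pos by (simp add: gibbs)
      show ?thesis unfolding p gibbs(2,3) E\<^sub>\<rho>_def
        using pos by (simp add: divide_simps power2_eq_square) algebra
    qed
    show ?thesis
      by (rule has_derivative_eq_rhs[OF has_derivative_add[OF has_derivative_minus[OF state_derivs(5)] 3]])
         (rule ext, subst coeff, simp add: d_grad_def matrix_vector_mult_def sum_4)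
  qed
  show "((\<lambda>V. V $ 2 / V $ 3) has_derivative (\<lambda>X. (d_grad *v X) $ 2)) (at V)"
    by (rule has_derivative_eq_rhs, (rule derivative_intros state_derivs)+)
       (use pos in \<open>auto simp: d_grad_def matrix_vector_mult_def sum_4 field_simps power2_eq_square fun_eq_iff\<close>)
  show "((\<lambda>V. - 1 / V $ 3) has_derivative (\<lambda>X. (d_grad *v X) $ 3)) (at V)"
    by (rule has_derivative_eq_rhs, (rule derivative_intros state_derivs)+)
       (use pos in \<open>auto simp: d_grad_def matrix_vector_mult_def sum_4 field_simps power2_eq_square fun_eq_iff\<close>)
  show "((\<lambda>V. - (V $ 4 powr (- 1 / 4))) has_derivative (\<lambda>X. (d_grad *v X) $ 4)) (at V)"
    by (rule has_derivative_eq_rhs, (rule derivative_intros state_derivs)+)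
       (use pos in \<open>auto simp: d_grad_def matrix_vector_mult_def sum_4\<close>)
qed

text \<open>The transpose comes from the index order in \<open>hessian\<close>; the symmetry of the Hessian is derived below from its
factorization.\<close>

lemma hessian_math_entropy:
  "hessian (math_entropy e s) (W_of_V e V) = transpose (d_grad ** dV)"
proof -
  have "hessian (math_entropy e s) (W_of_V e V) $ i $ j = (d_grad ** dV) $ j $ i" for i j
  proof -
    have "frechet_derivative (math_entropy e s) (at (W_of_V e V')) (axis j 1) = entropy_grad p e s V' $ j"
      if "V' \<in> V_domain" for V'
    proof -
      interpret V': fluid_state p e s V' by unfold_locales (use thermo that in auto)
      show ?thesis
        using fun_cong[OF frechet_derivative_at[OF V'.math_entropy_has_derivative], of "axis j 1"]
        by (simp add: inner_axis)
    qed
    moreover have "((\<lambda>V. entropy_grad p e s V $ j) has_derivative (\<lambda>X. (d_grad *v X) $ j)) (at V)"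
      using entropy_grad_has_derivative by (simp add: has_derivative_vec_iff)
    ultimately have "((\<lambda>W. frechet_derivative (math_entropy e s) (at W) (axis j 1)) has_derivative
        (\<lambda>Y. (d_grad *v (dV *v Y)) $ j)) (at (W_of_V e V))"
      by (intro has_derivative_through_V)
    from fun_cong[OF frechet_derivative_at[OF this], of "axis i 1"]
    have "frechet_derivative (\<lambda>W. frechet_derivative (math_entropy e s) (at W) (axis j 1)) (at (W_of_V e V)) (axis i 1)
        = (d_grad ** dV) $ j $ i"
      unfolding matrix_vector_mult_basis column_def
      by (simp add: matrix_vector_mult_def matrix_matrix_mult_def)
    thus ?thesis by (simp add: hessian_def)
  qed
  thus ?thesis by (simp add: vec_eq_iff transpose_def)
qed

text \<open>The Hessian of the entropy as a quadratic form in the perturbations of \<open>V\<close>; in these variables it is diagonal.\<close>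

definition K :: "real ^ 4 ^ 4" where
  "K = vector [vector [p\<^sub>\<rho> / (\<rho> * \<theta>), 0, 0, 0], vector [0, \<rho> / \<theta>, 0, 0],
     vector [0, 0, \<rho> * e\<^sub>\<theta> / \<theta>\<^sup>2, 0], vector [0, 0, 0, \<eta> powr (- 5 / 4) / 4]]"

definition Kinv :: "real ^ 4 ^ 4" where
  "Kinv = vector [vector [\<rho> * \<theta> / p\<^sub>\<rho>, 0, 0, 0], vector [0, \<theta> / \<rho>, 0, 0],
     vector [0, 0, \<theta>\<^sup>2 / (\<rho> * e\<^sub>\<theta>), 0], vector [0, 0, 0, 4 / \<eta> powr (- 5 / 4)]]"

lemma K_Kinv: "K ** Kinv = mat 1" "Kinv ** K = mat 1"
  using pos by (auto simp: K_def Kinv_def vec_eq_iff forall_4 matrix_matrix_mult_def sum_4 mat_def)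

lemma transpose_dW_d_grad: "transpose dW ** d_grad = K"
  using pos by (auto simp: K_def dW_def d_grad_def vec_eq_iff forall_4 matrix_matrix_mult_def sum_4 transpose_def
      power2_eq_square field_simps)

lemma transpose_K: "transpose K = K"
  by (auto simp: K_def vec_eq_iff forall_4 transpose_def)

lemma transpose_dV_dW: "transpose dV ** transpose dW = mat 1" "transpose dW ** transpose dV = mat 1"
  by (simp_all add: dV_dW flip: matrix_transpose_mul)

lemma hessian_factorization:
  "hessian (math_entropy e s) (W_of_V e V) = transpose dV ** K ** dV"
proof -
  have "d_grad = transpose dV ** (transpose dW ** d_grad)"
    by (simp add: matrix_mul_assoc transpose_dV_dW)
  hence "d_grad ** dV = transpose dV ** K ** dV" by (simp add: transpose_dW_d_grad)
  thus ?thesis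
    by (simp add: hessian_math_entropy matrix_transpose_mul transpose_K matrix_mul_assoc)
qed

text \<open>The reason for the primitive variables: the inverse Hessian is a congruence of a diagonal matrix, so
\<open>Kinv ** transpose dW\<close> applied to \<open>Z\<close> is the perturbation of \<open>V\<close>.\<close>

lemma inv_hess_eq: "inv_hess e s (W_of_V e V) = dW ** Kinv ** transpose dW"
  unfolding inv_hess_def hessian_factorization
proof (rule matrix_inv_eqI)
  have "transpose dV ** K ** dV ** (dW ** Kinv ** transpose dW)
      = transpose dV ** (K ** ((dV ** dW) ** Kinv)) ** transpose dW"
    by (simp only: matrix_mul_assoc)
  thus "transpose dV ** K ** dV ** (dW ** Kinv ** transpose dW) = mat 1"
    by (simp add: dV_dW K_Kinv transpose_dV_dW)
  have "dW ** Kinv ** transpose dW ** (transpose dV ** K ** dV)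
      = dW ** (Kinv ** ((transpose dW ** transpose dV) ** K)) ** dV"
    by (simp only: matrix_mul_assoc)
  thus "dW ** Kinv ** transpose dW ** (transpose dV ** K ** dV) = mat 1"
    by (simp add: dV_dW K_Kinv transpose_dV_dW)
qed

text \<open>Moves any coefficient matrix from the conserved to the primitive variables and applies the symmetrizer \<open>K\<close>.\<close>

lemma conjugate_inv_hess:
  assumes "X ** dW = dW ** Y"
  shows "(K ** dV) ** (X ** inv_hess e s (W_of_V e V)) = (K ** Y) ** (Kinv ** transpose dW)"
proof -
  have "(K ** dV) ** (X ** inv_hess e s (W_of_V e V)) = K ** dV ** (X ** dW) ** Kinv ** transpose dW"
    by (simp only: inv_hess_eq matrix_mul_assoc)
  also have "\<dots> = K ** ((dV ** dW) ** Y) ** Kinv ** transpose dW" by (simp only: assms matrix_mul_assoc)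
  finally show ?thesis by (simp add: dV_dW matrix_mul_assoc)
qed

lemma normal_form_A0: "(K ** dV) ** A0_mat e s (W_of_V e V) = K ** (Kinv ** transpose dW)"
  using conjugate_inv_hess[of "mat 1" "mat 1"] by (simp add: A0_mat_def)

definition d_flux :: "real ^ 4 ^ 4" where
  "d_flux = vector [vector [u, \<rho>, 0, 0], vector [u\<^sup>2 + p\<^sub>\<rho>, 2 * \<rho> * u, p\<^sub>\<theta>, 1 / 3],
     vector [u * E\<^sub>\<rho> + u * p\<^sub>\<rho>, \<rho> * u\<^sup>2 + \<rho> * (e \<rho> \<theta> + u\<^sup>2 / 2) + p \<rho> \<theta> + \<eta> / 3, \<rho> * e\<^sub>\<theta> * u + u * p\<^sub>\<theta>, u / 3],
     vector [0, \<eta>, 0, u]]"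

lemma jacobian_flux: "jacobian (flux p e) (at (W_of_V e V)) = d_flux ** dV"
proof (rule jacobian_through_V)
  let ?G = "\<lambda>V::real^4. vector [V $ 1 * V $ 2, V $ 1 * (V $ 2)\<^sup>2 + p (V $ 1) (V $ 3) + V $ 4 / 3,
    V $ 1 * (e (V $ 1) (V $ 3) + (V $ 2)\<^sup>2 / 2) * V $ 2 + (p (V $ 1) (V $ 3) + V $ 4 / 3) * V $ 2, V $ 4 * V $ 2] :: real ^ 4"
  show "(?G has_derivative (\<lambda>X. d_flux *v X)) (at V)"
    unfolding has_derivative_vec_iff forall_4
    by (auto simp: d_flux_def matrix_vector_mult_def sum_4 E\<^sub>\<rho>_def power2_eq_square fun_eq_iff field_simps
        intro!: derivative_eq_intros state_derivs(1,3,4))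
  show "flux p e (W_of_V e V') = ?G V'" if "V' \<in> V_domain" for V'
    using that by (simp add: flux_def Let_def vel_W_of_V temp_W_of_V) (simp add: W_of_V_def)
qed

text \<open>The convection matrix of the equations in nonconservative form for \<open>(\<rho>, u, \<theta>, \<eta>)\<close>.  The radiation pressure work
that \<open>nonconservative\<close> moves between the two energy equations leaves \<open>4/3 \<eta>\<close> in the last row and none in the third.\<close>

definition A_prim :: "real ^ 4 ^ 4" where
  "A_prim = vector [vector [u, \<rho>, 0, 0], vector [p\<^sub>\<rho> / \<rho>, u, p\<^sub>\<theta> / \<rho>, 1 / (3 * \<rho>)],
     vector [0, \<theta> * p\<^sub>\<theta> / (\<rho> * e\<^sub>\<theta>), u, 0], vector [0, 4 / 3 * \<eta>, 0, u]]"

text \<open>The pressure is eliminated with the Gibbs relation \<open>p = \<rho>\<^sup>2 e\<^sub>\<rho> + \<theta> p\<^sub>\<theta>\<close>.\<close>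

lemma flux_conjugate:
  "(jacobian (flux p e) (at (W_of_V e V)) - nonconservative e (W_of_V e V)) ** dW = dW ** A_prim"
proof -
  have pe: "p \<rho> \<theta> = \<rho>\<^sup>2 * d_rho e \<rho> \<theta> + \<theta> * p\<^sub>\<theta>" using pos by (simp add: gibbs)
  have C: "nonconservative e (W_of_V e V) = vector [vector [0, 0, 0, 0], vector [0, 0, 0, 0],
      vector [- (u * \<eta> / (3 * \<rho>)), \<eta> / (3 * \<rho>), 0, 0], vector [u * \<eta> / (3 * \<rho>), - (\<eta> / (3 * \<rho>)), 0, 0]]"
    by (simp add: nonconservative_def Let_def vel_W_of_V[OF V]) (simp add: W_of_V_def)
  have "(jacobian (flux p e) (at (W_of_V e V)) - nonconservative e (W_of_V e V)) ** dW
      = d_flux ** dV ** dW - nonconservative e (W_of_V e V) ** dW"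
    unfolding jacobian_flux by (simp add: matrix_matrix_mult_def vec_eq_iff left_diff_distrib sum_subtractf)
  also have "\<dots> = d_flux - nonconservative e (W_of_V e V) ** dW"
    by (simp add: dV_dW flip: matrix_mul_assoc)
  also have "\<dots> = dW ** A_prim"
    unfolding C vec_eq_iff forall_4 using pos
    by (auto simp: matrix_matrix_mult_def sum_4 d_flux_def dW_def A_prim_def E\<^sub>\<rho>_def pe field_simps power2_eq_square)
  finally show ?thesis .
qed

definition L_prim :: "real \<Rightarrow> real ^ 4 ^ 4" where
  "L_prim \<sigma>a = vector [vector [0, 0, 0, 0], vector [0, 0, 0, 0],
     vector [0, 0, 4 * \<sigma>a * \<theta> ^ 3 / (\<rho> * e\<^sub>\<theta>), - \<sigma>a / (\<rho> * e\<^sub>\<theta>)],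
     vector [0, 0, - 4 * \<sigma>a * \<theta> ^ 3, \<sigma>a]]"

lemma source_conjugate: "(- jacobian (source \<sigma>a e) (at (W_of_V e V))) ** dW = dW ** L_prim \<sigma>a"
proof -
  let ?G = "\<lambda>V::real^4. vector [0, 0, \<sigma>a * (V $ 4 - V $ 3 ^ 4), - \<sigma>a * (V $ 4 - V $ 3 ^ 4)] :: real ^ 4"
  define DQ :: "real ^ 4 ^ 4" where "DQ = vector [vector [0, 0, 0, 0], vector [0, 0, 0, 0],
     vector [0, 0, - 4 * \<sigma>a * \<theta> ^ 3, \<sigma>a], vector [0, 0, 4 * \<sigma>a * \<theta> ^ 3, - \<sigma>a]]"
  have J: "jacobian (source \<sigma>a e) (at (W_of_V e V)) = DQ ** dV"
  proof (rule jacobian_through_V)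
    show "(?G has_derivative (\<lambda>X. DQ *v X)) (at V)"
      unfolding has_derivative_vec_iff forall_4
      by (auto simp: DQ_def matrix_vector_mult_def sum_4 algebra_simps
          intro!: derivative_eq_intros state_derivs(1))
    show "source \<sigma>a e (W_of_V e V') = ?G V'" if "V' \<in> V_domain" for V'
      using that by (simp add: source_def Let_def temp_W_of_V) (simp add: W_of_V_def)
  qed
  have "(- jacobian (source \<sigma>a e) (at (W_of_V e V))) ** dW = - (DQ ** dV ** dW)"
    unfolding J by (simp add: matrix_matrix_mult_def vec_eq_iff sum_negf)
  also have "\<dots> = - DQ" by (simp add: dV_dW flip: matrix_mul_assoc)
  also have "\<dots> = dW ** L_prim \<sigma>a"
    unfolding vec_eq_iff forall_4 using pos
    by (auto simp: DQ_def dW_def L_prim_def matrix_matrix_mult_def sum_4 field_simps)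
  finally show ?thesis .
qed

lemma diffusion_conjugate: "diffusion \<sigma>s ** dW = dW ** diffusion \<sigma>s"
  by (auto simp: diffusion_def dW_def vec_eq_iff forall_4 matrix_matrix_mult_def sum_4)

end

text \<open>The four matrices of the symmetric normal form \<open>K X\<^sub>t + S X\<^sub>x + R X = D X\<^sub>x\<^sub>x\<close> in the order of the components
\<open>(\<rho>, u, \<theta>, \<eta>)\<close>.\<close>

abbreviation mass_mat :: "real \<Rightarrow> real \<Rightarrow> real \<Rightarrow> real \<Rightarrow> real ^ 4 ^ 4" where
  "mass_mat k1 k2 k3 k4 \<equiv> vector [vector [k1, 0, 0, 0], vector [0, k2, 0, 0], vector [0, 0, k3, 0], vector [0, 0, 0, k4]]"

abbreviation convection_mat ::
  "real \<Rightarrow> real \<Rightarrow> real \<Rightarrow> real \<Rightarrow> real \<Rightarrow> real \<Rightarrow> real \<Rightarrow> real \<Rightarrow> real ^ 4 ^ 4" where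
  "convection_mat v k1 k2 k3 k4 a b c \<equiv>
     vector [vector [v * k1, a, 0, 0], vector [a, v * k2, b, c], vector [0, b, v * k3, 0], vector [0, c, 0, v * k4]]"

abbreviation relaxation_mat :: "real \<Rightarrow> real \<Rightarrow> real ^ 4 ^ 4" where
  "relaxation_mat g \<mu> \<equiv>
     vector [vector [0, 0, 0, 0], vector [0, 0, 0, 0], vector [0, 0, g * \<mu>\<^sup>2, - (g * \<mu>)], vector [0, 0, - (g * \<mu>), g]]"

abbreviation diffusion_mat :: "real \<Rightarrow> real ^ 4 ^ 4" where
  "diffusion_mat d \<equiv> vector [vector [0, 0, 0, 0], vector [0, 0, 0, 0], vector [0, 0, 0, 0], vector [0, 0, 0, d]]"

text \<open>Here \<open>M Z\<close> is the perturbation of \<open>(\<rho>, u, \<theta>, \<eta>)\<close> and \<open>N\<close> passes from the conservative equations to symmetrized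
primitive ones.  The positive off-diagonal entries \<open>a\<close> and \<open>b\<close> come from \<open>p\<^sub>\<rho>\<close> and \<open>p\<^sub>\<theta>\<close>, and the relaxation
block is \<open>g\<close> times the square of \<open>\<mu> \<theta> - \<eta>\<close> with \<open>\<mu> = 4 \<theta>bar\<^sup>3\<close>.  At equilibrium the entropy weights of \<open>\<theta>\<close>
and \<open>\<eta>\<close> match, which makes both this block and the coupling of \<open>u\<close> with \<open>\<eta>\<close> symmetric.\<close>

proposition linearized_normal_form:
  assumes thermo: "thermodynamics p e s" and "\<sigma>a > 0" "\<sigma>s > 0" and eq: "equilibrium_state e W"
  obtains k1 k2 k3 k4 u a b c \<mu> g d :: real and M M' N :: "real ^ 4 ^ 4"
  where "k1 > 0" "k2 > 0" "k3 > 0" "k4 > 0" "a > 0" "b > 0" "\<mu> > 0" "g > 0" "d > 0"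
    "M' ** M = mat 1"
    "N ** A0_mat e s W = mass_mat k1 k2 k3 k4 ** M"
    "N ** A1_mat p e s W = convection_mat u k1 k2 k3 k4 a b c ** M"
    "N ** L_mat \<sigma>a e s W = relaxation_mat g \<mu> ** M"
    "N ** B_mat \<sigma>s e s W = diffusion_mat d ** M"
proof -
  obtain V where V: "V \<in> V_domain" and W: "W = W_of_V e V" using eq by (auto simp: equilibrium_state_def)
  interpret fluid_state p e s V by unfold_locales (use thermo V in auto)
  have eta: "\<eta> = \<theta> ^ 4" using eq V by (simp add: equilibrium_state_def W temp_W_of_V) (simp add: W_of_V_def)
  have pw: "\<eta> powr (- 5 / 4) = 1 / \<theta> ^ 5"
  proof -
    have "\<eta> = \<theta> powr 4" using pos eta by (simp add: powr_numeral)
    hence "\<eta> powr (- 5 / 4) = \<theta> powr (- 5)" by (simp add: powr_powr)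
    thus ?thesis using pos by (simp add: powr_minus powr_numeral inverse_eq_divide)
  qed
  show ?thesis
  proof (rule that[where M = "Kinv ** transpose dW" and M' = "transpose dV ** K" and N = "K ** dV"])
    show "p\<^sub>\<rho> / (\<rho> * \<theta>) > 0" "\<rho> / \<theta> > 0" "\<rho> * e\<^sub>\<theta> / \<theta>\<^sup>2 > 0" "1 / (4 * \<theta> ^ 5) > 0" "p\<^sub>\<rho> / \<theta> > 0" "p\<^sub>\<theta> / \<theta> > 0"
      "4 * \<theta> ^ 3 > 0" "\<sigma>a / (4 * \<theta> ^ 5) > 0" "1 / (12 * \<sigma>s * \<theta> ^ 5) > 0"
      using pos assms by auto
    have "transpose dV ** K ** (Kinv ** transpose dW) = transpose dV ** (K ** Kinv) ** transpose dW"
      by (simp only: matrix_mul_assoc)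
    thus "transpose dV ** K ** (Kinv ** transpose dW) = mat 1" by (simp add: K_Kinv transpose_dV_dW)
    have K: "K = vector [vector [p\<^sub>\<rho> / (\<rho> * \<theta>), 0, 0, 0], vector [0, \<rho> / \<theta>, 0, 0],
       vector [0, 0, \<rho> * e\<^sub>\<theta> / \<theta>\<^sup>2, 0], vector [0, 0, 0, 1 / (4 * \<theta> ^ 5)]]"
      unfolding K_def pw by (simp add: mult.commute)
    show "K ** dV ** A0_mat e s W = vector [vector [p\<^sub>\<rho> / (\<rho> * \<theta>), 0, 0, 0], vector [0, \<rho> / \<theta>, 0, 0],
       vector [0, 0, \<rho> * e\<^sub>\<theta> / \<theta>\<^sup>2, 0], vector [0, 0, 0, 1 / (4 * \<theta> ^ 5)]] ** (Kinv ** transpose dW)"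
      unfolding W normal_form_A0 by (simp only: K)
    have "K ** A_prim = vector [vector [u * (p\<^sub>\<rho> / (\<rho> * \<theta>)), p\<^sub>\<rho> / \<theta>, 0, 0],
      vector [p\<^sub>\<rho> / \<theta>, u * (\<rho> / \<theta>), p\<^sub>\<theta> / \<theta>, 1 / (3 * \<theta>)],
      vector [0, p\<^sub>\<theta> / \<theta>, u * (\<rho> * e\<^sub>\<theta> / \<theta>\<^sup>2), 0], vector [0, 1 / (3 * \<theta>), 0, u * (1 / (4 * \<theta> ^ 5))]]"
      unfolding vec_eq_iff forall_4 using pos
      by (auto simp: K A_prim_def eta matrix_matrix_mult_def sum_4 field_simps power2_eq_square power_numeral_reduce)
    thus "K ** dV ** A1_mat p e s W = vector [vector [u * (p\<^sub>\<rho> / (\<rho> * \<theta>)), p\<^sub>\<rho> / \<theta>, 0, 0],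
      vector [p\<^sub>\<rho> / \<theta>, u * (\<rho> / \<theta>), p\<^sub>\<theta> / \<theta>, 1 / (3 * \<theta>)],
      vector [0, p\<^sub>\<theta> / \<theta>, u * (\<rho> * e\<^sub>\<theta> / \<theta>\<^sup>2), 0], vector [0, 1 / (3 * \<theta>), 0, u * (1 / (4 * \<theta> ^ 5))]] ** (Kinv ** transpose dW)"
      unfolding A1_mat_def W conjugate_inv_hess[OF flux_conjugate] by simp
    have "K ** L_prim \<sigma>a = vector [vector [0, 0, 0, 0], vector [0, 0, 0, 0],
      vector [0, 0, \<sigma>a / (4 * \<theta> ^ 5) * (4 * \<theta> ^ 3)\<^sup>2, - (\<sigma>a / (4 * \<theta> ^ 5) * (4 * \<theta> ^ 3))],
      vector [0, 0, - (\<sigma>a / (4 * \<theta> ^ 5) * (4 * \<theta> ^ 3)), \<sigma>a / (4 * \<theta> ^ 5)]]"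
      unfolding vec_eq_iff forall_4 using pos
      by (auto simp: K L_prim_def matrix_matrix_mult_def sum_4 field_simps power2_eq_square power_numeral_reduce)
    thus "K ** dV ** L_mat \<sigma>a e s W = vector [vector [0, 0, 0, 0], vector [0, 0, 0, 0],
      vector [0, 0, \<sigma>a / (4 * \<theta> ^ 5) * (4 * \<theta> ^ 3)\<^sup>2, - (\<sigma>a / (4 * \<theta> ^ 5) * (4 * \<theta> ^ 3))],
      vector [0, 0, - (\<sigma>a / (4 * \<theta> ^ 5) * (4 * \<theta> ^ 3)), \<sigma>a / (4 * \<theta> ^ 5)]] ** (Kinv ** transpose dW)"
      unfolding L_mat_def W conjugate_inv_hess[OF source_conjugate] by simp
    have "K ** diffusion \<sigma>s = vector [vector [0, 0, 0, 0], vector [0, 0, 0, 0], vector [0, 0, 0, 0],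
      vector [0, 0, 0, 1 / (12 * \<sigma>s * \<theta> ^ 5)]]"
      unfolding vec_eq_iff forall_4 using pos
      by (auto simp: K diffusion_def matrix_matrix_mult_def sum_4 field_simps)
    thus "K ** dV ** B_mat \<sigma>s e s W = vector [vector [0, 0, 0, 0], vector [0, 0, 0, 0], vector [0, 0, 0, 0],
      vector [0, 0, 0, 1 / (12 * \<sigma>s * \<theta> ^ 5)]] ** (Kinv ** transpose dW)"
      unfolding B_mat_def W conjugate_inv_hess[OF diffusion_conjugate] by simp
  qed
qed

section \<open>Decay of one Fourier mode\<close>

lemma young: fixes x y :: real assumes "\<beta> > 0" shows "x * y \<le> \<beta> * x\<^sup>2 + y\<^sup>2 / (4 * \<beta>)"
proof -
  have "0 \<le> (2 * \<beta> * x - y)\<^sup>2 / (4 * \<beta>)" using assms by simp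
  also have "\<dots> = \<beta> * x\<^sup>2 - x * y + y\<^sup>2 / (4 * \<beta>)" using assms by (simp add: power2_eq_square field_simps)
  finally show ?thesis by simp
qed

text \<open>The quadratic form that arises when the energy is corrected by the two compensators.  The variables stand for:
\<open>N1, ..., N4\<close> the moduli of the components, \<open>Q\<close> the modulus of the relaxation variable, \<open>x2 = \<xi>\<^sup>2\<close>,
\<open>w = \<xi>\<^sup>2 / (1 + \<xi>\<^sup>2)\<close> and \<open>z = |\<xi>| / (1 + \<xi>\<^sup>2)\<close>.  Different powers of \<open>\<epsilon>\<close> are needed because each
compensator creates bad terms in the component gained just before it: the \<open>\<epsilon>\<^sup>3\<close> term costs \<open>N2\<^sup>2\<close>, which is
gained at order \<open>\<epsilon>\<^sup>2\<close>, while the product \<open>\<epsilon>\<^sup>2 N3 N1\<close> is split into \<open>\<epsilon>\<^sup>3 N1\<^sup>2\<close>, which is gained, and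
\<open>\<epsilon> N3\<^sup>2\<close>, which is paid for by the energy dissipation of order one.\<close>

lemma dissipation_inequality:
  fixes a1 a2 b2 b3 c2 d g g3 \<mu> :: real
  assumes pos: "a1 > 0" "a2 > 0" "b2 > 0" "b3 > 0" "c2 \<ge> 0" "d > 0" "g > 0" "g3 > 0" "\<mu> > 0" "\<epsilon>0 > 0"
  obtains \<epsilon> \<kappa> where "0 < \<epsilon>" "\<epsilon> \<le> 1" "\<epsilon> \<le> \<epsilon>0" "\<kappa> > 0"
    "\<And>w z x2 N1 N2 N3 N4 Q. \<lbrakk>0 \<le> w; w \<le> 1; w \<le> x2; 0 \<le> z; z\<^sup>2 \<le> w; N1 \<ge> 0; N2 \<ge> 0; N3 \<ge> 0; N4 \<ge> 0; Q \<ge> 0; \<mu> * N3 \<le> Q + N4\<rbrakk>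
      \<Longrightarrow> - g * Q\<^sup>2 - d * x2 * N4\<^sup>2
        + \<epsilon>\<^sup>2 * (- w * b3 * N2\<^sup>2 + z * (g3 * \<mu>) * (Q * N2) + w * (a2 * (N3 * N1) + b2 * N3\<^sup>2 + c2 * (N3 * N4)))
        + \<epsilon> ^ 3 * (- w * a2 * N1\<^sup>2 + w * (b2 * (N3 * N1) + c2 * (N4 * N1)) + w * a1 * N2\<^sup>2)
        \<le> - \<kappa> * w * (N1\<^sup>2 + N2\<^sup>2 + N3\<^sup>2 + N4\<^sup>2)"
proof -
  (* m bounds the damping of N3 and N4 that is available from half of the relaxation and the
     diffusion, R bounds the coupling coefficients, A and H collect what has to be absorbed. *)
  define m where "m = min (g * \<mu>\<^sup>2 / 4) (min d (d * \<mu>\<^sup>2 / 4) / 2)"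
  define R where "R = a1 + a2 + b2 + c2"
  define A where "A = (g3 * \<mu>)\<^sup>2 / b3"
  define H where "H = R\<^sup>2 / a2 * 5 + 2 * R"
  have m: "m > 0" using pos by (simp add: m_def)
  have R: "R > 0" "a1 \<le> R" "a2 \<le> R" "b2 \<le> R" "c2 \<le> R" using pos by (auto simp: R_def)
  have A: "A > 0" and H: "H > 0" using pos R by (auto simp: A_def H_def add_pos_pos)
  define \<epsilon> where "\<epsilon> = Min {1, \<epsilon>0, g / (2 * A), b3 / (4 * R), m / (2 * H)}"
  have e: "\<epsilon> > 0" "\<epsilon> \<le> 1" "\<epsilon> \<le> \<epsilon>0" "\<epsilon> \<le> g / (2 * A)" "\<epsilon> \<le> b3 / (4 * R)" "\<epsilon> \<le> m / (2 * H)"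
    using pos A H R m by (auto simp: \<epsilon>_def)
  have e2: "\<epsilon>\<^sup>2 \<le> \<epsilon>" "\<epsilon> ^ 3 \<le> \<epsilon>" "\<epsilon> ^ 3 = \<epsilon>\<^sup>2 * \<epsilon>"
    using e power_decreasing[of 1 2 \<epsilon>] power_decreasing[of 1 3 \<epsilon>] by (auto simp: power2_eq_square power3_eq_cube)
  have eA: "\<epsilon>\<^sup>2 * A \<le> g / 2"
  proof -
    have "\<epsilon>\<^sup>2 * A \<le> \<epsilon> * A" using e2 A by (intro mult_right_mono) auto
    also have "\<dots> \<le> g / 2" using e(4) A by (simp add: field_simps)
    finally show ?thesis .
  qed
  have eR: "\<epsilon> * R \<le> b3 / 4" using e(5) R by (simp add: field_simps)
  have eH: "\<epsilon> * H \<le> m / 2" using e(6) H by (simp add: field_simps)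
  define \<kappa> where "\<kappa> = Min {m / 2, \<epsilon>\<^sup>2 * b3 / 2, \<epsilon> ^ 3 * a2 / 4}"
  have k: "\<kappa> > 0" "\<kappa> \<le> m / 2" "\<kappa> \<le> \<epsilon>\<^sup>2 * b3 / 2" "\<kappa> \<le> \<epsilon> ^ 3 * a2 / 4"
    using e pos m by (auto simp: \<kappa>_def)
  show ?thesis
  proof (rule that[OF e(1-3) k(1)])
    fix w z x2 N1 N2 N3 N4 Q :: real
    assume as: "0 \<le> w" "w \<le> 1" "w \<le> x2" "0 \<le> z" "z\<^sup>2 \<le> w" "N1 \<ge> 0" "N2 \<ge> 0" "N3 \<ge> 0" "N4 \<ge> 0" "Q \<ge> 0" "\<mu> * N3 \<le> Q + N4"
    (* Relaxation and diffusion together control N3, since \<mu> N3 is at most Q + N4. *)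
    have base: "- g * Q\<^sup>2 - d * x2 * N4\<^sup>2 \<le> - (g / 2) * Q\<^sup>2 - m * w * (N3\<^sup>2 + N4\<^sup>2)"
    proof -
      have "(\<mu> * N3)\<^sup>2 \<le> (Q + N4)\<^sup>2" using as pos by (intro power_mono) auto
      also have "\<dots> \<le> 2 * Q\<^sup>2 + 2 * N4\<^sup>2"
        using zero_le_power2[of "Q - N4"] by (simp add: power2_eq_square algebra_simps)
      finally have n3: "\<mu>\<^sup>2 * N3\<^sup>2 \<le> 2 * Q\<^sup>2 + 2 * N4\<^sup>2" by (simp add: power_mult_distrib)
      have m1: "m * N3\<^sup>2 \<le> g / 2 * Q\<^sup>2 + d / 2 * N4\<^sup>2 * 1"
      proof -
        have "m \<le> g * \<mu>\<^sup>2 / 4" "m \<le> d * \<mu>\<^sup>2 / 4 / 2" by (auto simp: m_def)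
        hence ma: "m / \<mu>\<^sup>2 \<le> g / 4" "m / \<mu>\<^sup>2 \<le> d / 8" using pos by (auto simp: pos_divide_le_eq)
        have "m * N3\<^sup>2 = m / \<mu>\<^sup>2 * (\<mu>\<^sup>2 * N3\<^sup>2)" using pos by simp
        also have "\<dots> \<le> m / \<mu>\<^sup>2 * (2 * Q\<^sup>2 + 2 * N4\<^sup>2)" using m by (intro mult_left_mono n3) auto
        also have "\<dots> = m / \<mu>\<^sup>2 * (2 * Q\<^sup>2) + m / \<mu>\<^sup>2 * (2 * N4\<^sup>2)" by (simp add: distrib_left)
        also have "\<dots> \<le> g / 4 * (2 * Q\<^sup>2) + d / 8 * (2 * N4\<^sup>2)"
          by (intro add_mono mult_right_mono ma) auto
        also have "\<dots> \<le> g / 2 * Q\<^sup>2 + d / 2 * N4\<^sup>2 * 1" using pos by (simp add: field_simps)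
        finally show ?thesis .
      qed
      have m2: "m * N4\<^sup>2 \<le> d / 2 * N4\<^sup>2"
        unfolding m_def by (intro mult_right_mono min.coboundedI2) auto
      have "m * w * (N3\<^sup>2 + N4\<^sup>2) = w * (m * N3\<^sup>2 + m * N4\<^sup>2)" by (simp add: algebra_simps)
      also have "\<dots> \<le> w * (g / 2 * Q\<^sup>2 + d * N4\<^sup>2)" using m1 m2 as by (intro mult_left_mono) auto
      also have "\<dots> \<le> g / 2 * Q\<^sup>2 + d * x2 * N4\<^sup>2"
      proof -
        have "w * (g / 2 * Q\<^sup>2) \<le> 1 * (g / 2 * Q\<^sup>2)" using as pos by (intro mult_right_mono) auto
        moreover have "w * (d * N4\<^sup>2) \<le> x2 * (d * N4\<^sup>2)" using as pos by (intro mult_right_mono) auto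
        ultimately show ?thesis by (simp add: algebra_simps)
      qed
      finally show ?thesis by (simp add: algebra_simps)
    qed
    have qy: "z * (g3 * \<mu>) * (Q * N2) \<le> b3 / 4 * w * N2\<^sup>2 + A * Q\<^sup>2"
    proof -
      have "(z * N2) * (g3 * \<mu> * Q) \<le> b3 / 4 * (z * N2)\<^sup>2 + (g3 * \<mu> * Q)\<^sup>2 / (4 * (b3 / 4))"
        by (rule young) (use pos in simp)
      also have "(g3 * \<mu> * Q)\<^sup>2 / (4 * (b3 / 4)) = A * Q\<^sup>2" by (simp add: A_def power_mult_distrib)
      also have "b3 / 4 * (z * N2)\<^sup>2 \<le> b3 / 4 * w * N2\<^sup>2"
      proof -
        have "b3 / 4 * (z * N2)\<^sup>2 = z\<^sup>2 * (b3 / 4 * N2\<^sup>2)" by (simp add: power_mult_distrib)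
        also have "\<dots> \<le> w * (b3 / 4 * N2\<^sup>2)" using as pos by (intro mult_right_mono) auto
        finally show ?thesis by (simp add: mult_ac)
      qed
      finally show ?thesis by (simp add: mult_ac)
    qed
    have p31: "\<epsilon>\<^sup>2 * (a2 * (N3 * N1)) \<le> \<epsilon> ^ 3 * a2 / 4 * N1\<^sup>2 + \<epsilon> * (R\<^sup>2 / a2) * N3\<^sup>2"
    proof -
      have "N1 * (\<epsilon>\<^sup>2 * a2 * N3) \<le> \<epsilon> ^ 3 * a2 / 4 * N1\<^sup>2 + (\<epsilon>\<^sup>2 * a2 * N3)\<^sup>2 / (4 * (\<epsilon> ^ 3 * a2 / 4))"
        by (rule young) (use e pos in simp)
      also have "(\<epsilon>\<^sup>2 * a2 * N3)\<^sup>2 / (4 * (\<epsilon> ^ 3 * a2 / 4)) = \<epsilon> * (a2\<^sup>2 / a2) * N3\<^sup>2"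
        using e pos by (simp add: power2_eq_square power3_eq_cube field_simps)
      also have "\<dots> \<le> \<epsilon> * (R\<^sup>2 / a2) * N3\<^sup>2"
        using e pos R by (intro mult_right_mono mult_left_mono divide_right_mono power_mono) auto
      finally show ?thesis by (simp add: mult_ac)
    qed
    have pj1: "\<epsilon> ^ 3 * (cf * (N * N1)) \<le> \<epsilon> ^ 3 * a2 / 8 * N1\<^sup>2 + \<epsilon> * (2 * R\<^sup>2 / a2) * N\<^sup>2" if "0 \<le> cf" "cf \<le> R" for cf N
    proof -
      have "N1 * (cf * N) \<le> a2 / 8 * N1\<^sup>2 + (cf * N)\<^sup>2 / (4 * (a2 / 8))" by (rule young) (use pos in simp)
      also have "(cf * N)\<^sup>2 / (4 * (a2 / 8)) = 2 * cf\<^sup>2 / a2 * N\<^sup>2" by (simp add: power_mult_distrib)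
      also have "\<dots> \<le> 2 * R\<^sup>2 / a2 * N\<^sup>2"
        using pos that by (intro mult_right_mono divide_right_mono mult_left_mono power_mono) auto
      finally have "\<epsilon> ^ 3 * (N1 * (cf * N)) \<le> \<epsilon> ^ 3 * (a2 / 8 * N1\<^sup>2 + 2 * R\<^sup>2 / a2 * N\<^sup>2)"
        using e by (intro mult_left_mono) auto
      also have "\<dots> = \<epsilon> ^ 3 * a2 / 8 * N1\<^sup>2 + \<epsilon> ^ 3 * (2 * R\<^sup>2 / a2) * N\<^sup>2" by (simp add: algebra_simps)
      also have "\<epsilon> ^ 3 * (2 * R\<^sup>2 / a2) * N\<^sup>2 \<le> \<epsilon> * (2 * R\<^sup>2 / a2) * N\<^sup>2"
        using e2 pos by (intro mult_right_mono) auto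
      finally show ?thesis by (simp add: mult_ac)
    qed
    have p33: "\<epsilon>\<^sup>2 * (b2 * N3\<^sup>2 + c2 * (N3 * N4)) \<le> \<epsilon> * (2 * R) * (N3\<^sup>2 + N4\<^sup>2)"
    proof -
      have "N3 * N4 \<le> N3\<^sup>2 + N4\<^sup>2"
        using zero_le_power2[of "N3 - N4"] zero_le_power2[of N3] zero_le_power2[of N4]
        unfolding power2_diff by linarith
      hence "b2 * N3\<^sup>2 + c2 * (N3 * N4) \<le> R * (N3\<^sup>2 + N4\<^sup>2) + R * (N3\<^sup>2 + N4\<^sup>2)"
        using R pos as by (intro add_mono mult_mono) auto
      hence "\<epsilon>\<^sup>2 * (b2 * N3\<^sup>2 + c2 * (N3 * N4)) \<le> \<epsilon>\<^sup>2 * (2 * R * (N3\<^sup>2 + N4\<^sup>2))"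
        using e by (intro mult_left_mono) auto
      also have "\<dots> \<le> \<epsilon> * (2 * R * (N3\<^sup>2 + N4\<^sup>2))" using e2 R by (intro mult_right_mono) auto
      finally show ?thesis by (simp add: mult_ac)
    qed
    have p22: "\<epsilon> ^ 3 * (a1 * N2\<^sup>2) \<le> \<epsilon>\<^sup>2 * (b3 / 4) * N2\<^sup>2"
    proof -
      have "\<epsilon> * a1 \<le> b3 / 4" using eR R mult_left_mono[of a1 R \<epsilon>] e by linarith
      hence "\<epsilon>\<^sup>2 * (\<epsilon> * a1) * N2\<^sup>2 \<le> \<epsilon>\<^sup>2 * (b3 / 4) * N2\<^sup>2" by (intro mult_right_mono mult_left_mono) auto
      thus ?thesis by (simp add: e2(3) mult_ac)
    qed
    have mixed: "\<epsilon>\<^sup>2 * (a2 * (N3 * N1) + b2 * N3\<^sup>2 + c2 * (N3 * N4)) + \<epsilon> ^ 3 * (b2 * (N3 * N1) + c2 * (N4 * N1)) + \<epsilon> ^ 3 * (a1 * N2\<^sup>2)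
        \<le> \<epsilon> ^ 3 * a2 / 2 * N1\<^sup>2 + \<epsilon>\<^sup>2 * (b3 / 4) * N2\<^sup>2 + m / 2 * (N3\<^sup>2 + N4\<^sup>2)"
    proof -
      have "\<epsilon> * (R\<^sup>2 / a2) * N3\<^sup>2 + \<epsilon> * (2 * R\<^sup>2 / a2) * N3\<^sup>2 + \<epsilon> * (2 * R\<^sup>2 / a2) * N4\<^sup>2 + \<epsilon> * (2 * R) * (N3\<^sup>2 + N4\<^sup>2)
          \<le> \<epsilon> * H * (N3\<^sup>2 + N4\<^sup>2)"
      proof -
        have "\<epsilon> * H * (N3\<^sup>2 + N4\<^sup>2) - (\<epsilon> * (R\<^sup>2 / a2) * N3\<^sup>2 + \<epsilon> * (2 * R\<^sup>2 / a2) * N3\<^sup>2 + \<epsilon> * (2 * R\<^sup>2 / a2) * N4\<^sup>2 + \<epsilon> * (2 * R) * (N3\<^sup>2 + N4\<^sup>2))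
          = \<epsilon> * (R\<^sup>2 / a2) * (2 * N3\<^sup>2 + 3 * N4\<^sup>2)" by (simp add: H_def algebra_simps add_divide_distrib)
        also have "\<dots> \<ge> 0" using e pos by (intro mult_nonneg_nonneg) auto
        finally show ?thesis by linarith
      qed
      also have "\<dots> \<le> m / 2 * (N3\<^sup>2 + N4\<^sup>2)" using eH by (intro mult_right_mono) auto
      finally have "\<epsilon> * (R\<^sup>2 / a2) * N3\<^sup>2 + \<epsilon> * (2 * R\<^sup>2 / a2) * N3\<^sup>2 + \<epsilon> * (2 * R\<^sup>2 / a2) * N4\<^sup>2 + \<epsilon> * (2 * R) * (N3\<^sup>2 + N4\<^sup>2) \<le> m / 2 * (N3\<^sup>2 + N4\<^sup>2)" .
      thus ?thesis
        using p31 pj1[of b2 N3] pj1[of c2 N4] p33 p22 pos R unfolding distrib_left by linarith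
    qed
    have "- g * Q\<^sup>2 - d * x2 * N4\<^sup>2
        + \<epsilon>\<^sup>2 * (- w * b3 * N2\<^sup>2 + z * (g3 * \<mu>) * (Q * N2) + w * (a2 * (N3 * N1) + b2 * N3\<^sup>2 + c2 * (N3 * N4)))
        + \<epsilon> ^ 3 * (- w * a2 * N1\<^sup>2 + w * (b2 * (N3 * N1) + c2 * (N4 * N1)) + w * a1 * N2\<^sup>2)
      = (- g * Q\<^sup>2 - d * x2 * N4\<^sup>2) + \<epsilon>\<^sup>2 * (z * (g3 * \<mu>) * (Q * N2)) - \<epsilon>\<^sup>2 * (w * b3 * N2\<^sup>2) - \<epsilon> ^ 3 * (w * a2 * N1\<^sup>2)
        + w * (\<epsilon>\<^sup>2 * (a2 * (N3 * N1) + b2 * N3\<^sup>2 + c2 * (N3 * N4)) + \<epsilon> ^ 3 * (b2 * (N3 * N1) + c2 * (N4 * N1)) + \<epsilon> ^ 3 * (a1 * N2\<^sup>2))"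
      by (simp add: algebra_simps)
    also have "\<dots> \<le> (- (g / 2) * Q\<^sup>2 - m * w * (N3\<^sup>2 + N4\<^sup>2)) + \<epsilon>\<^sup>2 * (b3 / 4 * w * N2\<^sup>2 + A * Q\<^sup>2) - \<epsilon>\<^sup>2 * (w * b3 * N2\<^sup>2) - \<epsilon> ^ 3 * (w * a2 * N1\<^sup>2)
        + w * (\<epsilon> ^ 3 * a2 / 2 * N1\<^sup>2 + \<epsilon>\<^sup>2 * (b3 / 4) * N2\<^sup>2 + m / 2 * (N3\<^sup>2 + N4\<^sup>2))"
      by (intro add_mono diff_right_mono base mult_left_mono qy mixed as) auto
    also have "\<dots> = (\<epsilon>\<^sup>2 * A - g / 2) * Q\<^sup>2 - w * (\<epsilon> ^ 3 * a2 / 2 * N1\<^sup>2 + \<epsilon>\<^sup>2 * b3 / 2 * N2\<^sup>2 + m / 2 * (N3\<^sup>2 + N4\<^sup>2))"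
      by (simp add: algebra_simps)
    also have "\<dots> \<le> 0 - w * (\<kappa> * N1\<^sup>2 + \<kappa> * N2\<^sup>2 + \<kappa> * (N3\<^sup>2 + N4\<^sup>2))"
    proof (intro diff_mono mult_left_mono add_mono mult_right_mono)
      show "(\<epsilon>\<^sup>2 * A - g / 2) * Q\<^sup>2 \<le> 0" using eA by (intro mult_nonpos_nonneg) auto
      show "\<kappa> \<le> \<epsilon> ^ 3 * a2 / 2" using k(4) e pos by (smt (verit) divide_strict_left_mono mult_pos_pos zero_less_power)
    qed (use k as in auto)
    also have "\<dots> = - \<kappa> * w * (N1\<^sup>2 + N2\<^sup>2 + N3\<^sup>2 + N4\<^sup>2)" by (simp add: algebra_simps)
    finally show "- g * Q\<^sup>2 - d * x2 * N4\<^sup>2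
        + \<epsilon>\<^sup>2 * (- w * b3 * N2\<^sup>2 + z * (g3 * \<mu>) * (Q * N2) + w * (a2 * (N3 * N1) + b2 * N3\<^sup>2 + c2 * (N3 * N4)))
        + \<epsilon> ^ 3 * (- w * a2 * N1\<^sup>2 + w * (b2 * (N3 * N1) + c2 * (N4 * N1)) + w * a1 * N2\<^sup>2)
        \<le> - \<kappa> * w * (N1\<^sup>2 + N2\<^sup>2 + N3\<^sup>2 + N4\<^sup>2)" .
  qed
qed

text \<open>The rate is \<open>r - \<delta>\<close> but the loss is paid only through the factor \<open>exp (\<delta> t)\<close>, so that \<open>\<delta> = 1/(1 + t)\<close> costs a constant.\<close>

lemma gronwall_decay:
  fixes F F' G :: "real \<Rightarrow> real"
  assumes t: "0 \<le> t" and cF: "continuous_on {0..t} F" and cG: "continuous_on {0..t} G" and G0: "\<And>s. G s \<ge> 0"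
    and D: "\<And>s. 0 < s \<Longrightarrow> s < t \<Longrightarrow> (F has_real_derivative F' s) (at s)"
    and le: "\<And>s. 0 < s \<Longrightarrow> s < t \<Longrightarrow> F' s \<le> - (r - \<delta>) * F s + G s"
    and r: "r \<ge> 0" and \<delta>: "\<delta> \<ge> 0"
  shows "F t \<le> exp (\<delta> * t) * (exp (- r * t) * F 0 + integral {0..t} G)"
proof (cases "t = 0")
  case False
  hence t': "0 < t" using t by simp
  (* The constant exp (r t) dominates the integrating factor on {0..t}. *)
  define h where "h = (\<lambda>s. exp ((r - \<delta>) * s) * F s - exp (r * t) * integral {0..s} G)"
  have int: "((\<lambda>s. integral {0..s} G) has_real_derivative G s) (at s)" if "0 < s" "s < t" for s
  proof -
    have "((\<lambda>s. integral {0..s} G) has_real_derivative G s) (at s within {0..t})"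
      by (rule integral_has_real_derivative[OF cG]) (use that in auto)
    moreover have "at s within {0..t} = at s" by (rule at_within_interior) (use that in auto)
    ultimately show ?thesis by simp
  qed
  have "h t \<le> h 0"
  proof (rule DERIV_nonpos_imp_decreasing_open[OF t])
    fix s assume s: "0 < s" "s < t"
    have "(h has_real_derivative ((r - \<delta>) * exp ((r - \<delta>) * s)) * F s + F' s * exp ((r - \<delta>) * s) - exp (r * t) * G s) (at s)"
      unfolding h_def by (auto intro!: derivative_eq_intros D[OF s] int[OF s])
    moreover have "((r - \<delta>) * exp ((r - \<delta>) * s)) * F s + F' s * exp ((r - \<delta>) * s) - exp (r * t) * G s \<le> 0"
    proof -
      have "((r - \<delta>) * exp ((r - \<delta>) * s)) * F s + F' s * exp ((r - \<delta>) * s) = exp ((r - \<delta>) * s) * (F' s + (r - \<delta>) * F s)"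
        by (simp add: algebra_simps)
      also have "\<dots> \<le> exp ((r - \<delta>) * s) * G s" using le[OF s] by (intro mult_left_mono) (auto simp: algebra_simps)
      also have "\<dots> \<le> exp (r * t) * G s"
      proof (intro mult_right_mono G0)
        have "(r - \<delta>) * s \<le> r * s" using \<delta> s by (intro mult_right_mono) auto
        also have "\<dots> \<le> r * t" using r s by (intro mult_left_mono) auto
        finally show "exp ((r - \<delta>) * s) \<le> exp (r * t)" by simp
      qed
      finally show ?thesis by simp
    qed
    ultimately show "\<exists>y. (h has_real_derivative y) (at s) \<and> y \<le> 0" by blast
  next
    show "continuous_on {0..t} h" unfolding h_def
      by (intro continuous_intros cF indefinite_integral_continuous_1 integrable_continuous_real cG)
  qed
  hence "exp ((r - \<delta>) * t) * F t \<le> F 0 + exp (r * t) * integral {0..t} G" by (simp add: h_def)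
  hence "exp ((\<delta> - r) * t) * (exp ((r - \<delta>) * t) * F t) \<le> exp ((\<delta> - r) * t) * (F 0 + exp (r * t) * integral {0..t} G)"
    by (rule mult_left_mono) simp
  moreover have "exp ((\<delta> - r) * t) * (exp ((r - \<delta>) * t) * F t) = F t"
    by (simp add: mult.assoc[symmetric] left_diff_distrib flip: exp_add)
  moreover have "exp ((\<delta> - r) * t) * (F 0 + exp (r * t) * integral {0..t} G) = exp (\<delta> * t) * (exp (- r * t) * F 0 + integral {0..t} G)"
  proof -
    have "exp ((\<delta> - r) * t) = exp (\<delta> * t) * exp (- r * t)" "exp (- r * t) * exp (r * t) = 1"
      by (auto simp: algebra_simps simp flip: exp_add)
    thus ?thesis by (simp add: distrib_left mult.assoc)
  qed
  ultimately show ?thesis by simp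
qed simp

text \<open>The symmetric convection part is skew for the real inner product and drops out.\<close>

lemma energy_identity:
  fixes y1 y2 y3 y4 e1 e2 e3 e4 :: complex and \<xi> v k1 k2 k3 k4 a b c d g \<mu> :: real
  shows "inner y1 (- \<i> * \<xi> * (v * k1 * y1 + a * y2) + e1)
     + inner y2 (- \<i> * \<xi> * (a * y1 + v * k2 * y2 + b * y3 + c * y4) + e2)
     + inner y3 (- \<i> * \<xi> * (b * y2 + v * k3 * y3) - g * \<mu> * (\<mu> * y3 - y4) + e3)
     + inner y4 (- \<i> * \<xi> * (c * y2 + v * k4 * y4) + g * (\<mu> * y3 - y4) - d * \<xi>\<^sup>2 * y4 + e4)
   = - g * (norm (\<mu> * y3 - y4))\<^sup>2 - d * \<xi>\<^sup>2 * (norm y4)\<^sup>2 + (inner y1 e1 + inner y2 e2 + inner y3 e3 + inner y4 e4)"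
  unfolding cmod_power2 by (simp add: inner_complex_def power2_eq_square algebra_simps)

text \<open>The time derivative of the product of \<open>i y3\<close> with \<open>y2\<close>: the coupling of the two components leaves
\<open>\<xi> b3 |y2|\<^sup>2\<close>, while the transport with speed \<open>v\<close> cancels.\<close>

lemma compensator_identity_32:
  fixes y1 y2 y3 y4 f2 f3 :: complex and \<xi> v a2 b2 b3 c2 g3 \<mu> :: real
  shows "inner (\<i> * (- \<i> * \<xi> * (b3 * y2 + v * y3) - g3 * \<mu> * (\<mu> * y3 - y4) + f3)) y2
     + inner (\<i> * y3) (- \<i> * \<xi> * (a2 * y1 + v * y2 + b2 * y3 + c2 * y4) + f2)
   = \<xi> * b3 * (norm y2)\<^sup>2 - g3 * \<mu> * inner (\<i> * (\<mu> * y3 - y4)) y2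
     - \<xi> * (a2 * inner y3 y1 + b2 * (norm y3)\<^sup>2 + c2 * inner y3 y4) + (inner (\<i> * f3) y2 + inner (\<i> * y3) f2)"
  unfolding cmod_power2 by (simp add: inner_complex_def power2_eq_square algebra_simps)

text \<open>The next link of the chain, producing \<open>|y1|\<^sup>2\<close> from the coupling of the first two components.\<close>

lemma compensator_identity_21:
  fixes y1 y2 y3 y4 f1 f2 :: complex and \<xi> v a1 a2 b2 c2 :: real
  shows "inner (\<i> * (- \<i> * \<xi> * (a2 * y1 + v * y2 + b2 * y3 + c2 * y4) + f2)) y1
     + inner (\<i> * y2) (- \<i> * \<xi> * (v * y1 + a1 * y2) + f1)
   = \<xi> * (a2 * (norm y1)\<^sup>2 + b2 * inner y3 y1 + c2 * inner y4 y1) - \<xi> * a1 * (norm y2)\<^sup>2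
     + (inner (\<i> * f2) y1 + inner (\<i> * y2) f1)"
  unfolding cmod_power2 by (simp add: inner_complex_def power2_eq_square algebra_simps)

text \<open>Parabolic for low frequencies and bounded below for high ones, so that no derivatives are lost in the decay.\<close>

definition damping :: "real \<Rightarrow> real" where
  "damping \<xi> = \<xi>\<^sup>2 / (1 + \<xi>\<^sup>2)"

lemma damping_bounds: "0 \<le> damping \<xi>" "damping \<xi> \<le> 1" "damping \<xi> \<le> \<xi>\<^sup>2"
proof -
  have "1 + \<xi>\<^sup>2 > 0" by (simp add: add_pos_nonneg)
  thus "0 \<le> damping \<xi>" "damping \<xi> \<le> 1" "damping \<xi> \<le> \<xi>\<^sup>2"
    by (auto simp: damping_def field_simps)
qed

text \<open>The equations of the mode of frequency \<open>\<xi>\<close> of the normal form, with forcing \<open>e\<close>.\<close>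

definition mode_equations ::
  "real \<Rightarrow> real \<Rightarrow> real \<Rightarrow> real \<Rightarrow> real \<Rightarrow> real \<Rightarrow> real \<Rightarrow> real \<Rightarrow> real \<Rightarrow> real \<Rightarrow> real
    \<Rightarrow> real \<Rightarrow> (real \<Rightarrow> complex ^ 4) \<Rightarrow> (real \<Rightarrow> complex ^ 4) \<Rightarrow> real \<Rightarrow> bool" where
  "mode_equations k1 k2 k3 k4 v a b c \<mu> g d \<xi> y e s \<longleftrightarrow>
        ((\<lambda>s. y s $ 1) has_vector_derivative (1 / k1) *\<^sub>R (- \<i> * of_real \<xi> * (of_real (v * k1) * y s $ 1 + of_real a * y s $ 2) + e s $ 1)) (at s) \<and>
        ((\<lambda>s. y s $ 2) has_vector_derivative (1 / k2) *\<^sub>R (- \<i> * of_real \<xi> * (of_real a * y s $ 1 + of_real (v * k2) * y s $ 2 + of_real b * y s $ 3 + of_real c * y s $ 4) + e s $ 2)) (at s) \<and>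
        ((\<lambda>s. y s $ 3) has_vector_derivative (1 / k3) *\<^sub>R (- \<i> * of_real \<xi> * (of_real b * y s $ 2 + of_real (v * k3) * y s $ 3) - of_real (g * \<mu>) * (of_real \<mu> * y s $ 3 - y s $ 4) + e s $ 3)) (at s) \<and>
        ((\<lambda>s. y s $ 4) has_vector_derivative (1 / k4) *\<^sub>R (- \<i> * of_real \<xi> * (of_real c * y s $ 2 + of_real (v * k4) * y s $ 4) + of_real g * (of_real \<mu> * y s $ 3 - y s $ 4) - of_real (d * \<xi>\<^sup>2) * y s $ 4 + e s $ 4)) (at s)"

text \<open>The Lyapunov function is the energy minus \<open>\<epsilon>\<^sup>2\<close> and \<open>\<epsilon>\<^sup>3\<close> times the two compensators, each weighted by
\<open>\<xi> / (1 + \<xi>\<^sup>2)\<close>; this weight is bounded, so the function stays comparable to the energy uniformly in \<open>\<xi>\<close>,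
and times \<open>\<xi>\<close> it is the damping rate.  The forcing \<open>e\<close> is included because windowed solutions satisfy the mode
equation only up to an error.\<close>

proposition mode_decay:
  fixes k1 k2 k3 k4 v a b c \<mu> g d :: real
  assumes pos: "k1 > 0" "k2 > 0" "k3 > 0" "k4 > 0" "a > 0" "b > 0" "\<mu> > 0" "g > 0" "d > 0"
  obtains C \<gamma> where "C > 0" "\<gamma> > 0"
    "\<And>\<xi> t (y :: real \<Rightarrow> complex ^ 4) (e :: real \<Rightarrow> complex ^ 4). \<lbrakk>0 \<le> t; continuous_on {0..t} y; continuous_on {0..t} e;
      \<And>s. 0 < s \<Longrightarrow> s < t \<Longrightarrow>
        mode_equations k1 k2 k3 k4 v a b c \<mu> g d \<xi> y e s\<rbrakk>
     \<Longrightarrow> (norm (y t))\<^sup>2 \<le> C * (exp (- \<gamma> * damping \<xi> * t) * (norm (y 0))\<^sup>2 + (1 + t) * integral {0..t} (\<lambda>s. (norm (e s))\<^sup>2))"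
proof -
  define a1 a2 b2 b3 c2 g3 where "a1 = a / k1" and "a2 = a / k2" and "b2 = b / k2" and "b3 = b / k3" and "c2 = c / k2" and "g3 = g / k3"
  have cpos: "a1 > 0" "a2 > 0" "b2 > 0" "b3 > 0" "\<bar>c2\<bar> \<ge> 0" "g3 > 0"
    using pos by (auto simp: a1_def a2_def b2_def b3_def g3_def)
  define kmin where "kmin = min (min k1 k2) (min k3 k4)"
  define kmax where "kmax = max (max k1 k2) (max k3 k4)"
  have kmin: "kmin > 0" "kmin \<le> k1" "kmin \<le> k2" "kmin \<le> k3" "kmin \<le> k4"
    and kmax: "kmax > 0" "k1 \<le> kmax" "k2 \<le> kmax" "k3 \<le> kmax" "k4 \<le> kmax"
    using pos by (auto simp: kmin_def kmax_def)
  obtain \<epsilon> \<kappa> where e: "0 < \<epsilon>" "\<epsilon> \<le> 1" "\<epsilon> \<le> kmin / 2" and \<kappa>: "\<kappa> > 0" and diss: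
    "\<And>w z x2 N1 N2 N3 N4 Q. \<lbrakk>0 \<le> w; w \<le> 1; w \<le> x2; 0 \<le> z; z\<^sup>2 \<le> w; N1 \<ge> 0; N2 \<ge> 0; N3 \<ge> 0; N4 \<ge> 0; Q \<ge> 0; \<mu> * N3 \<le> Q + N4\<rbrakk>
      \<Longrightarrow> - g * Q\<^sup>2 - d * x2 * N4\<^sup>2
        + \<epsilon>\<^sup>2 * (- w * b3 * N2\<^sup>2 + z * (g3 * \<mu>) * (Q * N2) + w * (a2 * (N3 * N1) + b2 * N3\<^sup>2 + \<bar>c2\<bar> * (N3 * N4)))
        + \<epsilon> ^ 3 * (- w * a2 * N1\<^sup>2 + w * (b2 * (N3 * N1) + \<bar>c2\<bar> * (N4 * N1)) + w * a1 * N2\<^sup>2)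
        \<le> - \<kappa> * w * (N1\<^sup>2 + N2\<^sup>2 + N3\<^sup>2 + N4\<^sup>2)"
    using dissipation_inequality[of a1 a2 b2 b3 "\<bar>c2\<bar>" d g g3 \<mu> "kmin / 2"] pos cpos kmin
    by (metis half_gt_zero)
  have e2: "\<epsilon>\<^sup>2 \<le> \<epsilon>" "\<epsilon> ^ 3 \<le> \<epsilon>" "\<epsilon>\<^sup>2 \<ge> 0" "\<epsilon> ^ 3 \<ge> 0" "\<epsilon>\<^sup>2 \<le> 1" "\<epsilon> ^ 3 \<le> 1"
    using e power_decreasing[of 1 2 \<epsilon>] power_decreasing[of 1 3 \<epsilon>] by auto
  define F where "F = (\<lambda>\<xi> (y :: complex ^ 4). (k1 * (norm (y $ 1))\<^sup>2 + k2 * (norm (y $ 2))\<^sup>2 + k3 * (norm (y $ 3))\<^sup>2 + k4 * (norm (y $ 4))\<^sup>2) / 2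
     - (\<epsilon>\<^sup>2 * (\<xi> / (1 + \<xi>\<^sup>2)) * inner (\<i> * y $ 3) (y $ 2) + \<epsilon> ^ 3 * (\<xi> / (1 + \<xi>\<^sup>2)) * inner (\<i> * y $ 2) (y $ 1)))"
  have half: "kN / 4 \<le> S / 2 - X" if "kN \<le> S" "eN \<le> kN / 4" "\<bar>X\<bar> \<le> eN" for kN S eN X :: real
    using that by linarith
  have half': "S / 2 - X \<le> kN + N" if "S \<le> kN" "eN \<le> N" "\<bar>X\<bar> \<le> eN" "0 \<le> kN" for kN S eN X N :: real
    using that by linarith
  have z: "\<bar>\<xi> / (1 + \<xi>\<^sup>2)\<bar> \<le> 1 / 2" "(\<xi> / (1 + \<xi>\<^sup>2))\<^sup>2 \<le> damping \<xi>" "\<xi> / (1 + \<xi>\<^sup>2) * \<xi> = damping \<xi>" for \<xi> :: real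
  proof -
    have p: "1 + \<xi>\<^sup>2 > 0" by (simp add: add_pos_nonneg)
    have "2 * \<bar>\<xi>\<bar> \<le> 1 + \<xi>\<^sup>2" using zero_le_power2[of "\<bar>\<xi>\<bar> - 1"] by (simp add: power2_diff)
    thus "\<bar>\<xi> / (1 + \<xi>\<^sup>2)\<bar> \<le> 1 / 2" using p by (simp add: abs_div field_simps)
    have "(\<xi> / (1 + \<xi>\<^sup>2))\<^sup>2 = damping \<xi> * (1 / (1 + \<xi>\<^sup>2))" by (simp add: damping_def power2_eq_square)
    also have "\<dots> \<le> damping \<xi> * 1" using p by (intro mult_left_mono damping_bounds) auto
    finally show "(\<xi> / (1 + \<xi>\<^sup>2))\<^sup>2 \<le> damping \<xi>" by simp
    show "\<xi> / (1 + \<xi>\<^sup>2) * \<xi> = damping \<xi>" by (simp add: damping_def power2_eq_square)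
  qed
  have inner_le: "\<bar>inner (\<i> * x) y\<bar> \<le> norm x * norm y" "\<bar>inner x y\<bar> \<le> norm x * norm y" for x y :: complex
    using Cauchy_Schwarz_ineq2[of "\<i> * x" y] Cauchy_Schwarz_ineq2[of x y] by (auto simp: norm_mult)
  have N4: "(norm y)\<^sup>2 = (norm (y $ 1))\<^sup>2 + (norm (y $ 2))\<^sup>2 + (norm (y $ 3))\<^sup>2 + (norm (y $ 4))\<^sup>2" for y :: "complex ^ 4"
    by (simp add: norm_vec_def L2_set_def sum_nonneg sum_4)
  have comp: "\<bar>\<epsilon>\<^sup>2 * (\<xi> / (1 + \<xi>\<^sup>2)) * inner (\<i> * y $ 3) (y $ 2) + \<epsilon> ^ 3 * (\<xi> / (1 + \<xi>\<^sup>2)) * inner (\<i> * y $ 2) (y $ 1)\<bar>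
      \<le> \<epsilon> / 2 * (norm y)\<^sup>2" for \<xi> and y :: "complex ^ 4"
  proof -
    have *: "\<bar>\<delta> * (\<xi> / (1 + \<xi>\<^sup>2)) * inner (\<i> * p) q\<bar> \<le> \<epsilon> / 4 * ((norm p)\<^sup>2 + (norm q)\<^sup>2)" if "0 \<le> \<delta>" "\<delta> \<le> \<epsilon>" for \<delta> p q
    proof -
      have "\<bar>\<delta> * (\<xi> / (1 + \<xi>\<^sup>2)) * inner (\<i> * p) q\<bar> = \<delta> * \<bar>\<xi> / (1 + \<xi>\<^sup>2)\<bar> * \<bar>inner (\<i> * p) q\<bar>"
        using that by (simp add: abs_mult)
      also have "\<dots> \<le> \<epsilon> * (1 / 2) * (norm p * norm q)"
        using that e by (intro mult_mono z inner_le mult_nonneg_nonneg) auto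
      also have "\<dots> \<le> \<epsilon> * (1 / 2) * (((norm p)\<^sup>2 + (norm q)\<^sup>2) / 2)"
        using e zero_le_power2[of "norm p - norm q"] by (intro mult_left_mono) (auto simp: power2_diff)
      finally show ?thesis by simp
    qed
    have "\<bar>\<epsilon>\<^sup>2 * (\<xi> / (1 + \<xi>\<^sup>2)) * inner (\<i> * y $ 3) (y $ 2) + \<epsilon> ^ 3 * (\<xi> / (1 + \<xi>\<^sup>2)) * inner (\<i> * y $ 2) (y $ 1)\<bar>
      \<le> \<epsilon> / 4 * ((norm (y $ 3))\<^sup>2 + (norm (y $ 2))\<^sup>2) + \<epsilon> / 4 * ((norm (y $ 2))\<^sup>2 + (norm (y $ 1))\<^sup>2)"
      using *[of "\<epsilon>\<^sup>2"] *[of "\<epsilon> ^ 3"] e2 by (intro order_trans[OF abs_triangle_ineq] add_mono) auto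
    also have "\<dots> \<le> \<epsilon> / 2 * (norm y)\<^sup>2" unfolding N4 using e by (simp add: field_simps)
    finally show ?thesis .
  qed
  have F_lower: "kmin / 4 * (norm y)\<^sup>2 \<le> F \<xi> y" for \<xi> y
  proof -
    have "kmin * (norm y)\<^sup>2 \<le> k1 * (norm (y $ 1))\<^sup>2 + k2 * (norm (y $ 2))\<^sup>2 + k3 * (norm (y $ 3))\<^sup>2 + k4 * (norm (y $ 4))\<^sup>2"
      unfolding N4 distrib_left by (intro add_mono mult_right_mono kmin) auto
    moreover have "\<epsilon> / 2 * (norm y)\<^sup>2 \<le> kmin * (norm y)\<^sup>2 / 4" using mult_right_mono[of "\<epsilon> / 2" "kmin / 4" "(norm y)\<^sup>2"] e by simp
    ultimately have "kmin * (norm y)\<^sup>2 / 4 \<le> F \<xi> y"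
      unfolding F_def by (rule half[OF _ _ comp[of \<xi> y]])
    thus ?thesis by simp
  qed
  have F_upper: "F \<xi> y \<le> (kmax + 1) * (norm y)\<^sup>2" for \<xi> y
  proof -
    have "k1 * (norm (y $ 1))\<^sup>2 + k2 * (norm (y $ 2))\<^sup>2 + k3 * (norm (y $ 3))\<^sup>2 + k4 * (norm (y $ 4))\<^sup>2 \<le> kmax * (norm y)\<^sup>2"
      unfolding N4 distrib_left by (intro add_mono mult_right_mono kmax) auto
    moreover have "\<epsilon> / 2 * (norm y)\<^sup>2 \<le> 1 * (norm y)\<^sup>2" using e by (intro mult_right_mono) auto
    moreover have "0 \<le> kmax * (norm y)\<^sup>2" using kmax by auto
    ultimately show ?thesis unfolding F_def distrib_right by (intro half'[OF _ _ comp[of \<xi> y]])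
  qed
  define E where "E = 4 + 2 / kmin"
  define r where "r = \<kappa> / (kmax + 1)"
  define C1 where "C1 = E\<^sup>2 / kmin"
  have E: "E > 0" and r: "r > 0" using kmin kmax \<kappa> by (auto simp: E_def r_def add_pos_pos)
  have C1: "C1 > 0" using E kmin by (simp add: C1_def)
  define C where "C = max (12 * (kmax + 1) / kmin) (12 * C1 / kmin)"
  show ?thesis
  proof (rule that[of C r])
    show "C > 0" using kmax kmin by (auto simp: C_def less_max_iff_disj)
    show "r > 0" by (rule r)
    fix \<xi> t :: real and y f :: "real \<Rightarrow> complex ^ 4"
    assume t: "0 \<le> t" and cy: "continuous_on {0..t} y" and cf: "continuous_on {0..t} f"
    assume "\<And>s. 0 < s \<Longrightarrow> s < t \<Longrightarrow>
        mode_equations k1 k2 k3 k4 v a b c \<mu> g d \<xi> y f s"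
    note eqs = this[unfolded mode_equations_def]
    note ode = eqs[THEN conjunct1] eqs[THEN conjunct2, THEN conjunct1] eqs[THEN conjunct2, THEN conjunct2, THEN conjunct1]
      eqs[THEN conjunct2, THEN conjunct2, THEN conjunct2]
    let ?z = "\<xi> / (1 + \<xi>\<^sup>2)" and ?w = "damping \<xi>"
    define R1 where "R1 = (\<lambda>s. - \<i> * \<xi> * (v * k1 * y s $ 1 + a * y s $ 2) + f s $ 1)"
    define R2 where "R2 = (\<lambda>s. - \<i> * \<xi> * (a * y s $ 1 + v * k2 * y s $ 2 + b * y s $ 3 + c * y s $ 4) + f s $ 2)"
    define R3 where "R3 = (\<lambda>s. - \<i> * \<xi> * (b * y s $ 2 + v * k3 * y s $ 3) - g * \<mu> * (\<mu> * y s $ 3 - y s $ 4) + f s $ 3)"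
    define R4 where "R4 = (\<lambda>s. - \<i> * \<xi> * (c * y s $ 2 + v * k4 * y s $ 4) + g * (\<mu> * y s $ 3 - y s $ 4) - d * \<xi>\<^sup>2 * y s $ 4 + f s $ 4)"
    have ode': "((\<lambda>s. y s $ 1) has_vector_derivative (1 / k1) *\<^sub>R R1 s) (at s)"
      "((\<lambda>s. y s $ 2) has_vector_derivative (1 / k2) *\<^sub>R R2 s) (at s)"
      "((\<lambda>s. y s $ 3) has_vector_derivative (1 / k3) *\<^sub>R R3 s) (at s)"
      "((\<lambda>s. y s $ 4) has_vector_derivative (1 / k4) *\<^sub>R R4 s) (at s)" if "0 < s" "s < t" for s
      unfolding R1_def R2_def R3_def R4_def using ode that by blast+
    define F' where "F' = (\<lambda>s. inner (y s $ 1) (R1 s) + inner (y s $ 2) (R2 s) + inner (y s $ 3) (R3 s) + inner (y s $ 4) (R4 s)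
      - \<epsilon>\<^sup>2 * ?z * (inner (\<i> * ((1 / k3) *\<^sub>R R3 s)) (y s $ 2) + inner (\<i> * y s $ 3) ((1 / k2) *\<^sub>R R2 s))
      - \<epsilon> ^ 3 * ?z * (inner (\<i> * ((1 / k2) *\<^sub>R R2 s)) (y s $ 1) + inner (\<i> * y s $ 2) ((1 / k1) *\<^sub>R R1 s)))"
    have DF: "((\<lambda>s. F \<xi> (y s)) has_real_derivative F' s) (at s)" if s: "0 < s" "s < t" for s
    proof -
      have sq: "((\<lambda>s. k * (norm (Y s))\<^sup>2) has_real_derivative 2 * inner (Y s) R) (at s)"
        if "(Y has_vector_derivative (1 / k) *\<^sub>R R) (at s)" "k > 0" for Y :: "real \<Rightarrow> complex" and R k
      proof -
        have "((\<lambda>s. inner (Y s) (Y s)) has_vector_derivative (inner (Y s) ((1 / k) *\<^sub>R R) + inner ((1 / k) *\<^sub>R R) (Y s))) (at s)"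
          by (rule bounded_bilinear.has_vector_derivative[OF bounded_bilinear_inner that(1) that(1)])
        hence "((\<lambda>s. (norm (Y s))\<^sup>2) has_real_derivative 2 / k * inner (Y s) R) (at s)"
          by (simp add: has_real_derivative_iff_has_vector_derivative power2_norm_eq_inner inner_commute)
        from DERIV_cmult[OF this, of k] that(2) show ?thesis by simp
      qed
      have cr: "((\<lambda>s. inner (\<i> * Y s) (X s)) has_real_derivative (inner (\<i> * Y') (X s) + inner (\<i> * Y s) X')) (at s)"
        if "(Y has_vector_derivative Y') (at s)" "(X has_vector_derivative X') (at s)" for X Y X' Y'
      proof -
        have "((\<lambda>s. \<i> * Y s) has_vector_derivative \<i> * Y') (at s)"
          by (rule bounded_linear.has_vector_derivative[OF bounded_linear_mult_right that(1)])
        from bounded_bilinear.has_vector_derivative[OF bounded_bilinear_inner this that(2)]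
        show ?thesis by (simp add: has_real_derivative_iff_has_vector_derivative add.commute)
      qed
      have "((\<lambda>s. F \<xi> (y s)) has_real_derivative
         (2 * inner (y s $ 1) (R1 s) + 2 * inner (y s $ 2) (R2 s) + 2 * inner (y s $ 3) (R3 s) + 2 * inner (y s $ 4) (R4 s)) / 2
          - (\<epsilon>\<^sup>2 * ?z * (inner (\<i> * ((1 / k3) *\<^sub>R R3 s)) (y s $ 2) + inner (\<i> * y s $ 3) ((1 / k2) *\<^sub>R R2 s))
          + \<epsilon> ^ 3 * ?z * (inner (\<i> * ((1 / k2) *\<^sub>R R2 s)) (y s $ 1) + inner (\<i> * y s $ 2) ((1 / k1) *\<^sub>R R1 s)))) (at s)"
        unfolding F_def
        by (intro DERIV_diff DERIV_cdivide DERIV_add DERIV_cmult sq cr ode'[OF s] pos)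
      moreover have "(2 * p1 + 2 * p2 + 2 * p3 + 2 * p4) / 2 - (X + Y) = p1 + p2 + p3 + p4 - X - Y" for p1 p2 p3 p4 X Y :: real
        by simp
      ultimately show ?thesis unfolding F'_def by (simp only:)
    qed
    have le: "F' s \<le> - \<kappa> * ?w * (norm (y s))\<^sup>2 + E * (norm (f s) * norm (y s))" for s
    proof -
      let ?q = "\<mu> * y s $ 3 - y s $ 4"
      let ?f1 = "(1 / k1) *\<^sub>R f s $ 1" and ?f2 = "(1 / k2) *\<^sub>R f s $ 2" and ?f3 = "(1 / k3) *\<^sub>R f s $ 3"
      have r1: "(1 / k1) *\<^sub>R R1 s = - \<i> * \<xi> * (v * y s $ 1 + a1 * y s $ 2) + ?f1"
        and r2: "(1 / k2) *\<^sub>R R2 s = - \<i> * \<xi> * (a2 * y s $ 1 + v * y s $ 2 + b2 * y s $ 3 + c2 * y s $ 4) + ?f2"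
        and r3: "(1 / k3) *\<^sub>R R3 s = - \<i> * \<xi> * (b3 * y s $ 2 + v * y s $ 3) - g3 * \<mu> * ?q + ?f3"
        using pos by (auto simp: R1_def R2_def R3_def a1_def a2_def b2_def b3_def c2_def g3_def scaleR_conv_of_real field_simps)
      define er where "er = inner (y s $ 1) (f s $ 1) + inner (y s $ 2) (f s $ 2) + inner (y s $ 3) (f s $ 3) + inner (y s $ 4) (f s $ 4)
        - \<epsilon>\<^sup>2 * ?z * (inner (\<i> * ?f3) (y s $ 2) + inner (\<i> * y s $ 3) ?f2) - \<epsilon> ^ 3 * ?z * (inner (\<i> * ?f2) (y s $ 1) + inner (\<i> * y s $ 2) ?f1)"
      have "F' s = - g * (norm ?q)\<^sup>2 - d * \<xi>\<^sup>2 * (norm (y s $ 4))\<^sup>2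
        + \<epsilon>\<^sup>2 * (- ?w * b3 * (norm (y s $ 2))\<^sup>2 + ?z * (g3 * \<mu>) * inner (\<i> * ?q) (y s $ 2)
           + ?w * (a2 * inner (y s $ 3) (y s $ 1) + b2 * (norm (y s $ 3))\<^sup>2 + c2 * inner (y s $ 3) (y s $ 4)))
        + \<epsilon> ^ 3 * (- ?w * a2 * (norm (y s $ 1))\<^sup>2 - ?w * (b2 * inner (y s $ 3) (y s $ 1) + c2 * inner (y s $ 4) (y s $ 1)) + ?w * a1 * (norm (y s $ 2))\<^sup>2)
        + er"
      proof -
        have alg: "(P + e0) - p2 * z * (x * b3 * N22 - g3 * \<mu> * I1 - x * (a2 * i31 + b2 * N33 + c2 * i34) + x1)
            - p3 * z * (x * (a2 * N11 + b2 * i31 + c2 * i41) - x * a1 * N22 + x2)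
          = P + p2 * (- (z * x) * b3 * N22 + z * (g3 * \<mu>) * I1 + (z * x) * (a2 * i31 + b2 * N33 + c2 * i34))
            + p3 * (- (z * x) * a2 * N11 - (z * x) * (b2 * i31 + c2 * i41) + (z * x) * a1 * N22)
            + (e0 - p2 * z * x1 - p3 * z * x2)"
          for P e0 p2 p3 z x N11 N22 N33 I1 i31 i34 i41 x1 x2 :: real
          by (simp add: algebra_simps)
        show ?thesis
          unfolding F'_def r1 r2 r3 compensator_identity_32 compensator_identity_21 er_def z(3)[symmetric]
          unfolding R1_def R2_def R3_def R4_def energy_identity
          by (rule alg)
      qed
      also have "\<dots> \<le> - g * (norm ?q)\<^sup>2 - d * \<xi>\<^sup>2 * (norm (y s $ 4))\<^sup>2
        + \<epsilon>\<^sup>2 * (- ?w * b3 * (norm (y s $ 2))\<^sup>2 + \<bar>?z\<bar> * (g3 * \<mu>) * (norm ?q * norm (y s $ 2))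
           + ?w * (a2 * (norm (y s $ 3) * norm (y s $ 1)) + b2 * (norm (y s $ 3))\<^sup>2 + \<bar>c2\<bar> * (norm (y s $ 3) * norm (y s $ 4))))
        + \<epsilon> ^ 3 * (- ?w * a2 * (norm (y s $ 1))\<^sup>2 + ?w * (b2 * (norm (y s $ 3) * norm (y s $ 1)) + \<bar>c2\<bar> * (norm (y s $ 4) * norm (y s $ 1))) + ?w * a1 * (norm (y s $ 2))\<^sup>2)
        + E * (norm (f s) * norm (y s))"
      proof -
        have ab: "p * q \<le> P * Q" if "\<bar>p\<bar> \<le> P" "\<bar>q\<bar> \<le> Q" for p q P Q :: real
        proof -
          have "p * q \<le> \<bar>p\<bar> * \<bar>q\<bar>" by (simp flip: abs_mult)
          also have "\<dots> \<le> P * Q" using that by (intro mult_mono) auto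
          finally show ?thesis .
        qed
        have 1: "?z * (g3 * \<mu>) * inner (\<i> * ?q) (y s $ 2) \<le> \<bar>?z\<bar> * (g3 * \<mu>) * (norm ?q * norm (y s $ 2))"
          using cpos pos by (intro ab inner_le) (auto simp: abs_mult)
        have 2: "a2 * inner (y s $ 3) (y s $ 1) \<le> a2 * (norm (y s $ 3) * norm (y s $ 1))"
          using cpos by (intro ab inner_le) auto
        have 3: "c2 * inner (y s $ 3) (y s $ 4) \<le> \<bar>c2\<bar> * (norm (y s $ 3) * norm (y s $ 4))"
          by (intro ab inner_le) auto
        have 4: "- (b2 * inner (y s $ 3) (y s $ 1) + c2 * inner (y s $ 4) (y s $ 1))
            \<le> b2 * (norm (y s $ 3) * norm (y s $ 1)) + \<bar>c2\<bar> * (norm (y s $ 4) * norm (y s $ 1))"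
        proof -
          have "- b2 * inner (y s $ 3) (y s $ 1) \<le> b2 * (norm (y s $ 3) * norm (y s $ 1))"
            using cpos by (intro ab inner_le) auto
          moreover have "- c2 * inner (y s $ 4) (y s $ 1) \<le> \<bar>c2\<bar> * (norm (y s $ 4) * norm (y s $ 1))"
            by (intro ab inner_le) auto
          ultimately show ?thesis by simp
        qed
        have 5: "er \<le> E * (norm (f s) * norm (y s))"
        proof -
          have n: "norm (f s $ i) * norm (y s $ j) \<le> norm (f s) * norm (y s)" for i j
            by (intro mult_mono Finite_Cartesian_Product.norm_nth_le) auto
          have i: "inner (y s $ i) (f s $ i) \<le> norm (f s) * norm (y s)" for i
            using inner_le(2)[of "y s $ i" "f s $ i"] n[of i i] by (simp add: mult.commute)
          have j: "\<bar>inner (\<i> * ((1 / k) *\<^sub>R f s $ i)) (y s $ j)\<bar> \<le> 1 / kmin * (norm (f s) * norm (y s))"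
            "\<bar>inner (\<i> * y s $ j) ((1 / k) *\<^sub>R f s $ i)\<bar> \<le> 1 / kmin * (norm (f s) * norm (y s))" if "kmin \<le> k" for k i j
          proof -
            have k: "0 < k" "1 / k \<le> 1 / kmin" using that kmin by (auto simp: frac_le)
            have "norm ((1 / k) *\<^sub>R f s $ i) * norm (y s $ j) = 1 / k * (norm (f s $ i) * norm (y s $ j))" using k by simp
            also have "\<dots> \<le> 1 / kmin * (norm (f s) * norm (y s))" using k kmin by (intro mult_mono n) auto
            finally have "norm ((1 / k) *\<^sub>R f s $ i) * norm (y s $ j) \<le> 1 / kmin * (norm (f s) * norm (y s))" .
            thus "\<bar>inner (\<i> * ((1 / k) *\<^sub>R f s $ i)) (y s $ j)\<bar> \<le> 1 / kmin * (norm (f s) * norm (y s))"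
              "\<bar>inner (\<i> * y s $ j) ((1 / k) *\<^sub>R f s $ i)\<bar> \<le> 1 / kmin * (norm (f s) * norm (y s))"
              using inner_le(1)[of "(1 / k) *\<^sub>R f s $ i" "y s $ j"] inner_le(1)[of "y s $ j" "(1 / k) *\<^sub>R f s $ i"]
              by (auto simp: mult.commute)
          qed
          have ez: "\<bar>\<epsilon>\<^sup>2 * ?z\<bar> \<le> 1 / 2" "\<bar>\<epsilon> ^ 3 * ?z\<bar> \<le> 1 / 2"
            using z(1)[of \<xi>] e2 mult_mono[of "\<epsilon>\<^sup>2" 1 "\<bar>?z\<bar>" "1/2"] mult_mono[of "\<epsilon> ^ 3" 1 "\<bar>?z\<bar>" "1/2"]
            by (auto simp: abs_mult)
          define Y where "Y = 1 / kmin * (norm (f s) * norm (y s))"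
          have Y: "E * (norm (f s) * norm (y s)) = 4 * (norm (f s) * norm (y s)) + 2 * Y"
            by (simp add: E_def Y_def distrib_right)
          have two: "\<bar>p + q\<bar> \<le> 2 * Y" if "\<bar>p\<bar> \<le> Y" "\<bar>q\<bar> \<le> Y" for p q using that by linarith
          have x1: "- (\<epsilon>\<^sup>2 * ?z) * (inner (\<i> * ?f3) (y s $ 2) + inner (\<i> * y s $ 3) ?f2) \<le> 1 / 2 * (2 * Y)"
            by (rule ab[OF _ two[OF j(1)[OF kmin(4), of 3 2, folded Y_def] j(2)[OF kmin(3), of 3 2, folded Y_def]]])
               (use ez in \<open>simp only: abs_minus_cancel\<close>)
          have x2: "- (\<epsilon> ^ 3 * ?z) * (inner (\<i> * ?f2) (y s $ 1) + inner (\<i> * y s $ 2) ?f1) \<le> 1 / 2 * (2 * Y)"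
            by (rule ab[OF _ two[OF j(1)[OF kmin(3), of 2 1, folded Y_def] j(2)[OF kmin(2), of 2 1, folded Y_def]]])
               (use ez in \<open>simp only: abs_minus_cancel\<close>)
          have fin: "i1 + i2 + i3 + i4 - p * q - p' * q' \<le> 4 * N + 2 * Y"
            if "i1 \<le> N" "i2 \<le> N" "i3 \<le> N" "i4 \<le> N" "- p * q \<le> 1 / 2 * (2 * Y)" "- p' * q' \<le> 1 / 2 * (2 * Y)"
            for i1 i2 i3 i4 p q p' q' N :: real
            using that by simp
          show ?thesis unfolding er_def Y by (intro fin i x1 x2)
        qed
        have 6: "- ?w * a2 * (norm (y s $ 1))\<^sup>2 - ?w * (b2 * inner (y s $ 3) (y s $ 1) + c2 * inner (y s $ 4) (y s $ 1))
            \<le> - ?w * a2 * (norm (y s $ 1))\<^sup>2 + ?w * (b2 * (norm (y s $ 3) * norm (y s $ 1)) + \<bar>c2\<bar> * (norm (y s $ 4) * norm (y s $ 1)))"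
        proof -
          have sub: "p - X \<le> p + Y" if "- X \<le> Y" for p X Y :: real using that by linarith
          show ?thesis
            by (rule sub) (use mult_left_mono[OF 4 damping_bounds(1)[of \<xi>]] in \<open>simp only: mult_minus_right\<close>)
        qed
        show ?thesis
          by (intro add_mono mult_left_mono order_refl 1 2 3 5 6 e2 damping_bounds)
      qed
      also have "\<dots> \<le> - \<kappa> * ?w * ((norm (y s $ 1))\<^sup>2 + (norm (y s $ 2))\<^sup>2 + (norm (y s $ 3))\<^sup>2 + (norm (y s $ 4))\<^sup>2) + E * (norm (f s) * norm (y s))"
      proof (intro add_right_mono diss)
        have "norm (\<mu> * y s $ 3) \<le> norm ?q + norm (y s $ 4)" using norm_triangle_ineq[of ?q "y s $ 4"] by simp
        thus "\<mu> * norm (y s $ 3) \<le> norm ?q + norm (y s $ 4)" using pos by (simp add: norm_mult)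
        show "\<bar>?z\<bar>\<^sup>2 \<le> ?w" unfolding power2_abs by (rule z(2))
      qed (use damping_bounds in auto)
      finally show ?thesis by (simp add: N4)
    qed
    (* The forcing is absorbed into a fraction 1/(1+t) of the energy: over the interval of length t
       this costs a bounded factor, and only a factor 1 + t in front of the forcing. *)
    define \<delta> where "\<delta> = 1 / (1 + t)"
    have \<delta>: "\<delta> > 0" "\<delta> * t \<le> 1" "1 / \<delta> = 1 + t" using t by (auto simp: \<delta>_def field_simps)
    have le': "F' s \<le> - (r * ?w - \<delta>) * F \<xi> (y s) + C1 * (1 + t) * (norm (f s))\<^sup>2" for s
    proof -
      have "r * F \<xi> (y s) \<le> r * ((kmax + 1) * (norm (y s))\<^sup>2)" using r by (intro mult_left_mono F_upper) auto
      also have "\<dots> = \<kappa> * (norm (y s))\<^sup>2" using kmax by (simp add: r_def)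
      finally have A: "?w * (r * F \<xi> (y s)) \<le> ?w * (\<kappa> * (norm (y s))\<^sup>2)" by (intro mult_left_mono damping_bounds)
      have "norm (y s) * (E * norm (f s)) \<le> \<delta> * (kmin / 4) * (norm (y s))\<^sup>2 + (E * norm (f s))\<^sup>2 / (4 * (\<delta> * (kmin / 4)))"
        by (rule young) (use \<delta> kmin in auto)
      also have "(E * norm (f s))\<^sup>2 / (4 * (\<delta> * (kmin / 4))) = C1 * (1 + t) * (norm (f s))\<^sup>2"
        unfolding \<delta>(3)[symmetric] C1_def by (simp add: power_mult_distrib mult_ac)
      finally have B: "norm (y s) * (E * norm (f s)) \<le> \<delta> * (kmin / 4) * (norm (y s))\<^sup>2 + C1 * (1 + t) * (norm (f s))\<^sup>2" .
      have D: "\<delta> * (kmin / 4 * (norm (y s))\<^sup>2) \<le> \<delta> * F \<xi> (y s)" using \<delta> by (intro mult_left_mono F_lower) auto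
      have "L \<le> - (r * w - \<delta>) * Fv + G"
        if "w * (r * Fv) \<le> w * (\<kappa> * Y)" "n * (E * m) \<le> \<delta> * (kmin / 4) * Y + G" "\<delta> * (kmin / 4 * Y) \<le> \<delta> * Fv"
          "L \<le> - \<kappa> * w * Y + E * (m * n)" for L w Fv Y n m G :: real
        using that by (simp add: algebra_simps)
      from this[OF A B D le] show ?thesis .
    qed
    have "F \<xi> (y t) \<le> exp (\<delta> * t) * (exp (- (r * ?w) * t) * F \<xi> (y 0) + integral {0..t} (\<lambda>s. C1 * (1 + t) * (norm (f s))\<^sup>2))"
    proof (rule gronwall_decay[where F = "\<lambda>s. F \<xi> (y s)" and F' = F' and G = "\<lambda>s. C1 * (1 + t) * (norm (f s))\<^sup>2"
          and r = "r * ?w" and \<delta> = \<delta> and t = t])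
      show "((\<lambda>s. F \<xi> (y s)) has_real_derivative F' s) (at s)" if "0 < s" "s < t" for s by (rule DF[OF that])
      show "F' s \<le> - (r * ?w - \<delta>) * F \<xi> (y s) + C1 * (1 + t) * (norm (f s))\<^sup>2" for s by (rule le')
      show "0 \<le> t" by (rule t)
      have cyi: "continuous_on {0..t} (\<lambda>s. y s $ i)" for i by (intro continuous_on_component cy)
      show "continuous_on {0..t} (\<lambda>s. F \<xi> (y s))" unfolding F_def
        by (intro continuous_on_diff continuous_on_add continuous_on_divide continuous_on_mult continuous_on_const
            continuous_on_inner continuous_on_power continuous_on_norm cyi) simp
      show "continuous_on {0..t} (\<lambda>s. C1 * (1 + t) * (norm (f s))\<^sup>2)" by (intro continuous_intros cf)
      show "0 \<le> C1 * (1 + t) * (norm (f s))\<^sup>2" for s using C1 t by simp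
      show "0 \<le> r * ?w" using r damping_bounds by simp
    qed (use \<delta> in auto)
    also have "integral {0..t} (\<lambda>s. C1 * (1 + t) * (norm (f s))\<^sup>2) = C1 * (1 + t) * integral {0..t} (\<lambda>s. (norm (f s))\<^sup>2)" by simp
    finally have 1: "F \<xi> (y t) \<le> exp (\<delta> * t) * (exp (- (r * ?w) * t) * F \<xi> (y 0) + C1 * (1 + t) * integral {0..t} (\<lambda>s. (norm (f s))\<^sup>2))" .
    define I where "I = integral {0..t} (\<lambda>s. (norm (f s))\<^sup>2)"
    have I0: "I \<ge> 0" unfolding I_def
      by (intro Henstock_Kurzweil_Integration.integral_nonneg integrable_continuous_real continuous_intros cf) auto
    have "exp (\<delta> * t) \<le> exp 1" using \<delta> by simp
    hence ex: "exp (\<delta> * t) \<le> 3" using exp_le by linarith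
    have "kmin / 4 * (norm (y t))\<^sup>2 \<le> exp (\<delta> * t) * (exp (- (r * ?w) * t) * F \<xi> (y 0) + C1 * (1 + t) * I)"
      using F_lower[of "y t" \<xi>] 1 by (simp add: I_def)
    also have "\<dots> \<le> 3 * (exp (- (r * ?w) * t) * ((kmax + 1) * (norm (y 0))\<^sup>2) + C1 * (1 + t) * I)"
      using ex I0 C1 t order_trans[OF _ F_lower[of "y 0" \<xi>], of 0] kmin
      by (intro mult_mono add_mono mult_left_mono F_upper) auto
    finally have "(norm (y t))\<^sup>2 \<le> 4 / kmin * (3 * (exp (- (r * ?w) * t) * ((kmax + 1) * (norm (y 0))\<^sup>2) + C1 * (1 + t) * I))"
      using kmin by (simp add: field_simps)
    also have "\<dots> = 12 * (kmax + 1) / kmin * (exp (- (r * ?w) * t) * (norm (y 0))\<^sup>2) + 12 * C1 / kmin * ((1 + t) * I)"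
      using kmin by (simp add: field_simps)
    also have "\<dots> \<le> C * (exp (- (r * ?w) * t) * (norm (y 0))\<^sup>2) + C * ((1 + t) * I)"
      using I0 t by (intro add_mono mult_right_mono) (auto simp: C_def)
    finally show "(norm (y t))\<^sup>2 \<le> C * (exp (- r * ?w * t) * (norm (y 0))\<^sup>2 + (1 + t) * integral {0..t} (\<lambda>s. (norm (f s))\<^sup>2))"
      by (simp add: I_def distrib_left)
  qed
qed

section \<open>The windowed equation\<close>

lemma test_function_times_L2_integrable:
  assumes "test_function \<phi>" "square_integrable (u::real\<Rightarrow>real)"
  shows "integrable lborel (\<lambda>x. \<phi> x * u x)"
  using test_function_scaleR_integrable[OF assms(1) square_integrable_locally_integrable[OF assms(2)]] by simp

lemma square_integrable_matrix_vector:
  fixes Z :: "real \<Rightarrow> real ^ 'n"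
  assumes "square_integrable Z" shows "square_integrable (\<lambda>x. (A :: real ^ 'n ^ 'n) *v Z x)"
proof -
  obtain K where K: "K > 0" "\<And>z. norm (A *v z) \<le> norm z * K"
    using bounded_linear.pos_bounded[OF matrix_vector_mul_bounded_linear[of A]] by auto
  show ?thesis
  proof (rule square_integrable_bound)
    show "integrable lborel (\<lambda>x. K\<^sup>2 * (norm (Z x))\<^sup>2)" using square_integrable_sq[OF assms] by simp
    show "(\<lambda>x. A *v Z x) \<in> borel_measurable borel"
      using measurable_compose[OF square_integrable_measurable[OF assms], of "(*v) A"]
        borel_measurable_continuous_onI[OF linear_continuous_on[OF matrix_vector_mul_bounded_linear[of A]]] by simp
    show "(norm (A *v Z x))\<^sup>2 \<le> K\<^sup>2 * (norm (Z x))\<^sup>2" for x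
      using power_mono[OF K(2) norm_ge_zero, of "Z x" 2] by (simp add: power_mult_distrib mult.commute)
  qed
qed

lemma FT1_of_real_product:
  assumes i: "integrable lborel (\<lambda>x. h x * u x)"
  shows "FT1 (\<lambda>x. complex_of_real (h x * u x)) \<xi>
    = of_real (\<integral>x. h x * cos (\<xi> * x) * u x \<partial>lborel) - \<i> * of_real (\<integral>x. h x * sin (\<xi> * x) * u x \<partial>lborel)"
proof -
  have m: "(\<lambda>x. h x * u x) \<in> borel_measurable borel" using i by auto
  have c: "integrable lborel (\<lambda>x. h x * cos (\<xi> * x) * u x)"
  proof (rule Bochner_Integration.integrable_bound[OF i])
    have "(\<lambda>x. (h x * u x) * cos (\<xi> * x)) \<in> borel_measurable borel" using m by measurable
    thus "(\<lambda>x. h x * cos (\<xi> * x) * u x) \<in> borel_measurable lborel" by (simp add: mult_ac)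
    have "\<bar>h x * u x\<bar> * \<bar>cos (\<xi> * x)\<bar> \<le> \<bar>h x * u x\<bar>" for x by (intro mult_left_le) auto
    thus "AE x in lborel. norm (h x * cos (\<xi> * x) * u x) \<le> norm (h x * u x)" by (simp add: abs_mult mult_ac)
  qed
  have s: "integrable lborel (\<lambda>x. h x * sin (\<xi> * x) * u x)"
  proof (rule Bochner_Integration.integrable_bound[OF i])
    have "(\<lambda>x. (h x * u x) * sin (\<xi> * x)) \<in> borel_measurable borel" using m by measurable
    thus "(\<lambda>x. h x * sin (\<xi> * x) * u x) \<in> borel_measurable lborel" by (simp add: mult_ac)
    have "\<bar>h x * u x\<bar> * \<bar>sin (\<xi> * x)\<bar> \<le> \<bar>h x * u x\<bar>" for x by (intro mult_left_le) auto
    thus "AE x in lborel. norm (h x * sin (\<xi> * x) * u x) \<le> norm (h x * u x)" by (simp add: abs_mult mult_ac)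
  qed
  have "FT1 (\<lambda>x. complex_of_real (h x * u x)) \<xi>
      = (\<integral>x. of_real (h x * cos (\<xi> * x) * u x) - \<i> * of_real (h x * sin (\<xi> * x) * u x) \<partial>lborel)"
    unfolding FT1_def by (intro Bochner_Integration.integral_cong) (auto simp: complex_eq_iff mult_ac)
  also have "\<dots> = (\<integral>x. complex_of_real (h x * cos (\<xi> * x) * u x) \<partial>lborel) - (\<integral>x. \<i> * of_real (h x * sin (\<xi> * x) * u x) \<partial>lborel)"
    using c s by (intro Bochner_Integration.integral_diff integrable_mult_right) (simp_all only: complex_of_real_integrable_eq)
  finally show ?thesis by (simp only: integral_mult_right_zero integral_complex_of_real)
qed

lemma test_function_cos_sin:
  assumes "test_function h"
  shows "test_function (\<lambda>x. h x * cos (\<xi> * x))" "test_function (\<lambda>x. h x * sin (\<xi> * x))"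
  using test_function_mult_smooth[OF assms smooth_on_cos_sin[of 1 \<xi> 0]]
    test_function_mult_smooth[OF assms smooth_on_cos_sin[of 0 \<xi> 1]] by simp_all

lemma deriv_cos_sin:
  assumes "test_function h"
  shows "deriv (\<lambda>x. h x * cos (\<xi> * x)) = (\<lambda>x. deriv h x * cos (\<xi> * x) - \<xi> * (h x * sin (\<xi> * x)))"
    "deriv (\<lambda>x. h x * sin (\<xi> * x)) = (\<lambda>x. deriv h x * sin (\<xi> * x) + \<xi> * (h x * cos (\<xi> * x)))"
  by (rule ext, rule DERIV_imp_deriv, auto intro!: derivative_eq_intros test_function_DERIV[OF assms])+

lemma deriv_deriv_cos_sin:
  assumes h: "test_function h"
  shows "deriv (deriv (\<lambda>x. h x * cos (\<xi> * x))) = (\<lambda>x. deriv (deriv h) x * cos (\<xi> * x)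
      - 2 * \<xi> * (deriv h x * sin (\<xi> * x)) - \<xi>\<^sup>2 * (h x * cos (\<xi> * x)))"
    "deriv (deriv (\<lambda>x. h x * sin (\<xi> * x))) = (\<lambda>x. deriv (deriv h) x * sin (\<xi> * x)
      + 2 * \<xi> * (deriv h x * cos (\<xi> * x)) - \<xi>\<^sup>2 * (h x * sin (\<xi> * x)))"
  unfolding deriv_cos_sin[OF h]
  by (rule ext, rule DERIV_imp_deriv,
      auto intro!: derivative_eq_intros test_function_DERIV[OF h] test_function_DERIV[OF test_function_deriv[OF h]]
        simp: power2_eq_square algebra_simps)+

text \<open>Test functions are real, so the complex window \<open>h(x) e\<^sup>-\<^sup>i\<^sup>x\<^sup>\<xi>\<close> is tested through its real and imaginary parts.
The formulas are the product rule: every derivative falls on the exponential, as a factor \<open>-i \<xi>\<close>, or on \<open>h\<close>.\<close>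

lemma window_pairing:
  fixes u :: "real \<Rightarrow> real" and \<xi> :: real
  assumes h: "test_function h" and u: "square_integrable u"
  defines "W \<equiv> \<lambda>h. FT1 (\<lambda>x. complex_of_real (h x * u x)) \<xi>"
    and "c \<equiv> \<lambda>x. h x * cos (\<xi> * x)" and "s \<equiv> \<lambda>x. h x * sin (\<xi> * x)"
  shows "of_real (\<integral>x. c x * u x \<partial>lborel) - \<i> * of_real (\<integral>x. s x * u x \<partial>lborel) = W h"
    "of_real (\<integral>x. deriv c x * u x \<partial>lborel) - \<i> * of_real (\<integral>x. deriv s x * u x \<partial>lborel)
      = W (deriv h) - \<i> * of_real \<xi> * W h"
    "of_real (\<integral>x. deriv (deriv c) x * u x \<partial>lborel) - \<i> * of_real (\<integral>x. deriv (deriv s) x * u x \<partial>lborel)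
      = W (deriv (deriv h)) - 2 * \<i> * of_real \<xi> * W (deriv h) - of_real (\<xi>\<^sup>2) * W h"
proof -
  note h1 = test_function_deriv[OF h] and h2 = test_function_deriv[OF test_function_deriv[OF h]]
  have Weq: "W h = of_real (\<integral>x. h x * cos (\<xi> * x) * u x \<partial>lborel) - \<i> * of_real (\<integral>x. h x * sin (\<xi> * x) * u x \<partial>lborel)"
    if "test_function h" for h
    unfolding W_def by (rule FT1_of_real_product[OF test_function_times_L2_integrable[OF that u]])
  note ci = test_function_times_L2_integrable[OF test_function_cos_sin(1)[OF h] u, of \<xi>]
    test_function_times_L2_integrable[OF test_function_cos_sin(1)[OF h1] u, of \<xi>]
    test_function_times_L2_integrable[OF test_function_cos_sin(1)[OF h2] u, of \<xi>]
  note si = test_function_times_L2_integrable[OF test_function_cos_sin(2)[OF h] u, of \<xi>]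
    test_function_times_L2_integrable[OF test_function_cos_sin(2)[OF h1] u, of \<xi>]
    test_function_times_L2_integrable[OF test_function_cos_sin(2)[OF h2] u, of \<xi>]
  show "of_real (\<integral>x. c x * u x \<partial>lborel) - \<i> * of_real (\<integral>x. s x * u x \<partial>lborel) = W h"
    unfolding c_def s_def by (rule Weq[OF h, symmetric])
  have 1: "(\<integral>x. deriv c x * u x \<partial>lborel) = (\<integral>x. deriv h x * cos (\<xi> * x) * u x \<partial>lborel) - \<xi> * (\<integral>x. h x * sin (\<xi> * x) * u x \<partial>lborel)"
  proof -
    have "(\<integral>x. deriv c x * u x \<partial>lborel) = (\<integral>x. deriv h x * cos (\<xi> * x) * u x - \<xi> * (h x * sin (\<xi> * x) * u x) \<partial>lborel)"
      unfolding c_def deriv_cos_sin[OF h] by (simp add: algebra_simps)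
    thus ?thesis using ci(2) si(1) by simp
  qed
  have 2: "(\<integral>x. deriv s x * u x \<partial>lborel) = (\<integral>x. deriv h x * sin (\<xi> * x) * u x \<partial>lborel) + \<xi> * (\<integral>x. h x * cos (\<xi> * x) * u x \<partial>lborel)"
  proof -
    have "(\<integral>x. deriv s x * u x \<partial>lborel) = (\<integral>x. deriv h x * sin (\<xi> * x) * u x + \<xi> * (h x * cos (\<xi> * x) * u x) \<partial>lborel)"
      unfolding s_def deriv_cos_sin[OF h] by (simp add: algebra_simps)
    thus ?thesis using ci(1) si(2) by simp
  qed
  show "of_real (\<integral>x. deriv c x * u x \<partial>lborel) - \<i> * of_real (\<integral>x. deriv s x * u x \<partial>lborel)
      = W (deriv h) - \<i> * of_real \<xi> * W h"
    unfolding 1 2 Weq[OF h] Weq[OF h1] by (simp add: complex_eq_iff)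
  have 3: "(\<integral>x. deriv (deriv c) x * u x \<partial>lborel) = (\<integral>x. deriv (deriv h) x * cos (\<xi> * x) * u x \<partial>lborel)
      - 2 * \<xi> * (\<integral>x. deriv h x * sin (\<xi> * x) * u x \<partial>lborel) - \<xi>\<^sup>2 * (\<integral>x. h x * cos (\<xi> * x) * u x \<partial>lborel)"
  proof -
    have "(\<integral>x. deriv (deriv c) x * u x \<partial>lborel) = (\<integral>x. deriv (deriv h) x * cos (\<xi> * x) * u x
        - 2 * \<xi> * (deriv h x * sin (\<xi> * x) * u x) - \<xi>\<^sup>2 * (h x * cos (\<xi> * x) * u x) \<partial>lborel)"
      unfolding c_def deriv_deriv_cos_sin[OF h] by (simp add: algebra_simps)
    thus ?thesis using ci si by simp
  qed
  have 4: "(\<integral>x. deriv (deriv s) x * u x \<partial>lborel) = (\<integral>x. deriv (deriv h) x * sin (\<xi> * x) * u x \<partial>lborel)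
      + 2 * \<xi> * (\<integral>x. deriv h x * cos (\<xi> * x) * u x \<partial>lborel) - \<xi>\<^sup>2 * (\<integral>x. h x * sin (\<xi> * x) * u x \<partial>lborel)"
  proof -
    have "(\<integral>x. deriv (deriv s) x * u x \<partial>lborel) = (\<integral>x. deriv (deriv h) x * sin (\<xi> * x) * u x
        + 2 * \<xi> * (deriv h x * cos (\<xi> * x) * u x) - \<xi>\<^sup>2 * (h x * sin (\<xi> * x) * u x) \<partial>lborel)"
      unfolding s_def deriv_deriv_cos_sin[OF h] by (simp add: algebra_simps)
    thus ?thesis using ci si by simp
  qed
  show "of_real (\<integral>x. deriv (deriv c) x * u x \<partial>lborel) - \<i> * of_real (\<integral>x. deriv (deriv s) x * u x \<partial>lborel)
      = W (deriv (deriv h)) - 2 * \<i> * of_real \<xi> * W (deriv h) - of_real (\<xi>\<^sup>2) * W h"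
    unfolding 3 4 Weq[OF h] Weq[OF h1] Weq[OF h2] by (simp add: complex_eq_iff algebra_simps)
qed

text \<open>The left multiplication by \<open>N\<close> and the choice of a component are continuous linear maps and commute with the
integral and the time derivative.\<close>

lemma weak_form_transformed:
  fixes Z :: "real \<Rightarrow> real \<Rightarrow> real ^ 'n" and N :: "real ^ 'n ^ 'n" and i :: 'n
  assumes sol: "cauchy_solution r A0 A1 L B Z0 Z" and t: "t > 0" and \<phi>: "test_function \<phi>"
  shows "((\<lambda>\<tau>. \<integral>x. \<phi> x * ((N ** A0) *v Z \<tau> x) $ i \<partial>lborel) has_real_derivative
     (\<integral>x. deriv \<phi> x * ((N ** A1) *v Z t x) $ i \<partial>lborel) - (\<integral>x. \<phi> x * ((N ** L) *v Z t x) $ i \<partial>lborel)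
       + (\<integral>x. deriv (deriv \<phi>) x * ((N ** B) *v Z t x) $ i \<partial>lborel)) (at t)"
proof -
  have sZ: "square_integrable (Z \<tau>)" if "\<tau> \<ge> 0" for \<tau>
    using sol that unfolding cauchy_solution_def by (blast intro: sobolev_square_integrable)
  note \<phi>1 = test_function_deriv[OF \<phi>] and \<phi>2 = test_function_deriv[OF test_function_deriv[OF \<phi>]]
  have int: "integrable lborel (\<lambda>x. \<psi> x *\<^sub>R (A *v Z \<tau> x))" if "test_function \<psi>" "\<tau> \<ge> 0" for \<psi> \<tau> and A :: "real ^ 'n ^ 'n"
    by (rule test_function_scaleR_integrable[OF that(1) square_integrable_locally_integrable[OF square_integrable_matrix_vector[OF sZ[OF that(2)]]]])
  have bl: "bounded_linear (\<lambda>X. (N *v X) $ i)"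
    by (rule bounded_linear_compose[OF bounded_linear_vec_nth matrix_vector_mul_bounded_linear])
  have pull: "(N *v (\<integral>x. F x \<partial>lborel)) $ i = (\<integral>x. (N *v F x) $ i \<partial>lborel)" if "integrable lborel F" for F :: "real \<Rightarrow> real ^ 'n"
    by (rule integral_bounded_linear[OF bl that, symmetric])
  let ?D = "\<integral>x. deriv \<phi> x *\<^sub>R (A1 *v Z t x) - \<phi> x *\<^sub>R (L *v Z t x) + deriv (deriv \<phi>) x *\<^sub>R (B *v Z t x) \<partial>lborel"
  have "((\<lambda>\<tau>. \<integral>x. \<phi> x *\<^sub>R (A0 *v Z \<tau> x) \<partial>lborel) has_vector_derivative ?D) (at t)"
    using sol t \<phi> unfolding cauchy_solution_def by blast
  from bounded_linear.has_vector_derivative[OF bl this]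
  have D: "((\<lambda>\<tau>. (N *v (\<integral>x. \<phi> x *\<^sub>R (A0 *v Z \<tau> x) \<partial>lborel)) $ i) has_real_derivative (N *v ?D) $ i) (at t)"
    by (simp add: has_real_derivative_iff_has_vector_derivative)
  have comp: "(N *v (c *\<^sub>R (A *v z))) $ i = c * ((N ** A) *v z) $ i" for c z and A :: "real ^ 'n ^ 'n"
    by (simp add: matrix_vector_mult_scaleR matrix_vector_mul_assoc)
  have lhs: "(N *v (\<integral>x. \<phi> x *\<^sub>R (A0 *v Z \<tau> x) \<partial>lborel)) $ i = (\<integral>x. \<phi> x * ((N ** A0) *v Z \<tau> x) $ i \<partial>lborel)" if "\<tau> \<ge> 0" for \<tau>
    by (simp only: pull[OF int[OF \<phi> that]] comp)
  have isplit: "integrable lborel (\<lambda>x. \<psi> x * ((N ** A) *v Z t x) $ i)" if "test_function \<psi>" for \<psi> and A :: "real ^ 'n ^ 'n"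
    using integrable_bounded_linear[OF bl int[OF that, of t A]] t by (simp only: comp less_imp_le)
  have "(N *v ?D) $ i = (\<integral>x. (N *v (deriv \<phi> x *\<^sub>R (A1 *v Z t x) - \<phi> x *\<^sub>R (L *v Z t x) + deriv (deriv \<phi>) x *\<^sub>R (B *v Z t x))) $ i \<partial>lborel)"
    using t by (intro pull Bochner_Integration.integrable_add Bochner_Integration.integrable_diff int \<phi> \<phi>1 \<phi>2) auto
  also have "\<dots> = (\<integral>x. deriv \<phi> x * ((N ** A1) *v Z t x) $ i - \<phi> x * ((N ** L) *v Z t x) $ i + deriv (deriv \<phi>) x * ((N ** B) *v Z t x) $ i \<partial>lborel)"
    by (simp only: matrix_vector_right_distrib matrix_vector_mult_diff_distrib vector_add_component vector_minus_component comp)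
  also have "\<dots> = (\<integral>x. deriv \<phi> x * ((N ** A1) *v Z t x) $ i \<partial>lborel) - (\<integral>x. \<phi> x * ((N ** L) *v Z t x) $ i \<partial>lborel)
       + (\<integral>x. deriv (deriv \<phi>) x * ((N ** B) *v Z t x) $ i \<partial>lborel)"
    using isplit[OF \<phi>] isplit[OF \<phi>1] isplit[OF \<phi>2] by simp
  finally have rhs: "(N *v ?D) $ i = \<dots>" .
  show ?thesis
    by (rule has_field_derivative_transform_within_open[OF D[unfolded rhs], of "{0<..}"])
       (use t lhs in auto)
qed

text \<open>For \<open>h = 1\<close> this would be the mode equation itself; the terms with \<open>deriv h\<close> are the error of the window.\<close>

lemma windowed_mode:
  fixes Z :: "real \<Rightarrow> real \<Rightarrow> real ^ 'n" and \<xi> :: real and N :: "real ^ 'n ^ 'n" and i :: 'n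
  assumes sol: "cauchy_solution r A0 A1 L B Z0 Z" and t: "t > 0" and h: "test_function h"
  defines "W \<equiv> \<lambda>h A \<tau> i. FT1 (\<lambda>x. complex_of_real (h x * (A *v Z \<tau> x) $ i)) \<xi>"
  shows "((\<lambda>\<tau>. W h (N ** A0) \<tau> i) has_vector_derivative
    (W (deriv h) (N ** A1) t i - \<i> * of_real \<xi> * W h (N ** A1) t i) - W h (N ** L) t i
     + (W (deriv (deriv h)) (N ** B) t i - 2 * \<i> * of_real \<xi> * W (deriv h) (N ** B) t i - of_real (\<xi>\<^sup>2) * W h (N ** B) t i)) (at t)"
proof -
  have sZ: "square_integrable (Z \<tau>)" if "\<tau> \<ge> 0" for \<tau>
    using sol that unfolding cauchy_solution_def by (blast intro: sobolev_square_integrable)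
  have su: "square_integrable (\<lambda>x. (A *v Z \<tau> x) $ i)" if "\<tau> \<ge> 0" for A :: "real ^ 'n ^ 'n" and \<tau>
    using square_integrable_matrix_vector[OF sZ[OF that], of A] by (simp add: square_integrable_vec_iff)
  let ?c = "\<lambda>x. h x * cos (\<xi> * x)" and ?s = "\<lambda>x. h x * sin (\<xi> * x)"
  let ?P = "\<lambda>\<phi> A \<tau>. \<integral>x. \<phi> x * (A *v Z \<tau> x) $ i \<partial>lborel"
  let ?R = "\<lambda>\<phi>. ?P (deriv \<phi>) (N ** A1) t - ?P \<phi> (N ** L) t + ?P (deriv (deriv \<phi>)) (N ** B) t"
  have Dc: "((\<lambda>\<tau>. complex_of_real (?P ?c (N ** A0) \<tau>)) has_vector_derivative of_real (?R ?c)) (at t)"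
    using weak_form_transformed[OF sol t test_function_cos_sin(1)[OF h], where N=N and i=i]
    by (intro bounded_linear.has_vector_derivative[OF bounded_linear_of_real])
       (simp add: has_real_derivative_iff_has_vector_derivative)
  have Ds: "((\<lambda>\<tau>. complex_of_real (?P ?s (N ** A0) \<tau>)) has_vector_derivative of_real (?R ?s)) (at t)"
    using weak_form_transformed[OF sol t test_function_cos_sin(2)[OF h], where N=N and i=i]
    by (intro bounded_linear.has_vector_derivative[OF bounded_linear_of_real])
       (simp add: has_real_derivative_iff_has_vector_derivative)
  have D: "((\<lambda>\<tau>. of_real (?P ?c (N ** A0) \<tau>) - \<i> * of_real (?P ?s (N ** A0) \<tau>)) has_vector_derivative
      of_real (?R ?c) - \<i> * of_real (?R ?s)) (at t)"
    by (intro has_vector_derivative_diff Dc bounded_linear.has_vector_derivative[OF bounded_linear_mult_right Ds])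
  have "of_real (?R ?c) - \<i> * of_real (?R ?s)
      = (of_real (?P (deriv ?c) (N ** A1) t) - \<i> * of_real (?P (deriv ?s) (N ** A1) t))
        - (of_real (?P ?c (N ** L) t) - \<i> * of_real (?P ?s (N ** L) t))
        + (of_real (?P (deriv (deriv ?c)) (N ** B) t) - \<i> * of_real (?P (deriv (deriv ?s)) (N ** B) t))"
    by (simp only: of_real_add of_real_diff) (simp only: algebra_simps)
  also have "\<dots> = (W (deriv h) (N ** A1) t i - \<i> * of_real \<xi> * W h (N ** A1) t i) - W h (N ** L) t i
     + (W (deriv (deriv h)) (N ** B) t i - 2 * \<i> * of_real \<xi> * W (deriv h) (N ** B) t i - of_real (\<xi>\<^sup>2) * W h (N ** B) t i)"
    unfolding W_def using window_pairing[OF h su[of t], of \<xi>] t by simp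
  finally have eq: "of_real (?R ?c) - \<i> * of_real (?R ?s) = \<dots>" .
  show ?thesis
    by (rule has_vector_derivative_transform_within_open[OF D[unfolded eq], of "{0<..}"])
       (use t window_pairing(1)[OF h su, of _ \<xi>] in \<open>auto simp: W_def\<close>)
qed

section \<open>Continuous curves in \<open>L\<^sup>2\<close>\<close>

lemma FT1_continuous:
  assumes "integrable lborel f" shows "continuous_on A (FT1 f)"
proof -
  have [measurable]: "f \<in> borel_measurable borel" using assms by auto
  have "isCont (FT1 f) \<xi>" for \<xi>
    unfolding continuous_at_sequentially comp_def
  proof (intro allI impI)
    fix x :: "nat \<Rightarrow> real" assume x: "x \<longlonglongrightarrow> \<xi>"
    show "(\<lambda>n. FT1 f (x n)) \<longlonglongrightarrow> FT1 f \<xi>"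
      unfolding FT1_def
    proof (rule integral_dominated_convergence[where w="\<lambda>y. norm (f y)"])
      show "AE y in lborel. (\<lambda>n. cis (- (y * x n)) * f y) \<longlonglongrightarrow> cis (- (y * \<xi>)) * f y"
        by (intro AE_I2 tendsto_intros isCont_tendsto_compose[of _ cis] x continuous_intros)
      show "integrable lborel (\<lambda>y. norm (f y))" using assms by simp
    qed (auto simp: norm_mult)
  qed
  thus ?thesis by (intro continuous_at_imp_continuous_on) auto
qed

definition L2_curve :: "(real \<Rightarrow> real \<Rightarrow> real) \<Rightarrow> bool" where
  "L2_curve u \<longleftrightarrow> (\<forall>t\<ge>0. square_integrable (u t)) \<and>
     (\<forall>t\<ge>0. ((\<lambda>\<tau>. L2_norm (\<lambda>x. u \<tau> x - u t x)) \<longlongrightarrow> 0) (at t within {0..}))"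

lemma L2_curve_sequentially:
  assumes "L2_curve u" "t \<ge> 0" "\<And>n. \<tau> n \<ge> 0" "\<tau> \<longlonglongrightarrow> t"
  shows "(\<lambda>n. L2_norm (\<lambda>x. u (\<tau> n) x - u t x)) \<longlonglongrightarrow> 0"
proof -
  have "L2_norm (\<lambda>x. u t x - u t x) = 0" by (simp add: L2_norm_def)
  hence "continuous (at t within {0..}) (\<lambda>\<tau>. L2_norm (\<lambda>x. u \<tau> x - u t x))"
    using assms(1,2) by (simp add: continuous_within L2_curve_def)
  thus ?thesis using assms(3,4) \<open>L2_norm _ = 0\<close> unfolding continuous_within_sequentially comp_def by fastforce
qed

lemma L2_norm_real_triangle:
  fixes f g :: "real \<Rightarrow> real"
  assumes "square_integrable f" "square_integrable g"
  shows "\<bar>L2_norm f - L2_norm g\<bar> \<le> L2_norm (\<lambda>x. f x - g x)"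
proof -
  let ?f = "\<lambda>x. complex_of_real (f x)" and ?g = "\<lambda>x. complex_of_real (g x)"
  have s: "square_integrable ?f" "square_integrable ?g" using assms by (auto simp: square_integrable_of_real_iff)
  have d: "L2_norm (\<lambda>x. ?f x - ?g x) = L2_norm (\<lambda>x. f x - g x)"
    using L2_norm_of_real[of "\<lambda>x. f x - g x"] by simp
  have "L2_norm ?f \<le> L2_norm (\<lambda>x. ?f x - ?g x) + L2_norm ?g"
    using L2_norm_triangle[OF square_integrable_diff[OF s] s(2)] by simp
  moreover have "L2_norm ?g \<le> L2_norm (\<lambda>x. ?f x - ?g x) + L2_norm ?f"
    using L2_norm_triangle[OF square_integrable_diff[OF s(2,1)] s(1)] L2_norm_minus_commute[of ?g ?f] by simp
  ultimately show ?thesis by (simp add: d L2_norm_of_real)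
qed

lemma L2_curve_bounded:
  assumes u: "L2_curve u" shows "\<exists>K\<ge>0. \<forall>s\<in>{0..T}. L2_norm (u s) \<le> K"
proof -
  have "continuous_on {0..T} (\<lambda>s. L2_norm (u s))"
    unfolding continuous_on_sequentially comp_def
  proof (intro allI impI ballI)
    fix x :: "nat \<Rightarrow> real" and t assume as: "t \<in> {0..T}" "(\<forall>n. x n \<in> {0..T}) \<and> x \<longlonglongrightarrow> t"
    hence lim: "(\<lambda>n. L2_norm (\<lambda>y. u (x n) y - u t y)) \<longlonglongrightarrow> 0"
      by (intro L2_curve_sequentially[OF u]) auto
    have "\<bar>L2_norm (u (x n)) - L2_norm (u t)\<bar> \<le> L2_norm (\<lambda>y. u (x n) y - u t y)" for n
      using u as by (intro L2_norm_real_triangle) (auto simp: L2_curve_def)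
    hence "(\<lambda>n. L2_norm (u (x n)) - L2_norm (u t)) \<longlonglongrightarrow> 0"
      by (intro Lim_null_comparison[OF always_eventually lim]) simp
    thus "(\<lambda>n. L2_norm (u (x n))) \<longlonglongrightarrow> L2_norm (u t)" by (rule LIM_zero_cancel)
  qed
  hence "bounded ((\<lambda>s. L2_norm (u s)) ` {0..T})"
    by (intro compact_imp_bounded compact_continuous_image) auto
  then obtain K where "\<forall>s\<in>{0..T}. \<bar>L2_norm (u s)\<bar> \<le> K" by (auto simp: bounded_iff)
  thus ?thesis by (intro exI[of _ "\<bar>K\<bar>"]) (auto intro: order_trans abs_ge_self)
qed

lemma square_integrable_test_times:
  assumes h: "test_function h" "\<And>x. \<bar>h x\<bar> \<le> B" and u: "square_integrable (u :: real \<Rightarrow> real)"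
  shows "square_integrable (\<lambda>x. complex_of_real (h x * u x))" "integrable lborel (\<lambda>x. complex_of_real (h x * u x))"
    "L2_norm (\<lambda>x. complex_of_real (h x * u x)) \<le> B * L2_norm u"
proof -
  have B: "B \<ge> 0" using h(2)[of 0] by linarith
  have [measurable]: "u \<in> borel_measurable borel" "h \<in> borel_measurable borel"
    using square_integrable_measurable[OF u] test_function_measurable[OF h(1)] by auto
  have su: "square_integrable (\<lambda>x. of_real B * complex_of_real (u x))"
    using u by (intro square_integrable_cmult) (simp add: square_integrable_of_real_iff)
  have b: "AE x in lborel. norm (complex_of_real (h x * u x)) \<le> norm (of_real B * complex_of_real (u x))"
    using h(2) B by (intro AE_I2) (auto simp: norm_mult abs_mult intro: mult_right_mono)
  show "square_integrable (\<lambda>x. complex_of_real (h x * u x))" by (rule L2_norm_mono(1)[OF _ su b]) measurable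
  have "L2_norm (\<lambda>x. complex_of_real (h x * u x)) \<le> L2_norm (\<lambda>x. of_real B * complex_of_real (u x))"
    by (rule L2_norm_mono(2)[OF _ su b]) measurable
  also have "\<dots> = B * L2_norm u" unfolding L2_norm_cmult L2_norm_of_real using B by simp
  finally show "L2_norm (\<lambda>x. complex_of_real (h x * u x)) \<le> B * L2_norm u" .
  show "integrable lborel (\<lambda>x. complex_of_real (h x * u x))"
    using test_function_times_L2_integrable[OF h(1) u] by (simp only: complex_of_real_integrable_eq)
qed

lemma window_energy:
  assumes h: "test_function h" "\<And>x. \<bar>h x\<bar> \<le> B" and u: "square_integrable (u :: real \<Rightarrow> real)"
  shows "(\<integral>\<^sup>+\<xi>. ennreal ((norm (FT1 (\<lambda>x. complex_of_real (h x * u x)) \<xi>))\<^sup>2) \<partial>lborel) \<le> ennreal (2 * pi * (B * L2_norm u)\<^sup>2)"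
proof -
  note s = square_integrable_test_times[OF assms]
  let ?F = "FT1 (\<lambda>x. complex_of_real (h x * u x))"
  have "L2_norm ?F \<le> sqrt (2 * pi) * L2_norm (\<lambda>x. complex_of_real (h x * u x))" by (rule FT1_L2_bound(2)[OF s(2,1)])
  also have "\<dots> \<le> sqrt (2 * pi) * (B * L2_norm u)" by (intro mult_left_mono s) auto
  finally have "(L2_norm ?F)\<^sup>2 \<le> (sqrt (2 * pi) * (B * L2_norm u))\<^sup>2" by (intro power_mono) auto
  also have "\<dots> = 2 * pi * (B * L2_norm u)\<^sup>2" by (simp add: power_mult_distrib)
  finally show ?thesis
    using nn_integral_L2_norm[OF FT1_L2_bound(1)[OF s(2,1)]] by (simp add: ennreal_leI)
qed

text \<open>Joint continuity in time and frequency, which provides the measurability for the exchange of integrals below.\<close>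

lemma window_continuous:
  assumes u: "L2_curve u" and h: "test_function h"
  shows "continuous_on ({0..} \<times> UNIV) (\<lambda>(s, \<xi>). FT1 (\<lambda>x. complex_of_real (h x * u s x)) \<xi>)"
  unfolding continuous_on_sequentially comp_def
proof (intro allI ballI impI)
  fix p :: "nat \<Rightarrow> real \<times> real" and p0 :: "real \<times> real"
  let ?W = "\<lambda>s. FT1 (\<lambda>x. complex_of_real (h x * u s x))"
  assume as: "p0 \<in> {0..} \<times> UNIV" "(\<forall>n. p n \<in> {0..} \<times> UNIV) \<and> p \<longlonglongrightarrow> p0"
  define t where "t = fst p0"
  define \<xi> where "\<xi> = snd p0"
  define \<tau> where "\<tau> = (\<lambda>n. fst (p n))"
  define z where "z = (\<lambda>n. snd (p n))"
  have lim: "\<tau> \<longlonglongrightarrow> t" "z \<longlonglongrightarrow> \<xi>" using as by (auto simp: \<tau>_def z_def t_def \<xi>_def intro: tendsto_fst tendsto_snd)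
  have t: "t \<ge> 0" "\<And>n. \<tau> n \<ge> 0" using as by (auto simp: \<tau>_def t_def mem_Times_iff)
  have su: "square_integrable (u t)" "\<And>n. square_integrable (u (\<tau> n))" using u t by (auto simp: L2_curve_def)
  obtain B where B: "B > 0" "\<And>x. \<bar>h x\<bar> \<le> B" using test_function_bounded[OF h] by blast
  have hi: "integrable lborel (\<lambda>x. complex_of_real (h x * v x))" if "square_integrable v" for v :: "real \<Rightarrow> real"
    by (rule square_integrable_test_times(2)[OF h B(2) that])
  define H where "H = L2_norm (\<lambda>x. complex_of_real (h x))"
  have est: "norm (?W (\<tau> n) (z n) - ?W t \<xi>) \<le> H * L2_norm (\<lambda>x. u (\<tau> n) x - u t x) + norm (?W t (z n) - ?W t \<xi>)" for n
  proof -
    have sd: "square_integrable (\<lambda>x. u (\<tau> n) x - u t x)" by (intro square_integrable_diff su)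
    have "?W (\<tau> n) (z n) - ?W t (z n) = FT1 (\<lambda>x. complex_of_real (h x * u (\<tau> n) x) - complex_of_real (h x * u t x)) (z n)"
      by (rule FT1_diff[symmetric]) (intro hi su)+
    also have "norm \<dots> \<le> (\<integral>x. norm (complex_of_real (h x * u (\<tau> n) x) - complex_of_real (h x * u t x)) \<partial>lborel)"
      by (rule norm_FT1_le)
    also have "\<dots> = (\<integral>x. norm (complex_of_real (h x) * complex_of_real (u (\<tau> n) x - u t x)) \<partial>lborel)"
      by (simp add: right_diff_distrib)
    also have "\<dots> \<le> H * L2_norm (\<lambda>x. complex_of_real (u (\<tau> n) x - u t x))"
      unfolding H_def
      by (rule Cauchy_Schwarz_L2[OF test_function_square_integrable(1)[OF h]])
         (use sd in \<open>simp only: square_integrable_of_real_iff\<close>)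
    also have "L2_norm (\<lambda>x. complex_of_real (u (\<tau> n) x - u t x)) = L2_norm (\<lambda>x. u (\<tau> n) x - u t x)"
      by (rule L2_norm_of_real)
    finally have "norm (?W (\<tau> n) (z n) - ?W t (z n)) \<le> H * L2_norm (\<lambda>x. u (\<tau> n) x - u t x)" .
    thus ?thesis using norm_triangle_ineq[of "?W (\<tau> n) (z n) - ?W t (z n)" "?W t (z n) - ?W t \<xi>"] by simp
  qed
  have c2: "(\<lambda>n. ?W t (z n)) \<longlonglongrightarrow> ?W t \<xi>"
    using FT1_continuous[OF hi[OF su(1)], of UNIV] lim(2)
    by (intro isCont_tendsto_compose[of _ "?W t"]) (auto simp: continuous_on_eq_continuous_at)
  have "(\<lambda>n. H * L2_norm (\<lambda>x. u (\<tau> n) x - u t x) + norm (?W t (z n) - ?W t \<xi>)) \<longlonglongrightarrow> H * 0 + norm (?W t \<xi> - ?W t \<xi>)"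
    by (intro tendsto_intros c2 L2_curve_sequentially[OF u t lim(1)])
  hence B: "(\<lambda>n. H * L2_norm (\<lambda>x. u (\<tau> n) x - u t x) + norm (?W t (z n) - ?W t \<xi>)) \<longlonglongrightarrow> 0" by simp
  have "(\<lambda>n. ?W (\<tau> n) (z n) - ?W t \<xi>) \<longlonglongrightarrow> 0"
    by (rule Lim_null_comparison[OF always_eventually B]) (use est in simp)
  hence "(\<lambda>n. ?W (\<tau> n) (z n)) \<longlonglongrightarrow> ?W t \<xi>" by (rule LIM_zero_cancel)
  thus "(\<lambda>n. case p n of (s, \<xi>) \<Rightarrow> ?W s \<xi>) \<longlonglongrightarrow> (case p0 of (s, \<xi>) \<Rightarrow> ?W s \<xi>)"
    by (simp add: \<tau>_def z_def t_def \<xi>_def case_prod_beta)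
qed

lemma window_continuous_time:
  assumes u: "L2_curve u" and h: "test_function h"
  shows "continuous_on {0..T} (\<lambda>s. FT1 (\<lambda>x. complex_of_real (h x * u s x)) \<xi>)"
proof -
  have "continuous_on {0..T} ((\<lambda>(s, \<xi>). FT1 (\<lambda>x. complex_of_real (h x * u s x)) \<xi>) \<circ> (\<lambda>s. (s, \<xi>)))"
    by (rule continuous_on_compose[OF _ continuous_on_subset[OF window_continuous[OF u h]]])
       (auto intro!: continuous_intros)
  thus ?thesis by (simp add: comp_def)
qed

text \<open>Applied to derivatives of a wide cutoff, where \<open>B\<close> is small, this shows that the forcing of the windowed mode
equation is small in \<open>L\<^sup>2\<close> over frequencies.\<close>

lemma window_time_energy:
  assumes u: "L2_curve u" and h: "test_function h" "\<And>x. \<bar>h x\<bar> \<le> B" and K: "\<And>s. s \<in> {0..T} \<Longrightarrow> L2_norm (u s) \<le> K" and T: "T \<ge> 0"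
  defines "Q \<equiv> \<lambda>\<xi>. integral {0..T} (\<lambda>s. (norm (FT1 (\<lambda>x. complex_of_real (h x * u s x)) \<xi>))\<^sup>2)"
  shows "integrable lborel Q" "\<And>\<xi>. Q \<xi> \<ge> 0" "(\<integral>\<xi>. Q \<xi> \<partial>lborel) \<le> T * (2 * pi * (B * K)\<^sup>2)"
proof -
  let ?W = "\<lambda>s \<xi>. (norm (FT1 (\<lambda>x. complex_of_real (h x * u s x)) \<xi>))\<^sup>2"
  have B: "B \<ge> 0" using h(2)[of 0] by linarith
  have ct: "continuous_on {0..T} (\<lambda>s. ?W s \<xi>)" for \<xi>
    by (intro continuous_intros window_continuous_time u h)
  show Q0: "Q \<xi> \<ge> 0" for \<xi> unfolding Q_def
    by (intro Henstock_Kurzweil_Integration.integral_nonneg integrable_continuous_real ct) auto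
  define G where "G = (\<lambda>p. indicator ({0..T} \<times> UNIV) p *\<^sub>R (case p of (s, \<xi>) \<Rightarrow> ?W s \<xi>))"
  have "G \<in> borel_measurable borel"
    unfolding G_def
  proof (rule borel_measurable_continuous_on_indicator)
    show "{0..T} \<times> (UNIV::real set) \<in> sets borel" by (intro borel_closed closed_Times) auto
    have "continuous_on ({0..T} \<times> UNIV) (\<lambda>p. case p of (s, \<xi>) \<Rightarrow> FT1 (\<lambda>x. complex_of_real (h x * u s x)) \<xi>)"
      by (rule continuous_on_subset[OF window_continuous[OF u h(1)]]) auto
    hence "continuous_on ({0..T} \<times> UNIV) (\<lambda>p. (norm (case p of (s, \<xi>) \<Rightarrow> FT1 (\<lambda>x. complex_of_real (h x * u s x)) \<xi>))\<^sup>2)"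
      by (intro continuous_intros)
    thus "continuous_on ({0..T} \<times> UNIV) (\<lambda>p. case p of (s, \<xi>) \<Rightarrow> ?W s \<xi>)" by (simp add: case_prod_beta)
  qed
  hence Gm: "(\<lambda>p. ennreal (G p)) \<in> borel_measurable (lborel \<Otimes>\<^sub>M lborel)"
    by (simp add: lborel_prod)
  have Geq: "ennreal (G (s, \<xi>)) = indicator {0..T} s * ennreal (?W s \<xi>)" for s \<xi>
    by (auto simp: G_def indicator_def)
  have Qeq: "ennreal (Q \<xi>) = (\<integral>\<^sup>+s. ennreal (G (s, \<xi>)) \<partial>lborel)" for \<xi>
  proof -
    have si: "set_integrable lborel {0..T} (\<lambda>s. ?W s \<xi>)" by (rule borel_integrable_atLeastAtMost'[OF ct])
    have "Q \<xi> = (\<integral>s. indicator {0..T} s *\<^sub>R ?W s \<xi> \<partial>lborel)"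
      unfolding Q_def using set_borel_integral_eq_integral(2)[OF si] by (simp add: set_lebesgue_integral_def)
    hence "ennreal (Q \<xi>) = (\<integral>\<^sup>+s. ennreal (indicator {0..T} s *\<^sub>R ?W s \<xi>) \<partial>lborel)"
      using nn_integral_eq_integral[OF si[unfolded set_integrable_def]] by simp
    thus ?thesis by (simp add: G_def indicator_times)
  qed
  have Qm: "Q \<in> borel_measurable borel"
  proof -
    have "(\<lambda>\<xi>. \<integral>\<^sup>+s. ennreal (G (s, \<xi>)) \<partial>lborel) \<in> borel_measurable lborel"
      by (rule lborel.borel_measurable_nn_integral)
         (use measurable_compose[OF measurable_pair_swap' Gm] in \<open>simp add: case_prod_beta\<close>)
    hence "(\<lambda>\<xi>. enn2real (ennreal (Q \<xi>))) \<in> borel_measurable lborel" unfolding Qeq by measurable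
    thus ?thesis using Q0 by simp
  qed
  have tot: "(\<integral>\<^sup>+\<xi>. ennreal (Q \<xi>) \<partial>lborel) \<le> ennreal (T * (2 * pi * (B * K)\<^sup>2))"
  proof -
    have "(\<integral>\<^sup>+\<xi>. ennreal (Q \<xi>) \<partial>lborel) = (\<integral>\<^sup>+s. (\<integral>\<^sup>+\<xi>. ennreal (G (s, \<xi>)) \<partial>lborel) \<partial>lborel)"
      unfolding Qeq using Gm by (intro lborel_pair.Fubini') simp
    also have "\<dots> \<le> (\<integral>\<^sup>+s. ennreal (2 * pi * (B * K)\<^sup>2) * indicator {0..T} s \<partial>lborel)"
    proof (intro nn_integral_mono)
      fix s :: real
      show "(\<integral>\<^sup>+\<xi>. ennreal (G (s, \<xi>)) \<partial>lborel) \<le> ennreal (2 * pi * (B * K)\<^sup>2) * indicator {0..T} s"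
      proof (cases "s \<in> {0..T}")
        case True
        hence su: "square_integrable (u s)" using u by (auto simp: L2_curve_def)
        have "(\<integral>\<^sup>+\<xi>. ennreal (G (s, \<xi>)) \<partial>lborel) = (\<integral>\<^sup>+\<xi>. ennreal (?W s \<xi>) \<partial>lborel)"
          using True by (simp add: Geq)
        also have "\<dots> \<le> ennreal (2 * pi * (B * L2_norm (u s))\<^sup>2)" by (rule window_energy[OF h su])
        also have "\<dots> \<le> ennreal (2 * pi * (B * K)\<^sup>2)"
          using K[OF True] B by (intro ennreal_leI mult_left_mono power_mono) auto
        finally show ?thesis using True by simp
      qed (simp add: Geq)
    qed
    also have "\<dots> = ennreal (2 * pi * (B * K)\<^sup>2) * ennreal T"
      using T by (subst nn_integral_cmult_indicator) (auto simp: emeasure_lborel_Icc_eq)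
    also have "\<dots> = ennreal (T * (2 * pi * (B * K)\<^sup>2))" using T by (simp add: mult.commute flip: ennreal_mult)
    finally show ?thesis .
  qed
  show Qi: "integrable lborel Q"
    using tot Qm Q0 by (intro integrableI_nonneg) (auto intro: le_less_trans)
  have "ennreal (\<integral>\<xi>. Q \<xi> \<partial>lborel) \<le> ennreal (T * (2 * pi * (B * K)\<^sup>2))"
    using tot nn_integral_eq_integral[OF Qi] Q0 by simp
  thus "(\<integral>\<xi>. Q \<xi> \<partial>lborel) \<le> T * (2 * pi * (B * K)\<^sup>2)"
    using T by (subst (asm) ennreal_le_iff) auto
qed

section \<open>From modes to the Fourier transform of the solution\<close>

lemma solution_L2_curve:
  fixes Z :: "real \<Rightarrow> real \<Rightarrow> real ^ 'n" and A :: "real ^ 'n ^ 'n"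
  assumes sol: "cauchy_solution r A0 A1 L B Z0 Z" and r: "r \<ge> 0"
  shows "L2_curve (\<lambda>\<tau> x. (A *v Z \<tau> x) $ i)"
  unfolding L2_curve_def
proof (intro conjI allI impI)
  have Z: "Z \<tau> \<in> sobolev r" if "\<tau> \<ge> 0" for \<tau> using sol that by (auto simp: cauchy_solution_def)
  note sZ = sobolev_square_integrable[OF Z]
  have su: "square_integrable (\<lambda>x. (A *v F x) $ i)" if "square_integrable F" for F
    using square_integrable_matrix_vector[OF that, of A] by (simp add: square_integrable_vec_iff)
  show "square_integrable (\<lambda>x. (A *v Z t x) $ i)" if "t \<ge> 0" for t by (rule su[OF sZ[OF that]])
  fix t :: real assume t: "t \<ge> 0"
  obtain K where K: "K > 0" "\<And>z. norm (A *v z) \<le> norm z * K"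
    using bounded_linear.pos_bounded[OF matrix_vector_mul_bounded_linear[of A]] by auto
  have est: "norm (L2_norm (\<lambda>x. (A *v Z \<tau> x) $ i - (A *v Z t x) $ i)) \<le> K * sobolev_norm r (\<lambda>x. Z \<tau> x - Z t x)" if \<tau>: "\<tau> \<ge> 0" for \<tau>
  proof -
    let ?F = "\<lambda>x. Z \<tau> x - Z t x"
    have sF: "square_integrable ?F" by (intro square_integrable_diff sZ \<tau> t)
    have sKF: "square_integrable (\<lambda>x. K *\<^sub>R ?F x)"
      using square_integrable_measurable[OF sF] square_integrable_sq[OF sF]
      by (simp add: square_integrable_def power_mult_distrib)
    have "L2_norm (\<lambda>x. (A *v ?F x) $ i) \<le> L2_norm (\<lambda>x. K *\<^sub>R ?F x)"
    proof (rule L2_norm_mono(2)[OF square_integrable_measurable[OF su[OF sF]] sKF], intro AE_I2)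
      fix x
      have "norm ((A *v ?F x) $ i) \<le> norm (A *v ?F x)" by (rule Finite_Cartesian_Product.norm_nth_le)
      also have "\<dots> \<le> norm (?F x) * K" by (rule K)
      finally show "norm ((A *v ?F x) $ i) \<le> norm (K *\<^sub>R ?F x)" using K by (simp add: mult.commute)
    qed
    also have "\<dots> = K * L2_norm ?F" using K by (simp add: L2_norm_def power_mult_distrib real_sqrt_mult)
    also have "\<dots> \<le> K * sobolev_norm r ?F"
      using K by (intro mult_left_mono L2_norm_diff_le_sobolev_norm Z \<tau> t r) auto
    finally show ?thesis by (simp add: matrix_vector_mult_diff_distrib)
  qed
  have "((\<lambda>\<tau>. K * sobolev_norm r (\<lambda>x. Z \<tau> x - Z t x)) \<longlongrightarrow> K * 0) (at t within {0..})"
    using sol t by (intro tendsto_intros) (auto simp: cauchy_solution_def)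
  hence lim: "((\<lambda>\<tau>. K * sobolev_norm r (\<lambda>x. Z \<tau> x - Z t x)) \<longlongrightarrow> 0) (at t within {0..})" by simp
  show "((\<lambda>\<tau>. L2_norm (\<lambda>x. (A *v Z \<tau> x) $ i - (A *v Z t x) $ i)) \<longlongrightarrow> 0) (at t within {0..})"
    by (rule Lim_null_comparison[OF _ lim]) (use est in \<open>auto simp: eventually_at_filter\<close>)
qed

lemma FT1_matrix:
  fixes S :: "real ^ 'n ^ 'n" and w :: "real \<Rightarrow> real ^ 'n"
  assumes "\<And>j. integrable lborel (\<lambda>x. complex_of_real (h x * w x $ j))"
  shows "FT1 (\<lambda>x. complex_of_real (h x * (S *v w x) $ i)) \<xi>
    = (\<Sum>j\<in>UNIV. of_real (S $ i $ j) * FT1 (\<lambda>x. complex_of_real (h x * w x $ j)) \<xi>)"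
proof -
  have "FT1 (\<lambda>x. complex_of_real (h x * (S *v w x) $ i)) \<xi>
      = (\<integral>x. (\<Sum>j\<in>UNIV. of_real (S $ i $ j) * (cis (- (x * \<xi>)) * complex_of_real (h x * w x $ j))) \<partial>lborel)"
    unfolding FT1_def
    by (intro Bochner_Integration.integral_cong refl)
       (simp add: matrix_vector_mult_def sum_distrib_left mult_ac)
  also have "\<dots> = (\<Sum>j\<in>UNIV. \<integral>x. of_real (S $ i $ j) * (cis (- (x * \<xi>)) * complex_of_real (h x * w x $ j)) \<partial>lborel)"
    by (intro Bochner_Integration.integral_sum integrable_mult_right integrable_cis_mult assms)
  finally show ?thesis by (simp add: FT1_def)
qed

text \<open>The windows of \<open>M Z\<close> satisfy a closed system, since all four transformed matrices factor through \<open>M\<close>.\<close>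

lemma windowed_mode_normal_form:
  fixes Z :: "real \<Rightarrow> real \<Rightarrow> real ^ 'n" and \<xi> :: real and N M S0 S1 SL SB :: "real ^ 'n ^ 'n" and i :: 'n
  assumes sol: "cauchy_solution r A0 A1 L B Z0 Z" and t: "t > 0" and h: "test_function h"
    and nf: "N ** A0 = S0 ** M" "N ** A1 = S1 ** M" "N ** L = SL ** M" "N ** B = SB ** M"
  defines "w \<equiv> \<lambda>h j \<tau>. FT1 (\<lambda>x. complex_of_real (h x * (M *v Z \<tau> x) $ j)) \<xi>"
  shows "((\<lambda>\<tau>. \<Sum>j\<in>UNIV. of_real (S0 $ i $ j) * w h j \<tau>) has_vector_derivative
    (\<Sum>j\<in>UNIV. of_real (S1 $ i $ j) * w (deriv h) j t) - \<i> * of_real \<xi> * (\<Sum>j\<in>UNIV. of_real (S1 $ i $ j) * w h j t)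
     - (\<Sum>j\<in>UNIV. of_real (SL $ i $ j) * w h j t)
     + ((\<Sum>j\<in>UNIV. of_real (SB $ i $ j) * w (deriv (deriv h)) j t)
        - 2 * \<i> * of_real \<xi> * (\<Sum>j\<in>UNIV. of_real (SB $ i $ j) * w (deriv h) j t)
        - of_real (\<xi>\<^sup>2) * (\<Sum>j\<in>UNIV. of_real (SB $ i $ j) * w h j t))) (at t)"
proof -
  have su: "square_integrable (\<lambda>x. (M *v Z \<tau> x) $ j)" if "\<tau> \<ge> 0" for \<tau> j
    using square_integrable_matrix_vector[OF sobolev_square_integrable, of "Z \<tau>" r M] sol that
    by (auto simp: cauchy_solution_def square_integrable_vec_iff)
  have W: "FT1 (\<lambda>x. complex_of_real (h x * ((S ** M) *v Z \<tau> x) $ i)) \<xi> = (\<Sum>j\<in>UNIV. of_real (S $ i $ j) * w h j \<tau>)"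
    if "test_function h" "\<tau> \<ge> 0" for h \<tau> and S :: "real ^ 'n ^ 'n"
    unfolding w_def matrix_vector_mul_assoc[symmetric]
    using test_function_times_L2_integrable[OF that(1) su[OF that(2)]]
    by (intro FT1_matrix) (simp only: complex_of_real_integrable_eq)
  note D = windowed_mode[where \<xi> = \<xi> and N = N and i = i, OF sol t h, unfolded nf]
  show ?thesis
    using has_vector_derivative_transform_within_open[OF D, of "{0<..}" "\<lambda>\<tau>. \<Sum>j\<in>UNIV. of_real (S0 $ i $ j) * w h j \<tau>"]
      W[OF h] W[OF test_function_deriv[OF h]] W[OF test_function_deriv[OF test_function_deriv[OF h]]] t
    by simp
qed

lemma sum_8_squares: "(a1 + a2 + a3 + a4 + b1 + b2 + b3 + b4 :: real)\<^sup>2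
    \<le> 8 * (a1\<^sup>2 + a2\<^sup>2 + a3\<^sup>2 + a4\<^sup>2 + b1\<^sup>2 + b2\<^sup>2 + b3\<^sup>2 + b4\<^sup>2)"
proof -
  have "(x + y)\<^sup>2 \<le> 2 * (x\<^sup>2 + y\<^sup>2)" for x y :: real
    using zero_le_power2[of "x - y"] by (simp add: power2_eq_square algebra_simps)
  note this[of "(a1 + a2) + (a3 + a4)" "(b1 + b2) + (b3 + b4)"] this[of "a1 + a2" "a3 + a4"] this[of "b1 + b2" "b3 + b4"]
    this[of a1 a2] this[of a3 a4] this[of b1 b2] this[of b3 b4]
  thus ?thesis by (simp add: add.assoc)
qed

lemma scaled_cutoff:
  assumes z: "test_function \<zeta>" and a: "a > 0"
  shows "test_function (\<lambda>x. \<zeta> (a * x))" "deriv (\<lambda>x. \<zeta> (a * x)) = (\<lambda>x. a * deriv \<zeta> (a * x))"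
    "deriv (deriv (\<lambda>x. \<zeta> (a * x))) = (\<lambda>x. a\<^sup>2 * deriv (deriv \<zeta>) (a * x))"
proof -
  show "test_function (\<lambda>x. \<zeta> (a * x))" using z a by (intro test_function_scale) auto
  have D: "deriv (\<lambda>x. f (a * x)) = (\<lambda>x. a * deriv f (a * x))" if "test_function f" for f
  proof (rule ext, rule DERIV_imp_deriv)
    fix x
    have "((\<lambda>x. f (a * x)) has_real_derivative deriv f (a * x) * a) (at x)"
      by (rule DERIV_chain'[where g=f, OF _ test_function_DERIV[OF that]]) (auto intro!: derivative_eq_intros)
    thus "((\<lambda>x. f (a * x)) has_real_derivative a * deriv f (a * x)) (at x)" by (simp add: mult.commute)
  qed
  show 1: "deriv (\<lambda>x. \<zeta> (a * x)) = (\<lambda>x. a * deriv \<zeta> (a * x))" by (rule D[OF z])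
  have "deriv (\<lambda>x. a * deriv \<zeta> (a * x)) = (\<lambda>x. a * deriv (\<lambda>x. deriv \<zeta> (a * x)) x)"
  proof (rule ext, rule DERIV_imp_deriv)
    fix x
    have "test_function (\<lambda>x. deriv \<zeta> (a * x))" using z a by (intro test_function_scale test_function_deriv) auto
    from DERIV_cmult[OF test_function_DERIV[OF this]]
    show "((\<lambda>x. a * deriv \<zeta> (a * x)) has_real_derivative a * deriv (\<lambda>x. deriv \<zeta> (a * x)) x) (at x)" .
  qed
  thus "deriv (deriv (\<lambda>x. \<zeta> (a * x))) = (\<lambda>x. a\<^sup>2 * deriv (deriv \<zeta>) (a * x))"
    unfolding 1 D[OF test_function_deriv[OF z]] by (simp add: power2_eq_square mult_ac)
qed

text \<open>The windows \<open>\<zeta>(x/n)\<close> exhaust the line.  The error terms at the times \<open>0\<close> and \<open>t\<close> and the time-integrated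
forcing tend to zero in \<open>L\<^sup>1\<close> over frequencies, hence almost everywhere along a subsequence, where
\<open>mode_decay\<close> passes to the limit.  The unbounded factor \<open>1 + \<xi>\<^sup>2\<close> of the forcing is harmless because \<open>\<xi>\<close> is
fixed by then.\<close>

proposition pointwise_decay:
  fixes k1 k2 k3 k4 v a b c \<mu> g d :: real
  assumes pos: "k1 > 0" "k2 > 0" "k3 > 0" "k4 > 0" "a > 0" "b > 0" "\<mu> > 0" "g > 0" "d > 0"
  obtains C \<gamma> where "C > 0" "\<gamma> > 0"
    "\<And>r A0 A1 L B (N :: real ^ 4 ^ 4) (M :: real ^ 4 ^ 4) Z0 (Z :: real \<Rightarrow> real \<Rightarrow> real ^ 4) (G :: real \<Rightarrow> real \<Rightarrow> complex ^ 4) t.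
      \<lbrakk>cauchy_solution r A0 A1 L B Z0 Z; r \<ge> 0;
       N ** A0 = mass_mat k1 k2 k3 k4 ** M;
       N ** A1 = convection_mat v k1 k2 k3 k4 a b c ** M;
       N ** L = relaxation_mat g \<mu> ** M;
       N ** B = diffusion_mat d ** M;
       \<And>\<tau> j. \<tau> \<ge> 0 \<Longrightarrow> is_FT (\<lambda>x. complex_of_real ((M *v Z \<tau> x) $ j)) (\<lambda>\<xi>. G \<tau> \<xi> $ j); t \<ge> 0\<rbrakk>
     \<Longrightarrow> AE \<xi> in lborel. (norm (G t \<xi>))\<^sup>2 \<le> C * (exp (- \<gamma> * damping \<xi> * t) * (norm (G 0 \<xi>))\<^sup>2)"
proof (rule mode_decay[OF pos, of v c])
  fix C \<gamma> :: real
  assume C: "C > 0" and \<gamma>: "\<gamma> > 0"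
  assume decay: "\<And>\<xi> t (y :: real \<Rightarrow> complex ^ 4) (e :: real \<Rightarrow> complex ^ 4). \<lbrakk>0 \<le> t; continuous_on {0..t} y; continuous_on {0..t} e;
      \<And>s. 0 < s \<Longrightarrow> s < t \<Longrightarrow>
        mode_equations k1 k2 k3 k4 v a b c \<mu> g d \<xi> y e s\<rbrakk>
     \<Longrightarrow> (norm (y t))\<^sup>2 \<le> C * (exp (- \<gamma> * damping \<xi> * t) * (norm (y 0))\<^sup>2 + (1 + t) * integral {0..t} (\<lambda>s. (norm (e s))\<^sup>2))"
  show thesis
  proof (rule that[OF C \<gamma>])
    fix r t :: real and A0 A1 L B N M :: "real ^ 4 ^ 4" and Z0 and Z :: "real \<Rightarrow> real \<Rightarrow> real ^ 4" and G :: "real \<Rightarrow> real \<Rightarrow> complex ^ 4"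
    assume sol: "cauchy_solution r A0 A1 L B Z0 Z" and r: "r \<ge> 0"
      and nf: "N ** A0 = mass_mat k1 k2 k3 k4 ** M"
       "N ** A1 = convection_mat v k1 k2 k3 k4 a b c ** M"
       "N ** L = relaxation_mat g \<mu> ** M"
       "N ** B = diffusion_mat d ** M"
      and G: "\<And>\<tau> j. \<tau> \<ge> 0 \<Longrightarrow> is_FT (\<lambda>x. complex_of_real ((M *v Z \<tau> x) $ j)) (\<lambda>\<xi>. G \<tau> \<xi> $ j)" and t: "t \<ge> 0"
    define u where "u = (\<lambda>j \<tau> x. (M *v Z \<tau> x) $ j)"
    have cu: "L2_curve (u j)" for j unfolding u_def by (rule solution_L2_curve[OF sol r])
    have su: "square_integrable (u j \<tau>)" if "\<tau> \<ge> 0" for j \<tau> using cu that by (auto simp: L2_curve_def)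
    obtain \<zeta> where z: "test_function \<zeta>" "\<And>x. 0 \<le> \<zeta> x" "\<And>x. \<zeta> x \<le> 1" "\<And>x. \<bar>x\<bar> \<le> 1 \<Longrightarrow> \<zeta> x = 1"
      using exists_cutoff by blast
    obtain B1 where B1: "B1 > 0" "\<And>x. \<bar>deriv \<zeta> x\<bar> \<le> B1" using test_function_bounded[OF test_function_deriv[OF z(1)]] by blast
    obtain B2 where B2: "B2 > 0" "\<And>x. \<bar>deriv (deriv \<zeta>) x\<bar> \<le> B2"
      using test_function_bounded[OF test_function_deriv[OF test_function_deriv[OF z(1)]]] by blast
    define \<alpha> where "\<alpha> = (\<lambda>n. 1 / real (Suc n))"
    have \<alpha>: "\<alpha> n > 0" for n by (simp add: \<alpha>_def)
    have \<alpha>0: "\<alpha> \<longlonglongrightarrow> 0" unfolding \<alpha>_def using LIMSEQ_Suc[OF lim_1_over_n] by simp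
    define h where "h = (\<lambda>n x. \<zeta> (\<alpha> n * x))"
    have h: "test_function (h n)" for n unfolding h_def by (rule scaled_cutoff(1)[OF z(1) \<alpha>])
    note h1 = test_function_deriv[OF h] and h2 = test_function_deriv[OF test_function_deriv[OF h]]
    have b1: "\<bar>deriv (h n) x\<bar> \<le> \<alpha> n * B1" for n x
      using B1(2) \<alpha>[of n] unfolding h_def scaled_cutoff(2)[OF z(1) \<alpha>] by (simp add: abs_mult)
    have b2: "\<bar>deriv (deriv (h n)) x\<bar> \<le> (\<alpha> n)\<^sup>2 * B2" for n x
      using B2(2) \<alpha>[of n] unfolding h_def scaled_cutoff(3)[OF z(1) \<alpha>] by (simp add: abs_mult mult_left_mono)
    define w where "w = (\<lambda>h j s \<xi>. FT1 (\<lambda>x. complex_of_real (h x * u j s x)) \<xi>)"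
    define y where "y = (\<lambda>n s \<xi>. (\<chi> j. w (h n) j s \<xi>) :: complex ^ 4)"
    define q1 where "q1 = (\<lambda>n j s \<xi>. w (deriv (h n)) j s \<xi>)"
    define q2 where "q2 = (\<lambda>n j s \<xi>. w (deriv (deriv (h n))) j s \<xi>)"
    (* The forcing: all terms of the windowed equation in which a derivative falls on the window. *)
    define f where "f = (\<lambda>n s \<xi>. vector [v * k1 * q1 n 1 s \<xi> + a * q1 n 2 s \<xi>,
       a * q1 n 1 s \<xi> + v * k2 * q1 n 2 s \<xi> + b * q1 n 3 s \<xi> + c * q1 n 4 s \<xi>,
       b * q1 n 2 s \<xi> + v * k3 * q1 n 3 s \<xi>,
       c * q1 n 2 s \<xi> + v * k4 * q1 n 4 s \<xi> + d * (q2 n 4 s \<xi> - 2 * \<i> * of_real \<xi> * q1 n 4 s \<xi>)] :: complex ^ 4)"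
    define Q1 where "Q1 = (\<lambda>n j \<xi>. integral {0..t} (\<lambda>s. (norm (q1 n j s \<xi>))\<^sup>2))"
    define Q2 where "Q2 = (\<lambda>n j \<xi>. integral {0..t} (\<lambda>s. (norm (q2 n j s \<xi>))\<^sup>2))"
    have cw: "continuous_on {0..t} (\<lambda>s. w h j s \<xi>)" if "test_function h" for h j \<xi>
      unfolding w_def by (rule window_continuous_time[OF cu that])
    have cq: "continuous_on {0..t} (\<lambda>s. q1 n j s \<xi>)" "continuous_on {0..t} (\<lambda>s. q2 n j s \<xi>)" for n j \<xi>
      unfolding q1_def q2_def by (intro cw h1 h2)+
    have cy: "continuous_on {0..t} (\<lambda>s. y n s \<xi>)" for n \<xi>
      unfolding y_def by (intro continuous_on_vec_lambda cw h)
    have cf: "continuous_on {0..t} (\<lambda>s. f n s \<xi>)" for n \<xi>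
    proof -
      have "continuous_on {0..t} (\<lambda>s. f n s \<xi> $ i)" for i
      proof -
        have "\<forall>i. continuous_on {0..t} (\<lambda>s. f n s \<xi> $ i)"
          unfolding forall_4 f_def vector_4 by (intro conjI continuous_intros cq)
        thus ?thesis ..
      qed
      hence "continuous_on {0..t} (\<lambda>s. \<chi> i. f n s \<xi> $ i)" by (rule continuous_on_vec_lambda)
      thus ?thesis by simp
    qed
    have ode: "mode_equations k1 k2 k3 k4 v a b c \<mu> g d \<xi> (\<lambda>s. y n s \<xi>) (\<lambda>s. f n s \<xi>) s"
      if s: "0 < s" "s < t" for n s \<xi>
    proof -

      have w': "FT1 (\<lambda>x. complex_of_real (h x * (M *v Z \<tau> x) $ j)) \<xi> = w h j \<tau> \<xi>" for h j \<tau> by (simp add: w_def u_def)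
      have div: "(F has_vector_derivative (1 / k) *\<^sub>R X) (at s)" if "((\<lambda>\<tau>. of_real k * F \<tau>) has_vector_derivative X) (at s)" "k > 0"
        for F :: "real \<Rightarrow> complex" and k X
        using bounded_linear.has_vector_derivative[OF bounded_linear_scaleR_right[of "1 / k"] that(1)] that(2)
        by (simp add: scaleR_conv_of_real)
      note E = windowed_mode_normal_form[where \<xi> = \<xi> and h = "h n", OF sol s(1) h nf, unfolded w' sum_4]
      have 1: "((\<lambda>\<tau>. of_real k1 * y n \<tau> \<xi> $ 1) has_vector_derivative (- \<i> * \<xi> * (v * k1 * y n s \<xi> $ 1 + a * y n s \<xi> $ 2) + f n s \<xi> $ 1)) (at s)"
        using E[where i = 1] by (simp add: y_def f_def q1_def algebra_simps)
      have 2: "((\<lambda>\<tau>. of_real k2 * y n \<tau> \<xi> $ 2) has_vector_derivative (- \<i> * \<xi> * (a * y n s \<xi> $ 1 + v * k2 * y n s \<xi> $ 2 + b * y n s \<xi> $ 3 + c * y n s \<xi> $ 4) + f n s \<xi> $ 2)) (at s)"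
        using E[where i = 2] by (simp add: y_def f_def q1_def algebra_simps)
      have 3: "((\<lambda>\<tau>. of_real k3 * y n \<tau> \<xi> $ 3) has_vector_derivative (- \<i> * \<xi> * (b * y n s \<xi> $ 2 + v * k3 * y n s \<xi> $ 3) - g * \<mu> * (\<mu> * y n s \<xi> $ 3 - y n s \<xi> $ 4) + f n s \<xi> $ 3)) (at s)"
        using E[where i = 3] by (simp add: y_def f_def q1_def power2_eq_square algebra_simps)
      have 4: "((\<lambda>\<tau>. of_real k4 * y n \<tau> \<xi> $ 4) has_vector_derivative (- \<i> * \<xi> * (c * y n s \<xi> $ 2 + v * k4 * y n s \<xi> $ 4) + g * (\<mu> * y n s \<xi> $ 3 - y n s \<xi> $ 4) - d * \<xi>\<^sup>2 * y n s \<xi> $ 4 + f n s \<xi> $ 4)) (at s)"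
        using E[where i = 4] by (simp add: y_def f_def q1_def q2_def algebra_simps)
      show ?thesis unfolding mode_equations_def by (intro conjI div pos 1 2 3 4)
    qed
    have mode: "(norm (y n t \<xi>))\<^sup>2 \<le> C * (exp (- \<gamma> * damping \<xi> * t) * (norm (y n 0 \<xi>))\<^sup>2 + (1 + t) * integral {0..t} (\<lambda>s. (norm (f n s \<xi>))\<^sup>2))" for n \<xi>
      by (rule decay[OF t cy cf ode])
    show "AE \<xi> in lborel. (norm (G t \<xi>))\<^sup>2 \<le> C * (exp (- \<gamma> * damping \<xi> * t) * (norm (G 0 \<xi>))\<^sup>2)"
    proof -
      define S where "S = (\<lambda>n \<xi>. \<Sum>j\<in>UNIV. Q1 n j \<xi> + Q2 n j \<xi>)"
      define R where "R = \<bar>v * k1\<bar> + \<bar>a\<bar> + \<bar>v * k2\<bar> + \<bar>b\<bar> + \<bar>c\<bar> + \<bar>v * k3\<bar> + \<bar>v * k4\<bar> + \<bar>d\<bar>"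
      have R: "\<bar>v * k1\<bar> \<le> R" "\<bar>a\<bar> \<le> R" "\<bar>v * k2\<bar> \<le> R" "\<bar>b\<bar> \<le> R" "\<bar>c\<bar> \<le> R" "\<bar>v * k3\<bar> \<le> R" "\<bar>v * k4\<bar> \<le> R" "\<bar>d\<bar> \<le> R" "0 \<le> R"
        unfolding R_def by (auto intro: add_increasing add_increasing2)
      have fbound: "(norm (f n s \<xi>))\<^sup>2 \<le> 256 * R\<^sup>2 * (1 + \<xi>\<^sup>2) * (\<Sum>j\<in>UNIV. (norm (q1 n j s \<xi>))\<^sup>2 + (norm (q2 n j s \<xi>))\<^sup>2)" for n s \<xi>
      proof -
        let ?p = "\<lambda>j. norm (q1 n j s \<xi>)" and ?q = "\<lambda>j. norm (q2 n j s \<xi>)"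
        define X where "X = ?p 1 + ?p 2 + ?p 3 + ?p 4 + ?q 1 + ?q 2 + ?q 3 + ?q 4"
        have X0: "X \<ge> 0" by (simp add: X_def)
        define Y where "Y = R * (1 + 2 * \<bar>\<xi>\<bar>) * X"
        have RX: "R * X \<le> Y" unfolding Y_def using R(9) X0 mult_left_mono[of 1 "1 + 2 * \<bar>\<xi>\<bar>" "R * X"] by (simp add: mult_ac)
        have tm: "norm (of_real k * z) \<le> R * norm z" if "\<bar>k\<bar> \<le> R" for k and z :: complex
          using that by (simp add: norm_mult mult_right_mono)
        have c1: "norm (f n s \<xi> $ 1) \<le> Y"
        proof -
          have "norm (f n s \<xi> $ 1) \<le> R * ?p 1 + R * ?p 2"
            unfolding f_def vector_4 using tm[OF R(1)] tm[OF R(2)]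
            by (intro order_trans[OF norm_triangle_ineq] add_mono) auto
          also have "\<dots> = R * (?p 1 + ?p 2)" by (simp add: distrib_left)
          also have "\<dots> \<le> R * X" using R(9) unfolding X_def by (intro mult_left_mono) auto
          finally show ?thesis using RX by simp
        qed
        have c2: "norm (f n s \<xi> $ 2) \<le> Y"
        proof -
          have "norm (f n s \<xi> $ 2) \<le> R * ?p 1 + R * ?p 2 + R * ?p 3 + R * ?p 4"
            unfolding f_def vector_4 using tm[OF R(2)] tm[OF R(3)] tm[OF R(4)] tm[OF R(5)]
            by (intro order_trans[OF norm_triangle_ineq] add_mono) auto
          also have "\<dots> = R * (?p 1 + ?p 2 + ?p 3 + ?p 4)" by (simp add: distrib_left)
          also have "\<dots> \<le> R * X" using R(9) unfolding X_def by (intro mult_left_mono) auto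
          finally show ?thesis using RX by simp
        qed
        have c3: "norm (f n s \<xi> $ 3) \<le> Y"
        proof -
          have "norm (f n s \<xi> $ 3) \<le> R * ?p 2 + R * ?p 3"
            unfolding f_def vector_4 using tm[OF R(4)] tm[OF R(6)]
            by (intro order_trans[OF norm_triangle_ineq] add_mono) auto
          also have "\<dots> = R * (?p 2 + ?p 3)" by (simp add: distrib_left)
          also have "\<dots> \<le> R * X" using R(9) unfolding X_def by (intro mult_left_mono) auto
          finally show ?thesis using RX by simp
        qed
        have c4: "norm (f n s \<xi> $ 4) \<le> Y"
        proof -
          have "norm (of_real d * (q2 n 4 s \<xi> - 2 * \<i> * of_real \<xi> * q1 n 4 s \<xi>)) \<le> R * (?q 4 + 2 * \<bar>\<xi>\<bar> * ?p 4)"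
          proof -
            have "norm (q2 n 4 s \<xi> - 2 * \<i> * of_real \<xi> * q1 n 4 s \<xi>) \<le> ?q 4 + 2 * \<bar>\<xi>\<bar> * ?p 4"
              using norm_triangle_ineq4[of "q2 n 4 s \<xi>" "2 * \<i> * of_real \<xi> * q1 n 4 s \<xi>"] by (simp add: norm_mult)
            from mult_left_mono[OF this R(9)] tm[OF R(8), of "q2 n 4 s \<xi> - 2 * \<i> * of_real \<xi> * q1 n 4 s \<xi>"]
            show ?thesis by linarith
          qed
          hence "norm (f n s \<xi> $ 4) \<le> R * ?p 2 + R * ?p 4 + R * (?q 4 + 2 * \<bar>\<xi>\<bar> * ?p 4)"
            unfolding f_def vector_4 using tm[OF R(5)] tm[OF R(7)]
            by (intro order_trans[OF norm_triangle_ineq] add_mono) auto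
          also have "\<dots> = R * (?p 2 + ?p 4 + ?q 4 + 2 * \<bar>\<xi>\<bar> * ?p 4)" by (simp add: distrib_left)
          also have "\<dots> \<le> R * (X + 2 * \<bar>\<xi>\<bar> * X)"
          proof (rule mult_left_mono[OF add_mono[OF _ mult_left_mono]])
            show "?p 2 + ?p 4 + ?q 4 \<le> X" "?p 4 \<le> X" by (auto simp: X_def)
          qed (use R(9) in simp_all)
          also have "\<dots> = Y" by (simp add: Y_def algebra_simps)
          finally show ?thesis .
        qed
        have "(norm (f n s \<xi>))\<^sup>2 = (norm (f n s \<xi> $ 1))\<^sup>2 + (norm (f n s \<xi> $ 2))\<^sup>2 + (norm (f n s \<xi> $ 3))\<^sup>2 + (norm (f n s \<xi> $ 4))\<^sup>2"
          by (simp add: norm_vec_sq sum_4)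
        also have "\<dots> \<le> Y\<^sup>2 + Y\<^sup>2 + Y\<^sup>2 + Y\<^sup>2" by (intro add_mono power_mono c1 c2 c3 c4) auto
        also have "\<dots> = 4 * (R\<^sup>2 * ((1 + 2 * \<bar>\<xi>\<bar>)\<^sup>2 * X\<^sup>2))" by (simp add: Y_def power_mult_distrib)
        also have "\<dots> \<le> 4 * (R\<^sup>2 * ((8 * (1 + \<xi>\<^sup>2)) * (8 * ((?p 1)\<^sup>2 + (?p 2)\<^sup>2 + (?p 3)\<^sup>2 + (?p 4)\<^sup>2 + (?q 1)\<^sup>2 + (?q 2)\<^sup>2 + (?q 3)\<^sup>2 + (?q 4)\<^sup>2))))"
        proof (intro mult_left_mono mult_mono)
          show "(1 + 2 * \<bar>\<xi>\<bar>)\<^sup>2 \<le> 8 * (1 + \<xi>\<^sup>2)"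
            using zero_le_power2[of "1 - 2 * \<bar>\<xi>\<bar>"] by (simp add: power2_eq_square algebra_simps)
          show "X\<^sup>2 \<le> 8 * ((?p 1)\<^sup>2 + (?p 2)\<^sup>2 + (?p 3)\<^sup>2 + (?p 4)\<^sup>2 + (?q 1)\<^sup>2 + (?q 2)\<^sup>2 + (?q 3)\<^sup>2 + (?q 4)\<^sup>2)"
            unfolding X_def by (rule sum_8_squares)
        qed auto
        also have "\<dots> = 256 * R\<^sup>2 * (1 + \<xi>\<^sup>2) * (\<Sum>j\<in>UNIV. (?p j)\<^sup>2 + (?q j)\<^sup>2)"
        proof -
          have "4 * (r * ((8 * x) * (8 * (p1 + p2 + p3 + p4 + s1 + s2 + s3 + s4))))
              = 256 * r * x * ((p1 + s1) + (p2 + s2) + (p3 + s3) + (p4 + s4))" for r x p1 p2 p3 p4 s1 s2 s3 s4 :: real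
            by (simp add: algebra_simps)
          thus ?thesis unfolding sum_4 .
        qed
        finally show ?thesis .
      qed
      have Ibound: "integral {0..t} (\<lambda>s. (norm (f n s \<xi>))\<^sup>2) \<le> 256 * R\<^sup>2 * (1 + \<xi>\<^sup>2) * S n \<xi>" for n \<xi>
      proof -
        have iq: "(\<lambda>s. (norm (q1 n j s \<xi>))\<^sup>2) integrable_on {0..t}" "(\<lambda>s. (norm (q2 n j s \<xi>))\<^sup>2) integrable_on {0..t}" for j
          by (intro integrable_continuous_real continuous_intros cq)+
        have "integral {0..t} (\<lambda>s. (norm (f n s \<xi>))\<^sup>2)
            \<le> integral {0..t} (\<lambda>s. 256 * R\<^sup>2 * (1 + \<xi>\<^sup>2) * (\<Sum>j\<in>UNIV. (norm (q1 n j s \<xi>))\<^sup>2 + (norm (q2 n j s \<xi>))\<^sup>2))"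
          by (intro integral_le fbound integrable_continuous_real continuous_intros cf cq)
        also have "\<dots> = 256 * R\<^sup>2 * (1 + \<xi>\<^sup>2) * integral {0..t} (\<lambda>s. \<Sum>j\<in>UNIV. (norm (q1 n j s \<xi>))\<^sup>2 + (norm (q2 n j s \<xi>))\<^sup>2)"
          by simp
        also have "integral {0..t} (\<lambda>s. \<Sum>j\<in>UNIV. (norm (q1 n j s \<xi>))\<^sup>2 + (norm (q2 n j s \<xi>))\<^sup>2) = S n \<xi>"
          unfolding S_def Q1_def Q2_def
          by (simp add: Henstock_Kurzweil_Integration.integral_sum Henstock_Kurzweil_Integration.integral_add iq
              Henstock_Kurzweil_Integration.integrable_add)
        finally show ?thesis .
      qed
      obtain K0 where K0: "\<And>j. K0 j \<ge> 0" "\<And>j s. s \<in> {0..t} \<Longrightarrow> L2_norm (u j s) \<le> K0 j"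
        using L2_curve_bounded[OF cu, of t] by metis
      define K where "K = (\<Sum>j\<in>UNIV. K0 j)"
      have K: "L2_norm (u j s) \<le> K" if "s \<in> {0..t}" for j s
        using K0(2)[OF that, of j] member_le_sum[of j UNIV K0] K0(1) by (simp add: K_def)
      have Q1: "integrable lborel (Q1 n j)" "Q1 n j \<xi> \<ge> 0" "(\<integral>\<xi>. Q1 n j \<xi> \<partial>lborel) \<le> t * (2 * pi * (\<alpha> n * B1 * K)\<^sup>2)" for n j \<xi>
        unfolding Q1_def q1_def w_def by (rule window_time_energy[OF cu h1 b1 K t], assumption)+
      have Q2: "integrable lborel (Q2 n j)" "Q2 n j \<xi> \<ge> 0" "(\<integral>\<xi>. Q2 n j \<xi> \<partial>lborel) \<le> t * (2 * pi * ((\<alpha> n)\<^sup>2 * B2 * K)\<^sup>2)" for n j \<xi>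
        unfolding Q2_def q2_def w_def by (rule window_time_energy[OF cu h2 b2 K t], assumption)+
      define \<Delta> where "\<Delta> = (\<lambda>\<tau> n j \<xi>. (norm (w (h n) j \<tau> \<xi> - G \<tau> \<xi> $ j))\<^sup>2)"
      have hb: "\<bar>h n x\<bar> \<le> 1" for n x using z by (simp add: h_def)
      have sw: "square_integrable (\<lambda>\<xi>. w (h n) j \<tau> \<xi> - G \<tau> \<xi> $ j)" if "\<tau> \<ge> 0" for n j \<tau>
        unfolding w_def
        by (intro square_integrable_diff FT1_L2_bound square_integrable_test_times[OF h hb] su that is_FT_square_integrable(2)[OF G])
      have \<Delta>i: "integrable lborel (\<Delta> \<tau> n j)" if "\<tau> \<ge> 0" for \<tau> n j
        unfolding \<Delta>_def by (rule square_integrable_sq[OF sw[OF that]])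
      have \<Delta>lim: "(\<lambda>n. \<integral>\<xi>. \<Delta> \<tau> n j \<xi> \<partial>lborel) \<longlonglongrightarrow> 0" if \<tau>: "\<tau> \<ge> 0" for \<tau> j
      proof -
        have suc: "square_integrable (\<lambda>x. complex_of_real (u j \<tau> x))" using su[OF \<tau>] by (simp add: square_integrable_of_real_iff)
        have "(\<lambda>n. L2_norm (\<lambda>x. of_real (h n x) * complex_of_real (u j \<tau> x) - of_real (u j \<tau> x))) \<longlonglongrightarrow> 0"
        proof (rule L2_norm_cutoff_tendsto[OF suc])
          show "(\<lambda>x. complex_of_real (h n x)) \<in> borel_measurable borel" for n using test_function_measurable[OF h] by simp
          show "norm (complex_of_real (h n x)) \<le> 1" for n x using hb by simp
          show "(\<lambda>n. complex_of_real (h n x)) \<longlonglongrightarrow> 1" for x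
          proof (rule tendsto_eventually)
            have "eventually (\<lambda>n. \<alpha> n * \<bar>x\<bar> < 1) sequentially"
              using order_tendstoD(2)[OF tendsto_mult_right[OF \<alpha>0, of "\<bar>x\<bar>"], of 1] by simp
            thus "\<forall>\<^sub>F n in sequentially. complex_of_real (h n x) = 1"
            proof eventually_elim
              case (elim n)
              thus ?case using z(4)[of "\<alpha> n * x"] \<alpha>[of n] by (simp add: h_def abs_mult)
            qed
          qed
        qed
        hence l: "(\<lambda>n. L2_norm (\<lambda>x. complex_of_real (h n x * u j \<tau> x) - of_real (u j \<tau> x))) \<longlonglongrightarrow> 0" by simp
        have "(\<lambda>n. L2_norm (\<lambda>\<xi>. FT1 (\<lambda>x. complex_of_real (h n x * u j \<tau> x)) \<xi> - G \<tau> \<xi> $ j)) \<longlonglongrightarrow> 0"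
          by (rule is_FT_approx[OF G[OF \<tau>, of j, folded u_def]])
             (intro square_integrable_test_times[OF h hb] su \<tau>, intro square_integrable_test_times[OF h hb] su \<tau>,
              use l in \<open>simp add: u_def\<close>)
        from tendsto_power[OF this, of 2] show ?thesis by (simp add: \<Delta>_def w_def L2_norm_sq)
      qed
      define D where "D = (\<lambda>n \<xi>. (\<Sum>j\<in>UNIV. \<Delta> t n j \<xi>) + (\<Sum>j\<in>UNIV. \<Delta> 0 n j \<xi>) + S n \<xi>)"
      have Si: "integrable lborel (S n)" for n unfolding S_def by (intro Bochner_Integration.integrable_sum Bochner_Integration.integrable_add Q1 Q2)
      have S0: "S n \<xi> \<ge> 0" for n \<xi> unfolding S_def by (intro sum_nonneg add_nonneg_nonneg Q1 Q2)
      have \<Delta>0: "\<Delta> \<tau> n j \<xi> \<ge> 0" for \<tau> n j \<xi> by (simp add: \<Delta>_def)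
      have Di: "integrable lborel (D n)" for n
        unfolding D_def by (intro Bochner_Integration.integrable_add Bochner_Integration.integrable_sum \<Delta>i Si t order_refl)
      have D0: "D n \<xi> \<ge> 0" for n \<xi> unfolding D_def by (intro add_nonneg_nonneg sum_nonneg \<Delta>0 S0)
      have Slim: "(\<lambda>n. \<integral>\<xi>. S n \<xi> \<partial>lborel) \<longlonglongrightarrow> 0"
      proof (rule Lim_null_comparison[OF always_eventually])
        show "\<forall>n. norm (\<integral>\<xi>. S n \<xi> \<partial>lborel) \<le> (\<Sum>j\<in>(UNIV :: 4 set). t * (2 * pi * (\<alpha> n * B1 * K)\<^sup>2) + t * (2 * pi * ((\<alpha> n)\<^sup>2 * B2 * K)\<^sup>2))"
        proof
          fix n
          have "norm (\<integral>\<xi>. S n \<xi> \<partial>lborel) = (\<integral>\<xi>. S n \<xi> \<partial>lborel)" using S0 by (simp add: integral_nonneg_AE)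
          also have "\<dots> = (\<Sum>j\<in>UNIV. (\<integral>\<xi>. Q1 n j \<xi> \<partial>lborel) + (\<integral>\<xi>. Q2 n j \<xi> \<partial>lborel))"
            unfolding S_def using Q1 Q2 by (simp add: Bochner_Integration.integral_sum)
          also have "\<dots> \<le> (\<Sum>j\<in>(UNIV :: 4 set). t * (2 * pi * (\<alpha> n * B1 * K)\<^sup>2) + t * (2 * pi * ((\<alpha> n)\<^sup>2 * B2 * K)\<^sup>2))"
            by (intro sum_mono add_mono Q1 Q2)
          finally show "norm (\<integral>\<xi>. S n \<xi> \<partial>lborel) \<le> \<dots>" .
        qed
        have "(\<lambda>n. \<Sum>j\<in>(UNIV :: 4 set). t * (2 * pi * (\<alpha> n * B1 * K)\<^sup>2) + t * (2 * pi * ((\<alpha> n)\<^sup>2 * B2 * K)\<^sup>2))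
            \<longlonglongrightarrow> (\<Sum>j\<in>(UNIV :: 4 set). t * (2 * pi * (0 * B1 * K)\<^sup>2) + t * (2 * pi * (0\<^sup>2 * B2 * K)\<^sup>2))"
          by (intro tendsto_intros \<alpha>0)
        thus "(\<lambda>n. \<Sum>j\<in>(UNIV :: 4 set). t * (2 * pi * (\<alpha> n * B1 * K)\<^sup>2) + t * (2 * pi * ((\<alpha> n)\<^sup>2 * B2 * K)\<^sup>2)) \<longlonglongrightarrow> 0" by simp
      qed
      have "(\<lambda>n. \<integral>\<xi>. norm (D n \<xi>) \<partial>lborel) \<longlonglongrightarrow> 0"
      proof -
        have "(\<integral>\<xi>. norm (D n \<xi>) \<partial>lborel) = (\<Sum>j\<in>UNIV. \<integral>\<xi>. \<Delta> t n j \<xi> \<partial>lborel) + (\<Sum>j\<in>UNIV. \<integral>\<xi>. \<Delta> 0 n j \<xi> \<partial>lborel) + (\<integral>\<xi>. S n \<xi> \<partial>lborel)" for n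
        proof -
          have "(\<integral>\<xi>. norm (D n \<xi>) \<partial>lborel) = (\<integral>\<xi>. D n \<xi> \<partial>lborel)" using D0 by simp
          thus ?thesis unfolding D_def using \<Delta>i[OF t] \<Delta>i[OF order_refl] Si by (simp add: Bochner_Integration.integral_sum)
        qed
        moreover have "(\<lambda>n. (\<Sum>j\<in>UNIV. \<integral>\<xi>. \<Delta> t n j \<xi> \<partial>lborel) + (\<Sum>j\<in>UNIV. \<integral>\<xi>. \<Delta> 0 n j \<xi> \<partial>lborel) + (\<integral>\<xi>. S n \<xi> \<partial>lborel))
            \<longlonglongrightarrow> (\<Sum>j\<in>(UNIV :: 4 set). 0) + (\<Sum>j\<in>(UNIV :: 4 set). 0) + 0"
          by (intro tendsto_add tendsto_sum \<Delta>lim Slim t order_refl)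
        ultimately show ?thesis by simp
      qed
      from tendsto_L1_AE_subseq[OF Di this] obtain \<rho> where "AE \<xi> in lborel. (\<lambda>n. D (\<rho> n) \<xi>) \<longlonglongrightarrow> 0" by blast
      thus ?thesis
      proof eventually_elim
        case (elim \<xi>)
        have Sl: "(\<lambda>n. S (\<rho> n) \<xi>) \<longlonglongrightarrow> 0"
        proof (rule Lim_null_comparison[OF always_eventually elim], intro allI)
          show "norm (S (\<rho> n) \<xi>) \<le> D (\<rho> n) \<xi>" for n
            using S0 sum_nonneg[of UNIV "\<lambda>j. \<Delta> t (\<rho> n) j \<xi>"] sum_nonneg[of UNIV "\<lambda>j. \<Delta> 0 (\<rho> n) j \<xi>"] \<Delta>0
            by (simp add: D_def)
        qed
        have yl: "(\<lambda>n. (norm (y (\<rho> n) \<tau> \<xi>))\<^sup>2) \<longlonglongrightarrow> (norm (G \<tau> \<xi>))\<^sup>2" if \<tau>: "\<tau> = 0 \<or> \<tau> = t" for \<tau>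
        proof -
          have "(\<lambda>n. w (h (\<rho> n)) j \<tau> \<xi>) \<longlonglongrightarrow> G \<tau> \<xi> $ j" for j
          proof -
            have "\<Delta> \<tau> (\<rho> n) j \<xi> \<le> D (\<rho> n) \<xi>" for n
              using S0[of "\<rho> n" \<xi>] \<tau> member_le_sum[of j UNIV "\<lambda>j. \<Delta> \<tau> (\<rho> n) j \<xi>"] \<Delta>0
                sum_nonneg[of UNIV "\<lambda>j. \<Delta> t (\<rho> n) j \<xi>"] sum_nonneg[of UNIV "\<lambda>j. \<Delta> 0 (\<rho> n) j \<xi>"]
              by (auto simp: D_def)
            hence "(\<lambda>n. \<Delta> \<tau> (\<rho> n) j \<xi>) \<longlonglongrightarrow> 0"
              by (intro Lim_null_comparison[OF always_eventually elim]) (use \<Delta>0 in simp)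
            hence "(\<lambda>n. sqrt (\<Delta> \<tau> (\<rho> n) j \<xi>)) \<longlonglongrightarrow> sqrt 0" by (rule tendsto_real_sqrt)
            hence "(\<lambda>n. norm (w (h (\<rho> n)) j \<tau> \<xi> - G \<tau> \<xi> $ j)) \<longlonglongrightarrow> 0" by (simp add: \<Delta>_def)
            hence "(\<lambda>n. w (h (\<rho> n)) j \<tau> \<xi> - G \<tau> \<xi> $ j) \<longlonglongrightarrow> 0" by (rule tendsto_norm_zero_cancel)
            thus ?thesis by (rule LIM_zero_cancel)
          qed
          hence "(\<lambda>n. \<Sum>j\<in>UNIV. (norm (w (h (\<rho> n)) j \<tau> \<xi>))\<^sup>2) \<longlonglongrightarrow> (\<Sum>j\<in>UNIV. (norm (G \<tau> \<xi> $ j))\<^sup>2)"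
            by (intro tendsto_intros)
          thus ?thesis by (simp add: norm_vec_sq y_def)
        qed
        let ?rhs = "\<lambda>n. C * (exp (- \<gamma> * damping \<xi> * t) * (norm (y (\<rho> n) 0 \<xi>))\<^sup>2 + (1 + t) * (256 * R\<^sup>2 * (1 + \<xi>\<^sup>2) * S (\<rho> n) \<xi>))"
        have "?rhs \<longlonglongrightarrow> C * (exp (- \<gamma> * damping \<xi> * t) * (norm (G 0 \<xi>))\<^sup>2 + (1 + t) * (256 * R\<^sup>2 * (1 + \<xi>\<^sup>2) * 0))"
          by (intro tendsto_intros yl Sl) simp
        moreover have "(norm (y (\<rho> n) t \<xi>))\<^sup>2 \<le> ?rhs n" for n
          using C t by (intro order_trans[OF mode] mult_left_mono add_left_mono Ibound) auto
        ultimately show ?case using LIMSEQ_le[OF yl[of t]] by auto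
      qed
    qed
  qed
qed

section \<open>The decay estimate\<close>

lemma is_FT_sum:
  assumes "finite S" "\<And>j. j \<in> S \<Longrightarrow> is_FT (f j) (g j)"
  shows "is_FT (\<lambda>x. \<Sum>j\<in>S. c j * f j x) (\<lambda>\<xi>. \<Sum>j\<in>S. c j * g j \<xi>)"
  using assms
proof (induction S rule: finite_induct)
  case empty
  have "FT1 (\<lambda>x. 0) = (\<lambda>\<xi>. 0)" by (simp add: FT1_def fun_eq_iff)
  thus ?case using is_FT_of_integrable[of "\<lambda>x. 0"] by (simp add: square_integrable_def)
next
  case (insert j S)
  have "is_FT (\<lambda>x. c j * f j x - (-1) * (\<Sum>j\<in>S. c j * f j x)) (\<lambda>\<xi>. c j * g j \<xi> - (-1) * (\<Sum>j\<in>S. c j * g j \<xi>))"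
    using insert by (intro is_FT_diff is_FT_cmult) auto
  thus ?case using insert by simp
qed

text \<open>The initial value is attained only almost everywhere, and \<open>fourier_L2\<close> is a choice; both are invisible up to null
sets of frequencies.\<close>

lemma fourier_L2_cong_AE:
  fixes f g :: "real \<Rightarrow> real ^ 'n"
  assumes f: "square_integrable f" and g: "square_integrable g" and ae: "AE x in lborel. f x = g x"
  shows "AE \<xi> in lborel. fourier_L2 f \<xi> = fourier_L2 g \<xi>"
proof -
  have [measurable]: "f \<in> borel_measurable borel" "g \<in> borel_measurable borel"
    using f g square_integrable_measurable by auto
  have [measurable]: "(\<lambda>x. f x $ i) \<in> borel_measurable borel" "(\<lambda>x. g x $ i) \<in> borel_measurable borel" for i
    using f g square_integrable_measurable borel_measurable_vec_iff by blast+
  have "AE \<xi> in lborel. fourier_L2 f \<xi> $ i = fourier_L2 g \<xi> $ i" for i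
  proof (rule is_FT_unique)
    show "is_FT (\<lambda>x. complex_of_real (f x $ i)) (\<lambda>\<xi>. fourier_L2 f \<xi> $ i)" by (rule fourier_L2_component[OF f])
    have eq: "FT1 (trunc n (\<lambda>x. complex_of_real (f x $ i))) = FT1 (trunc n (\<lambda>x. complex_of_real (g x $ i)))" for n
      unfolding FT1_def trunc_def
    proof (rule ext, rule integral_cong_AE)
      fix \<xi>
      show "AE x in lborel. cis (- (x * \<xi>)) * (indicator {- real n..real n} x * complex_of_real (f x $ i))
          = cis (- (x * \<xi>)) * (indicator {- real n..real n} x * complex_of_real (g x $ i))"
        using ae by eventually_elim simp
    qed measurable
    show "is_FT (\<lambda>x. complex_of_real (f x $ i)) (\<lambda>\<xi>. fourier_L2 g \<xi> $ i)"
      using fourier_L2_component[OF g, of i] fourier_L2_component[OF f, of i] unfolding is_FT_def eq by blast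
  qed
  hence "AE \<xi> in lborel. \<forall>i\<in>UNIV. fourier_L2 f \<xi> $ i = fourier_L2 g \<xi> $ i"
    by (subst AE_ball_countable) auto
  thus ?thesis by eventually_elim (simp add: vec_eq_iff)
qed

text \<open>Real coefficient matrices have to act on transforms, which are complex vectors.\<close>

definition complexify :: "real ^ 'n ^ 'n \<Rightarrow> complex ^ 'n \<Rightarrow> complex ^ 'n" where
  "complexify A z = (\<chi> i. \<Sum>j\<in>UNIV. of_real (A $ i $ j) * z $ j)"

lemma complexify_bound: "\<exists>K>0. \<forall>z. (norm (complexify A z))\<^sup>2 \<le> K * (norm z)\<^sup>2"
proof -
  define K where "K = 1 + (\<Sum>i\<in>UNIV. \<Sum>j\<in>UNIV. \<bar>A $ i $ j\<bar>)"
  have K: "K > 0" unfolding K_def by (intro add_pos_nonneg sum_nonneg) auto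
  have "norm (complexify A z) \<le> K * norm z" for z
  proof -
    have "norm (complexify A z) \<le> (\<Sum>i\<in>UNIV. norm (complexify A z $ i))"
      unfolding norm_vec_def by (rule L2_set_le_sum) auto
    also have "\<dots> \<le> (\<Sum>i\<in>UNIV. \<Sum>j\<in>UNIV. \<bar>A $ i $ j\<bar> * norm z)"
    proof (intro sum_mono)
      fix i
      have "norm (complexify A z $ i) \<le> (\<Sum>j\<in>UNIV. norm (of_real (A $ i $ j) * z $ j))"
        unfolding complexify_def by (simp add: norm_sum)
      also have "\<dots> \<le> (\<Sum>j\<in>UNIV. \<bar>A $ i $ j\<bar> * norm z)"
        by (intro sum_mono) (simp add: norm_mult mult_left_mono Finite_Cartesian_Product.norm_nth_le)
      finally show "norm (complexify A z $ i) \<le> \<dots>" .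
    qed
    also have "\<dots> \<le> K * norm z" by (simp add: K_def sum_distrib_right distrib_right)
    finally show ?thesis .
  qed
  hence "(norm (complexify A z))\<^sup>2 \<le> K\<^sup>2 * (norm z)\<^sup>2" for z
    using power_mono[of "norm (complexify A z)" "K * norm z" 2] by (simp add: power_mult_distrib)
  thus ?thesis using K by (intro exI[of _ "K\<^sup>2"]) auto
qed

lemma complexify_inverse:
  assumes "A ** B = mat 1" shows "complexify A (complexify B z) = z"
proof -
  have "(\<Sum>j\<in>UNIV. of_real (A $ i $ j) * (\<Sum>k\<in>UNIV. of_real (B $ j $ k) * z $ k)) = z $ i" for i
  proof -
    have "(\<Sum>j\<in>UNIV. of_real (A $ i $ j) * (\<Sum>k\<in>UNIV. of_real (B $ j $ k) * z $ k))
        = (\<Sum>j\<in>UNIV. \<Sum>k\<in>UNIV. of_real (A $ i $ j * B $ j $ k) * z $ k)"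
      by (simp add: sum_distrib_left mult_ac)
    also have "\<dots> = (\<Sum>k\<in>UNIV. \<Sum>j\<in>UNIV. of_real (A $ i $ j * B $ j $ k) * z $ k)" by (rule sum.swap)
    also have "\<dots> = (\<Sum>k\<in>UNIV. of_real ((A ** B) $ i $ k) * z $ k)"
      by (simp add: matrix_matrix_mult_def sum_distrib_right)
    also have "\<dots> = (\<Sum>k\<in>UNIV. if k = i then z $ k else 0)"
      unfolding assms by (intro sum.cong) (auto simp: mat_def)
    finally show ?thesis by simp
  qed
  thus ?thesis by (simp add: complexify_def vec_eq_iff)
qed

text \<open>The even moments of a normal density with variance \<open>1 / (\<gamma> (1 + t))\<close>.  The factor \<open>exp (\<gamma> / 2)\<close> replaces \<open>t\<close> by
\<open>1 + t\<close> on \<open>|\<xi>| \<le> 1\<close>, which keeps the bound finite at \<open>t = 0\<close>.\<close>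

lemma gaussian_moment_decay:
  fixes \<gamma> :: real
  assumes \<gamma>: "\<gamma> > 0"
  obtains J where "J > 0"
    "\<And>t. t \<ge> 0 \<Longrightarrow> integrable lborel (\<lambda>\<xi>::real. exp (\<gamma> / 2) * (\<xi> ^ (2 * l) * exp (- \<gamma> * (1 + t) * \<xi>\<^sup>2 / 2)))"
    "\<And>t. t \<ge> 0 \<Longrightarrow> (\<integral>\<xi>. exp (\<gamma> / 2) * (\<xi> ^ (2 * l) * exp (- \<gamma> * (1 + t) * \<xi>\<^sup>2 / 2)) \<partial>lborel)
      = J * ((1 + t) powr (- (real l / 2 + 1 / 4)))\<^sup>2"
proof -
  define m where "m = exp (\<gamma> / 2) * sqrt (2 * pi)"
  define J where "J = m * (fact (2 * l) / (2 ^ l * fact l)) * \<gamma> powr (- (real l + 1 / 2))"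
  have key: "integrable lborel (\<lambda>\<xi>::real. exp (\<gamma> / 2) * (\<xi> ^ (2 * l) * exp (- \<gamma> * (1 + t) * \<xi>\<^sup>2 / 2))) \<and>
    (\<integral>\<xi>. exp (\<gamma> / 2) * (\<xi> ^ (2 * l) * exp (- \<gamma> * (1 + t) * \<xi>\<^sup>2 / 2)) \<partial>lborel)
      = J * ((1 + t) powr (- (real l / 2 + 1 / 4)))\<^sup>2" if t: "t \<ge> 0" for t
  proof -
    define p where "p = \<gamma> * (1 + t)"
    have p: "p > 0" using \<gamma> t by (simp add: p_def)
    define \<sigma> where "\<sigma> = 1 / sqrt p"
    have \<sigma>: "\<sigma> > 0" "\<sigma>\<^sup>2 = 1 / p" using p by (auto simp: \<sigma>_def power_divide)
    have eq: "(\<lambda>\<xi>::real. exp (\<gamma> / 2) * (\<xi> ^ (2 * l) * exp (- \<gamma> * (1 + t) * \<xi>\<^sup>2 / 2)))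
        = (\<lambda>\<xi>. (m * \<sigma>) * (normal_density 0 \<sigma> \<xi> * (\<xi> - 0) ^ (2 * l)))"
    proof
      fix \<xi> :: real
      have "normal_density 0 \<sigma> \<xi> = exp (- \<gamma> * (1 + t) * \<xi>\<^sup>2 / 2) / (sqrt (2 * pi) * \<sigma>)"
      proof -
        have "sqrt (2 * pi * \<sigma>\<^sup>2) = sqrt (2 * pi) * \<sigma>" using \<sigma>(1) by (simp add: real_sqrt_mult)
        moreover have "- (\<xi>\<^sup>2 / (2 * \<sigma>\<^sup>2)) = - \<gamma> * (1 + t) * \<xi>\<^sup>2 / 2"
          unfolding \<sigma>(2) using p by (simp add: p_def field_simps)
        ultimately show ?thesis by (simp add: normal_density_def)
      qed
      thus "exp (\<gamma> / 2) * (\<xi> ^ (2 * l) * exp (- \<gamma> * (1 + t) * \<xi>\<^sup>2 / 2))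
        = (m * \<sigma>) * (normal_density 0 \<sigma> \<xi> * (\<xi> - 0) ^ (2 * l))"
        using \<sigma>(1) by (simp add: m_def)
    qed
    have "(\<integral>\<xi>. (m * \<sigma>) * (normal_density 0 \<sigma> \<xi> * (\<xi> - 0) ^ (2 * l)) \<partial>lborel) = m * \<sigma> * (fact (2 * l) / ((2 / \<sigma>\<^sup>2) ^ l * fact l))"
      using integral_normal_moment_even[where \<mu>=0 and \<sigma>=\<sigma> and k=l, OF \<sigma>(1)] by simp
    also have "\<dots> = m * (fact (2 * l) / (2 ^ l * fact l)) * (\<sigma> * (\<sigma>\<^sup>2) ^ l)"
      using \<sigma>(1) by (simp add: power_divide field_simps)
    also have "\<sigma> * (\<sigma>\<^sup>2) ^ l = p powr (- (real l + 1 / 2))"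
    proof -
      have "\<sigma> = p powr (- (1 / 2))" using p by (simp add: \<sigma>_def powr_minus powr_half_sqrt inverse_eq_divide)
      moreover have "(\<sigma>\<^sup>2) ^ l = p powr (- real l)"
        using p by (simp add: \<sigma>(2) powr_minus powr_realpow power_one_over inverse_eq_divide)
      ultimately show ?thesis by (simp add: add.commute flip: powr_add)
    qed
    also have "p powr (- (real l + 1 / 2)) = \<gamma> powr (- (real l + 1 / 2)) * ((1 + t) powr (- (real l / 2 + 1 / 4)))\<^sup>2"
    proof -
      have "((1 + t) powr (- (real l / 2 + 1 / 4)))\<^sup>2 = (1 + t) powr (- (real l + 1 / 2))"
        by (simp add: power2_eq_square flip: powr_add)
      thus ?thesis using \<gamma> t by (simp add: p_def powr_mult)
    qed
    finally show ?thesis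
      unfolding eq using integrable_normal_moment[where \<mu>=0 and \<sigma>=\<sigma> and k="2*l", OF \<sigma>(1)]
      by (simp add: J_def)
  qed
  have "J > 0" using \<gamma> by (simp add: J_def m_def)
  thus ?thesis using key that by blast
qed

theorem lemma4p3:
  fixes p e s :: "real \<Rightarrow> real \<Rightarrow> real" and \<sigma>a \<sigma>s r :: real and Wbar :: "real ^ 4" and l :: nat
  assumes "thermodynamics p e s" and "\<sigma>a > 0" and "\<sigma>s > 0"
    and "equilibrium_state e Wbar"
    and "r \<ge> 0" and "real l \<le> r"
  shows "\<exists>C>0. \<exists>c1>0. \<forall>Z0 Z.
    Z0 \<in> sobolev r \<and> integrable lborel Z0 \<and>
    cauchy_solution r (A0_mat e s Wbar) (A1_mat p e s Wbar) (L_mat \<sigma>a e s Wbar) (B_mat \<sigma>s e s Wbar) Z0 Z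
    \<longrightarrow> (\<forall>t\<ge>0. L2_norm (weak_deriv l (Z t))
           \<le> C * exp (- c1 * t) * L2_norm (weak_deriv l Z0)
             + C * (1 + t) powr (- (real l / 2 + 1 / 4)) * L1_norm Z0)"
proof (rule linearized_normal_form[OF assms(1-4)])
  fix k1 k2 k3 k4 v a b c \<mu> g d :: real and M M' N :: "real ^ 4 ^ 4"
  (* The matrix identities come first because they determine the parameters of the normal form;
     matching the sign conditions first would leave many combinations to be tried. *)
  assume nf: "N ** A0_mat e s Wbar = mass_mat k1 k2 k3 k4 ** M"
    "N ** A1_mat p e s Wbar = convection_mat v k1 k2 k3 k4 a b c ** M"
    "N ** L_mat \<sigma>a e s Wbar = relaxation_mat g \<mu> ** M"
    "N ** B_mat \<sigma>s e s Wbar = diffusion_mat d ** M"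
    and inv: "M' ** M = mat 1"
    and pos: "k1 > 0" "k2 > 0" "k3 > 0" "k4 > 0" "a > 0" "b > 0" "\<mu> > 0" "g > 0" "d > 0"
  obtain C \<gamma> where C: "C > 0" and \<gamma>: "\<gamma> > 0" and decay:
    "\<And>r A0 A1 L B (N :: real ^ 4 ^ 4) (M :: real ^ 4 ^ 4) Z0 (Z :: real \<Rightarrow> real \<Rightarrow> real ^ 4) (G :: real \<Rightarrow> real \<Rightarrow> complex ^ 4) t.
      \<lbrakk>cauchy_solution r A0 A1 L B Z0 Z; r \<ge> 0;
       N ** A0 = mass_mat k1 k2 k3 k4 ** M;
       N ** A1 = convection_mat v k1 k2 k3 k4 a b c ** M;
       N ** L = relaxation_mat g \<mu> ** M;
       N ** B = diffusion_mat d ** M;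
       \<And>\<tau> j. \<tau> \<ge> 0 \<Longrightarrow> is_FT (\<lambda>x. complex_of_real ((M *v Z \<tau> x) $ j)) (\<lambda>\<xi>. G \<tau> \<xi> $ j); t \<ge> 0\<rbrakk>
     \<Longrightarrow> AE \<xi> in lborel. (norm (G t \<xi>))\<^sup>2 \<le> C * (exp (- \<gamma> * damping \<xi> * t) * (norm (G 0 \<xi>))\<^sup>2)"
    by (rule pointwise_decay[OF pos, of v c]) blast
  obtain K where K: "K > 0" "\<And>z. (norm (complexify M z))\<^sup>2 \<le> K * (norm z)\<^sup>2" using complexify_bound[of M] by blast
  obtain K' where K': "K' > 0" "\<And>z. (norm (complexify M' z))\<^sup>2 \<le> K' * (norm z)\<^sup>2" using complexify_bound[of M'] by blast
  define C2 where "C2 = K' * (C * K)"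
  have C2: "C2 > 0" using C K K' by (simp add: C2_def)
  obtain J where J: "J > 0"
    "\<And>t. t \<ge> 0 \<Longrightarrow> integrable lborel (\<lambda>\<xi>::real. exp (\<gamma> / 2) * (\<xi> ^ (2 * l) * exp (- \<gamma> * (1 + t) * \<xi>\<^sup>2 / 2)))"
    "\<And>t. t \<ge> 0 \<Longrightarrow> (\<integral>\<xi>. exp (\<gamma> / 2) * (\<xi> ^ (2 * l) * exp (- \<gamma> * (1 + t) * \<xi>\<^sup>2 / 2)) \<partial>lborel)
      = J * ((1 + t) powr (- (real l / 2 + 1 / 4)))\<^sup>2"
    using gaussian_moment_decay[OF \<gamma>, of l] by blast
  (* All estimates are for squares; one constant serves both terms after taking the root. *)
  define C3 where "C3 = sqrt (C2 + C2 * J)"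
  have C3: "C3 > 0" "C3\<^sup>2 = C2 + C2 * J" using C2 J by (auto simp: C3_def add_pos_pos)
  show ?thesis
  proof (rule exI[of _ C3], rule conjI[OF C3(1)], rule exI[of _ "\<gamma> / 4"], intro conjI allI impI)
    show "\<gamma> / 4 > 0" using \<gamma> by auto
    fix Z0 :: "real \<Rightarrow> real ^ 4" and Z :: "real \<Rightarrow> real \<Rightarrow> real ^ 4" and t :: real
    assume as: "Z0 \<in> sobolev r \<and> integrable lborel Z0 \<and>
      cauchy_solution r (A0_mat e s Wbar) (A1_mat p e s Wbar) (L_mat \<sigma>a e s Wbar) (B_mat \<sigma>s e s Wbar) Z0 Z" and t: "t \<ge> 0"
    hence Z0: "Z0 \<in> sobolev r" "integrable lborel Z0"
      and sol: "cauchy_solution r (A0_mat e s Wbar) (A1_mat p e s Wbar) (L_mat \<sigma>a e s Wbar) (B_mat \<sigma>s e s Wbar) Z0 Z" by auto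
    have Zs: "Z \<tau> \<in> sobolev r" if "\<tau> \<ge> 0" for \<tau> using sol that by (auto simp: cauchy_solution_def)
    note sZ0 = sobolev_square_integrable[OF Z0(1)] and sZ = sobolev_square_integrable[OF Zs]
    define G where "G = (\<lambda>\<tau> \<xi>. complexify M (fourier_L2 (Z \<tau>) \<xi>))"
    have FG: "is_FT (\<lambda>x. complex_of_real ((M *v Z \<tau> x) $ j)) (\<lambda>\<xi>. G \<tau> \<xi> $ j)" if "\<tau> \<ge> 0" for \<tau> j
    proof -
      have "is_FT (\<lambda>x. \<Sum>k\<in>UNIV. of_real (M $ j $ k) * complex_of_real (Z \<tau> x $ k)) (\<lambda>\<xi>. \<Sum>k\<in>UNIV. of_real (M $ j $ k) * fourier_L2 (Z \<tau>) \<xi> $ k)"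
        by (intro is_FT_sum fourier_L2_component sZ that) auto
      thus ?thesis by (simp add: G_def complexify_def matrix_vector_mult_def)
    qed
    have ae1: "AE \<xi> in lborel. (norm (G t \<xi>))\<^sup>2 \<le> C * (exp (- \<gamma> * damping \<xi> * t) * (norm (G 0 \<xi>))\<^sup>2)"
      by (rule decay[OF sol assms(5) nf FG t])
    have ae2: "AE \<xi> in lborel. fourier_L2 (Z 0) \<xi> = fourier_L2 Z0 \<xi>"
      using sol by (intro fourier_L2_cong_AE sZ sZ0) (auto simp: cauchy_solution_def)
    have "AE \<xi> in lborel. \<forall>i\<in>UNIV. norm (fourier_L2 Z0 \<xi> $ i) \<le> L1_norm Z0"
      by (subst AE_ball_countable) (auto intro: fourier_L2_bounded_by_L1 sZ0 Z0)
    hence ae3: "AE \<xi> in lborel. (norm (fourier_L2 Z0 \<xi>))\<^sup>2 \<le> 4 * (L1_norm Z0)\<^sup>2"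
    proof eventually_elim
      case (elim \<xi>)
      have "(norm (fourier_L2 Z0 \<xi>))\<^sup>2 \<le> (\<Sum>i\<in>(UNIV :: 4 set). (L1_norm Z0)\<^sup>2)"
        unfolding norm_vec_sq using elim by (intro sum_mono power_mono) auto
      thus ?case by simp
    qed
    define A where "A = (\<lambda>(F :: real \<Rightarrow> real ^ 4) \<xi>. \<Sum>i\<in>UNIV. (norm (of_real (\<xi> ^ l) * (fourier_L2 F \<xi> $ i)))\<^sup>2 :: real)"
    have Aeq: "A F \<xi> = \<xi> ^ (2 * l) * (norm (fourier_L2 F \<xi>))\<^sup>2" for F :: "real \<Rightarrow> real ^ 4" and \<xi>
      by (simp add: A_def norm_vec_sq norm_mult power_mult_distrib norm_power sum_distrib_left power_mult mult.commute[of 2]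
          flip: power_abs)
    have Ai: "integrable lborel (A F)" "(\<integral>\<xi>. A F \<xi> \<partial>lborel) = 2 * pi * (L2_norm (weak_deriv l F))\<^sup>2" if "F \<in> sobolev r" for F :: "real \<Rightarrow> real ^ 4"
    proof -
      have i: "integrable lborel (\<lambda>\<xi>. (norm (of_real (\<xi> ^ l) * (fourier_L2 F \<xi> $ i)))\<^sup>2)" for i
        by (rule square_integrable_sq[OF sobolev_power_weight[OF that assms(6)]])
      show "integrable lborel (A F)" unfolding A_def by (intro Bochner_Integration.integrable_sum i)
      show "(\<integral>\<xi>. A F \<xi> \<partial>lborel) = 2 * pi * (L2_norm (weak_deriv l F))\<^sup>2"
      proof -
        have "(\<integral>\<xi>. A F \<xi> \<partial>lborel) = (\<Sum>i\<in>UNIV. \<integral>\<xi>. (norm (of_real (\<xi> ^ l) * (fourier_L2 F \<xi> $ i)))\<^sup>2 \<partial>lborel)"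
          unfolding A_def by (intro Bochner_Integration.integral_sum i)
        also have "\<dots> = 2 * pi * (L2_norm (weak_deriv l F))\<^sup>2"
          unfolding L2_norm_weak_deriv[OF that assms(6)] by (simp only: L2_norm_sq)
        finally show ?thesis .
      qed
    qed
    let ?H = "\<lambda>\<xi>::real. exp (\<gamma> / 2) * (\<xi> ^ (2 * l) * exp (- \<gamma> * (1 + t) * \<xi>\<^sup>2 / 2))"
    (* The two terms come from |\<xi>| \<ge> 1 and |\<xi>| < 1, each extended to all frequencies. *)
    have main: "AE \<xi> in lborel. A (Z t) \<xi> \<le> C2 * exp (- (\<gamma> / 2) * t) * A Z0 \<xi> + C2 * (4 * (L1_norm Z0)\<^sup>2) * ?H \<xi>"
      using ae1 ae2 ae3
    proof eventually_elim
      case (elim \<xi>)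
      let ?E = "exp (- \<gamma> * damping \<xi> * t)" and ?N = "(norm (fourier_L2 Z0 \<xi>))\<^sup>2"
      have "(norm (fourier_L2 (Z t) \<xi>))\<^sup>2 = (norm (complexify M' (G t \<xi>)))\<^sup>2"
        by (simp add: G_def complexify_inverse[OF inv])
      also have "\<dots> \<le> K' * (norm (G t \<xi>))\<^sup>2" by (rule K')
      also have "\<dots> \<le> K' * (C * (?E * (norm (G 0 \<xi>))\<^sup>2))" using K' elim(1) by (intro mult_left_mono) auto
      also have "\<dots> \<le> K' * (C * (?E * (K * ?N)))"
        using K'(1) C K(2)[of "fourier_L2 Z0 \<xi>"] by (intro mult_left_mono) (auto simp: G_def elim(2))
      also have "\<dots> = C2 * (?E * ?N)" by (simp add: C2_def)
      finally have zt: "(norm (fourier_L2 (Z t) \<xi>))\<^sup>2 \<le> C2 * (?E * ?N)" .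
      have xl: "0 \<le> \<xi> ^ (2 * l)" by simp
      have pw: "1 + \<xi>\<^sup>2 > 0" by (simp add: add_pos_nonneg)
      have split: "\<xi> ^ (2 * l) * (?E * ?N) \<le> exp (- (\<gamma> / 2) * t) * (\<xi> ^ (2 * l) * ?N) + (4 * (L1_norm Z0)\<^sup>2) * ?H \<xi>"
      proof (cases "\<bar>\<xi>\<bar> \<ge> 1")
        case True
        hence "1 \<le> \<xi>\<^sup>2" using power_mono[of 1 "\<bar>\<xi>\<bar>" 2] by simp
        hence "1 / 2 \<le> damping \<xi>" using pw by (simp add: damping_def field_simps)
        hence "\<gamma> / 2 * t \<le> \<gamma> * damping \<xi> * t" using \<gamma> t mult_left_mono[of "1/2" "damping \<xi>" "\<gamma> * t"] by (simp add: mult_ac)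
        hence "?E \<le> exp (- (\<gamma> / 2) * t)" by simp
        hence "\<xi> ^ (2 * l) * (?E * ?N) \<le> \<xi> ^ (2 * l) * (exp (- (\<gamma> / 2) * t) * ?N)"
          by (intro mult_left_mono mult_right_mono xl) auto
        moreover have "0 \<le> (4 * (L1_norm Z0)\<^sup>2) * ?H \<xi>" using xl by (intro mult_nonneg_nonneg) auto
        ultimately show ?thesis by (simp add: mult_ac)
      next
        case False
        hence "\<xi>\<^sup>2 \<le> 1" using power_mono[of "\<bar>\<xi>\<bar>" 1 2] by simp
        hence w: "\<xi>\<^sup>2 / 2 \<le> damping \<xi>"
          unfolding damping_def using pw by (intro divide_left_mono) auto
        have "\<xi>\<^sup>2 / 2 * (\<gamma> * t) \<le> damping \<xi> * (\<gamma> * t)" using \<gamma> t by (intro mult_right_mono w) auto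
        moreover have "\<gamma> * \<xi>\<^sup>2 \<le> \<gamma> * 1" using \<gamma> \<open>\<xi>\<^sup>2 \<le> 1\<close> by (intro mult_left_mono) auto
        moreover have "- \<gamma> * (1 + t) * \<xi>\<^sup>2 / 2 = - (\<gamma> * \<xi>\<^sup>2) / 2 - \<xi>\<^sup>2 / 2 * (\<gamma> * t)"
          "- \<gamma> * damping \<xi> * t = - (damping \<xi> * (\<gamma> * t))" by (simp_all add: field_simps)
        ultimately have "- \<gamma> * damping \<xi> * t \<le> \<gamma> / 2 + - \<gamma> * (1 + t) * \<xi>\<^sup>2 / 2" by linarith
        hence "?E \<le> exp (\<gamma> / 2 + - \<gamma> * (1 + t) * \<xi>\<^sup>2 / 2)" by simp
        hence "?E \<le> exp (\<gamma> / 2) * exp (- \<gamma> * (1 + t) * \<xi>\<^sup>2 / 2)" by (simp only: exp_add)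
        hence "?E * ?N \<le> (exp (\<gamma> / 2) * exp (- \<gamma> * (1 + t) * \<xi>\<^sup>2 / 2)) * (4 * (L1_norm Z0)\<^sup>2)"
          by (intro mult_mono elim(3)) auto
        hence "\<xi> ^ (2 * l) * (?E * ?N) \<le> \<xi> ^ (2 * l) * ((exp (\<gamma> / 2) * exp (- \<gamma> * (1 + t) * \<xi>\<^sup>2 / 2)) * (4 * (L1_norm Z0)\<^sup>2))"
          by (intro mult_left_mono xl)
        moreover have "0 \<le> exp (- (\<gamma> / 2) * t) * (\<xi> ^ (2 * l) * ?N)" using xl by (intro mult_nonneg_nonneg) auto
        ultimately show ?thesis by (simp add: mult_ac)
      qed
      have "A (Z t) \<xi> \<le> \<xi> ^ (2 * l) * (C2 * (?E * ?N))" unfolding Aeq by (intro mult_left_mono zt xl)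
      also have "\<dots> = C2 * (\<xi> ^ (2 * l) * (?E * ?N))" by simp
      also have "\<dots> \<le> C2 * (exp (- (\<gamma> / 2) * t) * (\<xi> ^ (2 * l) * ?N) + (4 * (L1_norm Z0)\<^sup>2) * ?H \<xi>)"
        using C2 by (intro mult_left_mono split) auto
      finally show ?case unfolding Aeq by (simp only: distrib_left mult.assoc)
    qed
    let ?X = "L2_norm (weak_deriv l Z0)" and ?P = "(1 + t) powr (- (real l / 2 + 1 / 4))" and ?L = "L1_norm Z0"
    have "(\<integral>\<xi>. A (Z t) \<xi> \<partial>lborel) \<le> (\<integral>\<xi>. C2 * exp (- (\<gamma> / 2) * t) * A Z0 \<xi> + C2 * (4 * (L1_norm Z0)\<^sup>2) * ?H \<xi> \<partial>lborel)"
      by (intro integral_mono_AE main Ai Zs t Bochner_Integration.integrable_add integrable_mult_right Z0 J)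
    also have "\<dots> = C2 * exp (- (\<gamma> / 2) * t) * (\<integral>\<xi>. A Z0 \<xi> \<partial>lborel) + C2 * (4 * (L1_norm Z0)\<^sup>2) * (\<integral>\<xi>. ?H \<xi> \<partial>lborel)"
      by (subst Bochner_Integration.integral_add)
         (intro integrable_mult_right Ai Z0 J t, intro integrable_mult_right Ai Z0 J t, simp only: integral_mult_right_zero)
    finally have "2 * pi * (L2_norm (weak_deriv l (Z t)))\<^sup>2
        \<le> C2 * exp (- (\<gamma> / 2) * t) * (2 * pi * ?X\<^sup>2) + C2 * (4 * ?L\<^sup>2) * (J * ?P\<^sup>2)"
      unfolding Ai(2)[OF Zs[OF t]] Ai(2)[OF Z0(1)] J(3)[OF t] .
    also have "\<dots> \<le> C2 * exp (- (\<gamma> / 2) * t) * (2 * pi * ?X\<^sup>2) + 2 * pi * (C2 * J * (?P * ?L)\<^sup>2)"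
    proof -
      have "4 * (C2 * J * (?P * ?L)\<^sup>2) \<le> 2 * pi * (C2 * J * (?P * ?L)\<^sup>2)"
        using pi_gt3 C2 J by (intro mult_right_mono) auto
      thus ?thesis by (simp add: power_mult_distrib mult_ac)
    qed
    finally have "2 * pi * (L2_norm (weak_deriv l (Z t)))\<^sup>2
        \<le> 2 * pi * (C2 * (exp (- (\<gamma> / 2) * t) * ?X\<^sup>2) + C2 * J * (?P * ?L)\<^sup>2)" by (simp add: algebra_simps)
    hence "(L2_norm (weak_deriv l (Z t)))\<^sup>2 \<le> C2 * (exp (- (\<gamma> / 2) * t) * ?X\<^sup>2) + C2 * J * (?P * ?L)\<^sup>2"
      by (simp only: mult_le_cancel_left_pos[of "2 * pi"] pi_gt_zero mult_pos_pos zero_less_numeral)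
    also have "exp (- (\<gamma> / 2) * t) * ?X\<^sup>2 = (exp (- (\<gamma> / 4) * t) * ?X)\<^sup>2"
      by (simp add: power_mult_distrib power2_eq_square flip: exp_add)
    also have "C2 * (exp (- (\<gamma> / 4) * t) * ?X)\<^sup>2 + C2 * J * (?P * ?L)\<^sup>2
        \<le> C3\<^sup>2 * (exp (- (\<gamma> / 4) * t) * ?X)\<^sup>2 + C3\<^sup>2 * (?P * ?L)\<^sup>2"
      unfolding C3(2) using C2 J by (intro add_mono mult_right_mono) auto
    also have "\<dots> \<le> (C3 * exp (- (\<gamma> / 4) * t) * ?X + C3 * ?P * ?L)\<^sup>2"
    proof -
      have "0 \<le> ?L" by (simp add: L1_norm_def)
      hence "0 \<le> (C3 * exp (- (\<gamma> / 4) * t) * ?X) * (C3 * ?P * ?L)" using C3 by (intro mult_nonneg_nonneg) auto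
      thus ?thesis by (simp add: power2_sum power_mult_distrib mult_ac)
    qed
    finally show "L2_norm (weak_deriv l (Z t)) \<le> C3 * exp (- (\<gamma> / 4) * t) * ?X + C3 * ?P * ?L"
      by (rule power2_le_imp_le) (use C3 in \<open>auto intro!: add_nonneg_nonneg mult_nonneg_nonneg simp: L1_norm_def\<close>)
  qed
qed

end
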